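(* Let $q\in\mathbb{C}\setminus\{0\}$ be generic, let $m,n\ge 0$ be integers, and let $\mathcal{M}(R,F)$ be a $GL(m|n)$ type quantum matrix algebra with matrix of generators $M$ and power sums $p_k(M)$, $k\ge 0$. Let $\mu=\{\mu_i\}_{1\le i\le m}$ and $\nu=\{\nu_j\}_{1\le j\le n}$ be algebraically independent commuting variables (the spectral values). Then under the spectral parameterization of the characteristic subalgebra of $\mathcal{M}(R,F)$ (the homomorphism to $\mathbb{C}[\mu,\nu]$ described in the context), the power sums are mapped as $$ p_k(M)\mapsto p_k(\mu,\nu)=\sum_{i=1}^m d_i\,\mu_i^k+\sum_{j=1}^n \tilde d_j\,\nu_j^k\qquad \text{for all } k\ge 0, $$ where the weight coefficients are $$ d_i:=q^{-1}\prod_{\substack{p=1\\ p\ne i}}^m\frac{\mu_i-q^{-2}\mu_p}{\mu_i-\mu_p}\,\prod_{j=1}^n\frac{\mu_i-q^2\nu_j}{\mu_i-\nu_j}, \qquad \tilde d_j:=-q\prod_{i=1}^m\frac{\nu_j-q^{-2}\mu_i}{\nu_j-\mu_i}\,\prod_{\substack{p=1\\ p\ne j}}^n\frac{\nu_j-q^2\nu_p}{\nu_j-\nu_p}. $$ Since the spectral values are algebraically independent, all the coefficients $d_i$ and $\tilde d_j$ are well defined and nonzero (as elements of the field $\mathbb{C}(\mu,\nu)$).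
   Context: **Notation.** $V$ is a complex vector space with $\dim V=N<\infty$; $I$ is the identity operator; $P$ is the permutation $P(u\otimes v)=v\otimes u$ on $V^{\otimes 2}$. For $X\in\mathrm{End}(V^{\otimes p})$ and $k\ge p$ put $X_i=I^{\otimes(i-1)}\otimes X\otimes I^{\otimes(k-p-i+1)}\in\mathrm{End}(V^{\otimes k})$, $1\le i\le k-p+1$. For operators on $V^{\otimes 2}$, subscripts such as $X_{13}$ indicate the tensor factors on which the operator acts, and $\mathrm{Tr}_{(i)}$ is the trace over the $i$-th factor. For $k\ge1$, $k_q:=(q^k-q^{-k})/(q-q^{-1})=q^{k-1}+q^{k-3}+\dots+q^{1-k}$; $q\in\mathbb{C}\setminus\{0\}$ is generic if $k_q\ne0$ for all $k\ge 2$. **R-matrices.** Let $R,F\in\mathrm{Aut}(V^{\otimes2})$ satisfy: (1) the Yang-Baxter equations $R_1R_2R_1=R_2R_1R_2$, $F_1F_2F_1=F_2F_1F_2$; (2) compatibility: $R_1F_2F_1=F_2F_1R_2$, $F_1F_2R_1=R_2F_1F_2$; (3) both are strictly skew invertible: for $R$ this means that there is $\Psi^R\in\mathrm{End}(V^{\otimes2})$ with $\mathrm{Tr}_{(2)}R_{12}\Psi^R_{23}=P_{13}$ and that the operator $D^R_1:=\mathrm{Tr}_{(2)}\Psi^R_{12}$ is invertible; similarly for $F$. The R-trace of an $N\times N$ matrix $X$ with entries in a vector space $W$ is $\mathrm{Tr}_R(X):=\sum_{i,j=1}^N (D^R)_i^j X_j^i\in W$; $\mathrm{Tr}_{R(1\dots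 k)}$ denotes the R-trace applied in each of the factors $1,\dots,k$. **Hecke and $GL(m|n)$ type.** $R$ is a Hecke R-matrix if $(R-qI)(R+q^{-1}I)=0$. The Hecke algebra $\mathcal{H}_k(q)$ is generated by $\sigma_1,\dots,\sigma_{k-1}$ with relations $\sigma_i\sigma_{i+1}\sigma_i=\sigma_{i+1}\sigma_i\sigma_{i+1}$, $\sigma_i\sigma_j=\sigma_j\sigma_i$ for $|i-j|\ge2$, and $(\sigma_i-q)(\sigma_i+q^{-1})=0$. A Hecke R-matrix gives a representation $\rho_R:\mathcal{H}_k(q)\to\mathrm{End}(V^{\otimes k})$, $\sigma_i\mapsto R_i$. For generic $q$, $\mathcal{H}_k(q)\cong\mathbb{C}[S_k]$ and its irreducible representations are labelled in the standard way by partitions $\lambda\vdash k$, with $(k)$ corresponding to $\sigma_i\mapsto q$ and $(1^k)$ to $\sigma_i\mapsto -q^{-1}$. Let $e^\lambda$ be the corresponding central idempotent and $d_\lambda$ the dimension of the representation; $e^\lambda=\sum_{a=1}^{d_\lambda}e^\lambda_a$ is a decomposition into primitive idempotents. Let $\mathsf{H}(m,n)$ be the set of partitions $\lambda=(\lambda_1,\lambda_2,\dots)$ with $\lambda_{m+1}\le n$. A Hecke R-matrix $R$ is of $GL(m|n)$ type if for all $k\ge2$ and all $\nu\vdash k$: $\rho_R(e^\nu)=0$ if and only if $\nu\notin\mathsf{H}(m,n)$. **Quantum matrix algebra.** $\mathcal{M}(R,F)$ is the unital associative $\mathbb{C}$-algebra generated by the $N^2$ entries of the matrix $M=\|M^i_j\|$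 subject to $R_1M_{\overline1}M_{\overline2}=M_{\overline1}M_{\overline2}R_1$, where $M_{\overline1}:=M_1$, $M_{\overline{k+1}}:=F_kM_{\overline k}F_k^{-1}$. It is said to be of $GL(m|n)$ type if $R$ is a Hecke R-matrix of $GL(m|n)$ type. **Characteristic subalgebra.** The Schur functions are $s_0(M):=1$ and $s_\lambda(M):=\mathrm{Tr}_{R(1\dots p)}\big(M_{\overline1}\cdots M_{\overline p}\,\rho_R(e^\lambda_a)\big)$ for $\lambda\vdash p\ge1$ (independent of $a$; one may replace $e^\lambda_a$ by $d_\lambda^{-1}e^\lambda$). Their linear span is a commutative subalgebra of $\mathcal{M}(R,F)$, called the characteristic subalgebra. Put $a_k(M):=s_{(1^k)}(M)$ and $s_k(M):=s_{(k)}(M)$. The power sums are the elements of the characteristic subalgebra $$p_0(M):=(\mathrm{Tr}_R I)\,1,\qquad p_k(M):=\mathrm{Tr}_{R(1\dots k)}\big(M_{\overline1}\cdots M_{\overline k}\,R_{k-1}\cdots R_1\big),\quad k\ge1.$$ Each of the sets $\{a_k(M)\}_{k\ge0}$, $\{s_k(M)\}_{k\ge0}$, $\{p_k(M)\}_{k\ge 0}$ generates the characteristic subalgebra. **Spectral parameterization.** For the $GL(m|n)$ type algebra it is known that there is a unique algebra homomorphism from the characteristic subalgebra to $\mathbb{C}[\mu,\nu]$ with $$a_k(M)\mapsto a_k(\mu,\nu):=\sum_{r=0}^k e_r(q^{-1}\mu)\,h_{k-r}(-q\nu),\qquad k\ge 0,$$ or, equivalently, with $$s_k(M)\mapsto s_k(\mu,\nu):=\sum_{r=0}^k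 e_r(-q\nu)\,h_{k-r}(q^{-1}\mu),\qquad k\ge0,$$ where $e_r$ and $h_r$ are the elementary and complete homogeneous symmetric polynomials, $q^{-1}\mu=\{q^{-1}\mu_i\}$ and $-q\nu=\{-q\nu_j\}$. This homomorphism is called the spectral parameterization. *)

theory Defs
  imports
    "HOL-Library.Poly_Mapping"
    "HOL-Library.Multiset"
    "HOL-Algebra.QuotRing"
    "HOL-Computational_Algebra.Polynomial_Factorial"
    "Jordan_Normal_Form.Gauss_Jordan_Elimination"
begin

text \<open>The Laurent polynomial form of \<open>(q^k - q^(-k)) / (q - q^(-1))\<close>; unlike the quotient it
  is also meaningful for \<open>q = 1\<close> and \<open>q = -1\<close>, which count as generic.\<close>

definition qnat :: "complex \<Rightarrow> nat \<Rightarrow> complex" where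
  "qnat q k = (\<Sum>j<k. q powi (int k - 1 - 2 * int j))"

definition qint :: "complex \<Rightarrow> int \<Rightarrow> complex" where
  "qint q d = (if 0 \<le> d then qnat q (nat d) else - qnat q (nat (- d)))"

definition generic :: "complex \<Rightarrow> bool" where
  "generic q \<longleftrightarrow> q \<noteq> 0 \<and> (\<forall>k\<ge>2. qnat q k \<noteq> 0)"

text \<open>Words under concatenation, so that \<open>'g fword \<Rightarrow>\<^sub>0 complex\<close> with the convolution product of
  \<^theory>\<open>HOL-Library.Poly_Mapping\<close> is the free unital associative algebra on \<open>'g\<close>.\<close>

datatype 'g fword = FWord (letters: "'g list")

instantiation fword :: (type) monoid_add
begin

definition zero_fword :: "'a fword" where
  "zero_fword = FWord []"

definition plus_fword :: "'a fword \<Rightarrow> 'a fword \<Rightarrow> 'a fword" where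
  "plus_fword u v = FWord (letters u @ letters v)"

instance
  by standard (simp_all add: zero_fword_def plus_fword_def)

end

type_synonym 'g free = "'g fword \<Rightarrow>\<^sub>0 complex"

text \<open>Scalars, used both in free algebras and in polynomial rings.\<close>

definition const :: "complex \<Rightarrow> ('m::monoid_add \<Rightarrow>\<^sub>0 complex)" where
  "const c = Poly_Mapping.single 0 c"

definition gen :: "'g \<Rightarrow> 'g free" where
  "gen g = Poly_Mapping.single (FWord [g]) 1"

definition free_alg :: "'g set \<Rightarrow> 'g free ring" where
  "free_alg G = \<lparr>carrier = {x. \<forall>w\<in>Poly_Mapping.keys x. set (letters w) \<subseteq> G},
     monoid.mult = (*), one = 1, zero = 0, add = (+)\<rparr>"

definition presented_alg :: "'g set \<Rightarrow> 'g free set \<Rightarrow> 'g free set ring" where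
  "presented_alg G rels = free_alg G Quot (Idl\<^bsub>free_alg G\<^esub> rels)"

definition presented_class :: "'g set \<Rightarrow> 'g free set \<Rightarrow> 'g free \<Rightarrow> 'g free set" where
  "presented_class G rels x = (Idl\<^bsub>free_alg G\<^esub> rels) +>\<^bsub>free_alg G\<^esub> x"

text \<open>\<open>V\<close> has dimension \<open>N\<close> and a fixed basis. The basis of the \<open>k\<close>-th tensor power is numbered
  by \<open>{..<N^k}\<close> through the base \<open>N\<close> expansion, the first tensor factor being the most
  significant digit. Hence \<open>End(V^k)\<close> is \<open>carrier_mat (N^k) (N^k)\<close>.\<close>

definition kron :: "'a::times mat \<Rightarrow> 'a mat \<Rightarrow> 'a mat" where
  "kron A B = mat (dim_row A * dim_row B) (dim_col A * dim_col B)
     (\<lambda>(i, j). A $$ (i div dim_row B, j div dim_col B) * B $$ (i mod dim_row B, j mod dim_col B))"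

fun kron_pow :: "'a::semiring_1 mat \<Rightarrow> nat \<Rightarrow> 'a mat" where
  "kron_pow A 0 = 1\<^sub>m 1"
| "kron_pow A (Suc k) = kron A (kron_pow A k)"

text \<open>\<open>amp N k p i X\<close> is \<open>X\<^sub>i \<in> End(V^k)\<close> for \<open>X \<in> End(V^p)\<close> and \<open>1 \<le> i \<le> k - p + 1\<close>.\<close>

definition amp :: "nat \<Rightarrow> nat \<Rightarrow> nat \<Rightarrow> nat \<Rightarrow> 'a::semiring_1 mat \<Rightarrow> 'a mat" where
  "amp N k p i X = kron (kron (1\<^sub>m (N ^ (i - 1))) X) (1\<^sub>m (N ^ (k - p + 1 - i)))"

definition perm_mat :: "nat \<Rightarrow> complex mat" where
  "perm_mat N = mat (N ^ 2) (N ^ 2)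
     (\<lambda>(i, j). if i div N = j mod N \<and> i mod N = j div N then 1 else 0)"

text \<open>Trace over the \<open>i\<close>-th of \<open>k\<close> tensor factors; the remaining factors keep their order.\<close>

definition tr_factor :: "nat \<Rightarrow> nat \<Rightarrow> nat \<Rightarrow> 'a::comm_monoid_add mat \<Rightarrow> 'a mat" where
  "tr_factor N k i X = (let b = N ^ (k - i); ins = (\<lambda>r s. (r div b) * (N * b) + s * b + r mod b) in
     mat (N ^ (k - 1)) (N ^ (k - 1)) (\<lambda>(r, c). \<Sum>s<N. X $$ (ins r s, ins c s)))"

definition mat_trace :: "'a::comm_monoid_add mat \<Rightarrow> 'a" where
  "mat_trace A = (\<Sum>i<dim_row A. A $$ (i, i))"

definition mat_prod :: "nat \<Rightarrow> 'a::semiring_1 mat list \<Rightarrow> 'a mat" where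
  "mat_prod d As = foldr (*) As (1\<^sub>m d)"

definition yang_baxter :: "nat \<Rightarrow> complex mat \<Rightarrow> bool" where
  "yang_baxter N R \<longleftrightarrow>
     amp N 3 2 1 R * amp N 3 2 2 R * amp N 3 2 1 R = amp N 3 2 2 R * amp N 3 2 1 R * amp N 3 2 2 R"

definition compatible :: "nat \<Rightarrow> complex mat \<Rightarrow> complex mat \<Rightarrow> bool" where
  "compatible N R F \<longleftrightarrow>
     amp N 3 2 1 R * amp N 3 2 2 F * amp N 3 2 1 F = amp N 3 2 2 F * amp N 3 2 1 F * amp N 3 2 2 R \<and>
     amp N 3 2 1 F * amp N 3 2 2 F * amp N 3 2 1 R = amp N 3 2 2 R * amp N 3 2 1 F * amp N 3 2 2 F"

text \<open>\<open>Tr\<^sub>(\<^sub>2\<^sub>) R\<^sub>1\<^sub>2 \<Psi>\<^sub>2\<^sub>3 = P\<^sub>1\<^sub>3\<close>. Tracing out the second factor leaves an operator on the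
  factors 1 and 3. The equation determines \<open>\<Psi>\<close>, so \<open>D_op\<close> below is well defined.\<close>

definition skew_inverse :: "nat \<Rightarrow> complex mat \<Rightarrow> complex mat \<Rightarrow> bool" where
  "skew_inverse N R \<Psi> \<longleftrightarrow> \<Psi> \<in> carrier_mat (N ^ 2) (N ^ 2) \<and>
     tr_factor N 3 2 (amp N 3 2 1 R * amp N 3 2 2 \<Psi>) = perm_mat N"

definition D_op :: "nat \<Rightarrow> complex mat \<Rightarrow> complex mat" where
  "D_op N R = tr_factor N 2 2 (THE \<Psi>. skew_inverse N R \<Psi>)"

definition strictly_skew_invertible :: "nat \<Rightarrow> complex mat \<Rightarrow> bool" where
  "strictly_skew_invertible N R \<longleftrightarrow> (\<exists>\<Psi>. skew_inverse N R \<Psi>) \<and> invertible_mat (D_op N R)"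

definition compatible_R_matrices :: "nat \<Rightarrow> complex mat \<Rightarrow> complex mat \<Rightarrow> bool" where
  "compatible_R_matrices N R F \<longleftrightarrow>
     R \<in> carrier_mat (N ^ 2) (N ^ 2) \<and> invertible_mat R \<and>
     F \<in> carrier_mat (N ^ 2) (N ^ 2) \<and> invertible_mat F \<and>
     yang_baxter N R \<and> yang_baxter N F \<and> compatible N R F \<and>
     strictly_skew_invertible N R \<and> strictly_skew_invertible N F"

definition hecke_R_matrix :: "nat \<Rightarrow> complex \<Rightarrow> complex mat \<Rightarrow> bool" where
  "hecke_R_matrix N q R \<longleftrightarrow>
     (R - q \<cdot>\<^sub>m 1\<^sub>m (N ^ 2)) * (R + inverse q \<cdot>\<^sub>m 1\<^sub>m (N ^ 2)) = 0\<^sub>m (N ^ 2) (N ^ 2)"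

text \<open>The R-trace in each of the \<open>k\<close> factors of a matrix over a complex algebra:
  contraction with \<open>D \<otimes> \<dots> \<otimes> D\<close>.\<close>

definition R_trace :: "nat \<Rightarrow> complex mat \<Rightarrow> nat \<Rightarrow> ('m::monoid_add \<Rightarrow>\<^sub>0 complex) mat
    \<Rightarrow> ('m \<Rightarrow>\<^sub>0 complex)" where
  "R_trace N R k X = mat_trace (map_mat const (kron_pow (D_op N R) k) * X)"

definition partitions :: "nat list set" where
  "partitions = {\<nu>. sorted_wrt (\<ge>) \<nu> \<and> 0 \<notin> set \<nu>}"

definition partitions_of :: "nat \<Rightarrow> nat list set" where
  "partitions_of k = {\<nu>\<in>partitions. sum_list \<nu> = k}"

text \<open>The condition is \<open>\<nu>\<^bsub>m+1\<^esub> \<le> n\<close>, parts beyond the length being zero.\<close>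

definition hook_partitions :: "nat \<Rightarrow> nat \<Rightarrow> nat list set" where
  "hook_partitions m n = {\<nu>\<in>partitions. m < length \<nu> \<longrightarrow> \<nu> ! m \<le> n}"

text \<open>Boxes are pairs (row, column).\<close>

type_synonym box = "nat \<times> nat"

definition young_diagram :: "nat list \<Rightarrow> box set" where
  "young_diagram \<nu> = {(r, c). r < length \<nu> \<and> c < \<nu> ! r}"

text \<open>A tableau is the list \<open>T\<close> for which \<open>T ! i\<close> is the box containing the entry \<open>i + 1\<close>;
  the last condition says that entries increase along rows and columns.\<close>

definition std_tableaux :: "nat list \<Rightarrow> box list set" where
  "std_tableaux \<nu> = {T. distinct T \<and> set T = young_diagram \<nu> \<and>
     (\<forall>j<length T. \<forall>i<j. \<not> (fst (T ! j) \<le> fst (T ! i) \<and> snd (T ! j) \<le> snd (T ! i)))}"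

definition content :: "box \<Rightarrow> int" where
  "content b = int (snd b) - int (fst b)"

definition hecke_gens :: "nat \<Rightarrow> nat set" where
  "hecke_gens k = {1..<k}"

definition hecke_rels :: "complex \<Rightarrow> nat \<Rightarrow> nat free set" where
  "hecke_rels q k =
     {gen i * gen (i + 1) * gen i - gen (i + 1) * gen i * gen (i + 1) | i.
        i \<in> hecke_gens k \<and> i + 1 \<in> hecke_gens k} \<union>
     {gen i * gen j - gen j * gen i | i j. i \<in> hecke_gens k \<and> j \<in> hecke_gens k \<and> i + 2 \<le> j} \<union>
     {(gen i - const q) * (gen i + const (inverse q)) | i. i \<in> hecke_gens k}"

definition hecke_alg :: "complex \<Rightarrow> nat \<Rightarrow> nat free set ring" where
  "hecke_alg q k = presented_alg (hecke_gens k) (hecke_rels q k)"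

text \<open>The irreducible representation labelled by \<open>\<nu>\<close>, in Hoefsmit's seminormal form with basis
  the standard tableaux of shape \<open>\<nu>\<close>. With \<open>d\<close> the content of the box of \<open>i + 1\<close> minus that of
  the box of \<open>i\<close>,
  \<open>\<sigma>\<^sub>i v\<^sub>T = q^d / [d] v\<^sub>T + [d + 1] / [d] v\<^bsub>s\<^sub>i T\<^esub>\<close>,
  the last term being absent unless \<open>s\<^sub>i T\<close> is standard.
  Thus \<open>(k)\<close> is \<open>\<sigma>\<^sub>i \<mapsto> q\<close> and \<open>(1^k)\<close> is \<open>\<sigma>\<^sub>i \<mapsto> - q^(-1)\<close>. The functions below give the
  coefficient of \<open>v\<^sub>S\<close> in the image of \<open>v\<^sub>T\<close>.\<close>

definition seminormal_gen :: "complex \<Rightarrow> nat \<Rightarrow> box list \<Rightarrow> box list \<Rightarrow> complex" where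
  "seminormal_gen q i S T = (let d = content (T ! i) - content (T ! (i - 1)) in
     if S = T then q powi d / qint q d
     else if S = T[i - 1 := T ! i, i := T ! (i - 1)] then qint q (d + 1) / qint q d
     else 0)"

fun seminormal_word :: "complex \<Rightarrow> nat list \<Rightarrow> nat list \<Rightarrow> box list \<Rightarrow> box list \<Rightarrow> complex" where
  "seminormal_word q \<nu> [] S T = (if S = T then 1 else 0)"
| "seminormal_word q \<nu> (i # w) S T =
     (\<Sum>U\<in>std_tableaux \<nu>. seminormal_gen q i S U * seminormal_word q \<nu> w U T)"

definition seminormal :: "complex \<Rightarrow> nat list \<Rightarrow> nat free \<Rightarrow> box list \<Rightarrow> box list \<Rightarrow> complex" where
  "seminormal q \<nu> x S T = (\<Sum>w\<in>Poly_Mapping.keys x.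
     Poly_Mapping.lookup x w * seminormal_word q \<nu> (letters w) S T)"

text \<open>Representations of the Hecke algebra are evaluated on representatives of its elements,
  which are cosets in the free algebra.\<close>

definition representative :: "'a set \<Rightarrow> 'a" where
  "representative X = (SOME x. x \<in> X)"

definition irrep :: "complex \<Rightarrow> nat list \<Rightarrow> nat free set \<Rightarrow> box list \<Rightarrow> box list \<Rightarrow> complex" where
  "irrep q \<nu> X = seminormal q \<nu> (representative X)"

definition irrep_dim :: "nat list \<Rightarrow> nat" where
  "irrep_dim \<nu> = card (std_tableaux \<nu>)"

text \<open>The central idempotent acting as the identity in the irreducible representation labelled
  by \<open>\<nu>\<close> and as zero in the others.\<close>

definition is_central_idempotent :: "complex \<Rightarrow> nat \<Rightarrow> nat list \<Rightarrow> nat free set \<Rightarrow> bool" where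
  "is_central_idempotent q k \<nu> X \<longleftrightarrow>
     X \<in> carrier (hecke_alg q k) \<and>
     (\<forall>Y\<in>carrier (hecke_alg q k). X \<otimes>\<^bsub>hecke_alg q k\<^esub> Y = Y \<otimes>\<^bsub>hecke_alg q k\<^esub> X) \<and>
     X \<otimes>\<^bsub>hecke_alg q k\<^esub> X = X \<and>
     (\<forall>\<mu>\<in>partitions_of k. \<forall>S\<in>std_tableaux \<mu>. \<forall>T\<in>std_tableaux \<mu>.
        irrep q \<mu> X S T = (if \<mu> = \<nu> \<and> S = T then 1 else 0))"

definition central_idempotent :: "complex \<Rightarrow> nat list \<Rightarrow> nat free set" where
  "central_idempotent q \<nu> = (THE X. is_central_idempotent q (sum_list \<nu>) \<nu> X)"

definition rho_word :: "nat \<Rightarrow> complex mat \<Rightarrow> nat \<Rightarrow> nat list \<Rightarrow> complex mat" where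
  "rho_word N R k w = mat_prod (N ^ k) (map (\<lambda>i. amp N k 2 i R) w)"

definition rho :: "nat \<Rightarrow> complex mat \<Rightarrow> nat \<Rightarrow> nat free set \<Rightarrow> complex mat" where
  "rho N R k X = (let x = representative X in mat (N ^ k) (N ^ k)
     (\<lambda>ab. \<Sum>w\<in>Poly_Mapping.keys x. Poly_Mapping.lookup x w * rho_word N R k (letters w) $$ ab))"

definition GL_type :: "nat \<Rightarrow> complex \<Rightarrow> nat \<Rightarrow> nat \<Rightarrow> complex mat \<Rightarrow> bool" where
  "GL_type N q m n R \<longleftrightarrow> hecke_R_matrix N q R \<and>
     (\<forall>k\<ge>2. \<forall>\<nu>\<in>partitions_of k.
        rho N R k (central_idempotent q \<nu>) = 0\<^sub>m (N ^ k) (N ^ k) \<longleftrightarrow> \<nu> \<notin> hook_partitions m n)"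

definition qma_gens :: "nat \<Rightarrow> (nat \<times> nat) set" where
  "qma_gens N = {..<N} \<times> {..<N}"

definition gen_mat :: "nat \<Rightarrow> (nat \<times> nat) free mat" where
  "gen_mat N = mat N N gen"

definition F_amp :: "nat \<Rightarrow> complex mat \<Rightarrow> nat \<Rightarrow> nat \<Rightarrow> (nat \<times> nat) free mat" where
  "F_amp N F K k = map_mat const (amp N K 2 k F)"

text \<open>\<open>M_bar N F K k\<close> is the matrix of the \<open>k\<close>-th copy \<open>M\<^bsub>k\<^esub>\<close> (with overlined index) in the
  \<open>K\<close>-th tensor power, \<open>1 \<le> k \<le> K\<close>, with entries in the free algebra.\<close>

fun M_bar :: "nat \<Rightarrow> complex mat \<Rightarrow> nat \<Rightarrow> nat \<Rightarrow> (nat \<times> nat) free mat" where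
  "M_bar N F K 0 = undefined"
| "M_bar N F K (Suc 0) = amp N K 1 1 (gen_mat N)"
| "M_bar N F K (Suc (Suc k)) =
     F_amp N F K (Suc k) * M_bar N F K (Suc k) * F_amp N (the (mat_inverse F)) K (Suc k)"

definition qma_rels :: "nat \<Rightarrow> complex mat \<Rightarrow> complex mat \<Rightarrow> (nat \<times> nat) free set" where
  "qma_rels N R F = (let R1 = map_mat const R; MM = M_bar N F 2 1 * M_bar N F 2 2 in
     {(R1 * MM - MM * R1) $$ (a, b) | a b. a < N ^ 2 \<and> b < N ^ 2})"

definition qma :: "nat \<Rightarrow> complex mat \<Rightarrow> complex mat \<Rightarrow> (nat \<times> nat) free set ring" where
  "qma N R F = presented_alg (qma_gens N) (qma_rels N R F)"

definition qma_class ::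
    "nat \<Rightarrow> complex mat \<Rightarrow> complex mat \<Rightarrow> (nat \<times> nat) free \<Rightarrow> (nat \<times> nat) free set" where
  "qma_class N R F = presented_class (qma_gens N) (qma_rels N R F)"

definition GL_type_qma :: "nat \<Rightarrow> complex \<Rightarrow> nat \<Rightarrow> nat \<Rightarrow> complex mat \<Rightarrow> complex mat \<Rightarrow> bool" where
  "GL_type_qma N q m n R F \<longleftrightarrow> compatible_R_matrices N R F \<and> GL_type N q m n R"

text \<open>Elements of the quantum matrix algebra built from \<open>M\<close> are computed in the free algebra
  and projected to the quotient. The normalization by \<open>irrep_dim\<close> replaces a primitive
  idempotent by the central one.\<close>

definition M_prod :: "nat \<Rightarrow> complex mat \<Rightarrow> nat \<Rightarrow> (nat \<times> nat) free mat" where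
  "M_prod N F k = mat_prod (N ^ k) (map (M_bar N F k) [1..<Suc k])"

definition schur_free ::
    "nat \<Rightarrow> complex \<Rightarrow> complex mat \<Rightarrow> complex mat \<Rightarrow> nat list \<Rightarrow> (nat \<times> nat) free" where
  "schur_free N q R F \<nu> = (if \<nu> = [] then 1 else let p = sum_list \<nu> in
     const (1 / of_nat (irrep_dim \<nu>)) *
     R_trace N R p (M_prod N F p * map_mat const (rho N R p (central_idempotent q \<nu>))))"

definition schur_fun ::
    "nat \<Rightarrow> complex \<Rightarrow> complex mat \<Rightarrow> complex mat \<Rightarrow> nat list \<Rightarrow> (nat \<times> nat) free set" where
  "schur_fun N q R F \<nu> = qma_class N R F (schur_free N q R F \<nu>)"

definition elem_fun ::
    "nat \<Rightarrow> complex \<Rightarrow> complex mat \<Rightarrow> complex mat \<Rightarrow> nat \<Rightarrow> (nat \<times> nat) free set" where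
  "elem_fun N q R F k = schur_fun N q R F (replicate k 1)"

definition power_sum ::
    "nat \<Rightarrow> complex mat \<Rightarrow> complex mat \<Rightarrow> nat \<Rightarrow> (nat \<times> nat) free set" where
  "power_sum N R F k = qma_class N R F (
     if k = 0 then R_trace N R 1 (1\<^sub>m N)
     else R_trace N R k (M_prod N F k *
       map_mat const (mat_prod (N ^ k) (map (\<lambda>i. amp N k 2 i R) (rev [1..<k])))))"

definition char_subalgebra ::
    "nat \<Rightarrow> complex \<Rightarrow> complex mat \<Rightarrow> complex mat \<Rightarrow> (nat \<times> nat) free set set" where
  "char_subalgebra N q R F =
     {qma_class N R F (\<Sum>\<nu>\<in>\<Lambda>. const (c \<nu>) * schur_free N q R F \<nu>) | \<Lambda> c.
        finite \<Lambda> \<and> \<Lambda> \<subseteq> partitions}"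

text \<open>Polynomials in countably many variables. The spectral values \<open>\<mu>\<^sub>1, \<dots>, \<mu>\<^sub>m, \<nu>\<^sub>1, \<dots>, \<nu>\<^sub>n\<close>
  are the variables with indices \<open>1, \<dots>, m + n\<close> in this order.\<close>

type_synonym cpoly = "(nat \<Rightarrow>\<^sub>0 nat) \<Rightarrow>\<^sub>0 complex"

definition var :: "nat \<Rightarrow> cpoly" where
  "var i = Poly_Mapping.single (Poly_Mapping.single i 1) 1"

definition mu :: "nat \<Rightarrow> cpoly" where
  "mu i = var i"

definition nu :: "nat \<Rightarrow> nat \<Rightarrow> cpoly" where
  "nu m j = var (m + j)"

definition spectral_poly_ring :: "nat \<Rightarrow> nat \<Rightarrow> cpoly ring" where
  "spectral_poly_ring m n =
     \<lparr>carrier = {f. \<forall>t\<in>Poly_Mapping.keys f. Poly_Mapping.keys t \<subseteq> {1..m + n}},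
      monoid.mult = (*), one = 1, zero = 0, add = (+)\<rparr>"

definition elem_sym :: "nat set \<Rightarrow> (nat \<Rightarrow> 'a::comm_semiring_1) \<Rightarrow> nat \<Rightarrow> 'a" where
  "elem_sym I x r = (\<Sum>S | S \<subseteq> I \<and> card S = r. \<Prod>i\<in>S. x i)"

definition complete_sym :: "nat set \<Rightarrow> (nat \<Rightarrow> 'a::comm_semiring_1) \<Rightarrow> nat \<Rightarrow> 'a" where
  "complete_sym I x r = (\<Sum>A | set_mset A \<subseteq> I \<and> size A = r. \<Prod>i\<in>#A. x i)"

definition spectral_elem :: "complex \<Rightarrow> nat \<Rightarrow> nat \<Rightarrow> nat \<Rightarrow> cpoly" where
  "spectral_elem q m n k = (\<Sum>r\<le>k. elem_sym {1..m} (\<lambda>i. const (inverse q) * mu i) r *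
     complete_sym {1..n} (\<lambda>j. const (- q) * nu m j) (k - r))"

definition spectral_parameterization ::
    "nat \<Rightarrow> complex \<Rightarrow> nat \<Rightarrow> nat \<Rightarrow> complex mat \<Rightarrow> complex mat
     \<Rightarrow> ((nat \<times> nat) free set \<Rightarrow> cpoly) \<Rightarrow> bool" where
  "spectral_parameterization N q m n R F \<phi> \<longleftrightarrow>
     \<phi> \<in> Ring.ring_hom ((qma N R F)\<lparr>carrier := char_subalgebra N q R F\<rparr>) (spectral_poly_ring m n) \<and>
     (\<forall>c. \<phi> (qma_class N R F (const c)) = const c) \<and>
     (\<forall>k. \<phi> (elem_fun N q R F k) = spectral_elem q m n k)"

definition weight_mu ::
    "'k::field \<Rightarrow> nat \<Rightarrow> nat \<Rightarrow> (nat \<Rightarrow> 'k) \<Rightarrow> (nat \<Rightarrow> 'k) \<Rightarrow> nat \<Rightarrow> 'k" where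
  "weight_mu q m n x y i = inverse q *
     (\<Prod>p\<in>{1..m} - {i}. (x i - inverse (q ^ 2) * x p) / (x i - x p)) *
     (\<Prod>j\<in>{1..n}. (x i - q ^ 2 * y j) / (x i - y j))"

definition weight_nu ::
    "'k::field \<Rightarrow> nat \<Rightarrow> nat \<Rightarrow> (nat \<Rightarrow> 'k) \<Rightarrow> (nat \<Rightarrow> 'k) \<Rightarrow> nat \<Rightarrow> 'k" where
  "weight_nu q m n x y j = - q *
     (\<Prod>i\<in>{1..m}. (y j - inverse (q ^ 2) * x i) / (y j - x i)) *
     (\<Prod>p\<in>{1..n} - {j}. (y j - q ^ 2 * y p) / (y j - y p))"

end

theory Submission
  imports Defs "Jordan_Normal_Form.Determinant" "HOL-Computational_Algebra.Formal_Power_Series"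
begin

text \<open>For generic \<open>q\<close>, comparing the \<open>k!\<close> words that span the Hecke algebra with matrix units
  constructed in Hoefsmit's seminormal form shows that this form is faithful, and expresses the central
  idempotents by matrix units. The functional \<open>x \<mapsto> Tr\<^sub>R (M\<^sub>1 \<dots> M\<^sub>k \<rho>(x))\<close> is a trace modulo the relations of
  the quantum matrix algebra and is multiplicative for juxtaposition of tensor factors. Applied to the recursion
  \<open>[j+1] e\<^bsub>j+1\<^esub> = q\<^sup>j e\<^sub>j - [j] e\<^sub>j \<sigma>\<^sub>j e\<^sub>j\<close> of the antisymmetrizers it yields the Newton relations
  \<open>(-1)^(k-1) [k] a\<^sub>k = \<Sum>l<k. (-q)^l a\<^sub>l p\<^bsub>k-l\<^esub>\<close>, which determine \<open>p\<^sub>k\<close> for \<open>k \<ge> 1\<close>. For \<open>k = 0\<close>, the partial R-trace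
  of the branching rule at the rectangle \<open>(m+1) \<times> (n+1)\<close> without its corner, whose full rectangle is annihilated by
  \<open>\<rho>\<close>, gives linear equations forcing \<open>Tr D = q^(n-m) [m-n]\<close>. The weighted sums of powers of the spectral values
  satisfy the same relations, by adding one spectral value at a time.\<close>

text \<open>The definitions use \<open>THE\<close> for the central idempotents and arbitrary
  representatives for elements of the Hecke algebra, so neither the Schur functions nor the GL
  condition can be evaluated before it is known that an element is determined by its seminormal
  matrices; that is the purpose of faithfulness. The map \<open>\<phi>\<close> is a homomorphism on
  the characteristic subalgebra only, so every trace entering a relation has to be located there.
  Expansion into matrix units does this, because traciality identifies the diagonal units of one
  shape and removes the off-diagonal ones. The element p_0 occurs in none of the Newton relations,
  and its value depends on m and n, which must therefore be read off from R itself: the missing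
  corner (m, n) of the rectangle is the first box that the GL condition forbids. Finally q may be 1
  or -1, so no step may divide by q - 1/q. On the spectral side the natural statement is the product
  formula A(-qX) (1 + (q - 1/q) H(X)) = A(-X/q), with A and H the generating series of the a_k and
  of the p_k for k >= 1; it appears in a form from which the factor q - 1/q has been
  cancelled.\<close>

abbreviation "keys \<equiv> Poly_Mapping.keys"
abbreviation "lookup \<equiv> Poly_Mapping.lookup"
abbreviation "single \<equiv> Poly_Mapping.single"

abbreviation sqm :: "nat \<Rightarrow> 'a mat set" where
  "sqm n \<equiv> carrier_mat n n"

abbreviation entry :: "nat \<Rightarrow> 'a mat \<Rightarrow> nat \<Rightarrow> nat \<Rightarrow> nat \<Rightarrow> nat \<Rightarrow> 'a" where
  "entry N A a b c d \<equiv> A $$ (a * N + b, c * N + d)"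

section \<open>Addition rules for quantum integers and the coefficients of Hoefsmit's
  matrices\<close>

section \<open>Quantum integers\<close>

lemma qnat_Suc: assumes "q \<noteq> 0"
  shows "qnat q (Suc n) = q * qnat q n + q powi (- int n)"
    and "qnat q (Suc n) = q powi int n + inverse q * qnat q n"
proof -
  have e: "(int (Suc n) - 1 - 2 * int j) = (int n - 1 - 2 * int j) + 1" for j by simp
  have "qnat q (Suc n) = (\<Sum>j<n. q powi (int (Suc n) - 1 - 2 * int j)) + q powi (- int n)"
    by (simp add: qnat_def)
  also have "(\<Sum>j<n. q powi (int (Suc n) - 1 - 2 * int j)) = q * qnat q n"
    unfolding qnat_def sum_distrib_left e using assms
    by (intro sum.cong refl) (simp only: power_int_add power_int_1_right mult.commute simp_thms)
  finally show "qnat q (Suc n) = q * qnat q n + q powi (- int n)" .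
  have e: "(int (Suc n) - 1 - 2 * int (Suc j)) = (int n - 1 - 2 * int j) + (-1)" for j by simp
  have "qnat q (Suc n) = q powi int n + (\<Sum>j<n. q powi (int (Suc n) - 1 - 2 * int (Suc j)))"
    unfolding qnat_def by (subst sum.lessThan_Suc_shift) simp
  also have "(\<Sum>j<n. q powi (int (Suc n) - 1 - 2 * int (Suc j))) = inverse q * qnat q n"
    unfolding qnat_def sum_distrib_left e using assms
    by (intro sum.cong refl, subst power_int_add) (auto simp: power_int_minus)
  finally show "qnat q (Suc n) = q powi int n + inverse q * qnat q n" .
qed

lemma qint_0 [simp]: "qint q 0 = 0"
  by (simp add: qint_def qnat_def)

lemma qint_1 [simp]: "qint q 1 = 1"
  by (simp add: qint_def qnat_def)

lemma qint_of_nat: "qint q (int n) = qnat q n"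
  by (simp add: qint_def)

lemma qint_minus: "qint q (- d) = - qint q d"
  by (auto simp: qint_def qnat_def)

lemma qint_plus_1: assumes "q \<noteq> 0"
  shows "qint q (d + 1) = q * qint q d + q powi (- d)"
proof (cases d)
  case (nonneg n)
  then have "d + 1 = int (Suc n)" by simp
  then show ?thesis using nonneg qnat_Suc(1)[OF assms, of n] by (metis qint_of_nat)
next
  case (neg n)
  have "qint q (d + 1) = - qnat q n" using neg qint_minus[of q "int n"] by (simp add: qint_of_nat)
  moreover have "qint q d = - qnat q (Suc n)" using neg qint_minus[of q "int (Suc n)"] by (simp only: qint_of_nat)
  moreover have "q powi (- d) = q * q powi int n" using neg assms by (simp add: power_int_add)
  ultimately show ?thesis using qnat_Suc(2)[OF assms, of n] assms by (simp add: field_simps)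
qed

text \<open>A closed formula would have q - 1/q in the denominator, so the rule is proved by integer
  induction in both directions from the one-step recursion. Its asymmetry, q^a on one term and
  q^(-b) on the other, is exploited later by using both orders of the summands.\<close>

lemma qint_add: assumes "q \<noteq> 0"
  shows "qint q (a + b) = q powi a * qint q b + q powi (- b) * qint q a"
proof (induction a rule: int_induct[where k = 0])
  case base show ?case by simp
next
  case (step1 i)
  have "qint q (i + 1 + b) = q * qint q (i + b) + q powi (- (i + b))"
    using qint_plus_1[OF assms, of "i + b"] by (simp add: algebra_simps)
  also have "\<dots> = q powi (i + 1) * qint q b + q powi (- b) * qint q (i + 1)"
    unfolding step1(2) qint_plus_1[OF assms] using assms
    by (simp add: power_int_add power_int_minus power_int_diff field_simps)
  finally show ?case .
next
  case (step2 i)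
  have 1: "qint q (i + b) = q * qint q (i - 1 + b) + q powi (- (i - 1 + b))"
    using qint_plus_1[OF assms, of "i - 1 + b"] by (simp add: algebra_simps)
  have 2: "qint q i = q * qint q (i - 1) + q powi (- (i - 1))"
    using qint_plus_1[OF assms, of "i - 1"] by simp
  have "q * qint q (i - 1 + b) = qint q (i + b) - q powi (- (i - 1 + b))" using 1 by simp
  also have "\<dots> = q * (q powi (i - 1) * qint q b + q powi (- b) * qint q (i - 1))"
    unfolding step2(2) 2 using assms
    by (simp add: power_int_add power_int_minus power_int_diff field_simps)
  finally show ?case using assms by simp
qed

text \<open>Comparing the two expansions of [d+1], as d + 1 and as 1 + d, gives the usual quotient
  formula in multiplied-out form, valid also for q = 1 and q = -1.\<close>

lemma qint_hq: assumes "q \<noteq> 0"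
  shows "(q - inverse q) * qint q d = q powi d - q powi (- d)"
proof -
  have "qint q (d + 1) = q * qint q d + q powi (- d)" by (rule qint_plus_1[OF assms])
  moreover have "qint q (1 + d) = q powi d + inverse q * qint q d"
    using qint_add[OF assms, of d 1] by (simp add: power_int_minus add.commute)
  ultimately show ?thesis by (simp add: algebra_simps)
qed

lemma qint_nonzero: assumes "generic q" "d \<noteq> 0" shows "qint q d \<noteq> 0"
proof -
  have n: "qnat q k \<noteq> 0" if "k \<noteq> 0" for k
  proof (cases "k = 1")
    case True then show ?thesis using qint_of_nat[of q 1] by simp
  next
    case False with that have "k \<ge> 2" by simp
    with assms show ?thesis by (auto simp: generic_def)
  qed
  show ?thesis using assms(2) n[of "nat d"] n[of "nat (-d)"] by (auto simp: qint_def)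
qed

text \<open>The diagonal coefficient of Hoefsmit's form at axial distance d. Its companion
  \<open>qg\<close> is the off-diagonal coefficient after transposition: exchanging the two entries
  negates d, and [1-d]/[-d] = [d-1]/[d].\<close>

definition qf :: "complex \<Rightarrow> int \<Rightarrow> complex" where
  "qf q d = q powi d / qint q d"

definition qg :: "complex \<Rightarrow> int \<Rightarrow> complex" where
  "qg q d = qint q (d - 1) / qint q d"

text \<open>The two diagonal entries of the block of a tableau and its swap add up to q - 1/q, the
  trace of a matrix with eigenvalues q and -1/q.\<close>

lemma qf_minus: assumes "generic q" "d \<noteq> 0"
  shows "qf q (- d) = (q - inverse q) - qf q d"
proof -
  have q: "q \<noteq> 0" using assms by (simp add: generic_def)
  show ?thesis using qint_hq[OF q, of d] qint_nonzero[OF assms]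
    by (simp add: qf_def qint_minus field_simps)
qed

text \<open>Three consecutive boxes have axial distances a, b and a + b. This relation between their
  diagonal coefficients is what the braid relation reduces to.\<close>

lemma qf_mult: assumes "generic q" "a \<noteq> 0" "b \<noteq> 0" "a + b \<noteq> 0"
  shows "qf q a * qf q b = qf q (a + b) * (qf q a + qf q b - (q - inverse q))"
proof -
  have q: "q \<noteq> 0" using assms by (simp add: generic_def)
  define A B where "A = qint q a" and "B = qint q b"
  define x y where "x = q powi a" and "y = q powi b"
  have nz: "A \<noteq> 0" "B \<noteq> 0" "x \<noteq> 0" "y \<noteq> 0" "qint q (a + b) \<noteq> 0"
    using qint_nonzero[OF assms(1)] assms q by (auto simp: A_def B_def x_def y_def)
  have AB: "qint q (a + b) = x * B + inverse y * A"
    using qint_add[OF q] by (simp add: x_def y_def A_def B_def power_int_minus)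
  have h: "(q - inverse q) * B = y - inverse y"
    using qint_hq[OF q] by (simp add: y_def B_def power_int_minus)
  have "(x * y) * (x * B + y * A - (q - inverse q) * A * B) = (x * y) * (x * B + y * A - A * (y - inverse y))"
    by (simp add: h[symmetric])
  also have "\<dots> = (x * y) * qint q (a + b)" unfolding AB by (simp add: algebra_simps)
  finally have e: "(x * y) * (x * B + y * A - (q - inverse q) * A * B) = (x * y) * qint q (a + b)" .
  have "qf q a + qf q b - (q - inverse q) = (x * B + y * A - (q - inverse q) * A * B) / (A * B)"
    using nz by (simp add: qf_def flip: A_def B_def x_def y_def) (simp add: field_simps)
  then have "qf q (a + b) * (qf q a + qf q b - (q - inverse q)) = (x * y) / qint q (a + b) * (x * B + y * A - (q - inverse q) * A * B) / (A * B)"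
    using q by (simp add: qf_def x_def y_def power_int_add)
  also have "\<dots> = ((x * y) * qint q (a + b)) / (qint q (a + b) * (A * B))"
    unfolding e[symmetric] by simp
  also have "\<dots> = qf q a * qf q b" using nz by (simp add: qf_def flip: A_def B_def x_def y_def)
  finally show ?thesis by simp
qed

text \<open>The determinant of the two-dimensional block is -1, the product of the eigenvalues q and
  -1/q.\<close>

lemma qg_mult: assumes "generic q" "d \<noteq> 0"
  shows "qg q d * qg q (- d) = (q - inverse q) * qf q d + 1 - (qf q d)\<^sup>2"
proof -
  have q: "q \<noteq> 0" using assms by (simp add: generic_def)
  define D x where "D = qint q d" and "x = q powi d"
  have nz: "D \<noteq> 0" "x \<noteq> 0" using qint_nonzero[OF assms] q by (auto simp: D_def x_def)
  have h: "(q - inverse q) * D = x - inverse x"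
    using qint_hq[OF q] by (simp add: x_def D_def power_int_minus)
  have p: "qint q (d + 1) = q * D + inverse x"
    using qint_plus_1[OF q] by (simp add: x_def D_def power_int_minus)
  have "qint q d = q * qint q (d - 1) + q powi (- (d - 1))"
    using qint_plus_1[OF q, of "d - 1"] by simp
  moreover have "q powi (- (d - 1)) = q * inverse x" using q by (simp add: x_def power_int_diff power_int_minus field_simps)
  ultimately have m: "qint q (d - 1) = inverse q * D - inverse x" using q by (simp add: D_def field_simps)
  have "- d - 1 = - (d + 1)" by simp
  then have m': "qint q (- d - 1) = - qint q (d + 1)" by (simp only: qint_minus)
  have "qint q (d - 1) * qint q (d + 1) = D\<^sup>2 - ((q - inverse q) * D) * inverse x - inverse x * inverse x"
    unfolding m p using q by (simp add: algebra_simps power2_eq_square)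
  also have "\<dots> = D\<^sup>2 - 1" unfolding h using nz by (simp add: algebra_simps)
  finally have e: "qint q (d - 1) * qint q (d + 1) = D\<^sup>2 - 1" .
  have "qg q d * qg q (- d) = (D\<^sup>2 - 1) / D\<^sup>2"
    using nz e by (simp add: qg_def m' qint_minus power2_eq_square flip: D_def)
  also have "\<dots> = (x * (x - inverse x) + D\<^sup>2 - x\<^sup>2) / D\<^sup>2" using nz by (simp add: field_simps power2_eq_square)
  also have "\<dots> = (q - inverse q) * qf q d + 1 - (qf q d)\<^sup>2"
    unfolding h[symmetric] using nz by (simp add: qf_def field_simps power2_eq_square flip: D_def x_def)
  finally show ?thesis .
qed

section \<open>Linear functionals on free algebras, and ideals generated by relations\<close>

section \<open>Free algebras and ideals of relations\<close>

lemma const_0 [simp]: "const 0 = 0" by (simp add: const_def)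
lemma const_1 [simp]: "const 1 = 1" by (simp add: const_def)
lemma const_add: "const (a + b) = const a + const b" by (simp add: const_def single_add)
lemma const_diff: "const (a - b) = const a - const b" by (simp add: const_def single_diff)
lemma const_minus: "const (- a) = - const a" by (simp add: const_def single_uminus)
lemma const_mult: "const (a * b) = const a * const b" by (simp add: const_def mult_single)
lemma const_sum: "const (sum f A) = (\<Sum>a\<in>A. const (f a))"
  by (induction A rule: infinite_finite_induct) (simp_all add: const_add)
lemma const_eq_0_iff [simp]: "const a = 0 \<longleftrightarrow> a = 0"
  by (metis const_def const_0 lookup_single_eq lookup_zero)
lemma pm_expand: "x = (\<Sum>w\<in>keys x. single w (lookup x w))"
proof (rule poly_mapping_eqI)
  fix k
  show "lookup x k = lookup (\<Sum>w\<in>keys x. single w (lookup x w)) k"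
    by (cases "k \<in> keys x")
      (auto simp: lookup_sum lookup_single when_def in_keys_iff)
qed

lemma const_single: "const c * single w a = single w (c * a)"
    "single w a * const c = single w (a * c)"
  by (simp_all add: const_def mult_single)

lemma const_commute: "const c * x = x * const c"
proof -
  have "const c * (\<Sum>w\<in>keys x. single w (lookup x w))
     = (\<Sum>w\<in>keys x. single w (lookup x w)) * const c"
    unfolding sum_distrib_left sum_distrib_right const_single by (simp add: mult.commute)
  then show ?thesis by (simp only: pm_expand[symmetric])
qed

text \<open>The linear extension of a function of words. Seminormal actions and entries of tensor
  operators are both of this kind, so additivity and the product rule are proved once.\<close>

definition lin :: "('w \<Rightarrow> complex) \<Rightarrow> ('w \<Rightarrow>\<^sub>0 complex) \<Rightarrow> complex" where
  "lin f x = (\<Sum>w\<in>keys x. lookup x w * f w)"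

lemma lin_superset: "finite A \<Longrightarrow> keys x \<subseteq> A \<Longrightarrow> lin f x = (\<Sum>w\<in>A. lookup x w * f w)"
  unfolding lin_def by (rule sum.mono_neutral_left) (auto simp: in_keys_iff)

lemma lin_add: "lin f (x + y) = lin f x + lin f y"
  using lin_superset[of "keys x \<union> keys y" x f]
    lin_superset[of "keys x \<union> keys y" y f]
    lin_superset[of "keys x \<union> keys y" "x + y" f] keys_add[of x y]
  by (simp add: lookup_add sum.distrib algebra_simps)

lemma lin_0 [simp]: "lin f 0 = 0" by (simp add: lin_def)

lemma lin_single [simp]: "lin f (single w a) = a * f w"
  by (simp add: lin_def)

lemma lin_sum: "lin f (sum g A) = (\<Sum>a\<in>A. lin f (g a))"
  by (induction A rule: infinite_finite_induct) (simp_all add: lin_add)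

lemma lin_const_mult: "lin f (const c * x) = c * lin f x"
proof -
  have "lin f (const c * (\<Sum>w\<in>keys x. single w (lookup x w))) = c * lin f x"
    unfolding sum_distrib_left const_single lin_sum lin_single by (simp add: lin_def sum_distrib_left mult.assoc)
  then show ?thesis by (simp only: pm_expand[symmetric])
qed

lemma lin_minus: fixes x :: "'w::monoid_add \<Rightarrow>\<^sub>0 complex" shows "lin f (- x) = - lin f x"
  using lin_const_mult[of f "- 1" x] by (simp add: const_minus)

lemma lin_diff: fixes x :: "'w::monoid_add \<Rightarrow>\<^sub>0 complex" shows "lin f (x - y) = lin f x - lin f y"
  using lin_add[of f x "- y"] by (simp add: lin_minus)

text \<open>Both factors are expanded into words. A function that is multiplicative on
  concatenations therefore extends to an algebra action; \<open>actx_mult\<close> and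
  \<open>rh_mult\<close> are the two instances.\<close>

lemma lin_mult: "lin f (x * y) = lin (\<lambda>u. lin (\<lambda>v. f (u + v)) y) x"
proof -
  have "lin f ((\<Sum>u\<in>keys x. single u (lookup x u))
     * (\<Sum>v\<in>keys y. single v (lookup y v))) = lin (\<lambda>u. lin (\<lambda>v. f (u + v)) y) x"
    unfolding sum_product lin_sum mult_single lin_single
    by (simp add: lin_def sum_distrib_left mult.assoc)
  then show ?thesis by (simp only: pm_expand[symmetric])
qed

lemma lin_fun_add: "lin (\<lambda>w. f w + g w) x = lin f x + lin g x"
  by (simp add: lin_def algebra_simps sum.distrib)

lemma lin_fun_mult: "lin (\<lambda>w. c * f w) x = c * lin f x"
  by (simp add: lin_def algebra_simps sum_distrib_left)

lemma lin_fun_sum: "lin (\<lambda>w. \<Sum>a\<in>A. f a w) x = (\<Sum>a\<in>A. lin (f a) x)"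
  unfolding lin_def sum_distrib_left by (rule sum.swap)

lemma lin_cong: "(\<And>w. w \<in> keys x \<Longrightarrow> f w = g w) \<Longrightarrow> lin f x = lin g x"
  by (simp add: lin_def)

abbreviation free_carrier :: "'g set \<Rightarrow> 'g free set" where
  "free_carrier G \<equiv> carrier (free_alg G)"

abbreviation fword_set :: "'g fword \<Rightarrow> 'g set" where
  "fword_set w \<equiv> set (letters w)"

lemma free_carrier_iff: "x \<in> free_carrier G \<longleftrightarrow> (\<forall>w\<in>keys x. fword_set w \<subseteq> G)"
  by (simp add: free_alg_def)

lemma free_alg_simps [simp]:
  "x \<otimes>\<^bsub>free_alg G\<^esub> y = x * y" "x \<oplus>\<^bsub>free_alg G\<^esub> y = x + y" "\<one>\<^bsub>free_alg G\<^esub> = 1" "\<zero>\<^bsub>free_alg G\<^esub> = 0"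
  by (simp_all add: free_alg_def)

lemma letters_plus [simp]: "letters (u + v) = letters u @ letters v"
  by (simp add: plus_fword_def)

lemma letters_0 [simp]: "letters 0 = []"
  by (simp add: zero_fword_def)

lemma free_carrier_0 [simp]: "0 \<in> free_carrier G" by (simp add: free_carrier_iff)
lemma free_carrier_single: "fword_set w \<subseteq> G \<Longrightarrow> single w a \<in> free_carrier G"
  by (simp add: free_carrier_iff)
lemma free_carrier_const [simp]: "const c \<in> free_carrier G"
  by (simp add: const_def free_carrier_single)
lemma free_carrier_1 [simp]: "1 \<in> free_carrier G"
  by (metis const_1 free_carrier_const)
lemma free_carrier_gen [simp]: "g \<in> G \<Longrightarrow> gen g \<in> free_carrier G"
  by (simp add: gen_def free_carrier_single)
lemma free_carrier_add [simp]: "x \<in> free_carrier G \<Longrightarrow> y \<in> free_carrier G \<Longrightarrow> x + y \<in> free_carrier G"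
  using keys_add[of x y] by (auto simp: free_carrier_iff)
lemma free_carrier_minus [simp]: "x \<in> free_carrier G \<Longrightarrow> - x \<in> free_carrier G"
  by (simp add: free_carrier_iff in_keys_iff)
lemma free_carrier_diff [simp]: "x \<in> free_carrier G \<Longrightarrow> y \<in> free_carrier G \<Longrightarrow> x - y \<in> free_carrier G"
  using free_carrier_add[of x G "- y"] by simp
lemma free_carrier_mult [simp]: "x \<in> free_carrier G \<Longrightarrow> y \<in> free_carrier G \<Longrightarrow> x * y \<in> free_carrier G"
  using keys_mult[of x y] by (fastforce simp: free_carrier_iff)
lemma free_carrier_sum [simp]: "(\<And>a. a \<in> A \<Longrightarrow> f a \<in> free_carrier G) \<Longrightarrow> sum f A \<in> free_carrier G"
  by (induction A rule: infinite_finite_induct) simp_all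
lemma free_carrier_mono: "G \<subseteq> H \<Longrightarrow> x \<in> free_carrier G \<Longrightarrow> x \<in> free_carrier H"
  by (auto simp: free_carrier_iff)

lemma ring_free_alg: "ring (free_alg G)"
proof (rule ringI)
  show "abelian_group (free_alg G)"
  proof (rule abelian_groupI)
    fix x assume "x \<in> free_carrier G"
    then show "\<exists>y\<in>free_carrier G. y \<oplus>\<^bsub>free_alg G\<^esub> x = \<zero>\<^bsub>free_alg G\<^esub>"
      by (intro bexI[of _ "- x"]) simp_all
  qed (simp_all add: add.commute add.left_commute)
  show "monoid (free_alg G)"
    by (rule monoidI) (simp_all add: mult.assoc)
qed (simp_all add: algebra_simps)

lemma ring_minus_free_alg: assumes "x \<in> free_carrier G" shows "\<ominus>\<^bsub>free_alg G\<^esub> x = - x"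
proof -
  interpret ring "free_alg G" by (rule ring_free_alg)
  show ?thesis using assms minus_equality[of "- x" x] by simp
qed

text \<open>Additive inverses come from multiplication by the scalar -1, so closure under sums and
  two-sided products suffices. In this shape kernels of actions are seen to be ideals at
  once.\<close>

lemma ideal_of_free_alg_iff:
  "ideal I (free_alg G) \<longleftrightarrow> I \<subseteq> free_carrier G \<and> 0 \<in> I \<and> (\<forall>x\<in>I. \<forall>y\<in>I. x + y \<in> I) \<and>
     (\<forall>x\<in>I. \<forall>y\<in>free_carrier G. x * y \<in> I \<and> y * x \<in> I)" (is "?L \<longleftrightarrow> ?R")
proof
  assume ?L
  then interpret ideal I "free_alg G" .
  have A: "additive_subgroup I (free_alg G)" by (rule additive_subgroup_axioms)
  show ?R
    using a_subset additive_subgroup.zero_closed[OF A] additive_subgroup.a_closed[OF A] I_l_closed I_r_closed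
    by auto
next
  assume R: ?R
  interpret ring "free_alg G" by (rule ring_free_alg)
  have neg: "- x \<in> I" if "x \<in> I" for x
  proof -
    have "const (- 1) * x \<in> I" using R that free_carrier_const by blast
    then show ?thesis by (simp add: const_minus)
  qed
  show ?L
  proof (rule idealI)
    show "ring (free_alg G)" by (rule ring_free_alg)
    show "subgroup I (add_monoid (free_alg G))"
    proof (rule add.subgroupI)
      show "I \<noteq> {}" using R by auto
      fix a assume "a \<in> I"
      then show "\<ominus>\<^bsub>free_alg G\<^esub> a \<in> I" using R neg by (subst ring_minus_free_alg) auto
    qed (use R in auto)
  qed (use R in auto)
qed

definition rel_ideal :: "'g set \<Rightarrow> 'g free set \<Rightarrow> 'g free set" where
  "rel_ideal G rels = Idl\<^bsub>free_alg G\<^esub> rels"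

context
  fixes G :: "'g set" and rels :: "'g free set"
  assumes rels: "rels \<subseteq> free_carrier G"
begin

lemma rel_ideal_ideal: "ideal (rel_ideal G rels) (free_alg G)"
  unfolding rel_ideal_def by (rule ring.genideal_ideal[OF ring_free_alg rels])

lemma rel_ideal_subset: "x \<in> rel_ideal G rels \<Longrightarrow> x \<in> free_carrier G"
  using rel_ideal_ideal by (auto simp: ideal_of_free_alg_iff)
lemma rel_ideal_0: "0 \<in> rel_ideal G rels"
  using rel_ideal_ideal by (auto simp: ideal_of_free_alg_iff)
lemma rel_ideal_add: "x \<in> rel_ideal G rels \<Longrightarrow> y \<in> rel_ideal G rels \<Longrightarrow> x + y \<in> rel_ideal G rels"
  using rel_ideal_ideal by (auto simp: ideal_of_free_alg_iff)
lemma rel_ideal_mult: "x \<in> rel_ideal G rels \<Longrightarrow> y \<in> free_carrier G \<Longrightarrow> x * y \<in> rel_ideal G rels"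
    "x \<in> rel_ideal G rels \<Longrightarrow> y \<in> free_carrier G \<Longrightarrow> y * x \<in> rel_ideal G rels"
  using rel_ideal_ideal by (auto simp: ideal_of_free_alg_iff)
lemma rel_ideal_minus: "x \<in> rel_ideal G rels \<Longrightarrow> - x \<in> rel_ideal G rels"
  using rel_ideal_mult(2)[of x "const (- 1)"] by (simp add: const_minus)
lemma rel_ideal_diff: "x \<in> rel_ideal G rels \<Longrightarrow> y \<in> rel_ideal G rels \<Longrightarrow> x - y \<in> rel_ideal G rels"
  using rel_ideal_add[of x "- y"] rel_ideal_minus by simp
lemma rel_ideal_sum: "(\<And>a. a \<in> A \<Longrightarrow> f a \<in> rel_ideal G rels) \<Longrightarrow> sum f A \<in> rel_ideal G rels"
  by (induction A rule: infinite_finite_induct) (auto simp: rel_ideal_0 rel_ideal_add)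
lemma rel_ideal_rel: "x \<in> rels \<Longrightarrow> x \<in> rel_ideal G rels"
  unfolding rel_ideal_def using ring.genideal_self[OF ring_free_alg rels] by blast
lemma rel_ideal_minimal: "ideal I (free_alg G) \<Longrightarrow> rels \<subseteq> I \<Longrightarrow> rel_ideal G rels \<subseteq> I"
  unfolding rel_ideal_def by (rule ring.genideal_minimal[OF ring_free_alg])

lemma presented_class_eq_iff:
  assumes "x \<in> free_carrier G" "y \<in> free_carrier G"
  shows "presented_class G rels x = presented_class G rels y \<longleftrightarrow> x - y \<in> rel_ideal G rels"
proof -
  have "x \<ominus>\<^bsub>free_alg G\<^esub> y = x - y"
    using assms by (simp add: a_minus_def ring_minus_free_alg)
  then show ?thesis
    using ring.quotient_eq_iff_same_a_r_cos[OF ring_free_alg rel_ideal_ideal assms]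
    by (simp add: presented_class_def rel_ideal_def)
qed

lemma presented_class_mem:
  assumes "x \<in> free_carrier G"
  shows "y \<in> presented_class G rels x \<longleftrightarrow> y - x \<in> rel_ideal G rels"
proof -
  have "y \<in> presented_class G rels x \<longleftrightarrow> (\<exists>z\<in>rel_ideal G rels. y = z + x)"
    by (auto simp: presented_class_def rel_ideal_def a_r_coset_def' )
  also have "\<dots> \<longleftrightarrow> y - x \<in> rel_ideal G rels"
    by (metis add_diff_cancel diff_add_cancel)
  finally show ?thesis .
qed

lemma presented_class_hom: "presented_class G rels \<in> Ring.ring_hom (free_alg G) (presented_alg G rels)"
  using ideal.rcos_ring_hom[OF rel_ideal_ideal]
  by (simp add: presented_class_def[abs_def] presented_alg_def rel_ideal_def)

lemma presented_class_add: "x \<in> free_carrier G \<Longrightarrow> y \<in> free_carrier G \<Longrightarrow>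
    presented_class G rels x \<oplus>\<^bsub>presented_alg G rels\<^esub> presented_class G rels y = presented_class G rels (x + y)"
  using ring_hom_add[OF presented_class_hom] by simp

lemma presented_class_mult: "x \<in> free_carrier G \<Longrightarrow> y \<in> free_carrier G \<Longrightarrow>
    presented_class G rels x \<otimes>\<^bsub>presented_alg G rels\<^esub> presented_class G rels y = presented_class G rels (x * y)"
  using ring_hom_mult[OF presented_class_hom] by simp

lemma presented_carrier: "carrier (presented_alg G rels) = presented_class G rels ` free_carrier G"
  by (auto simp: presented_alg_def presented_class_def[abs_def] FactRing_def A_RCOSETS_def')

text \<open>The chosen representative is arbitrary but stays in the coset of x, so an evaluation
  that vanishes on the ideal of relations does not depend on the choice.\<close>

lemma representative_class:
  assumes "x \<in> free_carrier G"
  shows "representative (presented_class G rels x) - x \<in> rel_ideal G rels"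
proof -
  have "x \<in> presented_class G rels x" using assms rel_ideal_0 by (simp add: presented_class_mem)
  then have "representative (presented_class G rels x) \<in> presented_class G rels x"
    unfolding representative_def by (rule someI)
  then show ?thesis using assms by (simp add: presented_class_mem)
qed

end

section \<open>Tableaux as growth sequences of diagrams\<close>

section \<open>Standard tableaux and the seminormal action\<close>

text \<open>Young diagrams as finite lower sets of pairs, so that adding and removing boxes are set
  operations. Lists of parts return only where the given definitions are compared with this
  encoding.\<close>

definition downset :: "box set \<Rightarrow> bool" where
  "downset D \<longleftrightarrow> finite D \<and> (\<forall>a\<in>D. \<forall>b. fst b \<le> fst a \<and> snd b \<le> snd a \<longrightarrow> b \<in> D)"

lemma downsetD: "downset D \<Longrightarrow> (r, c) \<in> D \<Longrightarrow> r' \<le> r \<Longrightarrow> c' \<le> c \<Longrightarrow> (r', c') \<in> D"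
  by (fastforce simp: downset_def)

lemma downset_finite: "downset D \<Longrightarrow> finite D"
  by (simp add: downset_def)

lemma downset_empty [simp]: "downset {}"
  by (simp add: downset_def)

lemma downset_Un: "downset A \<Longrightarrow> downset B \<Longrightarrow> downset (A \<union> B)"
  unfolding downset_def by (metis Un_iff finite_Un)

lemma downset_Int: "downset A \<Longrightarrow> downset B \<Longrightarrow> downset (A \<inter> B)"
  unfolding downset_def by (metis Int_iff finite_Int)

text \<open>A standard tableau is a sequence of boxes all of whose initial segments are diagrams.
  The shape is not fixed, so that appending a box expresses the branching rule.\<close>

definition Std :: "box list set" where
  "Std = {T. distinct T \<and> (\<forall>j. downset (set (take j T)))}"

lemma Std_Nil [simp]: "[] \<in> Std"
  by (simp add: Std_def)

lemma Std_distinct: "T \<in> Std \<Longrightarrow> distinct T"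
  by (simp add: Std_def)

lemma Std_downset: "T \<in> Std \<Longrightarrow> downset (set T)"
  unfolding Std_def by (metis (mono_tags, lifting) mem_Collect_eq order_refl take_all)

lemma Std_take: "T \<in> Std \<Longrightarrow> take j T \<in> Std"
  by (auto simp: Std_def)

lemma Std_append: "S @ T \<in> Std \<Longrightarrow> S \<in> Std"
  using Std_take[of "S @ T" "length S"] by simp

lemma Std_snoc: "T @ [b] \<in> Std \<longleftrightarrow> T \<in> Std \<and> b \<notin> set T \<and> downset (insert b (set T))"
proof
  assume "T @ [b] \<in> Std"
  then show "T \<in> Std \<and> b \<notin> set T \<and> downset (insert b (set T))"
    using Std_append Std_distinct Std_downset by fastforce
next
  assume A: "T \<in> Std \<and> b \<notin> set T \<and> downset (insert b (set T))"
  have "downset (set (take j (T @ [b])))" for j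
    using A by (cases "j \<le> length T") (auto simp: Std_def)
  with A show "T @ [b] \<in> Std" by (simp add: Std_def)
qed

text \<open>Increase along rows and columns says that no box comes after one lying weakly to its
  lower right, which is the closure of every initial segment under smaller boxes.\<close>

lemma std_tableaux_iff:
  "T \<in> std_tableaux \<nu> \<longleftrightarrow> downset (young_diagram \<nu>) \<and> T \<in> Std \<and> set T = young_diagram \<nu>"
  if "downset (young_diagram \<nu>)"
proof
  assume A: "T \<in> std_tableaux \<nu>"
  then have d: "distinct T" "set T = young_diagram \<nu>" by (auto simp: std_tableaux_def)
  have o: "\<not> (fst (T ! j) \<le> fst (T ! i) \<and> snd (T ! j) \<le> snd (T ! i))" if "j < length T" "i < j" for i j
    using A that by (auto simp: std_tableaux_def)
  have "downset (set (take j T))" for j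
    unfolding downset_def
  proof (intro conjI ballI allI impI)
    fix a b assume a: "a \<in> set (take j T)" and b: "fst b \<le> fst a \<and> snd b \<le> snd a"
    from a obtain i where i: "i < j" "i < length T" "a = T ! i" by (auto simp: in_set_conv_nth)
    have "b \<in> set T" using that d b a unfolding downset_def by (metis in_set_takeD)
    then obtain l where l: "l < length T" "b = T ! l" by (auto simp: in_set_conv_nth)
    have "\<not> i < l" using o[of l i] l i b by auto
    then show "b \<in> set (take j T)" using i l by (auto simp: in_set_conv_nth intro!: exI[of _ l])
  qed simp
  with d that show "downset (young_diagram \<nu>) \<and> T \<in> Std \<and> set T = young_diagram \<nu>" by (simp add: Std_def)
next
  assume A: "downset (young_diagram \<nu>) \<and> T \<in> Std \<and> set T = young_diagram \<nu>"
  have "\<not> (fst (T ! j) \<le> fst (T ! i) \<and> snd (T ! j) \<le> snd (T ! i))" if "j < length T" "i < j" for i j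
  proof
    assume le: "fst (T ! j) \<le> fst (T ! i) \<and> snd (T ! j) \<le> snd (T ! i)"
    have "downset (set (take (Suc i) T))" using A by (simp add: Std_def)
    moreover have "T ! i \<in> set (take (Suc i) T)" using that by (simp add: take_Suc_conv_app_nth)
    ultimately have "T ! j \<in> set (take (Suc i) T)" using le unfolding downset_def by blast
    then obtain l where "l < Suc i" "T ! l = T ! j" "l < length T" by (auto simp: in_set_conv_nth)
    then show False using A that Std_distinct[of T] by (auto simp: nth_eq_iff_index_eq)
  qed
  with A show "T \<in> std_tableaux \<nu>" by (auto simp: std_tableaux_def Std_distinct)
qed

text \<open>If B could also be added before A, neither box is weakly to the upper left of the other,
  so their diagonals are at least two apart. Otherwise the box that B waits for is A, and since
  nothing else may be missing, A is the left or the upper neighbour of B.\<close>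

lemma downset_insert2:
  assumes D: "downset D" and A: "downset (insert A D)" "A \<notin> D"
    and B: "downset (insert B (insert A D))" "B \<notin> insert A D"
  shows downset_insert2_swap: "downset (insert B D) \<Longrightarrow> \<bar>content B - content A\<bar> \<ge> 2"
    and downset_insert2_noswap: "\<not> downset (insert B D) \<Longrightarrow> \<bar>content B - content A\<bar> = 1"
proof -
  obtain r c where Arc: "A = (r, c)" by (cases A)
  obtain r' c' where Brc: "B = (r', c')" by (cases B)
  have nBA: "\<not> (r' \<le> r \<and> c' \<le> c)"
    using downsetD[OF A(1), of r c r' c'] B(2) by (auto simp: Arc Brc)
  show "\<bar>content B - content A\<bar> \<ge> 2" if "downset (insert B D)"
  proof -
    have "\<not> (r \<le> r' \<and> c \<le> c')"
      using downsetD[OF that, of r' c' r c] A(2) B(2) by (auto simp: Arc Brc)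
    with nBA show ?thesis by (auto simp: content_def Arc Brc)
  qed
  show "\<bar>content B - content A\<bar> = 1" if nd: "\<not> downset (insert B D)"
  proof -
    have "\<exists>b. fst b \<le> fst B \<and> snd b \<le> snd B \<and> b \<notin> insert B D"
    proof (rule ccontr)
      assume "\<not> ?thesis"
      then have "downset (insert B D)" using D unfolding downset_def by blast
      with nd show False ..
    qed
    then obtain b where b: "fst b \<le> fst B" "snd b \<le> snd B" "b \<notin> insert B D" by blast
    then have "b \<in> insert B (insert A D)" using B(1) unfolding downset_def by blast
    with b have "b = A" by auto
    with b have le: "r \<le> r'" "c \<le> c'" by (auto simp: Arc Brc)
    have "r = r' \<or> c = c'"
    proof (rule ccontr)
      assume n: "\<not> (r = r' \<or> c = c')"
      have "(r', c) \<in> insert B (insert A D)" using downsetD[OF B(1), of r' c' r' c] le by (auto simp: Brc)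
      with n have "(r', c) \<in> D" by (auto simp: Arc Brc)
      then have "A \<in> D" using downsetD[OF D, of r' c r c] le by (auto simp: Arc)
      with A(2) show False ..
    qed
    moreover have "\<not> (r' \<ge> r + 2)"
    proof
      assume g: "r' \<ge> r + 2"
      have "(r + 1, c) \<in> insert B (insert A D)" using downsetD[OF B(1), of r' c' "r + 1" c] le g by (auto simp: Brc)
      with g have "(r + 1, c) \<in> D" by (auto simp: Arc Brc)
      then have "A \<in> D" using downsetD[OF D, of "r + 1" c r c] by (auto simp: Arc)
      with A(2) show False ..
    qed
    moreover have "\<not> (c' \<ge> c + 2)"
    proof
      assume g: "c' \<ge> c + 2"
      have "(r, c + 1) \<in> insert B (insert A D)" using downsetD[OF B(1), of r' c' r "c + 1"] le g by (auto simp: Brc)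
      with g have "(r, c + 1) \<in> D" by (auto simp: Arc Brc)
      then have "A \<in> D" using downsetD[OF D, of r "c + 1" r c] by (auto simp: Arc)
      with A(2) show False ..
    qed
    ultimately show ?thesis using le nBA by (auto simp: content_def Arc Brc)
  qed
qed

text \<open>On the diagonal of A, the box C would lie strictly to the lower right, so both the right
  and the lower neighbour of A would have to be added in between; there is only B.\<close>

lemma downset_insert3:
  assumes D: "downset D" and A: "downset (insert A D)" "A \<notin> D"
    and B: "downset (insert B (insert A D))"
    and C: "downset (insert C (insert B (insert A D)))" "C \<notin> insert B (insert A D)"
  shows "content C \<noteq> content A"
proof
  assume eq: "content C = content A"
  obtain r c where Arc: "A = (r, c)" by (cases A)
  obtain r' c' where Crc: "C = (r', c')" by (cases C)
  have "\<not> (r' \<le> r \<and> c' \<le> c)"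
    using downsetD[OF A(1), of r c r' c'] C(2) by (auto simp: Arc Crc)
  with eq have g: "r' > r" "c' > c" by (auto simp: content_def Arc Crc)
  have "(r, c + 1) \<in> insert C (insert B (insert A D))" "(r + 1, c) \<in> insert C (insert B (insert A D))"
    by (rule downsetD[OF C(1), of r' c']; use g in \<open>simp add: Crc\<close>)+
  then have "(r, c + 1) = C \<or> (r, c + 1) = B \<or> (r, c + 1) = A \<or> (r, c + 1) \<in> D"
    "(r + 1, c) = C \<or> (r + 1, c) = B \<or> (r + 1, c) = A \<or> (r + 1, c) \<in> D" by blast+
  moreover have "(r, c + 1) \<noteq> C" "(r + 1, c) \<noteq> C" "(r, c + 1) \<noteq> A" "(r + 1, c) \<noteq> A" "(r, c + 1) \<noteq> (r + 1, c)"
    using g by (simp_all add: Arc Crc)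
  moreover have "(r, c + 1) \<notin> D" "(r + 1, c) \<notin> D"
    using downsetD[OF D, of r "c + 1" r c] downsetD[OF D, of "r + 1" c r c] A(2) by (auto simp: Arc)
  ultimately show False by metis
qed

text \<open>Exchanging two neighbours changes a single initial segment as a set, the one that ends
  between them.\<close>

lemma Std_mid2: "P @ A # B # Q \<in> Std \<Longrightarrow> P @ B # A # Q \<in> Std \<longleftrightarrow> downset (insert B (set P))"
proof -
  assume S: "P @ A # B # Q \<in> Std"
  show ?thesis
  proof
    assume "P @ B # A # Q \<in> Std"
    then have "take (Suc (length P)) (P @ B # A # Q) \<in> Std" by (rule Std_take)
    then have "P @ [B] \<in> Std" by simp
    then show "downset (insert B (set P))" by (simp add: Std_snoc)
  next
    assume d: "downset (insert B (set P))"
    have "downset (set (take j (P @ B # A # Q)))" for j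
    proof -
      consider "j \<le> length P" | "j = Suc (length P)" | "Suc (Suc (length P)) \<le> j"
        by linarith
      then show ?thesis
      proof cases
        case 1
        have "downset (set (take j (P @ A # B # Q)))" using S by (simp add: Std_def)
        with 1 show ?thesis by simp
      next
        case 2 with d show ?thesis by simp
      next
        case 3
        then obtain m where m: "j = Suc (Suc (length P)) + m" using le_Suc_ex by blast
        have "downset (set (take j (P @ A # B # Q)))" using S by (simp add: Std_def)
        with m show ?thesis by (simp add: insert_commute)
      qed
    qed
    with S show "P @ B # A # Q \<in> Std" by (auto simp: Std_def)
  qed
qed

lemma Std_mid_downsets:
  assumes "P @ A # B # Q \<in> Std"
  shows "downset (set P)" "downset (insert A (set P))" "A \<notin> set P"
    "downset (insert B (insert A (set P)))" "B \<notin> insert A (set P)"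
proof -
  have "(P @ [A]) @ [B] \<in> Std" using Std_append[of "P @ [A, B]" Q] assms by simp
  then show "downset (set P)" "downset (insert A (set P))" "A \<notin> set P"
    "downset (insert B (insert A (set P)))" "B \<notin> insert A (set P)"
    unfolding Std_snoc by (auto simp: Std_downset)
qed

lemma Std_content_swap:
  assumes "P @ A # B # Q \<in> Std" "P @ B # A # Q \<in> Std"
  shows "\<bar>content B - content A\<bar> \<ge> 2"
  using downset_insert2_swap[OF Std_mid_downsets[OF assms(1)]] Std_mid2[OF assms(1)] assms(2) by blast

lemma Std_content_noswap:
  assumes "P @ A # B # Q \<in> Std" "P @ B # A # Q \<notin> Std"
  shows "\<bar>content B - content A\<bar> = 1"
  using downset_insert2_noswap[OF Std_mid_downsets[OF assms(1)]] Std_mid2[OF assms(1)] assms(2) by blast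

lemma Std_content_neq: "P @ A # B # Q \<in> Std \<Longrightarrow> content B \<noteq> content A"
  using Std_content_swap[of P A B Q] Std_content_noswap[of P A B Q] by force

lemma Std_content_neq3:
  assumes "P @ A # B # C # Q \<in> Std" shows "content C \<noteq> content A"
proof -
  have 1: "(P @ [A]) @ B # C # Q \<in> Std" using assms by simp
  show ?thesis
    using downset_insert3[of "set P" A B C] Std_mid_downsets[OF assms] Std_mid_downsets[OF 1] by simp
qed

section \<open>The seminormal operators and the Hecke relations between them\<close>

definition swp :: "nat \<Rightarrow> box list \<Rightarrow> box list" where
  "swp i S = S[i - 1 := S ! i, i := S ! (i - 1)]"

definition cdiff :: "nat \<Rightarrow> box list \<Rightarrow> int" where
  "cdiff i S = content (S ! i) - content (S ! (i - 1))"

text \<open>The generator with index i exchanges the boxes of the entries i and i + 1, which sit at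
  positions i - 1 and i of the list. Writing the tableau as \<open>P @ A # B # Q\<close> turns the
  index arithmetic into matching of lists.\<close>

lemma split_at:
  assumes "1 \<le> i" "i < length S"
  obtains P A B Q where "S = P @ A # B # Q" "i = Suc (length P)"
proof -
  have "S = take (i - 1) S @ S ! (i - 1) # drop i S"
    using id_take_nth_drop[of "i - 1" S] assms by simp
  then have "S = take (i - 1) S @ S ! (i - 1) # S ! i # drop (Suc i) S"
    using Cons_nth_drop_Suc[of i S] assms by simp
  moreover have "i = Suc (length (take (i - 1) S))" using assms by simp
  ultimately show ?thesis using that by blast
qed

lemma swp_mid [simp]: "swp (Suc (length P)) (P @ A # B # Q) = P @ B # A # Q"
  by (simp add: swp_def nth_append list_update_append)

lemma cdiff_mid [simp]: "cdiff (Suc (length P)) (P @ A # B # Q) = content B - content A"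
  by (simp add: cdiff_def nth_append)

text \<open>The transpose of the seminormal form, acting on functions of tableaux of all shapes and sizes
  at once; appending a box to the tableaux commutes with it.\<close>

definition act1 :: "complex \<Rightarrow> nat \<Rightarrow> (box list \<Rightarrow> complex) \<Rightarrow> box list \<Rightarrow> complex" where
  "act1 q i v S = qf q (cdiff i S) * v S + (if swp i S \<in> Std then qg q (cdiff i S) * v (swp i S) else 0)"

lemma act1_mid: "act1 q (Suc (length P)) v (P @ A # B # Q) =
   qf q (content B - content A) * v (P @ A # B # Q) +
   of_bool (P @ B # A # Q \<in> Std) * qg q (content B - content A) * v (P @ B # A # Q)"
  by (simp add: act1_def)

lemma act1_mid_next: "act1 q (Suc (Suc (length P))) v (P @ A # B # C # Q) =
   qf q (content C - content B) * v (P @ A # B # C # Q) +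
   of_bool (P @ A # C # B # Q \<in> Std) * qg q (content C - content B) * v (P @ A # C # B # Q)"
  using act1_mid[of q "P @ [A]" v B C Q] by simp

text \<open>When the swap is not standard, the content difference is 1 or -1 and one of the two
  factors is \<open>qg q 1\<close>, that is [0]/[1] = 0. So the determinant identity survives with
  the indicator in front.\<close>

lemma qg_swap_indicator:
  assumes "generic q" "P @ A # B # Q \<in> Std"
  shows "of_bool (P @ B # A # Q \<in> Std) * qg q (content B - content A) * qg q (content A - content B)
     = (q - inverse q) * qf q (content B - content A) + 1 - (qf q (content B - content A))\<^sup>2"
proof -
  have e: "content A - content B = - (content B - content A)" by simp
  have m: "qg q (content B - content A) * qg q (content A - content B)
     = (q - inverse q) * qf q (content B - content A) + 1 - (qf q (content B - content A))\<^sup>2"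
    unfolding e using qg_mult[OF assms(1), of "content B - content A"] Std_content_neq[OF assms(2)] by simp
  show ?thesis
  proof (cases "P @ B # A # Q \<in> Std")
    case False
    have "qg q 1 = 0" by (simp add: qg_def)
    moreover have "content B - content A = 1 \<or> content A - content B = 1"
      using Std_content_noswap[OF assms(2) False] by linarith
    ultimately have "qg q (content B - content A) * qg q (content A - content B) = 0" by auto
    with m False show ?thesis by simp
  qed (use m in simp)
qed

text \<open>The Cayley-Hamilton identity of a block with trace q - 1/q and determinant -1. The
  indicator p also covers the tableaux whose swap is not standard.\<close>

lemma act1_quadratic:
  assumes "generic q" "S \<in> Std" "1 \<le> i" "i < length S"
  shows "act1 q i (act1 q i v) S = (q - inverse q) * act1 q i v S + v S"
proof -
  obtain P A B Q where S: "S = P @ A # B # Q" and i: "i = Suc (length P)" using split_at assms by metis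
  have f: "qf q (content A - content B) = (q - inverse q) - qf q (content B - content A)"
    using qf_minus[OF assms(1), of "content B - content A"] Std_content_neq[of P A B Q] assms S by simp
  have g: "of_bool (P @ B # A # Q \<in> Std) * qg q (content B - content A) * qg q (content A - content B)
     = (q - inverse q) * qf q (content B - content A) + 1 - (qf q (content B - content A))\<^sup>2"
    using qg_swap_indicator[OF assms(1)] assms(2) S by simp
  define a where "a = qf q (content B - content A)"
  define h where "h = q - inverse q"
  define p :: complex where "p = of_bool (P @ B # A # Q \<in> Std)"
  define b where "b = qg q (content B - content A)"
  define b' where "b' = qg q (content A - content B)"
  have g': "p * b * b' = h * a + 1 - a\<^sup>2" using g by (simp add: a_def b_def b'_def p_def h_def)
  have "act1 q i (act1 q i v) S = a * (a * v S + p * b * v (P @ B # A # Q)) + p * b * ((h - a) * v (P @ B # A # Q) + b' * v S)"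
    unfolding S i act1_mid f using assms(2) by (simp add: S a_def b_def b'_def p_def h_def)
  also have "\<dots> = (a\<^sup>2 + p * b * b') * v S + h * p * b * v (P @ B # A # Q)"
    by (simp add: algebra_simps power2_eq_square)
  also have "\<dots> = h * (a * v S + p * b * v (P @ B # A # Q)) + v S"
    unfolding g' by (simp add: algebra_simps)
  also have "\<dots> = (q - inverse q) * act1 q i v S + v S"
    unfolding S i act1_mid by (simp add: S a_def b_def b'_def p_def h_def)
  finally show ?thesis .
qed

text \<open>The orderings of three consecutive boxes give at most six coordinates. Both sides are
  expanded, with indicators for the orderings that may fail to be standard, and compared coordinate
  by coordinate.\<close>

lemma act1_braid:
  assumes q: "generic q" and Std: "S \<in> Std" and i: "1 \<le> i" "Suc i < length S"
  shows "act1 q i (act1 q (Suc i) (act1 q i v)) S = act1 q (Suc i) (act1 q i (act1 q (Suc i) v)) S"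
proof -
  have "i < length S" using i by simp
  then obtain P A B Q' where "S = P @ A # B # Q'" and iP: "i = Suc (length P)" using split_at i by metis
  with i obtain C Q where S: "S = P @ A # B # C # Q" by (cases Q') auto
  define p where "p X Y Z = (of_bool (P @ X # Y # Z # Q \<in> Std) :: complex)" for X Y Z
  define V where "V X Y Z = v (P @ X # Y # Z # Q)" for X Y Z
  define f where "f X Y = qf q (content Y - content X)" for X Y
  define g where "g X Y = qg q (content Y - content X)" for X Y
  define h where "h = q - inverse q"
  have S1: "P @ A # B # (C # Q) \<in> Std" and S2: "(P @ [A]) @ B # C # Q \<in> Std" using Std S by simp_all
  have nz: "content B \<noteq> content A" "content C \<noteq> content B" "content C \<noteq> content A"
    using Std_content_neq[OF S1] Std_content_neq[OF S2] Std_content_neq3[OF S1] by auto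
  have neg: "f Y X = h - f X Y" if "content Y \<noteq> content X" for X Y
    using qf_minus[OF q, of "content Y - content X"] that by (simp add: f_def h_def)
  have f3: "f A B * f B C = f A C * (f A B + f B C - h)"
    using qf_mult[OF q, of "content B - content A" "content C - content B"] nz
    by (simp add: f_def h_def algebra_simps)
  have g1: "p B A C * g A B * g B A = h * f A B + 1 - (f A B)\<^sup>2"
    using qg_swap_indicator[OF q S1] by (simp add: f_def g_def h_def p_def)
  have g2: "p A C B * g B C * g C B = h * f B C + 1 - (f B C)\<^sup>2"
    using qg_swap_indicator[OF q S2] by (simp add: f_def g_def h_def p_def)
  \<comment> \<open>The reversed ordering is reached along two paths. If it is standard, so are all
    orderings in between, because diagrams are closed under unions and intersections; otherwise both
    products vanish.\<close>
  have pp: "p B A C * p B C A * p C B A = p A C B * p C A B * p C B A"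
  proof (cases "P @ C # B # A # Q \<in> Std")
    case True
    note C1 = Std_mid_downsets[OF S1] Std_mid_downsets[OF S2]
    have T1: "P @ C # B # (A # Q) \<in> Std" "(P @ [C]) @ B # A # Q \<in> Std" using True by simp_all
    note C2 = Std_mid_downsets[OF T1(1)] Std_mid_downsets[OF T1(2)]
    have ne: "A \<noteq> C" "A \<noteq> B" "B \<noteq> C" using nz by auto
    have d1: "downset (insert B (set P))"
    proof -
      have "insert B (set P) = insert B (insert A (set P)) \<inter> insert B (insert C (set P))" using ne by auto
      then show ?thesis using downset_Int[OF C1(4) C2(4)] by simp
    qed
    have d2: "downset (insert A (insert C (set P)))"
      using downset_Un[OF C1(2) C2(2)] by (simp add: Un_commute insert_commute)
    have 1: "P @ B # A # C # Q \<in> Std" using Std_mid2[OF S1] d1 by simp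
    have 2: "(P @ [A]) @ C # B # Q \<in> Std" using Std_mid2[OF S2] d2 by (simp add: insert_commute)
    have 3: "P @ C # A # B # Q \<in> Std" using Std_mid2[of P A C "B # Q"] 2 C2(2) by simp
    have 4: "P @ B # C # A # Q \<in> Std" using Std_mid2[OF T1(1)] d1 by simp
    show ?thesis using 1 2 3 4 by (simp add: p_def)
  qed (simp add: p_def)
  have L: "act1 q i (act1 q (Suc i) (act1 q i v)) S
     = f A B * (f B C * (f A B * V A B C + p B A C * g A B * V B A C)
                + p A C B * g B C * (f A C * V A C B + p C A B * g A C * V C A B))
     + p B A C * g A B * (f A C * (f B A * V B A C + g B A * V A B C)
                + p B C A * g A C * (f B C * V B C A + p C B A * g B C * V C B A))"
    unfolding S iP act1_mid act1_mid_next using Std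
    by (simp add: f_def g_def V_def p_def S)
  have R: "act1 q (Suc i) (act1 q i (act1 q (Suc i) v)) S
     = f B C * (f A B * (f B C * V A B C + p A C B * g B C * V A C B)
                + p B A C * g A B * (f A C * V B A C + p B C A * g A C * V B C A))
     + p A C B * g B C * (f A C * (f C B * V A C B + g C B * V A B C)
                + p C A B * g A C * (f A B * V C A B + p C B A * g A B * V C B A))"
    unfolding S iP act1_mid act1_mid_next using Std
    by (simp add: f_def g_def V_def p_def S)
  \<comment> \<open>The coordinates of the orderings B C A and C A B agree term by term on the two
    sides and drop out, so four coefficients remain.\<close>
  have "act1 q i (act1 q (Suc i) (act1 q i v)) S - act1 q (Suc i) (act1 q i (act1 q (Suc i) v)) S =
     ((f A B - f B C) * (f A B * f B C) + f A C * (p B A C * g A B * g B A - p A C B * g B C * g C B)) * V A B C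
     + p B A C * g A B * (f A B * f B C + f A C * (f B A - f B C)) * V B A C
     + p A C B * g B C * (f A B * f A C - f B C * f A B - f A C * f C B) * V A C B
     + g A B * g A C * g B C * (p B A C * p B C A * p C B A - p A C B * p C A B * p C B A) * V C B A"
    unfolding L R by (simp add: algebra_simps)
  also have "\<dots> = 0"
  proof -
    have "(f A B - f B C) * (f A B * f B C) + f A C * (p B A C * g A B * g B A - p A C B * g B C * g C B) = 0"
      unfolding f3 g1 g2 by (simp add: algebra_simps power2_eq_square)
    moreover have "f A B * f B C + f A C * (f B A - f B C) = 0"
      unfolding f3 neg[OF nz(1)] by (simp add: algebra_simps)
    moreover have "f A B * f A C - f A B * f B C - f A C * f C B = 0"
      unfolding f3 neg[OF nz(2)] by (simp add: algebra_simps)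
    ultimately show ?thesis unfolding pp by (simp add: mult.commute[of "f B C" "f A B"])
  qed
  finally show ?thesis by simp
qed

section \<open>The Hecke module of functions on tableaux and its Jucys-Murphy spectrum\<close>

section \<open>The seminormal action of the Hecke algebra\<close>

lemma swp_props:
  assumes "1 \<le> i" "i < length S"
  shows "set (swp i S) = set S" "length (swp i S) = length S"
proof -
  obtain P A B Q where "S = P @ A # B # Q" "i = Suc (length P)" using split_at assms by metis
  then show "set (swp i S) = set S" "length (swp i S) = length S" by auto
qed

lemma swp_snoc: assumes "1 \<le> i" "i < length S"
  shows "swp i (S @ [b]) = swp i S @ [b]" "cdiff i (S @ [b]) = cdiff i S"
proof -
  obtain P A B Q where "S = P @ A # B # Q" "i = Suc (length P)" using split_at assms by metis
  then show "swp i (S @ [b]) = swp i S @ [b]" "cdiff i (S @ [b]) = cdiff i S" by simp_all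
qed

text \<open>The exchanges act on disjoint pairs of positions and leave each other's content
  differences alone, so only products of indicators have to be compared: if both exchanges are
  possible together, each is possible alone.\<close>

lemma act1_commute:
  assumes Std: "S \<in> Std" and i: "1 \<le> i" "i + 2 \<le> j" "j < length S"
  shows "act1 q i (act1 q j v) S = act1 q j (act1 q i v) S"
proof -
  have "i < length S" using i by simp
  then obtain P A B Q where S0: "S = P @ A # B # Q" and iP: "i = Suc (length P)" using split_at i by metis
  have "1 \<le> j - Suc i" "j - Suc i < length Q" using i S0 iP by auto
  then obtain P' C D Q' where Q: "Q = P' @ C # D # Q'" and jP: "j - Suc i = Suc (length P')"
    using split_at by metis
  have S: "S = P @ A # B # P' @ C # D # Q'" using S0 Q by simp
  have j: "j = Suc (length (P @ X # Y # P'))" for X Y using jP iP i by simp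
  define p where "p X Y Z W = (of_bool (P @ X # Y # P' @ Z # W # Q' \<in> Std) :: complex)" for X Y Z W
  define V where "V X Y Z W = v (P @ X # Y # P' @ Z # W # Q')" for X Y Z W
  define f where "f X Y = qf q (content Y - content X)" for X Y
  define g where "g X Y = qg q (content Y - content X)" for X Y
  have J: "act1 q j v' (P @ X # Y # P' @ Z # W # Q') = f Z W * v' (P @ X # Y # P' @ Z # W # Q') + p X Y W Z * g Z W * v' (P @ X # Y # P' @ W # Z # Q')"
    for v' X Y Z W
    using act1_mid[of q "P @ X # Y # P'" v' Z W Q'] j[of X Y] by (simp add: f_def g_def p_def)
  have I: "act1 q i v' (P @ X # Y # P' @ Z # W # Q') = f X Y * v' (P @ X # Y # P' @ Z # W # Q') + p Y X Z W * g X Y * v' (P @ Y # X # P' @ Z # W # Q')"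
    for v' X Y Z W
    using act1_mid[of q "P" v' X Y "P' @ Z # W # Q'"] iP by (simp add: f_def g_def p_def)
  have pp: "p B A C D * p B A D C = p A B D C * p B A D C"
  proof (cases "P @ B # A # P' @ D # C # Q' \<in> Std")
    case True
    then have T: "P @ B # A # (P' @ D # C # Q') \<in> Std" "(P @ B # A # P') @ D # C # Q' \<in> Std" by simp_all
    have 1: "P @ B # A # (P' @ C # D # Q') \<in> Std"
      using Std_mid2[of P A B "P' @ C # D # Q'"] Std Std_mid_downsets(2)[OF T(1)] by (simp add: S)
    have 2: "(P @ A # B # P') @ D # C # Q' \<in> Std"
      using Std_mid2[of "P @ A # B # P'" C D Q'] Std Std_mid_downsets(2)[OF T(2)]
      by (simp add: S insert_commute)
    show ?thesis using 1 2 by (simp add: p_def)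
  qed (simp add: p_def)
  have "act1 q i (act1 q j v) S - act1 q j (act1 q i v) S
     = g A B * g C D * V B A D C * (p B A C D * p B A D C - p A B D C * p B A D C)"
    unfolding S I J by (simp add: V_def[symmetric] algebra_simps)
  then show ?thesis using pp by simp
qed

fun actw :: "complex \<Rightarrow> nat list \<Rightarrow> (box list \<Rightarrow> complex) \<Rightarrow> box list \<Rightarrow> complex" where
  "actw q [] v = v"
| "actw q (i # w) v = act1 q i (actw q w v)"

lemma actw_append: "actw q (u @ w) v = actw q u (actw q w v)"
  by (induction u) simp_all

text \<open>The value at S is row S of the seminormal matrix applied to the coordinate function v.
  Thus one function carries the coordinates for all shapes, and no bases have to be
  enumerated.\<close>

definition actx :: "complex \<Rightarrow> nat free \<Rightarrow> (box list \<Rightarrow> complex) \<Rightarrow> box list \<Rightarrow> complex" where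
  "actx q x v S = lin (\<lambda>w. actw q (letters w) v S) x"

lemma act1_lin: "act1 q i (\<lambda>S. lin (\<lambda>w. V w S) y) S = lin (\<lambda>w. act1 q i (V w) S) y"
  by (auto simp: act1_def lin_fun_add lin_fun_mult) (simp add: lin_def)

lemma actw_lin: "actw q u (\<lambda>S. lin (\<lambda>w. V w S) y) S = lin (\<lambda>w. actw q u (V w) S) y"
proof (induction u arbitrary: S)
  case (Cons i u)
  then have "actw q u (\<lambda>S. lin (\<lambda>w. V w S) y) = (\<lambda>S. lin (\<lambda>w. actw q u (V w) S) y)" by blast
  then show ?case by (simp add: act1_lin)
qed simp

lemma actw_zero: "actw q w (\<lambda>U. 0) = (\<lambda>U. 0)"
  by (induction w) (simp_all add: act1_def fun_eq_iff)

lemma actx_mult: "actx q (x * y) v = actx q x (actx q y v)"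
proof
  fix S
  show "actx q (x * y) v S = actx q x (actx q y v) S"
    unfolding actx_def[abs_def] lin_mult actw_lin by (simp add: actw_append)
qed

lemma actx_add: "actx q (x + y) v S = actx q x v S + actx q y v S"
  by (simp add: actx_def lin_add)
lemma actx_diff: "actx q (x - y) v S = actx q x v S - actx q y v S"
  by (simp add: actx_def lin_diff)
lemma actx_const_mult: "actx q (const c * x) v S = c * actx q x v S"
  by (simp add: actx_def lin_const_mult)
lemma actx_sum: "actx q (sum f A) v S = (\<Sum>a\<in>A. actx q (f a) v S)"
  by (simp add: actx_def lin_sum)
lemma actx_0 [simp]: "actx q 0 v S = 0"
  by (simp add: actx_def)
lemma actx_gen [simp]: "actx q (gen i) v = act1 q i v"
  by (rule ext) (simp add: actx_def gen_def)
lemma actx_const: "actx q (const c) v S = c * v S"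
  by (simp add: actx_def const_def)
lemma actx_1 [simp]: "actx q 1 v = v"
  using actx_const[of q 1 v] by auto

lemma act1_cong:
  assumes "S \<in> Std" "1 \<le> i" "i < length S"
    and "\<And>U. U \<in> Std \<Longrightarrow> set U = set S \<Longrightarrow> length U = length S \<Longrightarrow> v U = v' U"
  shows "act1 q i v S = act1 q i v' S"
  using assms swp_props[OF assms(2,3)] by (simp add: act1_def)

text \<open>Generators only exchange positions, so the value at S sees nothing but standard tableaux
  of the same shape.\<close>

lemma actw_cong:
  assumes "S \<in> Std" "set w \<subseteq> {1..<length S}"
    and "\<And>U. U \<in> Std \<Longrightarrow> set U = set S \<Longrightarrow> length U = length S \<Longrightarrow> v U = v' U"
  shows "actw q w v S = actw q w v' S"
  using assms
proof (induction w arbitrary: S)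
  case (Cons i w)
  show ?case unfolding actw.simps
    by (rule act1_cong) (use Cons in auto)
qed auto

abbreviation hecke_free :: "nat \<Rightarrow> nat free set" where
  "hecke_free k \<equiv> free_carrier (hecke_gens k)"

lemma hecke_free_mono: "j \<le> k \<Longrightarrow> x \<in> hecke_free j \<Longrightarrow> x \<in> hecke_free k"
  by (rule free_carrier_mono[of "hecke_gens j"]) (auto simp: hecke_gens_def)

lemma actx_cong:
  assumes "x \<in> hecke_free (length S)" "S \<in> Std"
    and "\<And>U. U \<in> Std \<Longrightarrow> set U = set S \<Longrightarrow> length U = length S \<Longrightarrow> v U = v' U"
  shows "actx q x v S = actx q x v' S"
  unfolding actx_def using assms
  by (intro lin_cong actw_cong) (auto simp: free_carrier_iff hecke_gens_def)

lemma Std_snoc_swap: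
  assumes "T @ [b] \<in> Std" "set S = set T"
  shows "S @ [b] \<in> Std \<longleftrightarrow> S \<in> Std"
  using assms by (auto simp: Std_snoc)

text \<open>Generators below the length of S do not touch the last box, and rearrangements of S can
  be extended by the same boxes. This is the restriction of a representation to one strand
  less.\<close>

lemma actw_snoc:
  assumes "S @ [b] \<in> Std" "set w \<subseteq> {1..<length S}"
  shows "actw q w v (S @ [b]) = actw q w (\<lambda>U. v (U @ [b])) S"
  using assms
proof (induction w arbitrary: S)
  case (Cons i w)
  then have i: "1 \<le> i" "i < length S" by auto
  have s: "swp i S @ [b] \<in> Std \<longleftrightarrow> swp i S \<in> Std"
    using Std_snoc_swap[OF Cons.prems(1)] swp_props(1)[OF i] by simp
  have "swp i S @ [b] \<in> Std \<Longrightarrow> actw q w v (swp i S @ [b]) = actw q w (\<lambda>U. v (U @ [b])) (swp i S)"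
    using Cons.IH[of "swp i S"] Cons.prems(2) swp_props(2)[OF i] by simp
  moreover have "actw q w v (S @ [b]) = actw q w (\<lambda>U. v (U @ [b])) S"
    using Cons by simp
  ultimately show ?case using s by (simp add: act1_def swp_snoc[OF i])
qed simp

lemma actx_snoc:
  assumes "S @ [b] \<in> Std" "x \<in> hecke_free (length S)"
  shows "actx q x v (S @ [b]) = actx q x (\<lambda>U. v (U @ [b])) S"
  unfolding actx_def using assms
  by (intro lin_cong actw_snoc) (auto simp: free_carrier_iff hecke_gens_def)

definition hecke_ker :: "complex \<Rightarrow> nat \<Rightarrow> nat free set" where
  "hecke_ker q k = {x \<in> hecke_free k. \<forall>S\<in>Std. length S = k \<longrightarrow> (\<forall>v. actx q x v S = 0)}"

lemma ideal_hecke_ker: "ideal (hecke_ker q k) (free_alg (hecke_gens k))"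
proof -
  have "actx q (y * x) v S = 0" if "x \<in> hecke_ker q k" "y \<in> hecke_free k" "S \<in> Std" "length S = k" for x y v S
  proof -
    have "actx q (y * x) v S = actx q y (\<lambda>U. 0) S"
      unfolding actx_mult by (rule actx_cong) (use that in \<open>auto simp: hecke_ker_def\<close>)
    also have "\<dots> = 0" by (simp add: actx_def actw_zero lin_def)
    finally show ?thesis .
  qed
  then show ?thesis unfolding ideal_of_free_alg_iff
    by (auto simp: hecke_ker_def actx_add actx_mult)
qed

lemma hecke_rels_subset: "hecke_rels q k \<subseteq> hecke_free k"
  by (auto simp: hecke_rels_def)

lemma hecke_rels_ker: assumes "generic q" shows "hecke_rels q k \<subseteq> hecke_ker q k"
proof
  fix x assume x: "x \<in> hecke_rels q k"
  have qq: "q * inverse q = 1" using assms by (simp add: generic_def)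
  have "actx q x v S = 0" if S: "S \<in> Std" "length S = k" for v S
  proof -
    from x consider (1) i where "x = gen i * gen (i + 1) * gen i - gen (i + 1) * gen i * gen (i + 1)"
        "i \<in> hecke_gens k" "i + 1 \<in> hecke_gens k"
      | (2) i j where "x = gen i * gen j - gen j * gen i" "i \<in> hecke_gens k" "j \<in> hecke_gens k" "i + 2 \<le> j"
      | (3) i where "x = (gen i - const q) * (gen i + const (inverse q))" "i \<in> hecke_gens k"
      unfolding hecke_rels_def by blast
    then show ?thesis
    proof cases
      case 1
      then show ?thesis using act1_braid[OF assms S(1), of i v] S
        by (simp add: hecke_gens_def actx_diff actx_mult)
    next
      case 2
      then show ?thesis using act1_commute[OF S(1), of i j q v] S
        by (simp add: hecke_gens_def actx_diff actx_mult)
    next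
      case 3
      have x': "x = gen i * gen i + const (inverse q) * gen i - const q * gen i - const (q * inverse q)"
        unfolding 3(1) using const_commute[of "inverse q" "gen i"]
        by (simp only: const_mult algebra_simps)
      have "actx q x v S = act1 q i (act1 q i v) S + inverse q * act1 q i v S - q * act1 q i v S - q * inverse q * v S"
        unfolding x' by (simp only: actx_diff actx_add actx_mult actx_const_mult actx_const actx_gen)
      then show ?thesis using act1_quadratic[OF assms S(1), of i v] S 3(2)
        by (simp add: hecke_gens_def qq algebra_simps)
    qed
  qed
  then show "x \<in> hecke_ker q k" using subsetD[OF hecke_rels_subset x] by (auto simp: hecke_ker_def)
qed

definition hecke_ideal :: "complex \<Rightarrow> nat \<Rightarrow> nat free set" where
  "hecke_ideal q k = rel_ideal (hecke_gens k) (hecke_rels q k)"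

lemma hecke_ideal_ker: assumes "generic q" shows "hecke_ideal q k \<subseteq> hecke_ker q k"
  unfolding hecke_ideal_def
  by (rule rel_ideal_minimal[OF hecke_rels_subset ideal_hecke_ker hecke_rels_ker[OF assms]])

text \<open>The eigenvalue of the Jucys-Murphy element \<open>jm i\<close> on a tableau whose entry \<open>i + 1\<close> has
  content \<open>c\<close>; these eigenvalues separate the tableaux.\<close>

definition jl :: "complex \<Rightarrow> int \<Rightarrow> complex" where
  "jl q c = q powi c * qint q c"

text \<open>The difference of two eigenvalues is q^(a+b) [a-b], which for generic q vanishes only if
  a = b.\<close>

lemma jl_inj: assumes "generic q" "jl q a = jl q b" shows "a = b"
proof -
  have q: "q \<noteq> 0" using assms by (simp add: generic_def)
  have "q powi (a + b) * qint q (- b + a) = jl q a - jl q b"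
    unfolding qint_add[OF q, of "- b" a] qint_minus jl_def using q
    by (simp add: power_int_add power_int_minus field_simps)
  then have "qint q (- b + a) = 0" using assms q by simp
  then show ?thesis using qint_nonzero[OF assms(1), of "- b + a"] by force
qed

fun jm :: "nat \<Rightarrow> nat free" where
  "jm 0 = 0"
| "jm (Suc i) = gen (Suc i) + gen (Suc i) * jm i * gen (Suc i)"

lemma jm_carrier: "i < k \<Longrightarrow> jm i \<in> hecke_free k"
  by (induction i) (auto simp: hecke_gens_def)

text \<open>The vanishing of the off-diagonal entry of a Jucys-Murphy element in the block of a
  tableau and its swap.\<close>

lemma qf_jl: assumes "generic q" "a \<noteq> b"
  shows "qf q (b - a) * jl q a + ((q - inverse q) - qf q (b - a)) * jl q b + 1 = 0"
proof -
  have q: "q \<noteq> 0" using assms by (simp add: generic_def)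
  have nz: "qint q (b - a) \<noteq> 0" using qint_nonzero[OF assms(1)] assms(2) by simp
  define X Y D where "X = q powi a" and "Y = q powi b" and "D = qint q (b - a)"
  have nz': "X \<noteq> 0" "Y \<noteq> 0" "D \<noteq> 0" using q nz by (simp_all add: X_def Y_def D_def)
  have 1: "(q - inverse q) - qf q (b - a) = - (X / Y / D)"
    using qf_minus[OF assms(1), of "b - a"] assms(2) qint_minus[of q "b - a"] q
    unfolding qf_def by (simp add: X_def Y_def D_def power_int_diff)
  have 2: "qint q b = Y / X * qint q a + D / X"
    using qint_add[OF q, of "b - a" a] q by (simp add: X_def Y_def D_def power_int_diff power_int_minus field_simps)
  have 3: "qf q (b - a) = Y / X / D" using q by (simp add: qf_def X_def Y_def D_def power_int_diff)
  define A where "A = qint q a"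
  have "Y / X / D * (X * A) - X / Y / D * (Y * (Y / X * A + D / X)) + 1
     = Y * A / D - X * (Y / X * A + D / X) / D + 1" using nz' by simp
  also have "X * (Y / X * A + D / X) = Y * A + D" using nz' by (simp add: distrib_left)
  also have "Y * A / D - (Y * A + D) / D + 1 = 0" using nz' by (simp add: add_divide_distrib)
  finally show ?thesis
    unfolding 1 unfolding 3 jl_def 2 X_def[symmetric] Y_def[symmetric] A_def[symmetric]
    by (simp only: mult_minus_left add_uminus_conv_diff)
qed

text \<open>The recursion of \<open>jm\<close> conjugates an element that is already diagonal by one
  generator. In the block of S and its swap, \<open>qf_jl\<close> removes the off-diagonal entry and
  also evaluates the diagonal one.\<close>

lemma actx_jm:
  assumes "generic q"
  shows "S \<in> Std \<Longrightarrow> i < length S \<Longrightarrow> actx q (jm i) v S = jl q (content (S ! i)) * v S"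
proof (induction i arbitrary: S v)
  case 0
  obtain r c where rc: "S ! 0 = (r, c)" by (cases "S ! 0")
  \<comment> \<open>The first box is forced to be the corner, of content 0, and
    \<open>jl q 0\<close> = 0 agrees with \<open>jm 0 = 0\<close>.\<close>
  have "downset {S ! 0}" using 0 Std_take[of S 1] Std_downset[of "take 1 S"] by (cases S) auto
  then have "(0, 0) \<in> {S ! 0}" using downsetD[of "{S ! 0}" r c 0 0] rc by auto
  then have "S ! 0 = (0, 0)" by simp
  then have "content (S ! 0) = 0" by (simp add: content_def)
  then show ?case by (simp add: jl_def)
next
  case (Suc i)
  obtain P A B Q where S: "S = P @ A # B # Q" and "Suc i = Suc (length P)"
    by (rule split_at[of "Suc i" S]) (use Suc.prems in auto)
  then have i: "i = length P" by simp
  define f where "f = qf q (content B - content A)"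
  define p :: complex where "p = of_bool (P @ B # A # Q \<in> Std)"
  define g where "g = qg q (content B - content A)"
  define g' where "g' = qg q (content A - content B)"
  define h where "h = q - inverse q"
  have ne: "content A \<noteq> content B" using Std_content_neq[of P A B Q] Suc.prems S by auto
  have f': "qf q (content A - content B) = h - f"
    using qf_minus[OF assms, of "content B - content A"] ne by (simp add: f_def h_def)
  have gg: "p * g * g' = h * f + 1 - f\<^sup>2"
    using qg_swap_indicator[OF assms, of P A B Q] Suc.prems S by (simp add: f_def g_def g'_def h_def p_def)
  have J: "f * jl q (content A) + (h - f) * jl q (content B) + 1 = 0"
    using qf_jl[OF assms ne] by (simp add: f_def h_def)
  define V V' where "V = v S" and "V' = v (P @ B # A # Q)"
  have 1: "act1 q (Suc i) v S = f * V + p * g * V'"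
    unfolding i S act1_mid by (simp add: f_def g_def p_def V_def V'_def S)
  have 2: "p * act1 q (Suc i) v (P @ B # A # Q) = p * ((h - f) * V' + g' * V)"
    unfolding i act1_mid f' using Suc.prems by (simp add: p_def g'_def V_def V'_def S)
  have IH1: "actx q (jm i) w S = jl q (content A) * w S" for w
    using Suc by (simp add: S i nth_append)
  have IH2: "p * actx q (jm i) w (P @ B # A # Q) = p * (jl q (content B) * w (P @ B # A # Q))" for w
    using Suc.IH[of "P @ B # A # Q" w] by (simp add: i p_def nth_append)
  have "actx q (jm (Suc i)) v S = act1 q (Suc i) v S + act1 q (Suc i) (actx q (jm i) (act1 q (Suc i) v)) S"
    by (simp add: actx_add actx_mult)
  also have "act1 q (Suc i) (actx q (jm i) (act1 q (Suc i) v)) S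
     = f * (jl q (content A) * (f * V + p * g * V')) + g * (p * actx q (jm i) (act1 q (Suc i) v) (P @ B # A # Q))"
    unfolding 1[symmetric] IH1[symmetric] unfolding i S act1_mid by (simp add: f_def g_def p_def)
  also have "g * (p * actx q (jm i) (act1 q (Suc i) v) (P @ B # A # Q)) = g * jl q (content B) * (p * ((h - f) * V' + g' * V))"
    unfolding IH2 2[symmetric] by (simp add: algebra_simps)
  also have "act1 q (Suc i) v S + (f * (jl q (content A) * (f * V + p * g * V')) + \<dots>)
     = (f + f\<^sup>2 * jl q (content A) + p * g * g' * jl q (content B)) * V
       + p * g * (f * jl q (content A) + (h - f) * jl q (content B) + 1) * V'"
    unfolding 1 by (simp add: algebra_simps power2_eq_square)
  also have "\<dots> = (f * (f * jl q (content A) + (h - f) * jl q (content B) + 1) + jl q (content B)) * V"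
  proof -
    have "f + f\<^sup>2 * jl q (content A) + p * g * g' * jl q (content B)
      = f * (f * jl q (content A) + (h - f) * jl q (content B) + 1) + jl q (content B)"
      unfolding gg by (simp add: algebra_simps power2_eq_square)
    then show ?thesis by (simp only: J mult_zero_right mult_zero_left add_0_right)
  qed
  also have "\<dots> = jl q (content (S ! Suc i)) * v S"
    unfolding J by (simp add: S i nth_append V_def)
  finally show ?case .
qed

section \<open>Young's lattice and the sum of squares of the numbers of tableaux\<close>

section \<open>Counting standard tableaux\<close>

definition addb :: "box set \<Rightarrow> box set" where
  "addb D = {b. b \<notin> D \<and> downset (insert b D)}"

definition remb :: "box set \<Rightarrow> box set" where
  "remb D = {b \<in> D. downset (D - {b})}"

definition row_len :: "box set \<Rightarrow> nat \<Rightarrow> nat" where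
  "row_len D r = (LEAST c. (r, c) \<notin> D)"

lemma mem_row_len: assumes "downset D" shows "(r, c) \<in> D \<longleftrightarrow> c < row_len D r"
proof -
  have "finite {c. (r, c) \<in> D}"
    by (rule finite_surj[OF downset_finite[OF assms], of _ snd]) force
  then obtain c0 where "(r, c0) \<notin> D" by (metis (mono_tags, lifting) ex_new_if_finite infinite_UNIV_nat mem_Collect_eq)
  then have n: "(r, row_len D r) \<notin> D" unfolding row_len_def by (rule LeastI)
  show ?thesis
  proof
    assume "(r, c) \<in> D"
    then show "c < row_len D r" using downsetD[OF assms, of r c r "row_len D r"] n by (metis linorder_not_less order_refl)
  next
    assume "c < row_len D r"
    then show "(r, c) \<in> D" unfolding row_len_def using not_less_Least by blast
  qed
qed

lemma row_len_mono: assumes "downset D" "r \<le> r'" shows "row_len D r' \<le> row_len D r"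
proof (rule ccontr)
  assume "\<not> ?thesis"
  then have "(r', row_len D r) \<in> D" using mem_row_len[OF assms(1)] by simp
  then have "(r, row_len D r) \<in> D" using downsetD[OF assms(1)] assms(2) by blast
  then show False using mem_row_len[OF assms(1)] by simp
qed

lemma downset_insertI:
  assumes "downset D" "\<And>r' c'. r' \<le> fst b \<Longrightarrow> c' \<le> snd b \<Longrightarrow> (r', c') \<noteq> b \<Longrightarrow> (r', c') \<in> D"
  shows "downset (insert b D)"
  using assms unfolding downset_def by (metis finite_insert insert_iff prod.collapse)

text \<open>An addable box sits at the end of row 0 or at the end of a row strictly shorter than the
  one above it; a removable box sits at the end of a row strictly longer than the next. Both sets
  are indexed by the descents of the row lengths, with row 0 as the one extra case, whence
  \<open>card_addb\<close>.\<close>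

lemma addb_eq: assumes "downset D"
  shows "addb D = (\<lambda>r. (r, row_len D r)) ` insert 0 (Suc ` {r. row_len D (Suc r) < row_len D r})" (is "_ = ?R")
proof (intro equalityI subsetI)
  fix b assume b: "b \<in> addb D"
  obtain r c where rc: "b = (r, c)" by (cases b)
  have n: "(r, c) \<notin> D" and d: "downset (insert (r, c) D)" using b by (auto simp: addb_def rc)
  have "c = row_len D r"
  proof (rule ccontr)
    assume "c \<noteq> row_len D r"
    with n have "row_len D r < c" using mem_row_len[OF assms] by force
    then have "(r, row_len D r) \<in> D" using downsetD[OF d, of r c r "row_len D r"] by simp
    then show False using mem_row_len[OF assms] by simp
  qed
  moreover have "row_len D (Suc r') < row_len D r'" if "r = Suc r'" for r'
  proof -
    have "(r', c) \<in> D" using downsetD[OF d, of r c r' c] that by auto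
    then show ?thesis using mem_row_len[OF assms] \<open>c = _\<close> that by simp
  qed
  ultimately show "b \<in> ?R" unfolding rc by (cases r) auto
next
  fix b assume b: "b \<in> ?R"
  then obtain r where r: "b = (r, row_len D r)" "r = 0 \<or> (\<exists>r'. r = Suc r' \<and> row_len D r < row_len D r')" by auto
  have "downset (insert b D)"
  proof (rule downset_insertI[OF assms])
    fix r' c' assume le: "r' \<le> fst b" "c' \<le> snd b" "(r', c') \<noteq> b"
    show "(r', c') \<in> D"
    proof (cases "r' = r")
      case True
      then show ?thesis using le r mem_row_len[OF assms] by auto
    next
      case False
      with le r obtain s where s: "r = Suc s" "row_len D r < row_len D s" "r' \<le> s" by auto
      then have "c' < row_len D r'" using row_len_mono[OF assms, of r' s] le r by simp
      then show ?thesis using mem_row_len[OF assms] by simp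
    qed
  qed
  then show "b \<in> addb D" using mem_row_len[OF assms] r by (simp add: addb_def)
qed

lemma remb_eq: assumes "downset D"
  shows "remb D = (\<lambda>r. (r, row_len D r - 1)) ` {r. row_len D (Suc r) < row_len D r}" (is "_ = ?R")
proof (intro equalityI subsetI)
  fix b assume b: "b \<in> remb D"
  obtain r c where rc: "b = (r, c)" by (cases b)
  have m: "(r, c) \<in> D" and d: "downset (D - {(r, c)})" using b by (auto simp: remb_def rc)
  have 1: "(r, Suc c) \<notin> D" using downsetD[OF d, of r "Suc c" r c] by auto
  have 2: "(Suc r, c) \<notin> D" using downsetD[OF d, of "Suc r" c r c] by auto
  have "row_len D r = Suc c" "row_len D (Suc r) \<le> c" using m 1 2 mem_row_len[OF assms] by auto
  then show "b \<in> ?R" unfolding rc by (intro image_eqI[of _ _ r]) auto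
next
  fix b assume "b \<in> ?R"
  then obtain r where r: "b = (r, row_len D r - 1)" "row_len D (Suc r) < row_len D r" by auto
  have "b \<in> D" using r mem_row_len[OF assms] by simp
  moreover have "downset (D - {b})"
    unfolding downset_def
  proof (intro conjI ballI allI impI)
    show "finite (D - {b})" using downset_finite[OF assms] by simp
    fix x y assume x: "x \<in> D - {b}" and y: "fst y \<le> fst x \<and> snd y \<le> snd x"
    have "y \<in> D" using x y assms unfolding downset_def by blast
    moreover have "y \<noteq> b"
    proof
      assume yb: "y = b"
      obtain r' c' where x': "x = (r', c')" by (cases x)
      have le: "r \<le> r'" "row_len D r - 1 \<le> c'" using y yb r x' by auto
      have "c' < row_len D r'" using x x' mem_row_len[OF assms] by auto
      moreover have "row_len D r' \<le> row_len D (Suc r)" if "r' \<noteq> r" using row_len_mono[OF assms] le that by simp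
      ultimately have "r' = r" "c' = row_len D r - 1" using le r by fastforce+
      then show False using x x' r by simp
    qed
    ultimately show "y \<in> D - {b}" by simp
  qed
  ultimately show "b \<in> remb D" by (simp add: remb_def)
qed

lemma finite_descents: assumes "downset D" shows "finite {r. row_len D (Suc r) < row_len D r}"
proof -
  have "{r. row_len D (Suc r) < row_len D r} \<subseteq> fst ` D"
  proof
    fix r assume "r \<in> {r. row_len D (Suc r) < row_len D r}"
    then have "(r, 0) \<in> D" using mem_row_len[OF assms] by simp
    then show "r \<in> fst ` D" by force
  qed
  then show ?thesis using downset_finite[OF assms] finite_surj by blast
qed

lemma finite_addb: "downset D \<Longrightarrow> finite (addb D)"
  by (simp add: addb_eq finite_descents)

lemma finite_remb: "downset D \<Longrightarrow> finite (remb D)"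
  by (simp add: remb_eq finite_descents)

lemma card_addb: assumes "downset D" shows "card (addb D) = Suc (card (remb D))"
proof -
  let ?X = "{r. row_len D (Suc r) < row_len D r}"
  have "card (addb D) = card (insert 0 (Suc ` ?X))"
    unfolding addb_eq[OF assms] by (rule card_image) (simp add: inj_on_def)
  also have "\<dots> = Suc (card ?X)"
    by (subst card_insert_disjoint) (auto simp: finite_descents[OF assms] card_image)
  also have "card ?X = card (remb D)"
    unfolding remb_eq[OF assms] by (rule card_image[symmetric]) (simp add: inj_on_def)
  finally show ?thesis .
qed

text \<open>The lower of two addable boxes on one diagonal would require the upper one to be present
  already. So contents, and with them Jucys-Murphy eigenvalues, tell the extensions of a diagram
  apart.\<close>

lemma addb_content_inj: assumes "downset D" "b \<in> addb D" "b' \<in> addb D" "content b = content b'"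
  shows "b = b'"
proof -
  have no: False if "(r, c) \<in> addb D" "(r', c') \<in> addb D" "int c - int r = int c' - int r'" "r < r'" for r c r' c'
  proof -
    have "(r, c) \<in> insert (r', c') D"
      using downsetD[of "insert (r', c') D" r' c' r c] that by (auto simp: addb_def)
    then show False using that by (auto simp: addb_def)
  qed
  obtain r c r' c' where rc: "b = (r, c)" "b' = (r', c')" by (cases b, cases b')
  have "r = r'" using no[of r c r' c'] no[of r' c' r c] assms rc
    by (cases "r < r'"; cases "r' < r") (auto simp: content_def)
  then show ?thesis using assms(4) rc by (simp add: content_def)
qed

text \<open>A box that maximizes row plus column has no other box weakly to its lower right.\<close>

lemma remb_ex: assumes "downset D" "D \<noteq> {}" shows "remb D \<noteq> {}"
proof -
  obtain b where b: "b \<in> D" "\<And>x. x \<in> D \<Longrightarrow> fst x + snd x \<le> fst b + snd b"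
    using Max_in[of "(\<lambda>x. fst x + snd x) ` D"] Max_ge[of "(\<lambda>x. fst x + snd x) ` D"] downset_finite[OF assms(1)] assms(2)
    by (metis (no_types, lifting) finite_imageI image_iff image_is_empty)
  have "downset (D - {b})"
    unfolding downset_def
  proof (intro conjI ballI allI impI)
    show "finite (D - {b})" using downset_finite[OF assms(1)] by simp
    fix x y assume x: "x \<in> D - {b}" and y: "fst y \<le> fst x \<and> snd y \<le> snd x"
    have "y \<in> D" using x y assms unfolding downset_def by blast
    moreover have "y \<noteq> b"
    proof
      assume "y = b"
      then have "x = b" using b(2)[of x] x y by (auto intro: prod_eqI)
      with x show False by simp
    qed
    ultimately show "y \<in> D - {b}" by simp
  qed
  with b have "b \<in> remb D" by (simp add: remb_def)
  then show ?thesis by blast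
qed

lemma Std_exists: "downset D \<Longrightarrow> \<exists>T\<in>Std. set T = D"
proof (induction "card D" arbitrary: D)
  case 0
  then have "D = {}" using downset_finite by auto
  then show ?case by (intro bexI[of _ "[]"]) auto
next
  case (Suc n)
  then have "D \<noteq> {}" by auto
  then obtain b where b: "b \<in> D" "downset (D - {b})" using remb_ex[OF Suc.prems] by (auto simp: remb_def)
  then have "n = card (D - {b})" using Suc downset_finite by auto
  then obtain T where T: "T \<in> Std" "set T = D - {b}" using Suc.hyps(1) b by metis
  then have "T @ [b] \<in> Std" using b Suc.prems by (simp add: Std_snoc insert_absorb)
  then show ?case using T b by (intro bexI[of _ "T @ [b]"]) auto
qed

definition std_of :: "box set \<Rightarrow> box list set" where
  "std_of D = {T \<in> Std. set T = D}"

lemma std_of_length: "T \<in> std_of D \<Longrightarrow> length T = card D"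
  by (auto simp: std_of_def distinct_card Std_distinct)

lemma std_of_decomp: assumes "downset D" "D \<noteq> {}"
  shows "std_of D = (\<Union>b\<in>remb D. (\<lambda>T. T @ [b]) ` std_of (D - {b}))"
proof (intro equalityI subsetI)
  fix T assume T: "T \<in> std_of D"
  then have "T \<noteq> []" using assms by (auto simp: std_of_def)
  then obtain S b where S: "T = S @ [b]" by (metis rev_exhaust)
  then have "S \<in> Std" "b \<notin> set S" "D = insert b (set S)" using T by (auto simp: std_of_def Std_snoc)
  then show "T \<in> (\<Union>b\<in>remb D. (\<lambda>T. T @ [b]) ` std_of (D - {b}))"
    unfolding S by (intro UN_I[of b] imageI) (auto simp: remb_def std_of_def Std_downset)
next
  fix T assume "T \<in> (\<Union>b\<in>remb D. (\<lambda>T. T @ [b]) ` std_of (D - {b}))"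
  then obtain b S where "b \<in> remb D" "S \<in> std_of (D - {b})" "T = S @ [b]" by auto
  then show "T \<in> std_of D" using assms by (auto simp: remb_def std_of_def Std_snoc insert_absorb)
qed

lemma finite_std_of: "downset D \<Longrightarrow> finite (std_of D)"
  by (rule finite_subset[OF _ finite_lists_length_eq[of D "card D"]])
    (auto simp: downset_finite std_of_def distinct_card Std_distinct)

definition fcount :: "box set \<Rightarrow> nat" where
  "fcount D = card (std_of D)"

lemma fcount_remb: assumes "downset D" "D \<noteq> {}" shows "fcount D = (\<Sum>b\<in>remb D. fcount (D - {b}))"
proof -
  have "fcount D = (\<Sum>b\<in>remb D. card ((\<lambda>T. T @ [b]) ` std_of (D - {b})))"
    unfolding fcount_def std_of_decomp[OF assms]
    by (rule card_UN_disjoint, rule finite_remb[OF assms(1)]) (auto simp: finite_std_of remb_def)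
  also have "\<dots> = (\<Sum>b\<in>remb D. fcount (D - {b}))"
    unfolding fcount_def by (intro sum.cong refl card_image) (simp add: inj_on_def)
  finally show ?thesis .
qed

text \<open>Young's lattice is a differential poset: adding a box and removing a different one can
  be done in either order, and there is one more way to add than to remove. By induction on the size
  the count of tableaux is multiplied by k + 1.\<close>

lemma fcount_addb: "downset D \<Longrightarrow> (\<Sum>b\<in>addb D. fcount (insert b D)) = Suc (card D) * fcount D"
proof (induction "card D" arbitrary: D rule: less_induct)
  case less
  note D = less.prems
  \<comment> \<open>Pairs of an added box b and a removed box c different from b, in the two orders
    of carrying this out.\<close>
  let ?P = "Sigma (addb D) (\<lambda>b. remb (insert b D) - {b})"
  let ?Q = "Sigma (remb D) (\<lambda>c. addb (D - {c}) - {c})"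
  have bij: "bij_betw prod.swap ?P ?Q"
  proof (rule bij_betwI[of _ _ _ prod.swap])
    show "prod.swap \<in> ?P \<rightarrow> ?Q"
    proof
      fix x assume "x \<in> ?P"
      then obtain b c where x: "x = (b, c)" "b \<notin> D" "downset (insert b D)" "c \<in> D" "c \<noteq> b" "downset (insert b D - {c})"
        by (auto simp: addb_def remb_def)
      have e: "D - {c} = D \<inter> (insert b D - {c})" using x by auto
      have "downset (D - {c})" unfolding e by (rule downset_Int[OF D x(6)])
      moreover have "insert b D - {c} = insert b (D - {c})" using x by auto
      ultimately show "prod.swap x \<in> ?Q" using x by (auto simp: addb_def remb_def)
    qed
    show "prod.swap \<in> ?Q \<rightarrow> ?P"
    proof
      fix x assume "x \<in> ?Q"
      then obtain b c where x: "x = (c, b)" "c \<in> D" "downset (D - {c})" "b \<notin> D" "b \<noteq> c" "downset (insert b (D - {c}))"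
        by (auto simp: addb_def remb_def)
      have e: "insert b D = D \<union> insert b (D - {c})" using x by auto
      have "downset (insert b D)" unfolding e by (rule downset_Un[OF D x(6)])
      moreover have "insert b D - {c} = insert b (D - {c})" using x by auto
      ultimately show "prod.swap x \<in> ?P" using x by (auto simp: addb_def remb_def)
    qed
  qed auto
  have fa: "\<And>b. b \<in> addb D \<Longrightarrow> downset (insert b D)" by (simp add: addb_def)
  have fr: "\<And>b. b \<in> remb D \<Longrightarrow> downset (D - {b})" by (simp add: remb_def)
  \<comment> \<open>Each larger diagram is decomposed by the last box of its tableaux. Removing the
    added box itself returns D, which accounts for \<open>card (addb D)\<close> copies of
    \<open>fcount D\<close>.\<close>
  have L: "(\<Sum>b\<in>addb D. fcount (insert b D)) = card (addb D) * fcount D + (\<Sum>b\<in>addb D. \<Sum>c\<in>remb (insert b D) - {b}. fcount (insert b D - {c}))"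
  proof -
    have "fcount (insert b D) = fcount D + (\<Sum>c\<in>remb (insert b D) - {b}. fcount (insert b D - {c}))" if "b \<in> addb D" for b
    proof -
      have "b \<in> remb (insert b D)" using that D by (simp add: addb_def remb_def)
      then show ?thesis
        using fcount_remb[OF fa[OF that]] that finite_remb[OF fa[OF that]]
        by (simp add: sum.remove[of _ b] addb_def)
    qed
    then show ?thesis by (simp add: sum.distrib)
  qed
  have R: "(\<Sum>c\<in>remb D. \<Sum>b\<in>addb (D - {c}) - {c}. fcount (insert b (D - {c}))) + card (remb D) * fcount D = card D * (\<Sum>c\<in>remb D. fcount (D - {c}))"
  proof -
    have "(\<Sum>b\<in>addb (D - {c}) - {c}. fcount (insert b (D - {c}))) + fcount D = card D * fcount (D - {c})" if "c \<in> remb D" for c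
    proof -
      have c: "c \<in> D" using that by (simp add: remb_def)
      then have cd: "Suc (card (D - {c})) = card D" using downset_finite[OF D] by (metis card_Suc_Diff1)
      have "(\<Sum>b\<in>addb (D - {c}). fcount (insert b (D - {c}))) = card D * fcount (D - {c})"
        using less.hyps[OF _ fr[OF that]] cd by simp
      moreover have "c \<in> addb (D - {c})" using c D by (simp add: addb_def insert_absorb)
      ultimately show ?thesis using finite_addb[OF fr[OF that]] c
        by (simp add: sum.remove[of _ c] insert_absorb)
    qed
    then have "(\<Sum>c\<in>remb D. (\<Sum>b\<in>addb (D - {c}) - {c}. fcount (insert b (D - {c}))) + fcount D) = (\<Sum>c\<in>remb D. card D * fcount (D - {c}))"
      by (intro sum.cong refl) auto
    then show ?thesis by (simp add: sum.distrib sum_distrib_left)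
  qed
  have LR: "(\<Sum>b\<in>addb D. \<Sum>c\<in>remb (insert b D) - {b}. fcount (insert b D - {c})) = (\<Sum>c\<in>remb D. \<Sum>b\<in>addb (D - {c}) - {c}. fcount (insert b (D - {c})))"
  proof -
    have "(\<Sum>b\<in>addb D. \<Sum>c\<in>remb (insert b D) - {b}. fcount (insert b D - {c})) = (\<Sum>x\<in>?P. fcount (insert (fst x) D - {snd x}))"
      by (subst sum.Sigma) (auto simp: finite_addb[OF D] finite_remb fa split_beta)
    also have "\<dots> = (\<Sum>x\<in>?Q. fcount (insert (snd x) (D - {fst x})))"
    proof -
      have "(\<Sum>x\<in>?P. fcount (insert (fst x) D - {snd x})) = (\<Sum>x\<in>?P. fcount (insert (snd (prod.swap x)) (D - {fst (prod.swap x)})))"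
        by (intro sum.cong refl) (auto simp: insert_Diff_if)
      also have "\<dots> = (\<Sum>x\<in>?Q. fcount (insert (snd x) (D - {fst x})))"
        by (rule sum.reindex_bij_betw[OF bij])
      finally show ?thesis .
    qed
    also have "\<dots> = (\<Sum>c\<in>remb D. \<Sum>b\<in>addb (D - {c}) - {c}. fcount (insert b (D - {c})))"
      by (subst sum.Sigma) (auto simp: finite_remb[OF D] finite_addb fr split_beta)
    finally show ?thesis .
  qed
  show ?case
  proof (cases "D = {}")
    case True
    have e: "addb {} = {(0, 0)}"
      using addb_eq[of "{}"] by (auto simp: row_len_def)
    have "std_of {} = {[]}" by (auto simp: std_of_def)
    then have f1: "fcount {} = 1" by (simp add: fcount_def)
    have dd: "downset {(0, 0)}" using e by (auto simp: addb_def)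
    have "remb {(0, 0)} = {(0, 0)}" by (auto simp: remb_def)
    then have "fcount {(0, 0)} = 1" using fcount_remb[OF dd] f1 by simp
    then show ?thesis using True e f1 by simp
  next
    case False
    have "(\<Sum>b\<in>addb D. fcount (insert b D)) + card (remb D) * fcount D = card (addb D) * fcount D + card D * fcount D"
      using L R LR fcount_remb[OF D False] by simp
    then show ?thesis unfolding card_addb[OF D] by simp
  qed
qed

definition Stdk :: "nat \<Rightarrow> box list set" where
  "Stdk k = {T \<in> Std. length T = k}"

definition std_pairs :: "nat \<Rightarrow> (box list \<times> box list) set" where
  "std_pairs k = Sigma (Stdk k) (\<lambda>S. std_of (set S))"

lemma Stdk_Suc: "Stdk (Suc k) = (\<lambda>(S, b). S @ [b]) ` Sigma (Stdk k) (\<lambda>S. addb (set S))"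
proof (intro equalityI subsetI)
  fix T assume T: "T \<in> Stdk (Suc k)"
  then obtain S b where S: "T = S @ [b]" by (cases T rule: rev_cases) (auto simp: Stdk_def)
  with T show "T \<in> (\<lambda>(S, b). S @ [b]) ` Sigma (Stdk k) (\<lambda>S. addb (set S))"
    by (auto simp: Stdk_def Std_snoc addb_def)
qed (auto simp: Stdk_def Std_snoc addb_def)

lemma finite_Stdk: "finite (Stdk k)"
proof (induction k)
  case 0
  have "Stdk 0 = {[]}" by (auto simp: Stdk_def)
  then show ?case by simp
next
  case (Suc k)
  then show ?case unfolding Stdk_Suc
    by (intro finite_imageI finite_SigmaI) (auto simp: Stdk_def finite_addb Std_downset)
qed

lemma finite_std_pairs: "finite (std_pairs k)"
  unfolding std_pairs_def using finite_Stdk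
  by (intro finite_SigmaI) (auto simp: Stdk_def finite_std_of Std_downset)

text \<open>Summing \<open>fcount_addb\<close> over all tableaux of size k shows that the number of
  pairs is multiplied by k + 1. This is the sum of the squares of the dimensions, the number that
  has to match the spanning words.\<close>

lemma card_std_pairs: "card (std_pairs k) = fact k"
proof -
  have c: "card (std_pairs k) = (\<Sum>S\<in>Stdk k. fcount (set S))" for k
    unfolding std_pairs_def fcount_def
    by (subst card_SigmaI) (auto simp: finite_Stdk, auto simp: Stdk_def finite_std_of Std_downset)
  show ?thesis
  proof (induction k)
    case 0
    have "Stdk 0 = {[]}" by (auto simp: Stdk_def)
    moreover have "std_of {} = {[]}" by (auto simp: std_of_def)
    ultimately show ?case by (simp add: std_pairs_def)
  next
    case (Suc k)
    have "card (std_pairs (Suc k)) = (\<Sum>x\<in>Sigma (Stdk k) (\<lambda>S. addb (set S)). fcount (insert (snd x) (set (fst x))))"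
      unfolding c Stdk_Suc by (subst sum.reindex) (auto simp: inj_on_def split_beta)
    also have "\<dots> = (\<Sum>S\<in>Stdk k. \<Sum>b\<in>addb (set S). fcount (insert b (set S)))"
      by (subst sum.Sigma) (auto simp: finite_Stdk split_beta, auto simp: Stdk_def finite_addb Std_downset)
    also have "\<dots> = (\<Sum>S\<in>Stdk k. Suc k * fcount (set S))"
      by (intro sum.cong refl) (auto simp: Stdk_def fcount_addb Std_downset distinct_card Std_distinct)
    also have "\<dots> = Suc k * card (std_pairs k)" by (simp add: c sum_distrib_left)
    finally show ?case using Suc by simp
  qed
qed

section \<open>Matrix units by interpolation in Jucys-Murphy elements\<close>

section \<open>Matrix units\<close>

text \<open>The matrix unit with entry 1 at (S, T). The condition ranges over tableaux of all shapes
  of size k, so the element is zero on the other shapes.\<close>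

definition acts_as :: "complex \<Rightarrow> nat \<Rightarrow> nat free \<Rightarrow> box list \<Rightarrow> box list \<Rightarrow> bool" where
  "acts_as q k x S T \<longleftrightarrow> x \<in> hecke_free k \<and>
     (\<forall>U\<in>Stdk k. \<forall>v. actx q x v U = of_bool (U = S) * v T)"

lemma acts_asD: "acts_as q k x S T \<Longrightarrow> U \<in> Stdk k \<Longrightarrow> actx q x v U = of_bool (U = S) * v T"
  by (simp add: acts_as_def)

lemma acts_as_carrier: "acts_as q k x S T \<Longrightarrow> x \<in> hecke_free k"
  by (simp add: acts_as_def)

lemma Stdk_snoc: "S @ [b] \<in> Stdk (Suc k) \<longleftrightarrow> S \<in> Stdk k \<and> b \<in> addb (set S)"
  by (auto simp: Stdk_def Std_snoc addb_def)

text \<open>One level up a matrix unit becomes the sum of the units for S and T extended by a common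
  box c, over all possible c.\<close>

lemma acts_as_snoc:
  assumes "acts_as q k x S T" "U @ [c] \<in> Stdk (Suc k)"
  shows "actx q x v (U @ [c]) = of_bool (U = S) * v (T @ [c])"
proof -
  have "U \<in> Stdk k" using assms(2) by (simp add: Stdk_snoc)
  moreover have "actx q x v (U @ [c]) = actx q x (\<lambda>W. v (W @ [c])) U"
    by (rule actx_snoc) (use assms in \<open>auto simp: acts_as_def Stdk_def\<close>)
  ultimately show ?thesis using acts_asD[OF assms(1)] by simp
qed

lemma diagonal_product_exists:
  assumes "generic q" "finite C"
  shows "\<exists>y\<in>hecke_free (Suc k). \<forall>U\<in>Stdk (Suc k). \<forall>v.
    actx q y v U = (\<Prod>c\<in>C. jl q (content (U ! k)) - jl q c) * v U"
  using assms(2)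
proof (induction C rule: finite_induct)
  case empty
  show ?case by (intro bexI[of _ 1]) simp_all
next
  case (insert c C)
  then obtain y where y: "y \<in> hecke_free (Suc k)" "\<And>U v. U \<in> Stdk (Suc k) \<Longrightarrow>
      actx q y v U = (\<Prod>c\<in>C. jl q (content (U ! k)) - jl q c) * v U" by blast
  have "actx q ((jm k - const (jl q c)) * y) v U = (\<Prod>c\<in>insert c C. jl q (content (U ! k)) - jl q c) * v U"
    if "U \<in> Stdk (Suc k)" for v U
    using that actx_jm[OF assms(1), of U k] insert(1,2) y(2)[OF that]
    by (simp add: actx_mult actx_diff actx_const Stdk_def algebra_simps)
  moreover have "(jm k - const (jl q c)) * y \<in> hecke_free (Suc k)"
    using y(1) jm_carrier[of k "Suc k"] by simp
  ultimately show ?case by blast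
qed

text \<open>The element \<open>jm k\<close> takes distinct values on the extensions of T, so a
  Lagrange interpolation polynomial in it, with denominator D, isolates the box b.\<close>

lemma acts_as_diag_step:
  assumes q: "generic q" and x: "acts_as q k x T T" and T: "T @ [b] \<in> Stdk (Suc k)"
  shows "\<exists>y. acts_as q (Suc k) y (T @ [b]) (T @ [b])"
proof -
  define C where "C = content ` (addb (set T) - {b})"
  have d: "downset (set T)" and b: "b \<in> addb (set T)"
    using T[unfolded Stdk_snoc] by (auto simp: Stdk_def Std_downset)
  have finC: "finite C" using finite_addb[OF d] by (simp add: C_def)
  obtain y where y: "y \<in> hecke_free (Suc k)" "\<And>U v. U \<in> Stdk (Suc k) \<Longrightarrow>
      actx q y v U = (\<Prod>c\<in>C. jl q (content (U ! k)) - jl q c) * v U"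
    using diagonal_product_exists[OF q finC] by blast
  define D where "D = (\<Prod>c\<in>C. jl q (content b) - jl q c)"
  have D: "D \<noteq> 0"
  proof
    assume "D = 0"
    then have "\<exists>a\<in>C. jl q (content b) = jl q a" using finC by (auto simp: D_def)
    then obtain b' where "b' \<in> addb (set T)" "b' \<noteq> b" "content b = content b'"
      using jl_inj[OF q] by (auto simp: C_def)
    then show False using addb_content_inj[OF d b] by blast
  qed
  have xk: "x \<in> hecke_free (Suc k)" using acts_as_carrier[OF x] hecke_free_mono[of k "Suc k"] by simp
  have "actx q (const (1 / D) * x * y) v U = of_bool (U = T @ [b]) * v (T @ [b])" if U: "U \<in> Stdk (Suc k)" for U v
  proof -
    from U obtain W c where W: "U = W @ [c]" by (auto simp: Stdk_Suc)
    have "actx q (const (1 / D) * x * y) v U = 1 / D * (of_bool (W = T) * actx q y v (T @ [c]))"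
      using acts_as_snoc[OF x] U W by (simp add: actx_mult actx_const)
    also have "\<dots> = of_bool (U = T @ [b]) * v (T @ [b])"
    proof (cases "W = T")
      case True
      then have c: "c \<in> addb (set T)" and Tk: "T \<in> Stdk k" using U W by (auto simp: Stdk_snoc)
      then have l: "length T = k" by (simp add: Stdk_def)
      have "actx q y v (T @ [c]) = (\<Prod>c'\<in>C. jl q (content c) - jl q c') * v (T @ [c])"
        using y(2)[of "T @ [c]"] U W True l by (simp add: nth_append)
      also have "(\<Prod>c'\<in>C. jl q (content c) - jl q c') = of_bool (c = b) * D"
      proof (cases "c = b")
        case False
        then have "content c \<in> C" using c by (auto simp: C_def)
        then have "(\<Prod>c'\<in>C. jl q (content c) - jl q c') = 0" using finC by (intro prod_zero) auto
        then show ?thesis using False by simp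
      qed (simp add: D_def)
      finally show ?thesis using True W D by simp
    qed (use W in auto)
    finally show ?thesis .
  qed
  then show ?thesis unfolding acts_as_def using xk y(1) by (intro exI[of _ "const (1 / D) * x * y"]) simp
qed

text \<open>A unit from the level below acts on all extensions at once; multiplication by the
  diagonal unit of \<open>T @ [b]\<close> keeps only the extension by b.\<close>

lemma matrix_unit_same_last:
  assumes q: "generic q" and T: "T @ [b] \<in> Stdk (Suc k)" and S: "S \<in> Stdk k" "set S = set T"
    and IH: "\<And>S T. S \<in> Stdk k \<Longrightarrow> T \<in> Stdk k \<Longrightarrow> set S = set T \<Longrightarrow> \<exists>x. acts_as q k x S T"
  shows "\<exists>x. acts_as q (Suc k) x (S @ [b]) (T @ [b])"
proof -
  have Tk: "T \<in> Stdk k" using T by (simp add: Stdk_snoc)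
  obtain e where e: "acts_as q (Suc k) e (T @ [b]) (T @ [b])"
    using IH[OF Tk Tk] acts_as_diag_step[OF q _ T] by blast
  obtain x where x: "acts_as q k x S T" using IH[OF S(1) Tk S(2)] by blast
  have "actx q (x * e) v U = of_bool (U = S @ [b]) * v (T @ [b])" if U: "U \<in> Stdk (Suc k)" for U v
  proof -
    from U obtain W c where W: "U = W @ [c]" by (auto simp: Stdk_Suc)
    have "actx q (x * e) v U = of_bool (W = S) * actx q e v (T @ [c])"
      using acts_as_snoc[OF x] U W by (simp add: actx_mult)
    also have "\<dots> = of_bool (W = S) * of_bool (T @ [c] = T @ [b]) * v (T @ [b])"
    proof (cases "W = S")
      case True
      then have "T @ [c] \<in> Stdk (Suc k)" using U W S Tk by (simp add: Stdk_snoc)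
      then show ?thesis using acts_asD[OF e] by simp
    qed simp
    finally show ?thesis using W by simp
  qed
  moreover have "x * e \<in> hecke_free (Suc k)"
    using acts_as_carrier[OF x] acts_as_carrier[OF e] hecke_free_mono[of k "Suc k"] by simp
  ultimately show ?thesis unfolding acts_as_def by blast
qed

lemma qg_nonzero: "generic q \<Longrightarrow> \<bar>d\<bar> \<ge> 2 \<Longrightarrow> qg q d \<noteq> 0"
  using qint_nonzero[of q d] qint_nonzero[of q "d - 1"] by (auto simp: qg_def)

text \<open>Tableaux with the same last box are linked by units from the level below. For different
  last boxes a detour is made through two tableaux that differ by exchanging their last two boxes,
  and the generator with index k crosses between them.\<close>

lemma matrix_unit_exists:
  assumes q: "generic q"
  shows "S \<in> Stdk k \<Longrightarrow> T \<in> Stdk k \<Longrightarrow> set S = set T \<Longrightarrow> \<exists>x. acts_as q k x S T"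
proof (induction k arbitrary: S T)
  case 0
  then have "S = []" "T = []" by (auto simp: Stdk_def)
  then show ?case by (intro exI[of _ 1]) (auto simp: acts_as_def Stdk_def)
next
  case (Suc k)
  from Suc.prems obtain S' b T' c where ST: "S = S' @ [b]" "T = T' @ [c]"
    by (auto simp: Stdk_Suc)
  then have S': "S' \<in> Stdk k" "b \<in> addb (set S')" and T': "T' \<in> Stdk k" "c \<in> addb (set T')"
    using Suc.prems by (auto simp: Stdk_snoc)
  note same = matrix_unit_same_last[OF q _ _ _ Suc.IH]
  have setS: "set S' = set S - {b}" "set T' = set S - {c}"
    using S' T' ST Suc.prems(3) by (auto simp: addb_def)
  show ?case
  proof (cases "b = c")
    case True
    have "set S' = set T'" by (simp only: setS True)
    then show ?thesis unfolding ST True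
      by (intro same) (use Suc.prems(2) S'(1) ST(2) in simp_all)
  next
    case False
    \<comment> \<open>Both b and c are removable from the common shape, so a tableau R of what
      remains can be continued by them in either order. The contents then differ by at least 2,
      which makes the coefficient g of the crossing nonzero.\<close>
    define D where "D = set S - {b, c}"
    have D: "D = set S' \<inter> set T'" "insert c D = set S'" "insert b D = set T'"
    proof -
      have "c \<in> set S'" "b \<in> set T'" using False Suc.prems(3) ST by auto
      then show "D = set S' \<inter> set T'" "insert c D = set S'" "insert b D = set T'"
        unfolding D_def setS by auto
    qed
    have dS: "downset (set S')" "downset (set T')" "downset (set S)" using S' T' Suc.prems by (auto simp: Stdk_def Std_downset)
    then have "downset D" using downset_Int D(1) by simp
    then obtain R where R: "R \<in> Std" "set R = D" using Std_exists by blast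
    have nbc: "b \<notin> D" "c \<notin> D" by (auto simp: D_def)
    have Rc: "R @ [c] \<in> Std" "R @ [b] \<in> Std" using R D dS nbc by (simp_all add: Std_snoc)
    have S_eq: "insert b (insert c D) = set S" unfolding D(2) ST(1) by simp
    have P: "R @ [c, b] \<in> Std" using Std_snoc[of "R @ [c]" b] Rc R D dS False nbc S_eq by (auto simp: insert_commute)
    have Q: "R @ [b, c] \<in> Std" using Std_snoc[of "R @ [b]" c] Rc R D dS False nbc S_eq by (auto simp: insert_commute)
    have lS: "length S = Suc k" "length S' = k" using Suc.prems ST by (auto simp: Stdk_def)
    have lR: "length (R @ [c]) = k"
    proof -
      have "length (R @ [c]) = card (set (R @ [c]))" using Rc Std_distinct distinct_card by metis
      also have "set (R @ [c]) = set S'" using R D by auto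
      also have "card \<dots> = length S'" using S' by (simp add: Stdk_def Std_distinct distinct_card)
      finally show ?thesis using lS by simp
    qed
    then have k: "k = Suc (length R)" by simp
    have PQk: "(R @ [c]) @ [b] \<in> Stdk (Suc k)" "(R @ [b]) @ [c] \<in> Stdk (Suc k)" "R @ [b] \<in> Stdk k" "R @ [c] \<in> Stdk k"
      using P Q Rc lR by (simp_all add: Stdk_def)
    have e: "set S' = set (R @ [c])" "set (R @ [b]) = set T'" by (simp_all add: R(2) D(2,3))
    obtain x where x: "acts_as q (Suc k) x (S' @ [b]) ((R @ [c]) @ [b])"
      using same[OF PQk(1) S'(1) e(1)] by blast
    obtain y where y: "acts_as q (Suc k) y ((R @ [b]) @ [c]) (T' @ [c])"
      using same[OF Suc.prems(2)[unfolded ST(2)] PQk(3) e(2)] by blast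
    define g where "g = qg q (content b - content c)"
    have g: "g \<noteq> 0" unfolding g_def
      using qg_nonzero[OF q] Std_content_swap[of R c b "[]"] P Q by simp
    have "actx q (const (1 / g) * x * gen k * y) v U = of_bool (U = S) * v T" if U: "U \<in> Stdk (Suc k)" for U v
    proof -
      have "actx q (const (1 / g) * x * gen k * y) v U = 1 / g * (of_bool (U = S) * act1 q k (actx q y v) (R @ [c, b]))"
        using acts_asD[OF x U] ST by (simp add: actx_mult actx_const)
      also have "act1 q k (actx q y v) (R @ [c, b]) = g * v T"
        unfolding k act1_mid[of q R _ c b "[]"] using Q acts_asD[OF y PQk(1)] acts_asD[OF y PQk(2)] ST False
        by (simp add: g_def)
      finally show ?thesis using g by simp
    qed
    moreover have "const (1 / g) * x * gen k * y \<in> hecke_free (Suc k)"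
      using acts_as_carrier[OF x] acts_as_carrier[OF y] k by (simp add: hecke_gens_def)
    ultimately show ?thesis unfolding acts_as_def by blast
  qed
qed

definition munit :: "complex \<Rightarrow> box list \<Rightarrow> box list \<Rightarrow> nat free" where
  "munit q S T = (SOME x. acts_as q (length S) x S T)"

lemma munit: assumes "generic q" "S \<in> Stdk k" "T \<in> Stdk k" "set S = set T"
  shows "acts_as q k (munit q S T) S T"
proof -
  have "length S = k" using assms by (simp add: Stdk_def)
  then show ?thesis unfolding munit_def using matrix_unit_exists[OF assms] by (auto intro: someI)
qed

lemma munit_carrier: "generic q \<Longrightarrow> S \<in> Stdk k \<Longrightarrow> T \<in> Stdk k \<Longrightarrow> set S = set T \<Longrightarrow> munit q S T \<in> hecke_free k"
  using munit acts_as_carrier by blast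

section \<open>Calculation with representatives modulo the Hecke relations\<close>

definition heq :: "complex \<Rightarrow> nat \<Rightarrow> nat free \<Rightarrow> nat free \<Rightarrow> bool" where
  "heq q k x y \<longleftrightarrow> x \<in> hecke_free k \<and> y \<in> hecke_free k \<and> x - y \<in> hecke_ideal q k"

lemmas hecke_ideal_closed = rel_ideal_subset[OF hecke_rels_subset, folded hecke_ideal_def]
  rel_ideal_0[OF hecke_rels_subset, folded hecke_ideal_def]
  rel_ideal_add[OF hecke_rels_subset, folded hecke_ideal_def]
  rel_ideal_mult[OF hecke_rels_subset, folded hecke_ideal_def]
  rel_ideal_minus[OF hecke_rels_subset, folded hecke_ideal_def]
  rel_ideal_diff[OF hecke_rels_subset, folded hecke_ideal_def]
  rel_ideal_sum[OF hecke_rels_subset, folded hecke_ideal_def]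
  rel_ideal_rel[OF hecke_rels_subset, folded hecke_ideal_def]

lemma heq_carrier: "heq q k x y \<Longrightarrow> x \<in> hecke_free k" "heq q k x y \<Longrightarrow> y \<in> hecke_free k"
  by (simp_all add: heq_def)

lemma heq_refl: "x \<in> hecke_free k \<Longrightarrow> heq q k x x"
  by (simp add: heq_def hecke_ideal_closed)

lemma heq_sym: "heq q k x y \<Longrightarrow> heq q k y x"
  using hecke_ideal_closed(6)[of "x - y"] by (auto simp: heq_def)

lemma heq_trans [trans]: "heq q k x y \<Longrightarrow> heq q k y z \<Longrightarrow> heq q k x z"
  using hecke_ideal_closed(3)[of "x - y" q k "y - z"] by (auto simp: heq_def)

lemma heq_add: "heq q k x y \<Longrightarrow> heq q k u v \<Longrightarrow> heq q k (x + u) (y + v)"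
  using hecke_ideal_closed(3)[of "x - y" q k "u - v"] by (auto simp: heq_def algebra_simps)

lemma heq_mult: assumes "heq q k x y" "heq q k u v" shows "heq q k (x * u) (y * v)"
proof -
  have "(x - y) * u + y * (u - v) \<in> hecke_ideal q k"
    using assms hecke_ideal_closed(3,4,5) by (simp add: heq_def)
  then show ?thesis using assms by (simp add: heq_def algebra_simps)
qed

lemma heq_sum: "(\<And>a. a \<in> A \<Longrightarrow> heq q k (f a) (g a)) \<Longrightarrow> heq q k (sum f A) (sum g A)"
  by (induction A rule: infinite_finite_induct) (auto simp: heq_refl heq_add)

lemma heq_of_rel: "x - y \<in> hecke_rels q k \<Longrightarrow> x \<in> hecke_free k \<Longrightarrow> y \<in> hecke_free k \<Longrightarrow> heq q k x y"
  unfolding heq_def using hecke_ideal_closed(9) by blast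

lemma gen_hecke_free: "1 \<le> i \<Longrightarrow> i < k \<Longrightarrow> gen i \<in> hecke_free k"
  by (simp add: hecke_gens_def)

lemma heq_braid:
  assumes "1 \<le> i" "i + 1 < k"
  shows "heq q k (gen i * gen (i + 1) * gen i) (gen (i + 1) * gen i * gen (i + 1))"
proof (rule heq_of_rel)
  show "gen i * gen (i + 1) * gen i - gen (i + 1) * gen i * gen (i + 1) \<in> hecke_rels q k"
    unfolding hecke_rels_def
    by (intro UnI1 CollectI exI[of _ i]) (use assms in \<open>simp add: hecke_gens_def\<close>)
qed (use assms gen_hecke_free in \<open>auto intro!: free_carrier_mult\<close>)

lemma heq_commute:
  assumes "1 \<le> i" "i + 2 \<le> j" "j < k"
  shows "heq q k (gen i * gen j) (gen j * gen i)"
proof (rule heq_of_rel)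
  show "gen i * gen j - gen j * gen i \<in> hecke_rels q k"
    unfolding hecke_rels_def
    by (rule UnI1, rule UnI2, intro CollectI exI[of _ i] exI[of _ j]) (use assms in \<open>simp add: hecke_gens_def\<close>)
qed (use assms gen_hecke_free in \<open>auto intro!: free_carrier_mult\<close>)

lemma heq_quadratic:
  assumes "q \<noteq> 0" "1 \<le> i" "i < k"
  shows "heq q k (gen i * gen i) (const (q - inverse q) * gen i + 1)"
proof (rule heq_of_rel)
  have 1: "const q * const (inverse q) = 1" unfolding const_mult[symmetric] using assms(1) by simp
  have "(gen i - const q) * (gen i + const (inverse q)) = gen i * gen i - (const (q - inverse q) * gen i + 1)"
    by (simp add: 1 const_diff left_diff_distrib right_diff_distrib distrib_left distrib_right
        const_commute[of "inverse q" "gen i"])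
  moreover have "(gen i - const q) * (gen i + const (inverse q)) \<in> hecke_rels q k"
    unfolding hecke_rels_def
    by (intro UnI2 CollectI exI[of _ i]) (use assms in \<open>simp add: hecke_gens_def\<close>)
  ultimately show "gen i * gen i - (const (q - inverse q) * gen i + 1) \<in> hecke_rels q k" by simp
qed (use assms gen_hecke_free in \<open>auto intro!: free_carrier_mult free_carrier_add\<close>)

section \<open>Spanning words and faithfulness\<close>

section \<open>Faithfulness of the seminormal form\<close>

text \<open>Coset representatives \<open>\<sigma>\<^sub>k \<sigma>\<^bsub>k-1\<^esub> \<dots>\<close> with \<open>m\<close> factors; they show that \<open>k!\<close> words span the Hecke
  algebra, while the matrix units give \<open>k!\<close> independent elements.\<close>

fun tau :: "nat \<Rightarrow> nat \<Rightarrow> nat free" where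
  "tau k 0 = 1"
| "tau k (Suc m) = tau k m * gen (k - m)"

lemma tau_carrier: "m \<le> k \<Longrightarrow> tau k m \<in> hecke_free (Suc k)"
  by (induction m) (auto intro!: free_carrier_mult gen_hecke_free)

lemma heq_mult_left: "heq q k x y \<Longrightarrow> z \<in> hecke_free k \<Longrightarrow> heq q k (z * x) (z * y)"
  by (rule heq_mult[OF heq_refl])

lemma heq_mult_right: "heq q k x y \<Longrightarrow> z \<in> hecke_free k \<Longrightarrow> heq q k (x * z) (y * z)"
  by (rule heq_mult[OF _ heq_refl])

lemma tau_gen_below: "1 \<le> i \<Longrightarrow> i < k - m \<Longrightarrow> heq q (Suc k) (tau k m * gen i) (gen i * tau k m)"
proof (induction m)
  case 0
  then show ?case by (simp add: heq_refl gen_hecke_free)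
next
  case (Suc m)
  note g = tau_carrier[of m k] gen_hecke_free[of i "Suc k"] gen_hecke_free[of "k - m" "Suc k"]
  have "heq q (Suc k) (tau k m * (gen (k - m) * gen i)) (tau k m * (gen i * gen (k - m)))"
    by (rule heq_mult_left[OF heq_sym[OF heq_commute]]) (use Suc.prems g in auto)
  also have "tau k m * (gen i * gen (k - m)) = tau k m * gen i * gen (k - m)" by (simp only: mult.assoc)
  also have "heq q (Suc k) \<dots> (gen i * tau k m * gen (k - m))"
    by (rule heq_mult_right[OF Suc.IH]) (use Suc.prems g in auto)
  finally show ?case by (simp only: tau.simps mult.assoc)
qed

text \<open>The generator commutes with the last letters of the descending word until it meets its
  two neighbours; one braid move lowers its index by one, and it commutes with the rest.\<close>

lemma tau_gen_above: "k - m + 2 \<le> i \<Longrightarrow> i \<le> k \<Longrightarrow> m \<le> k \<Longrightarrow>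
    heq q (Suc k) (tau k m * gen i) (gen (i - 1) * tau k m)"
proof (induction m)
  case 0
  then show ?case by simp
next
  case (Suc m)
  note g = tau_carrier[of m k] gen_hecke_free[of i "Suc k"] gen_hecke_free[of "k - m" "Suc k"]
    gen_hecke_free[of "i - 1" "Suc k"]
  show ?case
  proof (cases "k - m + 2 \<le> i")
    case True
    have "heq q (Suc k) (tau k m * (gen (k - m) * gen i)) (tau k m * (gen i * gen (k - m)))"
      by (rule heq_mult_left[OF heq_commute]) (use Suc.prems True g in auto)
    also have "tau k m * (gen i * gen (k - m)) = tau k m * gen i * gen (k - m)" by (simp only: mult.assoc)
    also have "heq q (Suc k) \<dots> (gen (i - 1) * tau k m * gen (k - m))"
      by (rule heq_mult_right[OF Suc.IH]) (use Suc.prems True g in auto)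
    finally show ?thesis by (simp only: tau.simps mult.assoc)
  next
    case False
    then have i: "i = k - m + 1" "m \<ge> 1" using Suc.prems by auto
    then obtain l where l: "m = Suc l" by (cases m) auto
    define j where "j = k - m"
    have j: "1 \<le> j" "i = j + 1" "k - l = j + 1" "j + 1 < Suc k" "l \<le> k" using i l Suc.prems by (auto simp: j_def)
    have g': "tau k l \<in> hecke_free (Suc k)" "gen j \<in> hecke_free (Suc k)" "gen (j + 1) \<in> hecke_free (Suc k)"
      using tau_carrier[of l k] gen_hecke_free[of j "Suc k"] gen_hecke_free[of "j + 1" "Suc k"] j by auto
    have "heq q (Suc k) (tau k l * (gen (j + 1) * gen j * gen (j + 1))) (tau k l * (gen j * gen (j + 1) * gen j))"
      by (rule heq_mult_left[OF heq_sym[OF heq_braid]]) (use j g' in auto)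
    also have "tau k l * (gen j * gen (j + 1) * gen j) = tau k l * gen j * (gen (j + 1) * gen j)"
      by (simp only: mult.assoc)
    also have "heq q (Suc k) \<dots> (gen j * tau k l * (gen (j + 1) * gen j))"
      by (rule heq_mult_right[OF tau_gen_below free_carrier_mult]) (use j g' in auto)
    finally have "heq q (Suc k) (tau k l * (gen (j + 1) * gen j * gen (j + 1))) (gen j * tau k l * (gen (j + 1) * gen j))" .
    moreover have "tau k (Suc m) * gen i = tau k l * (gen (j + 1) * gen j * gen (j + 1))"
      unfolding l tau.simps j(3) using j(2) by (simp only: j_def l mult.assoc)
    moreover have "gen (i - 1) * tau k (Suc m) = gen j * tau k l * (gen (j + 1) * gen j)"
      unfolding l tau.simps j(3) using j(2) by (simp only: j_def l mult.assoc add_diff_cancel_right')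
    ultimately show ?thesis by simp
  qed
qed

text \<open>The left module generated by the coset representatives over the algebra on one strand
  less. It turns out to be everything because it contains 1 and is closed under right multiplication
  by generators.\<close>

definition coset_span :: "complex \<Rightarrow> nat \<Rightarrow> nat free set" where
  "coset_span q k = {x. \<exists>y. (\<forall>m\<le>k. y m \<in> hecke_free k) \<and> heq q (Suc k) x (\<Sum>m\<le>k. y m * tau k m)}"

lemma coset_span_add: assumes "x \<in> coset_span q k" "x' \<in> coset_span q k" shows "x + x' \<in> coset_span q k"
proof -
  from assms obtain y y' where "\<forall>m\<le>k. y m \<in> hecke_free k" "heq q (Suc k) x (\<Sum>m\<le>k. y m * tau k m)"
    "\<forall>m\<le>k. y' m \<in> hecke_free k" "heq q (Suc k) x' (\<Sum>m\<le>k. y' m * tau k m)" unfolding coset_span_def by blast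
  then have "(\<forall>m\<le>k. y m + y' m \<in> hecke_free k) \<and> heq q (Suc k) (x + x') (\<Sum>m\<le>k. (y m + y' m) * tau k m)"
    using heq_add by (simp add: distrib_right sum.distrib)
  then show ?thesis unfolding coset_span_def mem_Collect_eq by (rule exI[of _ "\<lambda>m. y m + y' m"])
qed

lemma coset_span_heq: "heq q (Suc k) x x' \<Longrightarrow> x' \<in> coset_span q k \<Longrightarrow> x \<in> coset_span q k"
  unfolding coset_span_def using heq_trans by blast

lemma coset_span_basic: assumes "y \<in> hecke_free k" "m \<le> k" shows "y * tau k m \<in> coset_span q k"
proof -
  have "(\<Sum>m'\<le>k. (if m' = m then y else 0) * tau k m') = (\<Sum>m'\<le>k. if m' = m then y * tau k m else 0)"
    by (intro sum.cong) auto
  also have "\<dots> = y * tau k m" using assms(2) by simp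
  finally show ?thesis unfolding coset_span_def mem_Collect_eq
    using assms hecke_free_mono[of k "Suc k" y] tau_carrier[of m k]
    by (intro exI[of _ "\<lambda>m'. if m' = m then y else 0"]) (simp add: heq_refl)
qed

lemma coset_span_0: "0 \<in> coset_span q k"
  unfolding coset_span_def mem_Collect_eq by (intro exI[of _ "\<lambda>_. 0"]) (simp add: heq_refl)

lemma coset_span_sum: "(\<And>a. a \<in> A \<Longrightarrow> f a \<in> coset_span q k) \<Longrightarrow> sum f A \<in> coset_span q k"
  by (induction A rule: infinite_finite_induct) (auto simp: coset_span_0 coset_span_add)

lemma coset_span_const: assumes "x \<in> coset_span q k" shows "const c * x \<in> coset_span q k"
proof -
  from assms obtain y where "\<forall>m\<le>k. y m \<in> hecke_free k" "heq q (Suc k) x (\<Sum>m\<le>k. y m * tau k m)"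
    unfolding coset_span_def by blast
  then have "(\<forall>m\<le>k. const c * y m \<in> hecke_free k) \<and> heq q (Suc k) (const c * x) (\<Sum>m\<le>k. (const c * y m) * tau k m)"
    using heq_mult_left by (simp add: mult.assoc flip: sum_distrib_left)
  then show ?thesis unfolding coset_span_def mem_Collect_eq by (rule exI[of _ "\<lambda>m. const c * y m"])
qed

text \<open>There are four positions of the generator relative to the descending word: it commutes
  through, it lengthens the word, it meets an equal last letter and the quadratic relation applies,
  or it passes through with its index lowered.\<close>

lemma coset_span_gen_basic:
  assumes q: "q \<noteq> 0" and y: "y \<in> hecke_free k" and m: "m \<le> k" and i: "1 \<le> i" "i \<le> k"
  shows "y * tau k m * gen i \<in> coset_span q k"
proof -
  note y' = hecke_free_mono[of k "Suc k" y, OF _ y]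
  note g = tau_carrier[of m k] gen_hecke_free[of i "Suc k"]
  consider "i < k - m" | "i = k - m" | "i = k - m + 1" "m \<ge> 1" | "k - m + 2 \<le> i" using m i by linarith
  then show ?thesis
  proof cases
    case 1
    have "heq q (Suc k) (y * (tau k m * gen i)) (y * (gen i * tau k m))"
      by (rule heq_mult_left[OF tau_gen_below]) (use 1 i y' in auto)
    moreover have "(y * gen i) * tau k m \<in> coset_span q k"
      by (rule coset_span_basic) (use 1 i m y gen_hecke_free[of i k] in auto)
    ultimately show ?thesis using coset_span_heq by (simp add: mult.assoc)
  next
    case 2
    then have "y * tau k m * gen i = y * tau k (Suc m)" by (simp add: mult.assoc)
    then show ?thesis using coset_span_basic[OF y, of "Suc m"] 2 i by simp
  next
    case 3
    then obtain l where l: "m = Suc l" by (cases m) auto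
    then have il: "k - l = i" using 3 m by simp
    have "heq q (Suc k) (y * tau k l * (gen i * gen i)) (y * tau k l * (const (q - inverse q) * gen i + 1))"
      by (rule heq_mult_left[OF heq_quadratic[OF q]]) (use i y' tau_carrier[of l k] l m in auto)
    moreover have "y * tau k l * (const (q - inverse q) * gen i + 1) = const (q - inverse q) * (y * tau k m) + y * tau k l"
      by (simp add: l il distrib_left mult.assoc) (metis const_commute mult.assoc)
    moreover have "const (q - inverse q) * (y * tau k m) + y * tau k l \<in> coset_span q k"
      using l m y by (intro coset_span_add coset_span_const coset_span_basic) auto
    moreover have "y * tau k m * gen i = y * tau k l * (gen i * gen i)" by (simp add: l il mult.assoc)
    ultimately show ?thesis using coset_span_heq by metis
  next
    case 4
    have "heq q (Suc k) (y * (tau k m * gen i)) (y * (gen (i - 1) * tau k m))"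
      by (rule heq_mult_left[OF tau_gen_above]) (use 4 i m y' in auto)
    moreover have "(y * gen (i - 1)) * tau k m \<in> coset_span q k"
      by (rule coset_span_basic) (use 4 i m y gen_hecke_free[of "i - 1" k] in auto)
    ultimately show ?thesis using coset_span_heq by (simp add: mult.assoc)
  qed
qed

lemma coset_span_gen:
  assumes q: "q \<noteq> 0" and x: "x \<in> coset_span q k" and i: "1 \<le> i" "i \<le> k"
  shows "x * gen i \<in> coset_span q k"
proof -
  from x obtain y where y: "\<forall>m\<le>k. y m \<in> hecke_free k" "heq q (Suc k) x (\<Sum>m\<le>k. y m * tau k m)"
    unfolding coset_span_def by blast
  have "heq q (Suc k) (x * gen i) ((\<Sum>m\<le>k. y m * tau k m) * gen i)"
    by (rule heq_mult_right[OF y(2)]) (use i gen_hecke_free in auto)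
  moreover have "(\<Sum>m\<le>k. y m * tau k m) * gen i \<in> coset_span q k"
    unfolding sum_distrib_right by (intro coset_span_sum coset_span_gen_basic) (use q y i in auto)
  ultimately show ?thesis by (rule coset_span_heq)
qed

lemma coset_span_all:
  assumes q: "q \<noteq> 0" and x: "x \<in> hecke_free (Suc k)"
  shows "x \<in> coset_span q k"
proof -
  have word: "single (FWord w) 1 \<in> coset_span q k" if "set w \<subseteq> {1..k}" for w
    using that
  proof (induction w rule: rev_induct)
    case Nil
    have "single (FWord []) 1 = (1 :: nat free)"
      by (metis single_one zero_fword_def)
    then show ?case using coset_span_basic[of 1 k 0 q] by simp
  next
    case (snoc i w)
    have "single (FWord (w @ [i])) 1 = single (FWord w) 1 * gen i"
      by (simp add: gen_def mult_single plus_fword_def)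
    then show ?case using snoc coset_span_gen[OF q] by simp
  qed
  have "x = (\<Sum>w\<in>keys x. const (lookup x w) * single w 1)"
    by (subst pm_expand) (simp add: const_single)
  also have "\<dots> \<in> coset_span q k"
  proof (intro coset_span_sum coset_span_const)
    fix w assume "w \<in> keys x"
    then show "single w 1 \<in> coset_span q k"
      using word[of "letters w"] x
      by (auto simp: free_carrier_iff hecke_gens_def atLeastLessThanSuc_atLeastAtMost)
  qed
  finally show ?thesis .
qed

text \<open>The words are numbered in the factorial number system: n modulo k + 1 is the length of
  the last coset representative, and the quotient numbers the word on fewer strands.\<close>

fun hword :: "nat \<Rightarrow> nat \<Rightarrow> nat free" where
  "hword 0 n = 1"
| "hword (Suc k) n = hword k (n div Suc k) * tau k (n mod Suc k)"

text \<open>The relations on k strands are among those on k + 1 strands, and the larger ideal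
  intersected with the smaller free algebra is an ideal of the latter.\<close>

lemma hecke_free_heq_mono: assumes "heq q k x y" shows "heq q (Suc k) x y"
proof -
  have "hecke_rels q k \<subseteq> hecke_rels q (Suc k)" by (fastforce simp: hecke_rels_def hecke_gens_def)
  moreover have I: "ideal (hecke_ideal q (Suc k) \<inter> hecke_free k) (free_alg (hecke_gens k))"
    unfolding ideal_of_free_alg_iff
    using hecke_ideal_closed(2-5)[where q = q and k = "Suc k"] hecke_free_mono[of k "Suc k"] by auto
  ultimately have "hecke_ideal q k \<subseteq> hecke_ideal q (Suc k) \<inter> hecke_free k"
    unfolding hecke_ideal_def[of q k]
    using hecke_rels_subset hecke_ideal_closed(9)[where q = q and k = "Suc k"]
    by (intro rel_ideal_minimal) auto
  then show ?thesis using assms hecke_free_mono[of k "Suc k"] by (auto simp: heq_def)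
qed

lemma hword_spans:
  assumes q: "q \<noteq> 0"
  shows "x \<in> hecke_free k \<Longrightarrow> \<exists>c. heq q k x (\<Sum>n<fact k. const (c n) * hword k n)"
proof (induction k arbitrary: x)
  case 0
  have "x = const (lookup x 0)"
  proof (rule poly_mapping_eqI)
    fix w
    have "w \<in> keys x \<Longrightarrow> w = 0"
      using 0 by (cases w) (auto simp: free_carrier_iff hecke_gens_def zero_fword_def)
    then show "lookup x w = lookup (const (lookup x 0)) w"
      by (auto simp: const_def lookup_single when_def in_keys_iff)
  qed
  then show ?case using heq_refl[OF 0, of q]
    by (intro exI[of _ "\<lambda>_. lookup x 0"]) simp
next
  case (Suc k)
  from coset_span_all[OF q Suc.prems] obtain y where
    y: "\<And>m. m \<le> k \<Longrightarrow> y m \<in> hecke_free k" "heq q (Suc k) x (\<Sum>m\<le>k. y m * tau k m)"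
    unfolding coset_span_def by blast
  have "\<exists>c. heq q k (y m) (\<Sum>n<fact k. const (c n) * hword k n)" if "m \<le> k" for m
    using Suc.IH y(1) that by blast
  then obtain c where c: "\<And>m. m \<le> k \<Longrightarrow> heq q k (y m) (\<Sum>n<fact k. const (c m n) * hword k n)"
    by metis
  \<comment> \<open>The two indices are packed into one number in the same way as
    \<open>hword\<close> unpacks it, so that the double sum becomes a single one.\<close>
  define c' where "c' n = c (n mod Suc k) (n div Suc k)" for n
  have "heq q (Suc k) x (\<Sum>m\<le>k. y m * tau k m)" by (rule y(2))
  also have "heq q (Suc k) \<dots> (\<Sum>m\<le>k. (\<Sum>n<fact k. const (c m n) * hword k n) * tau k m)"
    using c hecke_free_heq_mono tau_carrier by (intro heq_sum heq_mult_right) auto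
  also have "(\<Sum>m\<le>k. (\<Sum>n<fact k. const (c m n) * hword k n) * tau k m)
      = (\<Sum>n<fact k. \<Sum>m<Suc k. const (c m n) * hword k n * tau k m)"
    unfolding sum_distrib_right lessThan_Suc_atMost by (rule sum.swap)
  also have "\<dots> = (\<Sum>n<fact k. \<Sum>j\<in>{n * Suc k..<n * Suc k + Suc k}. const (c' j) * hword (Suc k) j)"
  proof (rule sum.cong[OF refl])
    fix n
    have "(\<Sum>j\<in>{n * Suc k..<n * Suc k + Suc k}. const (c' j) * hword (Suc k) j)
        = (\<Sum>m<Suc k. const (c' (m + n * Suc k)) * hword (Suc k) (m + n * Suc k))"
      by (subst sum.shift_bounds_nat_ivl[of _ 0 "n * Suc k" "Suc k", simplified add_0 add.commute[of "Suc k"]])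
         (simp only: atLeast0LessThan)
    also have "\<dots> = (\<Sum>m<Suc k. const (c m n) * hword k n * tau k m)"
    proof (intro sum.cong refl)
      fix m assume "m \<in> {..<Suc k}"
      then have "(m + n * Suc k) mod Suc k = m" "(m + n * Suc k) div Suc k = n"
        by (metis lessThan_iff mod_less mod_mult_self1,
            metis add.right_neutral div_less div_mult_self1 lessThan_iff nat.distinct(2))
      then show "const (c' (m + n * Suc k)) * hword (Suc k) (m + n * Suc k) = const (c m n) * hword k n * tau k m"
        by (simp only: c'_def hword.simps mult.assoc)
    qed
    finally show "(\<Sum>m<Suc k. const (c m n) * hword k n * tau k m) = (\<Sum>j\<in>{n * Suc k..<n * Suc k + Suc k}. const (c' j) * hword (Suc k) j)" ..
  qed
  also have "\<dots> = (\<Sum>n<fact (Suc k). const (c' n) * hword (Suc k) n)"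
    unfolding sum.nat_group by (simp add: mult.commute)
  finally show ?case by blast
qed

definition mcoef :: "complex \<Rightarrow> nat free \<Rightarrow> box list \<Rightarrow> box list \<Rightarrow> complex" where
  "mcoef q x S T = actx q x (\<lambda>U. of_bool (U = T)) S"

lemma heq_actx: "generic q \<Longrightarrow> heq q k x y \<Longrightarrow> S \<in> Stdk k \<Longrightarrow> actx q x v S = actx q y v S"
  using hecke_ideal_ker[of q k] actx_diff[of q x y v S]
  by (auto simp: heq_def hecke_ker_def Stdk_def)

text \<open>The k! words span, and expanding the k! matrix units in them yields a left inverse B of
  the matrix A of seminormal coefficients of the words. For square matrices a left inverse is a
  right inverse, so an element whose coefficients vanish has vanishing coordinates in the
  words.\<close>

theorem hecke_faithful:
  assumes q: "generic q" and x: "x \<in> hecke_free k"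
    and zero: "\<And>S T. (S, T) \<in> std_pairs k \<Longrightarrow> mcoef q x S T = 0"
  shows "x \<in> hecke_ideal q k"
proof -
  have q0: "q \<noteq> 0" using q by (simp add: generic_def)
  define n where "n = (fact k :: nat)"
  obtain p where p: "bij_betw p {..<n} (std_pairs k)"
    using ex_bij_betw_nat_finite[OF finite_std_pairs[of k]] by (auto simp: card_std_pairs n_def atLeast0LessThan)
  have pp: "p i \<in> std_pairs k" if "i < n" for i using p that by (auto simp: bij_betw_def)
  have pS: "fst (p i) \<in> Stdk k" "snd (p i) \<in> Stdk k" "set (fst (p i)) = set (snd (p i))" if "i < n" for i
    using pp[OF that] by (auto simp: std_pairs_def std_of_def Stdk_def split_beta)
       (metis Std_distinct distinct_card)
  \<comment> \<open>Rows are numbered by words and columns by pairs of tableaux of equal shape; the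
    equality of the two counts makes the matrix square.\<close>
  define A where "A = mat n n (\<lambda>(i, j). mcoef q (hword k i) (fst (p j)) (snd (p j)))"
  have "\<exists>b. heq q k (munit q (fst (p i)) (snd (p i))) (\<Sum>n<fact k. const (b n) * hword k n)" if "i < n" for i
    by (rule hword_spans[OF q0 munit_carrier[OF q pS[OF that]]])
  then obtain b where b: "\<And>i. i < n \<Longrightarrow> heq q k (munit q (fst (p i)) (snd (p i))) (\<Sum>n<fact k. const (b i n) * hword k n)"
    by metis
  define B where "B = mat n n (\<lambda>(i, j). b i j)"
  have m: "mcoef q (\<Sum>n<fact k. const (c n) * hword k n) S T = (\<Sum>i<n. c i * mcoef q (hword k i) S T)" for c S T
    by (simp add: mcoef_def actx_sum actx_const_mult n_def)
  have "B * A = 1\<^sub>m n"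
  proof (rule eq_matI)
    fix i j assume "i < dim_row (1\<^sub>m n :: complex mat)" "j < dim_col (1\<^sub>m n :: complex mat)"
    then have ij: "i < n" "j < n" by auto
    have "(B * A) $$ (i, j) = mcoef q (munit q (fst (p i)) (snd (p i))) (fst (p j)) (snd (p j))"
      using ij heq_actx[OF q b[OF ij(1)] pS(1)[OF ij(2)]] m[of "b i"]
      by (simp add: A_def B_def scalar_prod_def atLeast0LessThan mcoef_def)
    also have "\<dots> = of_bool (p j = p i)"
      using acts_asD[OF munit[OF q pS[OF ij(1)]] pS(1)[OF ij(2)]] by (auto simp: mcoef_def prod_eq_iff)
    also have "\<dots> = 1\<^sub>m n $$ (i, j)"
      using p ij by (auto simp: bij_betw_def inj_on_def)
    finally show "(B * A) $$ (i, j) = 1\<^sub>m n $$ (i, j)" .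
  qed (simp_all add: A_def B_def)
  then have AB: "A * B = 1\<^sub>m n"
    by (intro mat_mult_left_right_inverse[of B n A]) (simp_all add: A_def B_def)
  obtain c where c: "heq q k x (\<Sum>n<fact k. const (c n) * hword k n)" using hword_spans[OF q0 x] by blast
  have cA: "(\<Sum>i<n. c i * A $$ (i, j)) = 0" if "j < n" for j
    using zero[of "fst (p j)" "snd (p j)"] pp[OF that] heq_actx[OF q c pS(1)[OF that]] m[of c] that
    by (simp add: A_def mcoef_def)
  have "c i = 0" if "i < n" for i
  proof -
    have "c i = (\<Sum>l<n. c l * (A * B) $$ (l, i))" unfolding AB using that by (simp add: if_distrib cong: if_cong)
    also have "\<dots> = (\<Sum>l<n. \<Sum>j<n. c l * A $$ (l, j) * B $$ (j, i))"
      using that by (intro sum.cong refl) (simp add: A_def B_def scalar_prod_def atLeast0LessThan sum_distrib_left mult.assoc)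
    also have "\<dots> = (\<Sum>j<n. (\<Sum>l<n. c l * A $$ (l, j)) * B $$ (j, i))"
      by (subst sum.swap) (simp add: sum_distrib_right)
    finally show ?thesis using cA by simp
  qed
  then have "(\<Sum>n<fact k. const (c n) * hword k n) = 0" by (simp add: n_def)
  with c show ?thesis by (simp add: heq_def)
qed

text \<open>Faithfulness as a working rule: identities in the Hecke algebra are checked on
  tableaux.\<close>

lemma heqI:
  assumes "generic q" "x \<in> hecke_free k" "y \<in> hecke_free k"
    and "\<And>S v. S \<in> Stdk k \<Longrightarrow> actx q x v S = actx q y v S"
  shows "heq q k x y"
  unfolding heq_def using assms
  by (auto intro!: hecke_faithful simp: mcoef_def actx_diff std_pairs_def)

section \<open>Comparison with the given seminormal form; identification of the central
  idempotents\<close>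

section \<open>Partitions and central idempotents\<close>

lemma young_diagram_iff: "(r, c) \<in> young_diagram \<nu> \<longleftrightarrow> r < length \<nu> \<and> c < \<nu> ! r"
  by (simp add: young_diagram_def)

lemma young_diagram_downset: assumes "\<nu> \<in> partitions" shows "downset (young_diagram \<nu>)"
proof -
  have e: "young_diagram \<nu> = Sigma {..<length \<nu>} (\<lambda>r. {..<\<nu> ! r})"
    by (auto simp: young_diagram_def)
  have "\<nu> ! r' \<le> \<nu> ! r" if "r \<le> r'" "r' < length \<nu>" for r r'
    using assms that sorted_wrt_nth_less[of "(\<ge>)" \<nu> r r'] by (cases "r = r'") (auto simp: partitions_def)
  then show ?thesis unfolding downset_def
    by (auto simp: e) (meson le_less_trans less_le_trans)
qed

lemma card_young_diagram: "card (young_diagram \<nu>) = sum_list \<nu>"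
proof -
  have e: "young_diagram \<nu> = Sigma {..<length \<nu>} (\<lambda>r. {..<\<nu> ! r})"
    by (auto simp: young_diagram_def)
  show ?thesis unfolding e by (simp add: sum_list_sum_nth atLeast0LessThan)
qed

lemma young_diagram_inj:
  assumes "\<nu> \<in> partitions" "\<nu>' \<in> partitions" "young_diagram \<nu> = young_diagram \<nu>'"
  shows "\<nu> = \<nu>'"
proof -
  have l: "r < length \<nu> \<longleftrightarrow> (r, 0) \<in> young_diagram \<nu>" if "\<nu> \<in> partitions" for r \<nu>
    using that by (auto simp: young_diagram_iff partitions_def) (metis gr0I nth_mem)
  have "r < length \<nu> \<longleftrightarrow> r < length \<nu>'" for r using l assms by metis
  then have len: "length \<nu> = length \<nu>'" by (metis linorder_neqE_nat nat_less_le)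
  show ?thesis
  proof (rule nth_equalityI[OF len])
    fix r assume r: "r < length \<nu>"
    have "c < \<nu> ! r \<longleftrightarrow> c < \<nu>' ! r" for c
      using young_diagram_iff[of r c \<nu>] young_diagram_iff[of r c \<nu>'] r len assms(3) by simp
    then show "\<nu> ! r = \<nu>' ! r" by (metis linorder_neqE_nat nat_less_le)
  qed
qed

lemma young_diagram_surj: assumes "downset D" shows "\<exists>\<nu>\<in>partitions_of (card D). young_diagram \<nu> = D"
proof -
  have "finite {r. (r, 0) \<in> D}"
    by (rule finite_surj[OF downset_finite[OF assms], of _ fst]) force
  then obtain r0 where "(r0, 0) \<notin> D" by (metis (mono_tags, lifting) ex_new_if_finite infinite_UNIV_nat mem_Collect_eq)
  define n where "n = (LEAST r. (r, 0) \<notin> D)"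
  have n: "(n, 0) \<notin> D" unfolding n_def by (rule LeastI) fact
  have n': "(r, 0) \<in> D" if "r < n" for r using not_less_Least that unfolding n_def by blast
  define \<nu> where "\<nu> = map (row_len D) [0..<n]"
  have yd: "young_diagram \<nu> = D"
  proof -
    have "(r, c) \<in> young_diagram \<nu> \<longleftrightarrow> (r, c) \<in> D" for r c
    proof
      assume "(r, c) \<in> D"
      then have "r < n" using downsetD[OF assms, of r c n 0] n by force
      with \<open>(r, c) \<in> D\<close> show "(r, c) \<in> young_diagram \<nu>"
        using mem_row_len[OF assms] by (simp add: young_diagram_iff \<nu>_def)
    qed (auto simp: young_diagram_iff \<nu>_def mem_row_len[OF assms])
    then show ?thesis by auto
  qed
  have "sorted_wrt (\<ge>) \<nu>"
    unfolding \<nu>_def sorted_wrt_map by (rule sorted_wrt_mono_rel[of _ "(\<le>)"]) (auto simp: row_len_mono[OF assms])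
  moreover have "0 \<notin> set \<nu>"
  proof
    assume "0 \<in> set \<nu>"
    then obtain r where "r < n" "row_len D r = 0" by (auto simp: \<nu>_def)
    then show False using n' mem_row_len[OF assms] by force
  qed
  ultimately have "\<nu> \<in> partitions_of (card D)"
    using card_young_diagram[of \<nu>] yd by (simp add: partitions_def partitions_of_def)
  with yd show ?thesis by blast
qed

lemma std_tableaux_eq: assumes "\<nu> \<in> partitions" shows "std_tableaux \<nu> = std_of (young_diagram \<nu>)"
  using std_tableaux_iff[OF young_diagram_downset[OF assms]] young_diagram_downset[OF assms]
  by (auto simp: std_of_def)

lemma std_of_Stdk: "T \<in> std_of D \<Longrightarrow> T \<in> Stdk (card D)"
  using std_of_length by (auto simp: std_of_def Stdk_def)

text \<open>The given form lists the images of basis vectors, while the action used here transforms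
  coordinate functions; applied to the indicator of T the latter returns the entry at (S, T). The
  sum over all tableaux collapses to S and its swap.\<close>

lemma seminormal_word_actw:
  assumes \<nu>: "\<nu> \<in> partitions"
  shows "S \<in> std_tableaux \<nu> \<Longrightarrow> set w \<subseteq> {1..<length S} \<Longrightarrow>
    seminormal_word q \<nu> w S T = actw q w (\<lambda>U. of_bool (U = T)) S"
proof (induction w arbitrary: S)
  case (Cons i w)
  let ?D = "young_diagram \<nu>"
  have d: "downset ?D" by (rule young_diagram_downset[OF \<nu>])
  have S: "S \<in> Std" "set S = ?D" using Cons.prems std_tableaux_eq[OF \<nu>] by (auto simp: std_of_def)
  have i: "1 \<le> i" "i < length S" using Cons.prems by auto
  obtain P A B Q where SP: "S = P @ A # B # Q" and iP: "i = Suc (length P)" using split_at i by metis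
  have AB: "A \<noteq> B" using Std_distinct[OF S(1)] SP by auto
  define X where "X = (if swp i S \<in> Std then {S, swp i S} else {S})"
  have sub: "X \<subseteq> std_tableaux \<nu>"
    using S swp_props[OF i] by (auto simp: X_def std_tableaux_eq[OF \<nu>] std_of_def)
  have ne: "S \<noteq> swp i S" using AB by (simp add: SP iP)
  have sem0: "seminormal_gen q i S U = 0" if U: "U \<in> std_tableaux \<nu> - X" for U
  proof -
    have "S \<noteq> U" using U by (auto simp: X_def split: if_splits)
    moreover have "S \<noteq> swp i U"
    proof
      assume SU: "S = swp i U"
      have "length U = length S" using U std_of_length S(2) std_tableaux_eq[OF \<nu>] S Std_distinct distinct_card
        by (metis DiffD1 mem_Collect_eq std_of_def)
      then have "i < length U" using i by simp
      then obtain P' A' B' Q' where UP: "U = P' @ A' # B' # Q'" and iP': "i = Suc (length P')" using split_at i by metis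
      have "U = swp i S" unfolding SU unfolding UP iP' by simp
      then show False using U S by (auto simp: X_def std_tableaux_eq[OF \<nu>] std_of_def split: if_splits)
    qed
    ultimately show ?thesis by (simp add: seminormal_gen_def Let_def swp_def)
  qed
  have fin: "finite (std_tableaux \<nu>)" using finite_std_of[OF d] std_tableaux_eq[OF \<nu>] by simp
  have "seminormal_word q \<nu> (i # w) S T = (\<Sum>U\<in>X. seminormal_gen q i S U * seminormal_word q \<nu> w U T)"
    unfolding seminormal_word.simps
    by (rule sum.mono_neutral_right[OF fin sub]) (use sem0 in auto)
  also have "\<dots> = (\<Sum>U\<in>X. seminormal_gen q i S U * actw q w (\<lambda>U. of_bool (U = T)) U)"
  proof (intro sum.cong refl)
    fix U assume "U \<in> X"
    then have "U \<in> std_tableaux \<nu>" "length U = length S"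
      using sub swp_props[OF i] by (auto simp: X_def split: if_splits)
    then show "seminormal_gen q i S U * seminormal_word q \<nu> w U T = seminormal_gen q i S U * actw q w (\<lambda>U. of_bool (U = T)) U"
      using Cons by simp
  qed
  also have "\<dots> = act1 q i (actw q w (\<lambda>U. of_bool (U = T))) S"
  proof -
    have g1: "seminormal_gen q i S S = qf q (cdiff i S)"
      by (simp add: seminormal_gen_def qf_def cdiff_def Let_def)
    have sw: "swp i (swp i S) = S" by (simp add: SP iP)
    have cd: "cdiff i (swp i S) = - cdiff i S" by (simp add: SP iP)
    have "seminormal_gen q i S (swp i S) = qint q (cdiff i (swp i S) + 1) / qint q (cdiff i (swp i S))"
      using ne sw by (simp add: seminormal_gen_def cdiff_def Let_def) (simp add: swp_def)
    \<comment> \<open>In the given form the content difference is read off at the source, here the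
      swapped tableau, and this negates it.\<close>
    also have "\<dots> = qg q (cdiff i S)"
    proof -
      have "- cdiff i S + 1 = - (cdiff i S - 1)" by simp
      then show ?thesis unfolding cd qg_def by (simp only: qint_minus) simp
    qed
    finally show ?thesis using ne g1 by (simp add: X_def act1_def)
  qed
  finally show ?case by simp
qed simp

abbreviation hecke_class :: "complex \<Rightarrow> nat \<Rightarrow> nat free \<Rightarrow> nat free set" where
  "hecke_class q k \<equiv> presented_class (hecke_gens k) (hecke_rels q k)"

lemma hecke_class_eq_iff: "x \<in> hecke_free k \<Longrightarrow> y \<in> hecke_free k \<Longrightarrow>
    hecke_class q k x = hecke_class q k y \<longleftrightarrow> heq q k x y"
  using presented_class_eq_iff[OF hecke_rels_subset, of x k y q] by (simp add: heq_def hecke_ideal_def)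

lemma hecke_representative:
  assumes "x \<in> hecke_free k" shows "heq q k (representative (hecke_class q k x)) x"
proof -
  have "representative (hecke_class q k x) - x \<in> hecke_ideal q k"
    using representative_class[OF hecke_rels_subset assms] by (simp add: hecke_ideal_def)
  moreover from this have "representative (hecke_class q k x) - x + x \<in> hecke_free k"
    using assms hecke_ideal_closed(1) free_carrier_add by blast
  ultimately show ?thesis using assms by (simp add: heq_def)
qed

text \<open>The ideal of relations acts by zero on tableaux, so the arbitrary representative inside
  \<open>irrep\<close> may be replaced by x.\<close>

lemma irrep_class:
  assumes q: "generic q" and \<nu>: "\<nu> \<in> partitions_of k" and x: "x \<in> hecke_free k"
    and S: "S \<in> std_tableaux \<nu>"
  shows "irrep q \<nu> (hecke_class q k x) S T = mcoef q x S T"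
proof -
  have \<nu>': "\<nu> \<in> partitions" "sum_list \<nu> = k" using \<nu> by (auto simp: partitions_of_def)
  have Sk: "S \<in> Stdk k" using S std_of_Stdk card_young_diagram \<nu>' std_tableaux_eq by metis
  then have l: "length S = k" by (simp add: Stdk_def)
  let ?r = "representative (hecke_class q k x)"
  have r: "heq q k ?r x" by (rule hecke_representative[OF x])
  have "irrep q \<nu> (hecke_class q k x) S T = lin (\<lambda>w. seminormal_word q \<nu> (letters w) S T) ?r"
    by (simp add: irrep_def seminormal_def lin_def)
  also have "\<dots> = mcoef q ?r S T"
    unfolding mcoef_def actx_def using heq_carrier(1)[OF r] l
    by (intro lin_cong seminormal_word_actw \<nu>' S) (auto simp: free_carrier_iff hecke_gens_def)
  also have "\<dots> = mcoef q x S T" unfolding mcoef_def by (rule heq_actx[OF q r Sk])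
  finally show ?thesis .
qed

definition cidem :: "complex \<Rightarrow> box set \<Rightarrow> nat free" where
  "cidem q D = (\<Sum>T\<in>std_of D. munit q T T)"

lemma cidem_carrier: "generic q \<Longrightarrow> cidem q D \<in> hecke_free (card D)"
  unfolding cidem_def by (intro free_carrier_sum munit_carrier std_of_Stdk) auto

lemma actx_cidem:
  assumes "generic q" "downset D" "U \<in> Stdk (card D)"
  shows "actx q (cidem q D) v U = of_bool (set U = D) * v U"
proof -
  have "actx q (cidem q D) v U = (\<Sum>T\<in>std_of D. of_bool (U = T) * v T)"
    unfolding cidem_def actx_sum
    by (intro sum.cong refl acts_asD[OF munit[where k = "card D"]] assms std_of_Stdk) auto
  also have "\<dots> = (\<Sum>T\<in>std_of D. if T = U then v U else 0)" by (intro sum.cong) auto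
  also have "\<dots> = of_bool (set U = D) * v U"
    using finite_std_of[OF assms(2)] assms(3) by (simp add: std_of_def Stdk_def)
  finally show ?thesis .
qed

lemma actx_scale: "actx q x (\<lambda>U. c * v U) S = c * actx q x v S"
proof -
  have "actw q w (\<lambda>U. c * v U) = (\<lambda>U. c * actw q w v U)" for w
    by (induction w) (auto simp: act1_def fun_eq_iff algebra_simps)
  then show ?thesis by (simp add: actx_def lin_fun_mult)
qed

lemma cidem_central:
  assumes q: "generic q" and D: "downset D" and z: "z \<in> hecke_free (card D)"
  shows "heq q (card D) (cidem q D * z) (z * cidem q D)"
proof (rule heqI[OF q])
  fix S v assume S: "S \<in> Stdk (card D)"
  have "actx q (z * cidem q D) v S = actx q z (\<lambda>U. of_bool (set S = D) * v U) S"
    unfolding actx_mult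
    by (rule actx_cong) (use S z in \<open>auto simp: Stdk_def actx_cidem[OF q D]\<close>)
  then show "actx q (cidem q D * z) v S = actx q (z * cidem q D) v S"
    using S by (simp add: actx_mult actx_cidem[OF q D] actx_scale)
qed (use cidem_carrier[OF q] z in simp_all)

text \<open>Existence is read off from the matrix units. Uniqueness is faithfulness: every shape of
  size k is the diagram of a partition of k, so all matrix coefficients of a candidate are
  prescribed.\<close>

theorem central_idempotent_eq:
  assumes q: "generic q" and \<nu>: "\<nu> \<in> partitions"
  shows "central_idempotent q \<nu> = hecke_class q (sum_list \<nu>) (cidem q (young_diagram \<nu>))"
proof -
  define D k where "D = young_diagram \<nu>" and "k = sum_list \<nu>"
  have D: "downset D" "card D = k"
    using young_diagram_downset[OF \<nu>] card_young_diagram by (simp_all add: D_def k_def)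
  have \<nu>k: "\<nu> \<in> partitions_of k" using \<nu> by (simp add: partitions_of_def k_def)
  note c = cidem_carrier[OF q, of D, unfolded D(2)]
  have car: "carrier (hecke_alg q k) = hecke_class q k ` hecke_free k"
    by (simp add: hecke_alg_def presented_carrier[OF hecke_rels_subset])
  have mul: "hecke_class q k x \<otimes>\<^bsub>hecke_alg q k\<^esub> hecke_class q k y = hecke_class q k (x * y)"
    if "x \<in> hecke_free k" "y \<in> hecke_free k" for x y
    using presented_class_mult[OF hecke_rels_subset that] by (simp add: hecke_alg_def)
  have mc: "mcoef q (cidem q D) S T = of_bool (set S = D \<and> S = T)" if "S \<in> Stdk k" for S T
    using actx_cidem[OF q D(1)] that D(2) by (auto simp: mcoef_def)
  have irr: "irrep q \<mu> (hecke_class q k (cidem q D)) S T = (if \<mu> = \<nu> \<and> S = T then 1 else 0)"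
    if "\<mu> \<in> partitions_of k" "S \<in> std_tableaux \<mu>" "T \<in> std_tableaux \<mu>" for \<mu> S T
  proof -
    have \<mu>: "\<mu> \<in> partitions" "sum_list \<mu> = k" using that by (auto simp: partitions_of_def)
    have S: "S \<in> Stdk k" "set S = young_diagram \<mu>"
      using that \<mu> std_tableaux_eq std_of_Stdk card_young_diagram by (metis, simp add: std_tableaux_eq std_of_def)
    have "set S = D \<longleftrightarrow> \<mu> = \<nu>" using young_diagram_inj[OF \<mu>(1) \<nu>] S by (auto simp: D_def)
    then show ?thesis using irrep_class[OF q that(1) c that(2), of T] mc[OF S(1), of T] by simp
  qed
  have ex: "is_central_idempotent q k \<nu> (hecke_class q k (cidem q D))"
    unfolding is_central_idempotent_def
  proof (intro conjI ballI)
    show "hecke_class q k (cidem q D) \<in> carrier (hecke_alg q k)" using c by (auto simp: car)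
    fix Y assume "Y \<in> carrier (hecke_alg q k)"
    then obtain y where y: "Y = hecke_class q k y" "y \<in> hecke_free k" by (auto simp: car)
    show "hecke_class q k (cidem q D) \<otimes>\<^bsub>hecke_alg q k\<^esub> Y = Y \<otimes>\<^bsub>hecke_alg q k\<^esub> hecke_class q k (cidem q D)"
      using cidem_central[OF q D(1), of y] y c by (simp add: mul hecke_class_eq_iff D(2))
  next
    have "heq q k (cidem q D * cidem q D) (cidem q D)"
      by (rule heqI[OF q]) (use c in \<open>auto simp: actx_mult actx_cidem[OF q D(1)] D(2)\<close>)
    then show "hecke_class q k (cidem q D) \<otimes>\<^bsub>hecke_alg q k\<^esub> hecke_class q k (cidem q D) = hecke_class q k (cidem q D)"
      using c by (simp add: mul hecke_class_eq_iff)
  qed (rule irr)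
  have un: "X = hecke_class q k (cidem q D)" if X: "is_central_idempotent q k \<nu> X" for X
  proof -
    obtain x where x: "X = hecke_class q k x" "x \<in> hecke_free k"
      using X by (auto simp: is_central_idempotent_def car)
    have "x - cidem q D \<in> hecke_ideal q k"
    proof (rule hecke_faithful[OF q])
      fix S T assume ST: "(S, T) \<in> std_pairs k"
      then have S: "S \<in> Stdk k" "set T = set S" "T \<in> Std" by (auto simp: std_pairs_def std_of_def)
      then have dS: "downset (set S)" "card (set S) = k" by (auto simp: Stdk_def Std_downset Std_distinct distinct_card)
      then obtain \<mu> where \<mu>: "\<mu> \<in> partitions_of k" "young_diagram \<mu> = set S" using young_diagram_surj by blast
      then have m: "S \<in> std_tableaux \<mu>" "T \<in> std_tableaux \<mu>"
        using S std_tableaux_eq[of \<mu>] by (auto simp: partitions_of_def std_of_def Stdk_def)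
      have "irrep q \<mu> X S T = (if \<mu> = \<nu> \<and> S = T then 1 else 0)"
        using X \<mu>(1) m unfolding is_central_idempotent_def by blast
      then show "mcoef q (x - cidem q D) S T = 0"
        using irr[OF \<mu>(1) m] irrep_class[OF q \<mu>(1) x(2) m(1), of T] irrep_class[OF q \<mu>(1) c m(1), of T] x(1)
        by (simp add: mcoef_def actx_diff)
    qed (use x c in simp)
    then show ?thesis using x c by (simp add: hecke_class_eq_iff heq_def)
  qed
  show ?thesis unfolding central_idempotent_def k_def[symmetric] D_def[symmetric]
    using ex un by (rule the_equality)
qed

section \<open>Kronecker products over noncommutative rings and weighted partial traces\<close>

section \<open>Kronecker products and partial traces\<close>

lemma sum_div_mod: fixes g :: "nat \<Rightarrow> nat \<Rightarrow> 'a::comm_monoid_add"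
  shows "(\<Sum>k<n * m. g (k div m) (k mod m)) = (\<Sum>a<n. \<Sum>b<m. g a b)"
proof (cases "m = 0")
  case False
  have "(\<Sum>k<n * m. g (k div m) (k mod m)) = (\<Sum>a<n. \<Sum>k\<in>{a * m..<a * m + m}. g (k div m) (k mod m))"
    by (rule sum.nat_group[symmetric])
  also have "\<dots> = (\<Sum>a<n. \<Sum>b<m. g a b)"
  proof (rule sum.cong[OF refl])
    fix a
    have "(\<Sum>k\<in>{a * m..<a * m + m}. g (k div m) (k mod m)) = (\<Sum>b\<in>{0..<m}. g ((b + a * m) div m) ((b + a * m) mod m))"
      using sum.shift_bounds_nat_ivl[of "\<lambda>k. g (k div m) (k mod m)" 0 "a * m" m] by (simp add: add.commute)
    also have "\<dots> = (\<Sum>b<m. g a b)" unfolding atLeast0LessThan using False by (intro sum.cong) auto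
    finally show "(\<Sum>k\<in>{a * m..<a * m + m}. g (k div m) (k mod m)) = (\<Sum>b<m. g a b)" .
  qed
  finally show ?thesis .
qed simp

lemma sum_pairs: fixes g :: "nat \<Rightarrow> 'a::comm_monoid_add"
  shows "(\<Sum>k<n * m. g k) = (\<Sum>a<n. \<Sum>b<m. g (a * m + b))"
proof -
  have "(\<Sum>k<n * m. g k) = (\<Sum>k<n * m. g (k div m * m + k mod m))" by simp
  also have "\<dots> = (\<Sum>a<n. \<Sum>b<m. g (a * m + b))" by (rule sum_div_mod)
  finally show ?thesis .
qed

lemma pair_less: fixes a b n m :: nat assumes "a < n" "b < m" shows "a * m + b < n * m"
proof -
  have "a * m + b < Suc a * m" using assms by simp
  also have "\<dots> \<le> n * m" using assms by (intro mult_le_mono1) simp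
  finally show ?thesis .
qed

lemma div_mod_less: fixes i n m :: nat assumes "i < n * m" shows "i div m < n" "i mod m < m"
  using assms by (auto simp: less_mult_imp_div_less mult.commute intro!: mod_less_divisor Nat.gr0I)

lemma dim_kron [simp]: "dim_row (kron A B) = dim_row A * dim_row B" "dim_col (kron A B) = dim_col A * dim_col B"
  by (simp_all add: kron_def)

lemma kron_carrier [simp]: "A \<in> carrier_mat a b \<Longrightarrow> B \<in> carrier_mat c d \<Longrightarrow> kron A B \<in> carrier_mat (a * c) (b * d)"
  unfolding carrier_mat_def by simp

lemma kron_index: "i < dim_row A * dim_row B \<Longrightarrow> j < dim_col A * dim_col B \<Longrightarrow>
    kron A B $$ (i, j) = A $$ (i div dim_row B, j div dim_col B) * B $$ (i mod dim_row B, j mod dim_col B)"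
  by (simp add: kron_def)

lemma kron_index_pair: "a < dim_row A \<Longrightarrow> b < dim_row B \<Longrightarrow> c < dim_col A \<Longrightarrow> d < dim_col B \<Longrightarrow>
    kron A B $$ (a * dim_row B + b, c * dim_col B + d) = A $$ (a, c) * B $$ (b, d)"
  by (simp add: kron_index pair_less)

lemma kron_assoc: fixes A B C :: "'a::semigroup_mult mat"
  shows "kron (kron A B) C = kron A (kron B C)"
proof -
  have e: "i div c mod b = i mod (b * c) div c" "i div c div b = i div (b * c)" "i mod (b * c) mod c = i mod c"
    if "i < a * (b * c)" for i a b c :: nat
  proof -
    have "c > 0" using that by (metis gr_zeroI mult_0_right not_less0)
    then show "i div c mod b = i mod (b * c) div c" using mod_mult2_eq[of i c b] by (simp add: mult.commute)
    show "i div c div b = i div (b * c)" by (metis div_mult2_eq mult.commute)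
    show "i mod (b * c) mod c = i mod c" by (simp add: mod_mod_cancel)
  qed
  show ?thesis
  proof (rule eq_matI)
    fix i j assume "i < dim_row (kron A (kron B C))" "j < dim_col (kron A (kron B C))"
    then have ij: "i < dim_row A * (dim_row B * dim_row C)" "j < dim_col A * (dim_col B * dim_col C)" by auto
    note l = div_mod_less[OF ij(1)] div_mod_less[OF ij(2)]
    have ij': "i < dim_row A * dim_row B * dim_row C" "j < dim_col A * dim_col B * dim_col C"
      using ij by (simp_all add: mult.assoc)
    note l' = div_mod_less[OF ij'(1)] div_mod_less[OF ij'(2)]
    show "kron (kron A B) C $$ (i, j) = kron A (kron B C) $$ (i, j)"
      using ij ij' l l' e[OF ij(1)] e[OF ij(2)] by (simp add: kron_index mult.assoc)
  qed (simp_all add: mult.assoc)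
qed

lemma kron_one_one: "kron (1\<^sub>m a) (1\<^sub>m b) = (1\<^sub>m (a * b) :: 'a::semiring_1 mat)"
proof (rule eq_matI)
  fix i j assume "i < dim_row (1\<^sub>m (a * b) :: 'a mat)" "j < dim_col (1\<^sub>m (a * b) :: 'a mat)"
  then have ij: "i < a * b" "j < a * b" by auto
  note l = div_mod_less[OF ij(1)] div_mod_less[OF ij(2)]
  have "i = j \<longleftrightarrow> i div b = j div b \<and> i mod b = j mod b" by (metis div_mult_mod_eq)
  then show "kron (1\<^sub>m a) (1\<^sub>m b) $$ (i, j) = (1\<^sub>m (a * b) :: 'a mat) $$ (i, j)"
    using ij l by (auto simp: kron_index)
qed auto

lemma kron_1_left [simp]: "kron (1\<^sub>m (Suc 0)) A = (A :: 'a::semiring_1 mat)"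
  by (rule eq_matI) (auto simp: kron_index)

lemma kron_1_right [simp]: "kron A (1\<^sub>m (Suc 0)) = (A :: 'a::semiring_1 mat)"
  by (rule eq_matI) (auto simp: kron_index)

lemma mat_mult_index: "A \<in> carrier_mat n m \<Longrightarrow> B \<in> carrier_mat m p \<Longrightarrow> i < n \<Longrightarrow> j < p \<Longrightarrow>
   (A * B) $$ (i, j) = (\<Sum>k<m. A $$ (i, k) * B $$ (k, j))"
  by (simp add: scalar_prod_def atLeast0LessThan)

text \<open>Entries may lie in a free algebra. The mixed product rule for Kronecker products moves
  an entry of B past one of C, and asks for this much commutativity; matrices of scalars always
  provide it.\<close>

definition mat_commuting :: "'a::semiring_1 mat \<Rightarrow> 'a mat \<Rightarrow> bool" where
  "mat_commuting B C \<longleftrightarrow> (\<forall>i<dim_row B. \<forall>j<dim_col B. \<forall>k<dim_row C. \<forall>l<dim_col C.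
     B $$ (i, j) * C $$ (k, l) = C $$ (k, l) * B $$ (i, j))"

lemma mat_commuting_one [simp]: "mat_commuting (1\<^sub>m n) C" "mat_commuting C (1\<^sub>m n)"
  by (simp_all add: mat_commuting_def)

lemma mat_commuting_comm [simp]: "mat_commuting (B :: 'a::comm_semiring_1 mat) C"
  by (simp add: mat_commuting_def mult.commute)

lemma kron_mult:
  fixes A B C D :: "'a::semiring_1 mat"
  assumes "A \<in> carrier_mat a b" "C \<in> carrier_mat b c" "B \<in> carrier_mat a' b'" "D \<in> carrier_mat b' c'"
    and "mat_commuting B C"
  shows "kron A B * kron C D = kron (A * C) (B * D)"
proof (rule eq_matI)
  fix i j assume "i < dim_row (kron (A * C) (B * D))" "j < dim_col (kron (A * C) (B * D))"
  then have ij: "i < a * a'" "j < c * c'" using assms by auto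
  note l = div_mod_less[OF ij(1)] div_mod_less[OF ij(2)]
  have "(kron A B * kron C D) $$ (i, j) = (\<Sum>k<b * b'. kron A B $$ (i, k) * kron C D $$ (k, j))"
    by (rule mat_mult_index) (use assms ij in auto)
  also have "\<dots> = (\<Sum>k<b * b'. A $$ (i div a', k div b') * B $$ (i mod a', k mod b') * (C $$ (k div b', j div c') * D $$ (k mod b', j mod c')))"
    using assms ij by (intro sum.cong refl) (simp add: kron_index)
  also have "\<dots> = (\<Sum>x<b. \<Sum>y<b'. A $$ (i div a', x) * B $$ (i mod a', y) * (C $$ (x, j div c') * D $$ (y, j mod c')))"
    by (rule sum_div_mod)
  also have "\<dots> = (\<Sum>x<b. \<Sum>y<b'. (A $$ (i div a', x) * C $$ (x, j div c')) * (B $$ (i mod a', y) * D $$ (y, j mod c')))"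
  proof (intro sum.cong refl)
    fix x y assume xy: "x \<in> {..<b}" "y \<in> {..<b'}"
    have "B $$ (i mod a', y) * C $$ (x, j div c') = C $$ (x, j div c') * B $$ (i mod a', y)"
      using assms xy l unfolding mat_commuting_def by auto
    then show "A $$ (i div a', x) * B $$ (i mod a', y) * (C $$ (x, j div c') * D $$ (y, j mod c')) =
      (A $$ (i div a', x) * C $$ (x, j div c')) * (B $$ (i mod a', y) * D $$ (y, j mod c'))"
      by (metis mult.assoc)
  qed
  also have "\<dots> = (A * C) $$ (i div a', j div c') * (B * D) $$ (i mod a', j mod c')"
    using l by (simp add: mat_mult_index[OF assms(1,2)] mat_mult_index[OF assms(3,4)] sum_product)
  also have "\<dots> = kron (A * C) (B * D) $$ (i, j)" using assms ij by (simp add: kron_index)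
  finally show "(kron A B * kron C D) $$ (i, j) = kron (A * C) (B * D) $$ (i, j)" .
qed (use assms in auto)

lemma one_kron_mult_index:
  fixes X Z :: "'a::semiring_1 mat"
  assumes "X \<in> sqm m" "Z \<in> carrier_mat (a * m) n" "r < a" "p < m" "c < n"
  shows "(kron (1\<^sub>m a) X * Z) $$ (r * m + p, c) = (\<Sum>p'<m. X $$ (p, p') * Z $$ (r * m + p', c))"
proof -
  have "(kron (1\<^sub>m a) X * Z) $$ (r * m + p, c) = (\<Sum>k<a * m. kron (1\<^sub>m a) X $$ (r * m + p, k) * Z $$ (k, c))"
    by (rule mat_mult_index) (use assms pair_less in auto)
  also have "\<dots> = (\<Sum>r'<a. \<Sum>p'<m. kron (1\<^sub>m a) X $$ (r * m + p, r' * m + p') * Z $$ (r' * m + p', c))"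
    by (rule sum_pairs)
  also have "\<dots> = (\<Sum>r'<a. \<Sum>p'<m. if r' = r then X $$ (p, p') * Z $$ (r * m + p', c) else 0)"
    using kron_index_pair[of r "1\<^sub>m a :: 'a mat" p X] assms by (intro sum.cong refl) auto
  also have "\<dots> = (\<Sum>r'<a. if r' = r then \<Sum>p'<m. X $$ (p, p') * Z $$ (r * m + p', c) else 0)"
    by (intro sum.cong refl) auto
  finally show ?thesis using assms by simp
qed

lemma mult_one_kron_index:
  fixes X Z :: "'a::semiring_1 mat"
  assumes "X \<in> sqm m" "Z \<in> carrier_mat n (a * m)" "r < a" "p < m" "c < n"
  shows "(Z * kron (1\<^sub>m a) X) $$ (c, r * m + p) = (\<Sum>p'<m. Z $$ (c, r * m + p') * X $$ (p', p))"
proof -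
  have "(Z * kron (1\<^sub>m a) X) $$ (c, r * m + p) = (\<Sum>k<a * m. Z $$ (c, k) * kron (1\<^sub>m a) X $$ (k, r * m + p))"
    by (rule mat_mult_index) (use assms pair_less in auto)
  also have "\<dots> = (\<Sum>r'<a. \<Sum>p'<m. Z $$ (c, r' * m + p') * kron (1\<^sub>m a) X $$ (r' * m + p', r * m + p))"
    by (rule sum_pairs)
  also have "\<dots> = (\<Sum>r'<a. \<Sum>p'<m. if r' = r then Z $$ (c, r * m + p') * X $$ (p', p) else 0)"
    using kron_index_pair[of _ "1\<^sub>m a :: 'a mat" _ X r p] assms by (intro sum.cong refl) auto
  also have "\<dots> = (\<Sum>r'<a. if r' = r then \<Sum>p'<m. Z $$ (c, r * m + p') * X $$ (p', p) else 0)"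
    by (intro sum.cong refl) auto
  finally show ?thesis using assms by simp
qed

lemma kron_one_mult_index:
  fixes X Z :: "'a::semiring_1 mat"
  assumes "X \<in> sqm a" "Z \<in> carrier_mat (a * m) n" "r < a" "p < m" "c < n"
  shows "(kron X (1\<^sub>m m) * Z) $$ (r * m + p, c) = (\<Sum>r'<a. X $$ (r, r') * Z $$ (r' * m + p, c))"
proof -
  have "(kron X (1\<^sub>m m) * Z) $$ (r * m + p, c) = (\<Sum>k<a * m. kron X (1\<^sub>m m) $$ (r * m + p, k) * Z $$ (k, c))"
    by (rule mat_mult_index) (use assms pair_less in auto)
  also have "\<dots> = (\<Sum>r'<a. \<Sum>p'<m. kron X (1\<^sub>m m) $$ (r * m + p, r' * m + p') * Z $$ (r' * m + p', c))"
    by (rule sum_pairs)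
  also have "\<dots> = (\<Sum>r'<a. \<Sum>p'<m. if p' = p then X $$ (r, r') * Z $$ (r' * m + p, c) else 0)"
    using kron_index_pair[of r X p "1\<^sub>m m :: 'a mat"] assms by (intro sum.cong refl) auto
  finally show ?thesis using assms by simp
qed

lemma mult_kron_one_index:
  fixes X Z :: "'a::semiring_1 mat"
  assumes "X \<in> sqm a" "Z \<in> carrier_mat n (a * m)" "r < a" "p < m" "c < n"
  shows "(Z * kron X (1\<^sub>m m)) $$ (c, r * m + p) = (\<Sum>r'<a. Z $$ (c, r' * m + p) * X $$ (r', r))"
proof -
  have "(Z * kron X (1\<^sub>m m)) $$ (c, r * m + p) = (\<Sum>k<a * m. Z $$ (c, k) * kron X (1\<^sub>m m) $$ (k, r * m + p))"
    by (rule mat_mult_index) (use assms pair_less in auto)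
  also have "\<dots> = (\<Sum>r'<a. \<Sum>p'<m. Z $$ (c, r' * m + p') * kron X (1\<^sub>m m) $$ (r' * m + p', r * m + p))"
    by (rule sum_pairs)
  also have "\<dots> = (\<Sum>r'<a. \<Sum>p'<m. if p' = p then Z $$ (c, r' * m + p) * X $$ (r', r) else 0)"
    using kron_index_pair[of _ X _ "1\<^sub>m m :: 'a mat" r p] assms by (intro sum.cong refl) auto
  finally show ?thesis using assms by simp
qed

text \<open>The trace over the last tensor factor, weighted with \<open>D\<close>.\<close>

definition ptr :: "nat \<Rightarrow> 'a::semiring_1 mat \<Rightarrow> nat \<Rightarrow> 'a mat \<Rightarrow> 'a mat" where
  "ptr N D K Z = mat K K (\<lambda>(r, c). \<Sum>s<N. \<Sum>t<N. D $$ (s, t) * entry N Z r t c s)"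

lemma ptr_carrier [simp]: "ptr N D K Z \<in> sqm K"
  by (simp add: ptr_def)

lemma dim_ptr [simp]: "dim_row (ptr N D K Z) = K" "dim_col (ptr N D K Z) = K"
  by (simp_all add: ptr_def)

lemma ptr_index: "r < K \<Longrightarrow> c < K \<Longrightarrow> ptr N D K Z $$ (r, c) = (\<Sum>s<N. \<Sum>t<N. D $$ (s, t) * entry N Z r t c s)"
  by (simp add: ptr_def)

definition central_mat :: "'a::semiring_1 mat \<Rightarrow> bool" where
  "central_mat D \<longleftrightarrow> (\<forall>i<dim_row D. \<forall>j<dim_col D. \<forall>x. D $$ (i, j) * x = x * D $$ (i, j))"

lemma central_matD: "central_mat D \<Longrightarrow> i < dim_row D \<Longrightarrow> j < dim_col D \<Longrightarrow> D $$ (i, j) * x = x * D $$ (i, j)"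
  by (simp add: central_mat_def)

lemma central_mat_comm [simp]: "central_mat (D :: 'a::comm_semiring_1 mat)"
  by (simp add: central_mat_def mult.commute)

lemma central_mat_commuting: "central_mat D \<Longrightarrow> mat_commuting D C" "central_mat D \<Longrightarrow> mat_commuting C D"
  by (simp_all add: central_mat_def mat_commuting_def)

text \<open>The weighted trace is a bimodule map for operators on the untraced factors. On the left
  the entries of D have to be moved past those of A, hence the centrality; on the right, in
  \<open>ptr_mult_right\<close>, nothing is moved.\<close>

lemma ptr_mult_left:
  assumes "D \<in> sqm N" "central_mat D" "A \<in> sqm K" "Z \<in> sqm (K * N)"
  shows "ptr N D K (kron A (1\<^sub>m N) * Z) = A * ptr N D K Z"
proof (rule eq_matI)
  fix r c assume "r < dim_row (A * ptr N D K Z)" "c < dim_col (A * ptr N D K Z)"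
  then have rc: "r < K" "c < K" using assms by (auto simp: ptr_def)
  have "ptr N D K (kron A (1\<^sub>m N) * Z) $$ (r, c)
      = (\<Sum>s<N. \<Sum>t<N. D $$ (s, t) * (\<Sum>k<K. A $$ (r, k) * entry N Z k t c s))"
    unfolding ptr_index[OF rc] using assms rc
    by (intro sum.cong refl) (simp add: kron_one_mult_index[of A K Z N "K * N"] pair_less del: index_mult_mat(1))
  also have "\<dots> = (\<Sum>s<N. \<Sum>t<N. \<Sum>k<K. A $$ (r, k) * (D $$ (s, t) * entry N Z k t c s))"
    unfolding sum_distrib_left
  proof (intro sum.cong refl)
    fix s t k assume "s \<in> {..<N}" "t \<in> {..<N}"
    then show "D $$ (s, t) * (A $$ (r, k) * entry N Z k t c s) = A $$ (r, k) * (D $$ (s, t) * entry N Z k t c s)"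
      using central_matD[OF assms(2), of s t "A $$ (r, k)"] assms(1) by (simp flip: mult.assoc)
  qed
  also have "\<dots> = (\<Sum>s<N. \<Sum>k<K. \<Sum>t<N. A $$ (r, k) * (D $$ (s, t) * entry N Z k t c s))"
    by (intro sum.cong refl sum.swap)
  also have "\<dots> = (\<Sum>k<K. \<Sum>s<N. \<Sum>t<N. A $$ (r, k) * (D $$ (s, t) * entry N Z k t c s))"
    by (rule sum.swap)
  also have "\<dots> = (A * ptr N D K Z) $$ (r, c)"
    using rc by (simp add: mat_mult_index[OF assms(3) ptr_carrier] ptr_index sum_distrib_left del: index_mult_mat(1))
  finally show "ptr N D K (kron A (1\<^sub>m N) * Z) $$ (r, c) = (A * ptr N D K Z) $$ (r, c)" .
qed (use assms in \<open>auto simp: ptr_def\<close>)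

lemma ptr_mult_right:
  assumes "A \<in> sqm K" "Z \<in> sqm (K * N)"
  shows "ptr N D K (Z * kron A (1\<^sub>m N)) = ptr N D K Z * A"
proof (rule eq_matI)
  fix r c assume "r < dim_row (ptr N D K Z * A)" "c < dim_col (ptr N D K Z * A)"
  then have rc: "r < K" "c < K" using assms by (auto simp: ptr_def)
  have "ptr N D K (Z * kron A (1\<^sub>m N)) $$ (r, c)
      = (\<Sum>s<N. \<Sum>t<N. D $$ (s, t) * (\<Sum>k<K. entry N Z r t k s * A $$ (k, c)))"
    unfolding ptr_index[OF rc] using assms rc
    by (intro sum.cong refl) (simp add: mult_kron_one_index[of A K Z "K * N" N] pair_less del: index_mult_mat(1))
  also have "\<dots> = (\<Sum>s<N. \<Sum>t<N. \<Sum>k<K. D $$ (s, t) * entry N Z r t k s * A $$ (k, c))"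
    unfolding sum_distrib_left by (simp add: mult.assoc)
  also have "\<dots> = (\<Sum>s<N. \<Sum>k<K. \<Sum>t<N. D $$ (s, t) * entry N Z r t k s * A $$ (k, c))"
    by (intro sum.cong refl sum.swap)
  also have "\<dots> = (\<Sum>k<K. \<Sum>s<N. \<Sum>t<N. D $$ (s, t) * entry N Z r t k s * A $$ (k, c))"
    by (rule sum.swap)
  also have "\<dots> = (ptr N D K Z * A) $$ (r, c)"
    using rc by (simp add: mat_mult_index[OF ptr_carrier assms(1)] ptr_index sum_distrib_right del: index_mult_mat(1))
  finally show "ptr N D K (Z * kron A (1\<^sub>m N)) $$ (r, c) = (ptr N D K Z * A) $$ (r, c)" .
qed (use assms in \<open>auto simp: ptr_def\<close>)

text \<open>A full trace can be taken in stages, the last tensor factor first.\<close>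

lemma mat_trace_ptr:
  assumes "D \<in> sqm N" "P \<in> sqm K" "Z \<in> sqm (K * N)"
  shows "mat_trace (kron P D * Z) = mat_trace (P * ptr N D K Z)"
proof -
  have "mat_trace (kron P D * Z) = (\<Sum>i<K * N. \<Sum>j<K * N. kron P D $$ (i, j) * Z $$ (j, i))"
    using assms by (simp add: mat_trace_def mat_mult_index[of "kron P D" "K * N" "K * N" Z "K * N"] del: index_mult_mat(1))
  also have "\<dots> = (\<Sum>r<K. \<Sum>s<N. \<Sum>c<K. \<Sum>t<N. kron P D $$ (r * N + s, c * N + t) * entry N Z c t r s)"
    by (simp add: sum_pairs)
  also have "\<dots> = (\<Sum>r<K. \<Sum>s<N. \<Sum>c<K. \<Sum>t<N. P $$ (r, c) * (D $$ (s, t) * entry N Z c t r s))"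
    using kron_index_pair[of _ P _ D] assms by (intro sum.cong refl) (auto simp: mult.assoc)
  also have "\<dots> = (\<Sum>r<K. \<Sum>c<K. \<Sum>s<N. \<Sum>t<N. P $$ (r, c) * (D $$ (s, t) * entry N Z c t r s))"
    by (intro sum.cong refl sum.swap)
  also have "\<dots> = mat_trace (P * ptr N D K Z)"
    using assms by (simp add: mat_trace_def mat_mult_index[OF assms(2) ptr_carrier] ptr_index sum_distrib_left del: index_mult_mat(1))
  finally show ?thesis .
qed

lemma ptr_one_kron:
  assumes "X \<in> sqm (a * N)" "D \<in> sqm N" "b > 0"
  shows "ptr N D (b * a) (kron (1\<^sub>m b) X) = kron (1\<^sub>m b) (ptr N D a X)"
proof (rule eq_matI)
  fix i j assume "i < dim_row (kron (1\<^sub>m b) (ptr N D a X))" "j < dim_col (kron (1\<^sub>m b) (ptr N D a X))"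
  then have ij: "i < b * a" "j < b * a" by (auto simp: ptr_def)
  note l = div_mod_less[OF ij(1)] div_mod_less[OF ij(2)]
  have 1: "kron (1\<^sub>m b) X $$ (i * N + t, j * N + s) = (if i div a = j div a then X $$ ((i mod a) * N + t, (j mod a) * N + s) else 0)"
    if "s < N" "t < N" for s t
  proof -
    have "i * N + t = (i div a) * (a * N) + ((i mod a) * N + t)" "j * N + s = (j div a) * (a * N) + ((j mod a) * N + s)"
      by (metis add.assoc add_mult_distrib div_mult_mod_eq mult.assoc)+
    then show ?thesis
      using kron_index_pair[of "i div a" "1\<^sub>m b :: 'a mat" "(i mod a) * N + t" X "j div a" "(j mod a) * N + s"] assms l that
      by (simp add: pair_less add.assoc)
  qed
  have "ptr N D (b * a) (kron (1\<^sub>m b) X) $$ (i, j) = (if i div a = j div a then \<Sum>s<N. \<Sum>t<N. D $$ (s, t) * X $$ ((i mod a) * N + t, (j mod a) * N + s) else 0)"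
  proof -
    have "(\<Sum>s<N. \<Sum>t<N. D $$ (s, t) * kron (1\<^sub>m b) X $$ (i * N + t, j * N + s)) =
       (\<Sum>s<N. \<Sum>t<N. D $$ (s, t) * (if i div a = j div a then X $$ ((i mod a) * N + t, (j mod a) * N + s) else 0))"
      by (intro sum.cong refl) (simp add: 1)
    then show ?thesis unfolding ptr_index[OF ij] by simp
  qed
  also have "\<dots> = kron (1\<^sub>m b) (ptr N D a X) $$ (i, j)"
    using ij l by (simp add: kron_index ptr_def)
  finally show "ptr N D (b * a) (kron (1\<^sub>m b) X) $$ (i, j) = kron (1\<^sub>m b) (ptr N D a X) $$ (i, j)" .
qed (auto simp: ptr_def)

section \<open>Skew inverses, the operator D, and conjugation under the R-trace\<close>

section \<open>Skew invertible R-matrices\<close>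

lemma amp_3_2: "amp N 3 2 1 X = kron X (1\<^sub>m N)" "amp N 3 2 2 X = kron (1\<^sub>m N) X"
  by (simp_all add: amp_def)

lemma sum_delta2: fixes f :: "nat \<Rightarrow> nat \<Rightarrow> 'a::comm_monoid_add"
  assumes "x < n" "y < m"
  shows "(\<Sum>a<n. \<Sum>b<m. if a = x \<and> b = y then f a b else 0) = f x y"
proof -
  have "(\<Sum>a<n. \<Sum>b<m. if a = x \<and> b = y then f a b else 0) = (\<Sum>a<n. if a = x then f x y else 0)"
    using assms by (intro sum.cong refl) auto
  then show ?thesis using assms by simp
qed

lemma sum_swap22:
  "(\<Sum>a\<in>A. \<Sum>d\<in>B. \<Sum>x\<in>C. \<Sum>y\<in>E. f a d x y) = (\<Sum>x\<in>C. \<Sum>y\<in>E. \<Sum>a\<in>A. \<Sum>d\<in>B. f a d x y)"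
proof -
  have "(\<Sum>a\<in>A. \<Sum>d\<in>B. \<Sum>x\<in>C. \<Sum>y\<in>E. f a d x y) = (\<Sum>a\<in>A. \<Sum>x\<in>C. \<Sum>d\<in>B. \<Sum>y\<in>E. f a d x y)"
    by (intro sum.cong refl sum.swap)
  also have "\<dots> = (\<Sum>x\<in>C. \<Sum>a\<in>A. \<Sum>d\<in>B. \<Sum>y\<in>E. f a d x y)"
    by (rule sum.swap)
  also have "\<dots> = (\<Sum>x\<in>C. \<Sum>a\<in>A. \<Sum>y\<in>E. \<Sum>d\<in>B. f a d x y)"
    by (intro sum.cong refl sum.swap)
  also have "\<dots> = (\<Sum>x\<in>C. \<Sum>y\<in>E. \<Sum>a\<in>A. \<Sum>d\<in>B. f a d x y)"
    by (intro sum.cong refl sum.swap)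
  finally show ?thesis .
qed

context
  fixes N :: nat and R \<Psi> :: "complex mat"
  assumes R: "R \<in> sqm (N * N)" and skew: "skew_inverse N R \<Psi>"
begin

lemma Psi_carrier: "\<Psi> \<in> sqm (N * N)"
  using skew by (simp add: skew_inverse_def power2_eq_square)

text \<open>The entry form of the defining partial trace identity, after the identity factors of the
  two amplifications have been summed away.\<close>

lemma skew_right:
  assumes "a < N" "d < N" "c < N" "f < N"
  shows "(\<Sum>s<N. \<Sum>g<N. entry N R a s d g * entry N \<Psi> g c s f) = of_bool (a = f \<and> c = d)"
proof -
  let ?X = "kron R (1\<^sub>m N) * kron (1\<^sub>m N) \<Psi>"
  have kc: "kron (1\<^sub>m N) \<Psi> \<in> sqm (N * N * N)"
    using kron_carrier[OF one_carrier_mat Psi_carrier, of N] by (simp add: mult.assoc)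
  have pl: "a * N + c < N * N" "d * N + f < N * N" using assms pair_less by auto
  have e: "(r * N + c') div N = r" "(r * N + c') mod N = c'" if "c' < N" for r c' using that by auto
  have "of_bool (a = f \<and> c = d) = perm_mat N $$ (a * N + c, d * N + f)"
    using assms pl by (simp add: perm_mat_def power2_eq_square e)
  also have "\<dots> = (\<Sum>s<N. ?X $$ (a * (N * N) + s * N + c, d * (N * N) + s * N + f))"
    using skew pl assms unfolding skew_inverse_def amp_3_2 tr_factor_def
    by (auto simp: power2_eq_square e Let_def dest: arg_cong[of _ _ "\<lambda>M. entry N M a c d f"])
  also have "\<dots> = (\<Sum>s<N. \<Sum>g<N. entry N R a s d g * entry N \<Psi> g c s f)"
  proof (rule sum.cong[OF refl])
    fix s assume "s \<in> {..<N}"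
    then have s: "s < N" by simp
    have i1: "a * (N * N) + s * N + c = (a * N + s) * N + c" by (simp add: algebra_simps)
    have i2: "d * (N * N) + s * N + f = d * (N * N) + (s * N + f)" by simp
    have "?X $$ (a * (N * N) + s * N + c, d * (N * N) + s * N + f)
       = (\<Sum>r<N * N. R $$ (a * N + s, r) * kron (1\<^sub>m N) \<Psi> $$ (r * N + c, d * (N * N) + (s * N + f)))"
      unfolding i1 i2 using pair_less[of d N "s * N + f" "N * N"] pair_less s assms
      by (intro kron_one_mult_index[OF R kc]) (auto simp: mult.assoc)
    also have "\<dots> = (\<Sum>x<N. \<Sum>g<N. entry N R a s x g * kron (1\<^sub>m N) \<Psi> $$ ((x * N + g) * N + c, d * (N * N) + (s * N + f)))"
      by (rule sum_pairs)
    also have "\<dots> = (\<Sum>x<N. \<Sum>g<N. if x = d then R $$ (a * N + s, d * N + g) * entry N \<Psi> g c s f else 0)"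
    proof (intro sum.cong refl)
      fix x g assume "x \<in> {..<N}" "g \<in> {..<N}"
      then have xg: "x < N" "g < N" by auto
      have i3: "(x * N + g) * N + c = x * (N * N) + (g * N + c)" by (simp add: algebra_simps)
      have "kron (1\<^sub>m N) \<Psi> $$ ((x * N + g) * N + c, d * (N * N) + (s * N + f)) = of_bool (x = d) * entry N \<Psi> g c s f"
        unfolding i3 using kron_index_pair[of x "1\<^sub>m N :: complex mat" "g * N + c" \<Psi> d "s * N + f"] Psi_carrier xg assms s pair_less
        by simp
      then show "entry N R a s x g * kron (1\<^sub>m N) \<Psi> $$ ((x * N + g) * N + c, d * (N * N) + (s * N + f))
        = (if x = d then R $$ (a * N + s, d * N + g) * entry N \<Psi> g c s f else 0)" by simp
    qed
    also have "\<dots> = (\<Sum>x<N. if x = d then (\<Sum>g<N. entry N R a s d g * entry N \<Psi> g c s f) else 0)"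
      by (intro sum.cong refl) auto
    also have "\<dots> = (\<Sum>g<N. entry N R a s d g * entry N \<Psi> g c s f)" using assms by simp
    finally show "?X $$ (a * (N * N) + s * N + c, d * (N * N) + s * N + f)
       = (\<Sum>g<N. entry N R a s d g * entry N \<Psi> g c s f)" .
  qed
  finally show ?thesis by simp
qed

text \<open>With regrouped indices the skew inverse is an ordinary one-sided inverse of a square
  matrix, hence two-sided.\<close>

lemma skew_left:
  assumes "s < N" "g < N" "s' < N" "g' < N"
  shows "(\<Sum>a<N. \<Sum>d<N. entry N \<Psi> g d s a * entry N R a s' d g') = of_bool (s = s' \<and> g = g')"
proof -
  \<comment> \<open>The row index of A collects the two indices of R that belong to the first tensor
    factor, the column index those of the second; B regroups the skew inverse accordingly.\<close>
  define A where "A = mat (N * N) (N * N) (\<lambda>(i, j). R $$ ((i div N) * N + j div N, (i mod N) * N + j mod N))"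
  define B where "B = mat (N * N) (N * N) (\<lambda>(i, j). \<Psi> $$ ((i mod N) * N + j mod N, (i div N) * N + j div N))"
  have AB: "A * B = 1\<^sub>m (N * N)"
  proof (rule eq_matI)
    fix i j assume "i < dim_row (1\<^sub>m (N * N) :: complex mat)" "j < dim_col (1\<^sub>m (N * N) :: complex mat)"
    then have ij: "i < N * N" "j < N * N" by auto
    note l = div_mod_less[OF ij(1)] div_mod_less[OF ij(2)]
    have "(A * B) $$ (i, j) = (\<Sum>k<N * N. A $$ (i, k) * B $$ (k, j))"
      by (rule mat_mult_index) (use ij in \<open>auto simp: A_def B_def\<close>)
    also have "\<dots> = (\<Sum>k<N * N. R $$ ((i div N) * N + k div N, (i mod N) * N + k mod N) *
        \<Psi> $$ ((k mod N) * N + j mod N, (k div N) * N + j div N))"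
      using ij by (intro sum.cong refl) (simp add: A_def B_def)
    also have "\<dots> = (\<Sum>s<N. \<Sum>g<N. R $$ ((i div N) * N + s, (i mod N) * N + g) * \<Psi> $$ (g * N + j mod N, s * N + j div N))"
      by (rule sum_div_mod)
    also have "\<dots> = of_bool (i div N = j div N \<and> j mod N = i mod N)" by (rule skew_right) (use l in auto)
    also have "\<dots> = 1\<^sub>m (N * N) $$ (i, j)" using ij by (auto, metis div_mult_mod_eq)
    finally show "(A * B) $$ (i, j) = 1\<^sub>m (N * N) $$ (i, j)" .
  qed (simp_all add: A_def B_def)
  have BA: "B * A = 1\<^sub>m (N * N)"
    by (rule mat_mult_left_right_inverse[OF _ _ AB]) (simp_all add: A_def B_def)
  have pl: "s * N + g < N * N" "s' * N + g' < N * N" using assms pair_less by auto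
  have e: "(s * N + g) div N = s" "(s * N + g) mod N = g" "(s' * N + g') div N = s'" "(s' * N + g') mod N = g'"
    using assms by auto
  have "(B * A) $$ (s * N + g, s' * N + g') = (\<Sum>k<N * N. B $$ (s * N + g, k) * A $$ (k, s' * N + g'))"
    by (rule mat_mult_index) (use pl in \<open>auto simp: A_def B_def\<close>)
  also have "\<dots> = (\<Sum>k<N * N. \<Psi> $$ (g * N + k mod N, s * N + k div N) * R $$ ((k div N) * N + s', (k mod N) * N + g'))"
    using pl e by (intro sum.cong refl) (simp add: A_def B_def)
  also have "\<dots> = (\<Sum>a<N. \<Sum>d<N. entry N \<Psi> g d s a * entry N R a s' d g')"
    by (rule sum_div_mod)
  finally show ?thesis using BA pl assms e by (auto simp: of_bool_def) (metis e)+
qed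

text \<open>Contraction with the regrouped R is injective. Identities between kernels are therefore
  proved by contracting both sides with R.\<close>

lemma skew_cancel:
  fixes V W :: "nat \<Rightarrow> nat \<Rightarrow> complex"
  assumes "\<And>i j. i < N \<Longrightarrow> j < N \<Longrightarrow> (\<Sum>x<N. \<Sum>y<N. entry N R i x j y * V x y) = (\<Sum>x<N. \<Sum>y<N. entry N R i x j y * W x y)"
    and "s < N" "g < N"
  shows "V s g = W s g"
proof -
  have *: "(\<Sum>a<N. \<Sum>d<N. entry N \<Psi> g d s a * (\<Sum>x<N. \<Sum>y<N. entry N R a x d y * V x y)) = V s g" for V
  proof -
    have "(\<Sum>a<N. \<Sum>d<N. entry N \<Psi> g d s a * (\<Sum>x<N. \<Sum>y<N. entry N R a x d y * V x y))
      = (\<Sum>a<N. \<Sum>d<N. \<Sum>x<N. \<Sum>y<N. entry N \<Psi> g d s a * entry N R a x d y * V x y)"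
      by (simp add: sum_distrib_left mult.assoc)
    also have "\<dots> = (\<Sum>x<N. \<Sum>y<N. \<Sum>a<N. \<Sum>d<N. entry N \<Psi> g d s a * entry N R a x d y * V x y)"
      by (rule sum_swap22)
    also have "\<dots> = (\<Sum>x<N. \<Sum>y<N. (\<Sum>a<N. \<Sum>d<N. entry N \<Psi> g d s a * entry N R a x d y) * V x y)"
      by (simp add: sum_distrib_right)
    also have "\<dots> = (\<Sum>x<N. \<Sum>y<N. if x = s \<and> y = g then V x y else 0)"
      using assms(2,3) by (intro sum.cong refl) (auto simp: skew_left)
    finally show ?thesis using sum_delta2[OF assms(2,3), of V] by simp
  qed
  have "V s g = (\<Sum>a<N. \<Sum>d<N. entry N \<Psi> g d s a * (\<Sum>x<N. \<Sum>y<N. entry N R a x d y * V x y))"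
    by (rule *[symmetric])
  also have "\<dots> = (\<Sum>a<N. \<Sum>d<N. entry N \<Psi> g d s a * (\<Sum>x<N. \<Sum>y<N. entry N R a x d y * W x y))"
    using assms(1) by (intro sum.cong refl) simp
  also have "\<dots> = W s g" by (rule *)
  finally show ?thesis .
qed

end

lemma skew_inverse_unique:
  assumes R: "R \<in> sqm (N * N)" and \<Psi>: "skew_inverse N R \<Psi>" "skew_inverse N R \<Psi>'"
  shows "\<Psi>' = \<Psi>"
proof (rule eq_matI)
  note c = Psi_carrier[OF R \<Psi>(1)] Psi_carrier[OF R \<Psi>(2)]
  fix i j assume "i < dim_row \<Psi>" "j < dim_col \<Psi>"
  then have ij: "i < N * N" "j < N * N" using c by auto
  note l = div_mod_less[OF ij(1)] div_mod_less[OF ij(2)]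
  have "\<Psi>' $$ (i div N * N + i mod N, j div N * N + j mod N) = \<Psi> $$ (i div N * N + i mod N, j div N * N + j mod N)"
    by (rule skew_cancel[OF R \<Psi>(1), of "\<lambda>x y. \<Psi>' $$ (y * N + i mod N, x * N + j mod N)" "\<lambda>x y. \<Psi> $$ (y * N + i mod N, x * N + j mod N)" "j div N" "i div N"])
       (use l in \<open>simp_all add: skew_right[OF R \<Psi>(1)] skew_right[OF R \<Psi>(2)]\<close>)
  then show "\<Psi>' $$ (i, j) = \<Psi> $$ (i, j)" by simp
qed (use Psi_carrier[OF R \<Psi>(1)] Psi_carrier[OF R \<Psi>(2)] in auto)

lemma D_op_carrier [simp]: "D_op N R \<in> sqm N"
  by (simp add: D_op_def tr_factor_def Let_def)

lemma dim_D_op [simp]: "dim_row (D_op N R) = N" "dim_col (D_op N R) = N"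
  by (simp_all add: D_op_def tr_factor_def Let_def)

lemma D_op_index:
  assumes "R \<in> sqm (N * N)" "skew_inverse N R \<Psi>" "a < N" "b < N"
  shows "D_op N R $$ (a, b) = (\<Sum>s<N. entry N \<Psi> a s b s)"
proof -
  have "(THE \<Psi>. skew_inverse N R \<Psi>) = \<Psi>"
    using assms(2) skew_inverse_unique[OF assms(1)] by (intro the_equality) auto
  then show ?thesis using assms by (simp add: D_op_def tr_factor_def Let_def)
qed

text \<open>D is a partial trace of the skew inverse, so in each summand contraction with R leaves a
  delta. In the notation of R-traces, the trace over the second factor sends R to the
  identity.\<close>

lemma ptr_R:
  assumes R: "R \<in> sqm (N * N)" and \<Psi>: "skew_inverse N R \<Psi>"
  shows "ptr N (D_op N R) N R = 1\<^sub>m N"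
proof (rule eq_matI)
  fix a d assume "a < dim_row (1\<^sub>m N :: complex mat)" "d < dim_col (1\<^sub>m N :: complex mat)"
  then have ad: "a < N" "d < N" by auto
  have "ptr N (D_op N R) N R $$ (a, d) = (\<Sum>g<N. \<Sum>s<N. (\<Sum>c<N. entry N \<Psi> g c s c) * entry N R a s d g)"
    unfolding ptr_index[OF ad] by (intro sum.cong refl) (simp add: D_op_index[OF R \<Psi>])
  also have "\<dots> = (\<Sum>g<N. \<Sum>s<N. \<Sum>c<N. entry N R a s d g * entry N \<Psi> g c s c)"
    by (simp add: sum_distrib_left mult.commute)
  also have "\<dots> = (\<Sum>g<N. \<Sum>c<N. \<Sum>s<N. entry N R a s d g * entry N \<Psi> g c s c)"
    by (intro sum.cong refl sum.swap)
  also have "\<dots> = (\<Sum>c<N. \<Sum>g<N. \<Sum>s<N. entry N R a s d g * entry N \<Psi> g c s c)"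
    by (rule sum.swap)
  also have "\<dots> = (\<Sum>c<N. \<Sum>s<N. \<Sum>g<N. entry N R a s d g * entry N \<Psi> g c s c)"
    by (intro sum.cong refl sum.swap)
  also have "\<dots> = (\<Sum>c<N. if c = a then of_bool (a = d) else 0)"
    using ad by (intro sum.cong refl) (auto simp: skew_right[OF R \<Psi>])
  finally show "ptr N (D_op N R) N R $$ (a, d) = 1\<^sub>m N $$ (a, d)" using ad by simp
qed simp_all

text \<open>The middle operator is the identity on the last factor, which eliminates one of the four
  inner indices.\<close>

lemma conj_index:
  fixes Z F F' :: "'a::semiring_1 mat"
  assumes F: "F \<in> sqm (N * N)" and F': "F' \<in> sqm (N * N)"
    and Z: "Z \<in> sqm (K * N)"
    and "r < K" "r' < K" "a < N" "c < N" "t < N" "s < N"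
  shows "(kron (1\<^sub>m K) F * kron Z (1\<^sub>m N) * kron (1\<^sub>m K) F') $$ ((r * N + a) * N + t, (r' * N + c) * N + s)
    = (\<Sum>x<N. \<Sum>u<N. \<Sum>y<N. entry N F a t x u * entry N Z r x r' y * entry N F' y u c s)"
proof -
  have cZ: "kron Z (1\<^sub>m N) \<in> sqm (K * (N * N))"
    using kron_carrier[OF Z one_carrier_mat, of N] by (simp add: mult.assoc)
  have cF: "kron (1\<^sub>m K) F \<in> sqm (K * (N * N))" "kron (1\<^sub>m K) F' \<in> sqm (K * (N * N))"
    using kron_carrier[OF one_carrier_mat F] kron_carrier[OF one_carrier_mat F'] by auto
  have i: "(r * N + a) * N + t = r * (N * N) + (a * N + t)" "(r' * N + c) * N + s = r' * (N * N) + (c * N + s)"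
    by (simp_all add: algebra_simps)
  have pl: "a * N + t < N * N" "c * N + s < N * N" using assms pair_less by auto
  have cFZ: "kron (1\<^sub>m K) F * kron Z (1\<^sub>m N) \<in> sqm (K * (N * N))" using cF cZ by simp
  have rr: "r * (N * N) + (a * N + t) < K * (N * N)" using assms pl pair_less by blast
  have "(kron (1\<^sub>m K) F * kron Z (1\<^sub>m N) * kron (1\<^sub>m K) F') $$ (r * (N * N) + (a * N + t), r' * (N * N) + (c * N + s))
     = (\<Sum>p'<N * N. (kron (1\<^sub>m K) F * kron Z (1\<^sub>m N)) $$ (r * (N * N) + (a * N + t), r' * (N * N) + p') * F' $$ (p', c * N + s))"
    by (rule mult_one_kron_index[OF F' cFZ]) (use assms pl rr in auto)
  also have "\<dots> = (\<Sum>p'<N * N. (\<Sum>p<N * N. F $$ (a * N + t, p) * kron Z (1\<^sub>m N) $$ (r * (N * N) + p, r' * (N * N) + p')) * F' $$ (p', c * N + s))"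
    using assms pl pair_less[of r' K _ "N * N"]
    by (intro sum.cong refl arg_cong2[where f = "(*)"] one_kron_mult_index[OF F cZ]) auto
  also have "\<dots> = (\<Sum>y<N. \<Sum>w<N. (\<Sum>x<N. \<Sum>u<N. entry N F a t x u * kron Z (1\<^sub>m N) $$ (r * (N * N) + (x * N + u), r' * (N * N) + (y * N + w))) * entry N F' y w c s)"
    by (simp add: sum_pairs)
  also have "\<dots> = (\<Sum>y<N. \<Sum>w<N. (\<Sum>x<N. \<Sum>u<N. if u = w then F $$ (a * N + t, x * N + u) * entry N Z r x r' y else 0) * entry N F' y w c s)"
  proof (intro sum.cong refl arg_cong2[where f = "(*)"])
    fix y w x u assume "y \<in> {..<N}" "w \<in> {..<N}" "x \<in> {..<N}" "u \<in> {..<N}"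
    then have l: "y < N" "w < N" "x < N" "u < N" by auto
    have j: "r * (N * N) + (x * N + u) = (r * N + x) * N + u" "r' * (N * N) + (y * N + w) = (r' * N + y) * N + w"
      by (simp_all add: algebra_simps)
    have "kron Z (1\<^sub>m N) $$ (r * (N * N) + (x * N + u), r' * (N * N) + (y * N + w)) = entry N Z r x r' y * of_bool (u = w)"
      unfolding j using kron_index_pair[of "r * N + x" Z u "1\<^sub>m N :: 'a mat" "r' * N + y" w] Z l assms pair_less by simp
    then show "entry N F a t x u * kron Z (1\<^sub>m N) $$ (r * (N * N) + (x * N + u), r' * (N * N) + (y * N + w))
       = (if u = w then F $$ (a * N + t, x * N + u) * entry N Z r x r' y else 0)" by simp
  qed
  also have "\<dots> = (\<Sum>y<N. \<Sum>w<N. \<Sum>x<N. entry N F a t x w * entry N Z r x r' y * entry N F' y w c s)"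
    by (intro sum.cong refl) (simp add: sum_distrib_right)
  also have "\<dots> = (\<Sum>y<N. \<Sum>x<N. \<Sum>w<N. entry N F a t x w * entry N Z r x r' y * entry N F' y w c s)"
    by (intro sum.cong refl sum.swap)
  also have "\<dots> = (\<Sum>x<N. \<Sum>y<N. \<Sum>w<N. entry N F a t x w * entry N Z r x r' y * entry N F' y w c s)"
    by (rule sum.swap)
  also have "\<dots> = (\<Sum>x<N. \<Sum>u<N. \<Sum>y<N. entry N F a t x u * entry N Z r x r' y * entry N F' y u c s)"
    by (intro sum.cong refl sum.swap)
  finally show ?thesis unfolding i .
qed

text \<open>The kernel of conjugation by \<open>F\<close> under \<open>ptr\<close>. When \<open>F\<close> is compatible with \<open>R\<close> and \<open>D\<close> comes from
  \<open>R\<close>, it is that of the unconjugated trace.\<close>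

definition braid_kernel :: "nat \<Rightarrow> 'a::semiring_1 mat \<Rightarrow> 'a mat \<Rightarrow> 'a mat \<Rightarrow> nat \<Rightarrow> nat \<Rightarrow> nat \<Rightarrow> nat \<Rightarrow> 'a" where
  "braid_kernel N D F F' a c x y = (\<Sum>s<N. \<Sum>t<N. \<Sum>u<N. D $$ (s, t) * entry N F a t x u * entry N F' y u c s)"

lemma ptr_conj_index:
  fixes Z F F' D :: "'a::semiring_1 mat"
  assumes F: "F \<in> sqm (N * N)" and F': "F' \<in> sqm (N * N)" "central_mat F'"
    and Z: "Z \<in> sqm (K * N)"
    and l: "r < K" "r' < K" "a < N" "c < N"
  shows "ptr N D (K * N) (kron (1\<^sub>m K) F * kron Z (1\<^sub>m N) * kron (1\<^sub>m K) F') $$ (r * N + a, r' * N + c)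
    = (\<Sum>x<N. \<Sum>y<N. braid_kernel N D F F' a c x y * entry N Z r x r' y)"
proof -
  have "ptr N D (K * N) (kron (1\<^sub>m K) F * kron Z (1\<^sub>m N) * kron (1\<^sub>m K) F') $$ (r * N + a, r' * N + c)
    = (\<Sum>s<N. \<Sum>t<N. D $$ (s, t) * (\<Sum>x<N. \<Sum>u<N. \<Sum>y<N. entry N F a t x u * entry N Z r x r' y * entry N F' y u c s))"
    using l pair_less by (subst ptr_index) (auto simp: conj_index[OF F F'(1) Z] intro!: sum.cong simp del: index_mult_mat(1))
  also have "\<dots> = (\<Sum>s<N. \<Sum>t<N. \<Sum>x<N. \<Sum>u<N. \<Sum>y<N. D $$ (s, t) * entry N F a t x u * entry N F' y u c s * entry N Z r x r' y)"
    unfolding sum_distrib_left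
  proof (intro sum.cong refl)
    fix s t x u y assume "s \<in> {..<N}" "u \<in> {..<N}" "y \<in> {..<N}"
    then have "y * N + u < N * N" "c * N + s < N * N" using l pair_less by auto
    then have "entry N F' y u c s * entry N Z r x r' y = entry N Z r x r' y * entry N F' y u c s"
      using central_matD[OF F'(2)] F'(1) by auto
    then show "D $$ (s, t) * (entry N F a t x u * entry N Z r x r' y * entry N F' y u c s)
      = D $$ (s, t) * entry N F a t x u * entry N F' y u c s * entry N Z r x r' y"
      by (simp add: mult.assoc)
  qed
  also have "\<dots> = (\<Sum>s<N. \<Sum>t<N. \<Sum>x<N. \<Sum>y<N. \<Sum>u<N. D $$ (s, t) * entry N F a t x u * entry N F' y u c s * entry N Z r x r' y)"
    by (intro sum.cong refl sum.swap)
  also have "\<dots> = (\<Sum>x<N. \<Sum>y<N. \<Sum>s<N. \<Sum>t<N. \<Sum>u<N. D $$ (s, t) * entry N F a t x u * entry N F' y u c s * entry N Z r x r' y)"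
    by (rule sum_swap22)
  finally show ?thesis by (simp add: braid_kernel_def sum_distrib_right)
qed

lemma ptr_conj:
  fixes Z F F' D :: "'a::semiring_1 mat"
  assumes F: "F \<in> sqm (N * N)" and F': "F' \<in> sqm (N * N)" "central_mat F'"
    and Z: "Z \<in> sqm (K * N)"
    and k: "\<And>a c x y. a < N \<Longrightarrow> c < N \<Longrightarrow> x < N \<Longrightarrow> y < N \<Longrightarrow> braid_kernel N D F F' a c x y = (if a = c then D $$ (y, x) else 0)"
  shows "ptr N D (K * N) (kron (1\<^sub>m K) F * kron Z (1\<^sub>m N) * kron (1\<^sub>m K) F') = kron (ptr N D K Z) (1\<^sub>m N)"
proof (rule eq_matI)
  fix i j assume "i < dim_row (kron (ptr N D K Z) (1\<^sub>m N))" "j < dim_col (kron (ptr N D K Z) (1\<^sub>m N))"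
  then have ij: "i < K * N" "j < K * N" by auto
  define r a r' c where "r = i div N" and "a = i mod N" and "r' = j div N" and "c = j mod N"
  have l: "r < K" "r' < K" "a < N" "c < N" using div_mod_less[OF ij(1)] div_mod_less[OF ij(2)] by (auto simp: r_def a_def r'_def c_def)
  have i: "i = r * N + a" and j: "j = r' * N + c" by (simp_all add: r_def a_def r'_def c_def)
  have "ptr N D (K * N) (kron (1\<^sub>m K) F * kron Z (1\<^sub>m N) * kron (1\<^sub>m K) F') $$ (i, j)
    = (\<Sum>x<N. \<Sum>y<N. (if a = c then D $$ (y, x) else 0) * entry N Z r x r' y)"
    unfolding i j ptr_conj_index[OF F F' Z l] using l k by (intro sum.cong refl) auto
  also have "\<dots> = (if a = c then \<Sum>x<N. \<Sum>y<N. D $$ (y, x) * entry N Z r x r' y else 0)" by simp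
  also have "\<dots> = (if a = c then ptr N D K Z $$ (r, r') else 0)"
    using l by (subst sum.swap) (simp add: ptr_index)
  also have "\<dots> = kron (ptr N D K Z) (1\<^sub>m N) $$ (i, j)"
    using kron_index_pair[of r "ptr N D K Z" a "1\<^sub>m N :: 'a mat" r' c] l by (simp add: i j)
  finally show "ptr N D (K * N) (kron (1\<^sub>m K) F * kron Z (1\<^sub>m N) * kron (1\<^sub>m K) F') $$ (i, j) = kron (ptr N D K Z) (1\<^sub>m N) $$ (i, j)" .
qed simp_all

text \<open>Compatibility turns F_2 R_1 F_2^(-1) into F_1^(-1) R_2 F_1. The R-trace over the last
  factor sends R_2 to the identity, and F cancels. So the kernel and the trivial kernel agree after
  contraction with R, which can be cancelled.\<close>

lemma braid_kernel_eq:
  fixes R F F' :: "complex mat"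
  assumes R: "R \<in> sqm (N * N)" and \<Psi>: "skew_inverse N R \<Psi>"
    and F: "F \<in> sqm (N * N)" and F': "F' \<in> sqm (N * N)"
    and inv: "F * F' = 1\<^sub>m (N * N)" "F' * F = 1\<^sub>m (N * N)"
    and compat: "kron F (1\<^sub>m N) * kron (1\<^sub>m N) F * kron R (1\<^sub>m N) = kron (1\<^sub>m N) R * kron F (1\<^sub>m N) * kron (1\<^sub>m N) F"
    and l: "a < N" "c < N" "x < N" "y < N"
  shows "braid_kernel N (D_op N R) F F' a c x y = (if a = c then D_op N R $$ (y, x) else 0)"
proof -
  let ?n = "N * N * N" and ?D = "D_op N R"
  define F1 F2 F1' F2' R1 R2 where "F1 = kron F (1\<^sub>m N)" and "F2 = kron (1\<^sub>m N) F" and "F1' = kron F' (1\<^sub>m N)"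
    and "F2' = kron (1\<^sub>m N) F'" and "R1 = kron R (1\<^sub>m N)" and "R2 = kron (1\<^sub>m N) R"
  have cs: "F1 \<in> sqm ?n" "F2 \<in> sqm ?n" "F1' \<in> sqm ?n" "F2' \<in> sqm ?n"
      "R1 \<in> sqm ?n" "R2 \<in> sqm ?n"
    using kron_carrier[OF F one_carrier_mat[of N]] kron_carrier[OF one_carrier_mat[of N] F] kron_carrier[OF F' one_carrier_mat[of N]]
      kron_carrier[OF one_carrier_mat[of N] F'] kron_carrier[OF R one_carrier_mat[of N]] kron_carrier[OF one_carrier_mat[of N] R]
    by (simp_all add: F1_def F2_def F1'_def F2'_def R1_def R2_def mult.assoc)
  have 1: "F1' * F1 = 1\<^sub>m ?n" "F2 * F2' = 1\<^sub>m ?n"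
    using kron_mult[OF F' F one_carrier_mat[of N] one_carrier_mat[of N]] kron_mult[OF one_carrier_mat[of N] one_carrier_mat[of N] F F']
    by (simp_all add: F1_def F2_def F1'_def F2'_def inv kron_one_one mult.assoc)
  have eq: "F2 * R1 * F2' = F1' * R2 * F1"
  proof -
    have "F2 * R1 * F2' = (F1' * F1) * (F2 * R1 * F2')" using cs 1 by simp
    also have "\<dots> = F1' * (F1 * F2 * R1) * F2'" using cs by (simp add: assoc_mult_mat[of _ ?n ?n _ ?n _ ?n])
    also have "\<dots> = F1' * (R2 * F1 * F2) * F2'" using compat by (simp add: F1_def F2_def R1_def R2_def)
    also have "\<dots> = F1' * R2 * F1 * (F2 * F2')" using cs by (simp add: assoc_mult_mat[of _ ?n ?n _ ?n _ ?n])
    also have "\<dots> = F1' * R2 * F1" using cs 1 by simp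
    finally show ?thesis .
  qed
  have "ptr N ?D (N * N) (F1' * R2 * F1) = F' * ptr N ?D (N * N) R2 * F"
  proof -
    have "ptr N ?D (N * N) (F1' * R2 * F1) = ptr N ?D (N * N) (F1' * R2) * F"
      unfolding F1_def using cs by (intro ptr_mult_right[OF F]) simp
    also have "ptr N ?D (N * N) (F1' * R2) = F' * ptr N ?D (N * N) R2"
      unfolding F1'_def using cs by (intro ptr_mult_left F') simp_all
    finally show ?thesis .
  qed
  also have "ptr N ?D (N * N) R2 = 1\<^sub>m (N * N)"
    unfolding R2_def using l by (subst ptr_one_kron[OF R]) (simp_all add: ptr_R[OF R \<Psi>] kron_one_one)
  also have "F' * 1\<^sub>m (N * N) * F = 1\<^sub>m (N * N)" using F' inv by simp
  finally have p: "ptr N ?D (N * N) (F2 * R1 * F2') = 1\<^sub>m (N * N)" by (simp only: eq)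
  show ?thesis
  proof (rule skew_cancel[OF R \<Psi>, of "\<lambda>x y. braid_kernel N ?D F F' a c x y" "\<lambda>x y. if a = c then ?D $$ (y, x) else 0", OF _ l(3,4)])
    fix i j assume ij: "i < N" "j < N"
    have ne: "i * N + a = j * N + c \<longleftrightarrow> i = j \<and> a = c"
      using l by (metis add_right_cancel div_mult_self3 div_less add_cancel_left_left mod_mult_self3 mod_less less_nat_zero_code)
    have "(\<Sum>x<N. \<Sum>y<N. entry N R i x j y * braid_kernel N ?D F F' a c x y) = ptr N ?D (N * N) (F2 * R1 * F2') $$ (i * N + a, j * N + c)"
      unfolding F2_def R1_def F2'_def using ptr_conj_index[OF F F' central_mat_comm R ij l(1,2), of ?D] by (simp add: mult.commute)
    also have "\<dots> = of_bool (i = j \<and> a = c)" unfolding p using ij l pair_less ne by simp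
    also have "\<dots> = (if a = c then ptr N ?D N R $$ (i, j) else 0)" using ptr_R[OF R \<Psi>] ij by simp
    also have "\<dots> = (\<Sum>x<N. \<Sum>y<N. entry N R i x j y * (if a = c then ?D $$ (y, x) else 0))"
      using ij by (subst sum.swap) (simp add: ptr_index mult.commute)
    finally show "(\<Sum>x<N. \<Sum>y<N. entry N R i x j y * braid_kernel N ?D F F' a c x y)
      = (\<Sum>x<N. \<Sum>y<N. entry N R i x j y * (if a = c then ?D $$ (y, x) else 0))" .
  qed
qed

text \<open>With T the skew inverse conjugated by the flip, both R^(-1) D_2 = D_1 T and D_2 R^(-1) =
  T D_1 hold. Supplying the missing D_1 in each shows that R^(-1), and hence R, commutes with D on
  both factors.\<close>

lemma D_op_braid:
  fixes R R' :: "complex mat"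
  assumes R: "R \<in> sqm (N * N)" and \<Psi>: "skew_inverse N R \<Psi>"
    and R': "R' \<in> sqm (N * N)" and inv: "R * R' = 1\<^sub>m (N * N)" "R' * R = 1\<^sub>m (N * N)"
    and yb: "kron R (1\<^sub>m N) * kron (1\<^sub>m N) R * kron R (1\<^sub>m N) = kron (1\<^sub>m N) R * kron R (1\<^sub>m N) * kron (1\<^sub>m N) R"
    and D': "D' \<in> sqm N" "D' * D_op N R = 1\<^sub>m N" "D_op N R * D' = 1\<^sub>m N"
  shows "R * kron (D_op N R) (D_op N R) = kron (D_op N R) (D_op N R) * R"
proof -
  let ?D = "D_op N R" and ?n = "N * N * N" and ?k = "N * N"
  note P = Psi_carrier[OF R \<Psi>]
  define R1 R2 R1' R2' where "R1 = kron R (1\<^sub>m N)" and "R2 = kron (1\<^sub>m N) R" and "R1' = kron R' (1\<^sub>m N)" and "R2' = kron (1\<^sub>m N) R'"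
  have cs: "R1 \<in> sqm ?n" "R2 \<in> sqm ?n" "R1' \<in> sqm ?n" "R2' \<in> sqm ?n"
    using kron_carrier[OF R one_carrier_mat[of N]] kron_carrier[OF one_carrier_mat[of N] R]
      kron_carrier[OF R' one_carrier_mat[of N]] kron_carrier[OF one_carrier_mat[of N] R']
    by (simp_all add: R1_def R2_def R1'_def R2'_def mult.assoc)
  note as = assoc_mult_mat[of _ ?n ?n _ ?n _ ?n]
  have 1: "R1' * R1 = 1\<^sub>m ?n" "R2' * R2 = 1\<^sub>m ?n" "R1 * R1' = 1\<^sub>m ?n" "R2 * R2' = 1\<^sub>m ?n"
    using kron_mult[OF R' R one_carrier_mat[of N] one_carrier_mat[of N]] kron_mult[OF one_carrier_mat[of N] one_carrier_mat[of N] R' R]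
      kron_mult[OF R R' one_carrier_mat[of N] one_carrier_mat[of N]] kron_mult[OF one_carrier_mat[of N] one_carrier_mat[of N] R R']
    by (simp_all add: R1_def R2_def R1'_def R2'_def inv kron_one_one mult.assoc)
  have yb': "R1 * (R2 * R1) = R2 * (R1 * R2)"
    using yb unfolding R1_def[symmetric] R2_def[symmetric] as[OF cs(1,2,1)] as[OF cs(2,1,2)] .
  \<comment> \<open>The Yang-Baxter equation read as compatibility of R^(-1) with R, so that
    \<open>braid_kernel_eq\<close> applies to conjugation by R^(-1) as well.\<close>
  have c2: "R1' * R2' * R1 = R2 * R1' * R2'"
  proof -
    have l1: "R1 * (R1' * X) = X" and l2: "R1' * (R1 * X) = X" and l3: "R2' * (R2 * X) = X"
      if X: "X \<in> sqm ?n" for X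
      unfolding as[OF cs(1,3) X, symmetric] as[OF cs(3,1) X, symmetric] as[OF cs(4,2) X, symmetric]
      using 1 X by simp_all
    have "R1' * (R2' * R1) = R1' * (R2' * (R1 * (R2 * (R1 * (R1' * R2')))))"
      unfolding l1[OF cs(4)] 1 using cs by simp
    also have "R1 * (R2 * (R1 * (R1' * R2'))) = (R1 * (R2 * R1)) * (R1' * R2')" using cs by (simp add: as)
    also have "\<dots> = R2 * (R1 * (R2 * (R1' * R2')))" unfolding yb' using cs by (simp add: as)
    also have "R1' * (R2' * (R2 * (R1 * (R2 * (R1' * R2'))))) = R2 * (R1' * R2')"
      using cs by (simp add: l2 l3)
    finally show ?thesis using cs by (simp add: as)
  qed
  have k1: "braid_kernel N ?D R R' a c x y = (if a = c then ?D $$ (y, x) else 0)"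
    if "a < N" "c < N" "x < N" "y < N" for a c x y
    by (rule braid_kernel_eq[OF R \<Psi> R R' inv yb that])
  have k2: "braid_kernel N ?D R' R a c x y = (if a = c then ?D $$ (y, x) else 0)"
    if "a < N" "c < N" "x < N" "y < N" for a c x y
    by (rule braid_kernel_eq[OF R \<Psi> R' R inv(2,1) _ that])
       (use c2 in \<open>simp add: R1_def R2_def R1'_def R2'_def\<close>)
  define T where "T = mat ?k ?k (\<lambda>(i, j). \<Psi> $$ ((i mod N) * N + i div N, (j mod N) * N + j div N))"
  have Tc: "T \<in> sqm ?k" by (simp add: T_def)
  have T: "entry N T d u c t = entry N \<Psi> u d t c" if "d < N" "u < N" "c < N" "t < N" for d u c t
    using that pair_less by (simp add: T_def)
  have cD: "kron ?D (1\<^sub>m N) \<in> sqm ?k" "kron (1\<^sub>m N) ?D \<in> sqm ?k" "kron D' (1\<^sub>m N) \<in> sqm ?k"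
      "kron ?D ?D \<in> sqm ?k"
    using D'(1) by (auto intro!: kron_carrier)
  have A: "R' * kron (1\<^sub>m N) ?D = kron ?D (1\<^sub>m N) * T"
  proof (rule eq_matI)
    fix i j assume "i < dim_row (kron ?D (1\<^sub>m N) * T)" "j < dim_col (kron ?D (1\<^sub>m N) * T)"
    then have ij: "i < N * N" "j < N * N" using cD Tc by auto
    define y u c t where "y = i div N" and "u = i mod N" and "c = j div N" and "t = j mod N"
    have l: "y < N" "u < N" "c < N" "t < N" using div_mod_less[OF ij(1)] div_mod_less[OF ij(2)] by (auto simp: y_def u_def c_def t_def)
    have i: "i = y * N + u" and j: "j = c * N + t" by (simp_all add: y_def u_def c_def t_def)
    have "(R' * kron (1\<^sub>m N) ?D) $$ (i, j) = (\<Sum>s<N. entry N R' y u c s * ?D $$ (s, t))"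
      unfolding i j by (rule mult_one_kron_index[OF D_op_carrier R']) (use l pair_less in auto)
    also have "\<dots> = (\<Sum>d<N. ?D $$ (y, d) * entry N \<Psi> u d t c)"
    proof (rule skew_cancel[OF R \<Psi>, of "\<lambda>t u. \<Sum>s<N. entry N R' y u c s * ?D $$ (s, t)" "\<lambda>t u. \<Sum>d<N. ?D $$ (y, d) * entry N \<Psi> u d t c", OF _ l(4,2)])
      fix a x assume ax: "a < N" "x < N"
      have "(\<Sum>t<N. \<Sum>u<N. entry N R a t x u * (\<Sum>s<N. entry N R' y u c s * ?D $$ (s, t)))
         = (\<Sum>t<N. \<Sum>u<N. \<Sum>s<N. ?D $$ (s, t) * entry N R a t x u * entry N R' y u c s)"
        by (simp add: sum_distrib_left mult_ac)
      also have "\<dots> = (\<Sum>t<N. \<Sum>s<N. \<Sum>u<N. ?D $$ (s, t) * entry N R a t x u * entry N R' y u c s)"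
        by (intro sum.cong refl sum.swap)
      also have "\<dots> = braid_kernel N ?D R R' a c x y" unfolding braid_kernel_def by (rule sum.swap)
      also have "\<dots> = (\<Sum>d<N. ?D $$ (y, d) * of_bool (a = c \<and> d = x))"
        using ax by (simp add: k1[OF ax(1) l(3) ax(2) l(1)])
      also have "\<dots> = (\<Sum>d<N. ?D $$ (y, d) * (\<Sum>t<N. \<Sum>u<N. entry N R a t x u * entry N \<Psi> u d t c))"
        using ax l by (intro sum.cong refl) (simp add: skew_right[OF R \<Psi>])
      also have "\<dots> = (\<Sum>d<N. \<Sum>t<N. \<Sum>u<N. entry N R a t x u * (?D $$ (y, d) * entry N \<Psi> u d t c))"
        by (simp add: sum_distrib_left mult_ac)
      also have "\<dots> = (\<Sum>t<N. \<Sum>d<N. \<Sum>u<N. entry N R a t x u * (?D $$ (y, d) * entry N \<Psi> u d t c))"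
        by (rule sum.swap)
      also have "\<dots> = (\<Sum>t<N. \<Sum>u<N. \<Sum>d<N. entry N R a t x u * (?D $$ (y, d) * entry N \<Psi> u d t c))"
        by (intro sum.cong refl sum.swap)
      finally show "(\<Sum>t<N. \<Sum>u<N. entry N R a t x u * (\<Sum>s<N. entry N R' y u c s * ?D $$ (s, t)))
         = (\<Sum>t<N. \<Sum>u<N. entry N R a t x u * (\<Sum>d<N. ?D $$ (y, d) * entry N \<Psi> u d t c))"
        by (simp add: sum_distrib_left)
    qed
    also have "\<dots> = (\<Sum>d<N. ?D $$ (y, d) * entry N T d u c t)"
      using l by (intro sum.cong refl) (simp add: T)
    also have "\<dots> = (kron ?D (1\<^sub>m N) * T) $$ (i, j)"
      unfolding i j by (rule kron_one_mult_index[OF D_op_carrier Tc, symmetric]) (use l pair_less in auto)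
    finally show "(R' * kron (1\<^sub>m N) ?D) $$ (i, j) = (kron ?D (1\<^sub>m N) * T) $$ (i, j)" .
  qed (use R' cD Tc in auto)
  have B: "kron (1\<^sub>m N) ?D * R' = T * kron ?D (1\<^sub>m N)"
  proof (rule eq_matI)
    fix i j assume "i < dim_row (T * kron ?D (1\<^sub>m N))" "j < dim_col (T * kron ?D (1\<^sub>m N))"
    then have ij: "i < N * N" "j < N * N" using cD Tc by auto
    define a s x u where "a = i div N" and "s = i mod N" and "x = j div N" and "u = j mod N"
    have l: "a < N" "s < N" "x < N" "u < N" using div_mod_less[OF ij(1)] div_mod_less[OF ij(2)] by (auto simp: a_def s_def x_def u_def)
    have i: "i = a * N + s" and j: "j = x * N + u" by (simp_all add: a_def s_def x_def u_def)
    have "(kron (1\<^sub>m N) ?D * R') $$ (i, j) = (\<Sum>t<N. ?D $$ (s, t) * entry N R' a t x u)"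
      unfolding i j by (rule one_kron_mult_index[OF D_op_carrier R']) (use l pair_less in auto)
    also have "\<dots> = (\<Sum>f<N. entry N \<Psi> s a u f * ?D $$ (f, x))"
    proof (rule skew_cancel[OF R \<Psi>, of "\<lambda>u s. \<Sum>t<N. ?D $$ (s, t) * entry N R' a t x u" "\<lambda>u s. \<Sum>f<N. entry N \<Psi> s a u f * ?D $$ (f, x)", OF _ l(4,2)])
      fix y c assume yc: "y < N" "c < N"
      have "(\<Sum>u<N. \<Sum>s<N. entry N R y u c s * (\<Sum>t<N. ?D $$ (s, t) * entry N R' a t x u))
         = (\<Sum>u<N. \<Sum>s<N. \<Sum>t<N. ?D $$ (s, t) * entry N R' a t x u * entry N R y u c s)"
        by (simp add: sum_distrib_left mult_ac)
      also have "\<dots> = (\<Sum>s<N. \<Sum>u<N. \<Sum>t<N. ?D $$ (s, t) * entry N R' a t x u * entry N R y u c s)"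
        by (rule sum.swap)
      also have "\<dots> = braid_kernel N ?D R' R a c x y" unfolding braid_kernel_def by (intro sum.cong refl sum.swap)
      also have "\<dots> = (\<Sum>f<N. of_bool (y = f \<and> a = c) * ?D $$ (f, x))"
        using yc by (simp add: k2[OF l(1) yc(2) l(3) yc(1)])
      also have "\<dots> = (\<Sum>f<N. (\<Sum>u<N. \<Sum>s<N. entry N R y u c s * entry N \<Psi> s a u f) * ?D $$ (f, x))"
        using yc l by (intro sum.cong refl) (simp add: skew_right[OF R \<Psi>])
      also have "\<dots> = (\<Sum>f<N. \<Sum>u<N. \<Sum>s<N. entry N R y u c s * (entry N \<Psi> s a u f * ?D $$ (f, x)))"
        by (simp add: sum_distrib_right sum_distrib_left mult_ac)
      also have "\<dots> = (\<Sum>u<N. \<Sum>f<N. \<Sum>s<N. entry N R y u c s * (entry N \<Psi> s a u f * ?D $$ (f, x)))"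
        by (rule sum.swap)
      also have "\<dots> = (\<Sum>u<N. \<Sum>s<N. \<Sum>f<N. entry N R y u c s * (entry N \<Psi> s a u f * ?D $$ (f, x)))"
        by (intro sum.cong refl sum.swap)
      finally show "(\<Sum>u<N. \<Sum>s<N. entry N R y u c s * (\<Sum>t<N. ?D $$ (s, t) * entry N R' a t x u))
         = (\<Sum>u<N. \<Sum>s<N. entry N R y u c s * (\<Sum>f<N. entry N \<Psi> s a u f * ?D $$ (f, x)))"
        by (simp add: sum_distrib_left)
    qed
    also have "\<dots> = (\<Sum>f<N. entry N T a s f u * ?D $$ (f, x))"
      using l by (intro sum.cong refl) (simp add: T)
    also have "\<dots> = (T * kron ?D (1\<^sub>m N)) $$ (i, j)"
      unfolding i j by (rule mult_kron_one_index[OF D_op_carrier Tc, symmetric]) (use l pair_less in auto)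
    finally show "(kron (1\<^sub>m N) ?D * R') $$ (i, j) = (T * kron ?D (1\<^sub>m N)) $$ (i, j)" .
  qed (use R' cD Tc in auto)
  let ?D1 = "kron ?D (1\<^sub>m N)" and ?D2 = "kron (1\<^sub>m N) ?D"
  note as2 = assoc_mult_mat[of _ ?k ?k _ ?k _ ?k]
  have DD: "?D1 * ?D2 = kron ?D ?D" "?D2 * ?D1 = kron ?D ?D"
    using kron_mult[OF D_op_carrier[of N R] one_carrier_mat one_carrier_mat D_op_carrier[of N R]]
      kron_mult[OF one_carrier_mat D_op_carrier[of N R] D_op_carrier[of N R] one_carrier_mat]
      left_mult_one_mat[OF D_op_carrier[of N R]] right_mult_one_mat[OF D_op_carrier[of N R]] by auto
  have "kron ?D ?D * R' = ?D1 * (?D2 * R')" using cD R' by (simp add: as2 flip: DD(1))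
  also have "\<dots> = (?D1 * T) * ?D1" unfolding B using cD Tc by (simp add: as2)
  also have "\<dots> = R' * (?D2 * ?D1)" unfolding A[symmetric] using cD R' by (simp add: as2)
  finally have e: "kron ?D ?D * R' = R' * kron ?D ?D" by (simp only: DD)
  define K where "K = kron ?D ?D"
  have K: "K \<in> sqm ?k" "K * R' = R' * K" using cD(4) e by (simp_all only: K_def)
  have "R * K = R * (K * (R' * R))" using inv K by simp
  also have "\<dots> = R * ((K * R') * R)" by (simp only: as2[OF K(1) R' R])
  also have "\<dots> = (R * R') * (K * R)"
    by (simp only: K(2) as2[OF R' K(1) R] as2[OF R R' mult_carrier_mat[OF K(1) R]])
  also have "\<dots> = K * R" using inv K R by simp
  finally show ?thesis by (simp only: K_def)
qed

section \<open>Local operators on tensor powers: commutation at a distance and three-factor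
  relations\<close>

section \<open>Operators on tensor powers\<close>

lemma amp_carrier:
  assumes "X \<in> sqm (N ^ p)" "1 \<le> i" "i + p \<le> k + 1"
  shows "amp N k p i X \<in> sqm (N ^ k)"
proof -
  have "N ^ (i - 1) * N ^ p * N ^ (k - p + 1 - i) = N ^ k"
    using assms(2,3) by (simp flip: power_add)
  then show ?thesis unfolding amp_def
    using kron_carrier[OF kron_carrier[OF one_carrier_mat[of "N ^ (i - 1)"] assms(1)] one_carrier_mat[of "N ^ (k - p + 1 - i)"]]
    by simp
qed

lemma amp_Suc:
  fixes X :: "'a::semiring_1 mat"
  assumes "i + p \<le> k + 1" "p \<le> k" shows "amp N (Suc k) p i X = kron (amp N k p i X) (1\<^sub>m N)"
proof -
  have "Suc k - p + 1 - i = Suc (k - p + 1 - i)" using assms by simp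
  then show ?thesis unfolding amp_def by (simp add: kron_assoc kron_one_one mult.commute)
qed

lemma amp_add:
  fixes X :: "'a::semiring_1 mat"
  assumes "i + p \<le> k + 1" "p \<le> k" shows "amp N (k + j) p i X = kron (amp N k p i X) (1\<^sub>m (N ^ j))"
proof (induction j)
  case (Suc j)
  then show ?case using assms amp_Suc[of i p "k + j" N X]
    by (simp add: kron_assoc kron_one_one mult.commute)
qed simp

lemma amp_shift:
  fixes X :: "'a::semiring_1 mat"
  assumes "1 \<le> i" "p \<le> k" shows "amp N (j + k) p (j + i) X = kron (1\<^sub>m (N ^ j)) (amp N k p i X)"
proof -
  have "j + i - 1 = j + (i - 1)" "j + k - p + 1 - (j + i) = k - p + 1 - i" using assms by simp_all
  then show ?thesis by (simp add: amp_def kron_assoc power_add flip: kron_one_one)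
qed

lemma amp_top:
  fixes X :: "'a::semiring_1 mat"
  shows "amp N (k + 2) 2 (Suc k) X = kron (1\<^sub>m (N ^ k)) X"
  by (simp add: amp_def)

lemma amp_mult:
  fixes X Y :: "'a::semiring_1 mat"
  assumes "X \<in> sqm (N ^ p)" "Y \<in> sqm (N ^ p)"
  shows "amp N k p i X * amp N k p i Y = amp N k p i (X * Y)"
proof -
  let ?a = "N ^ (i - 1)" and ?b = "N ^ (k - p + 1 - i)"
  have "kron (1\<^sub>m ?a) X * kron (1\<^sub>m ?a) Y = kron (1\<^sub>m ?a) (X * Y)"
    using kron_mult[OF one_carrier_mat[of ?a] one_carrier_mat assms] by (simp add: mat_commuting_one)
  then show ?thesis unfolding amp_def
    using kron_mult[OF kron_carrier[OF one_carrier_mat[of ?a] assms(1)] kron_carrier[OF one_carrier_mat[of ?a] assms(2)] one_carrier_mat[of ?b] one_carrier_mat[of ?b]]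
    by simp
qed

lemma amp_one: "1 \<le> i \<Longrightarrow> i + p \<le> k + 1 \<Longrightarrow> amp N k p i (1\<^sub>m (N ^ p)) = (1\<^sub>m (N ^ k) :: 'a::semiring_1 mat)"
  by (simp add: amp_def kron_one_one flip: power_add)

lemma amp_amp3:
  fixes X :: "'a::semiring_1 mat"
  assumes "1 \<le> i" "i + 2 \<le> k"
  shows "amp N k 2 i X = amp N k 3 i (kron X (1\<^sub>m N))" "amp N k 2 (i + 1) X = amp N k 3 i (kron (1\<^sub>m N) X)"
proof -
  have e: "k - 2 + 1 - i = Suc (k - 3 + 1 - i)" "N ^ i = N ^ (i - 1) * N" "k - 2 + 1 - (i + 1) = k - 3 + 1 - i"
    using assms by (simp_all add: power_eq_if mult.commute)
  show "amp N k 2 i X = amp N k 3 i (kron X (1\<^sub>m N))"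
    unfolding amp_def e(1) by (simp add: kron_assoc flip: kron_one_one)
  show "amp N k 2 (i + 1) X = amp N k 3 i (kron (1\<^sub>m N) X)"
    unfolding amp_def e(3) using e(2) by (simp add: kron_assoc flip: kron_one_one)
qed

lemma kron_commute:
  fixes A B :: "'a::semiring_1 mat"
  assumes "A \<in> sqm a" "B \<in> sqm b" "mat_commuting A B"
  shows "kron (1\<^sub>m a) B * kron A (1\<^sub>m b) = kron A (1\<^sub>m b) * kron (1\<^sub>m a) B"
proof -
  have "mat_commuting B A" using assms(3) by (simp add: mat_commuting_def)
  then have "kron (1\<^sub>m a) B * kron A (1\<^sub>m b) = kron A B"
    using kron_mult[OF one_carrier_mat assms(1) assms(2) one_carrier_mat] assms by simp
  also have "\<dots> = kron A (1\<^sub>m b) * kron (1\<^sub>m a) B"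
    using kron_mult[OF assms(1) one_carrier_mat one_carrier_mat assms(2)] assms by simp
  finally show ?thesis .
qed

lemma amp2_carrier: "X \<in> sqm (N * N) \<Longrightarrow> 1 \<le> i \<Longrightarrow> i < k \<Longrightarrow> amp N k 2 i X \<in> sqm (N ^ k)"
  using amp_carrier[of X N 2 i k] by (simp add: power2_eq_square)

lemma central_mat_one: "central_mat (1\<^sub>m n)"
  by (simp add: central_mat_def)

lemma central_mat_kron:
  fixes A B :: "'a::semiring_1 mat"
  assumes "central_mat A" "central_mat B" shows "central_mat (kron A B)"
  unfolding central_mat_def
proof (intro allI impI)
  fix i j x assume "i < dim_row (kron A B)" "j < dim_col (kron A B)"
  then have ij: "i < dim_row A * dim_row B" "j < dim_col A * dim_col B" by auto
  note l = div_mod_less[OF ij(1)] div_mod_less[OF ij(2)]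
  have "A $$ (i div dim_row B, j div dim_col B) * y = y * A $$ (i div dim_row B, j div dim_col B)"
    "B $$ (i mod dim_row B, j mod dim_col B) * y = y * B $$ (i mod dim_row B, j mod dim_col B)" for y
    using central_matD[OF assms(1)] central_matD[OF assms(2)] l by blast+
  then show "kron A B $$ (i, j) * x = x * kron A B $$ (i, j)"
    unfolding kron_index[OF ij] by (metis mult.assoc)
qed

text \<open>The operators live on disjoint tensor factors. The entries of Z may be noncommuting
  generators, so those of X are required to be central.\<close>

lemma amp2_far_commute:
  fixes X Z :: "'a::semiring_1 mat"
  assumes X: "X \<in> sqm (N * N)" and Z: "Z \<in> sqm (N ^ j)"
    and i: "j < i" "i < j + k" and c: "central_mat X"
  shows "amp N (j + k) 2 i X * kron Z (1\<^sub>m (N ^ k)) = kron Z (1\<^sub>m (N ^ k)) * amp N (j + k) 2 i X"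
proof -
  define l where "l = i - j"
  have l: "i = j + l" "1 \<le> l" "l < k" using i by (auto simp: l_def)
  have e: "amp N (j + k) 2 i X = kron (1\<^sub>m (N ^ j)) (amp N k 2 l X)"
    unfolding l(1) using l by (intro amp_shift) auto
  have cl: "amp N k 2 l X \<in> sqm (N ^ k)" by (rule amp2_carrier[OF X l(2,3)])
  have "central_mat (amp N k 2 l X)"
    unfolding amp_def by (intro central_mat_kron central_mat_one c)
  then show ?thesis unfolding e
    by (intro kron_commute Z cl central_mat_commuting(2))
qed

lemma amp2_commute:
  fixes X Y :: "complex mat"
  assumes "X \<in> sqm (N * N)" "Y \<in> sqm (N * N)" "1 \<le> i" "i + 2 \<le> j" "j < k"
  shows "amp N k 2 i X * amp N k 2 j Y = amp N k 2 j Y * amp N k 2 i X"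
proof -
  define d where "d = k - (j - 1)"
  have k: "k = (j - 1) + d" using assms by (simp add: d_def)
  have e: "amp N k 2 i X = kron (amp N (j - 1) 2 i X) (1\<^sub>m (N ^ d))"
    unfolding k by (rule amp_add) (use assms in auto)
  have "amp N (j - 1 + d) 2 j Y * kron (amp N (j - 1) 2 i X) (1\<^sub>m (N ^ d)) =
     kron (amp N (j - 1) 2 i X) (1\<^sub>m (N ^ d)) * amp N (j - 1 + d) 2 j Y"
    by (rule amp2_far_commute[OF assms(2) amp2_carrier[OF assms(1)]]) (use assms k in auto)
  then show ?thesis unfolding e k[symmetric] ..
qed

text \<open>Amplification is multiplicative, so an identity on three tensor factors holds on any
  three neighbouring factors.\<close>

lemma amp2_triple:
  fixes A B C A' B' C' :: "'a::semiring_1 mat"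
  assumes c: "A \<in> sqm (N * N)" "B \<in> sqm (N * N)" "C \<in> sqm (N * N)"
      "A' \<in> sqm (N * N)" "B' \<in> sqm (N * N)" "C' \<in> sqm (N * N)"
    and e: "kron A (1\<^sub>m N) * kron (1\<^sub>m N) B * kron C (1\<^sub>m N) = kron (1\<^sub>m N) A' * kron B' (1\<^sub>m N) * kron (1\<^sub>m N) C'"
    and i: "1 \<le> i" "i + 2 \<le> k"
  shows "amp N k 2 i A * amp N k 2 (i + 1) B * amp N k 2 i C = amp N k 2 (i + 1) A' * amp N k 2 i B' * amp N k 2 (i + 1) C'"
proof -
  have l: "kron X (1\<^sub>m N) \<in> sqm (N ^ 3)" and r: "kron (1\<^sub>m N) X \<in> sqm (N ^ 3)"
    if "X \<in> sqm (N * N)" for X :: "'a mat"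
    using kron_carrier[OF that one_carrier_mat[of N]] kron_carrier[OF one_carrier_mat[of N] that]
    by (simp_all add: power3_eq_cube mult.assoc)
  have "amp N k 2 i A * amp N k 2 (i + 1) B * amp N k 2 i C = amp N k 3 i (kron A (1\<^sub>m N) * kron (1\<^sub>m N) B * kron C (1\<^sub>m N))"
    unfolding amp_amp3[OF i] amp_mult[OF l[OF c(1)] r[OF c(2)]] amp_mult[OF mult_carrier_mat[OF l[OF c(1)] r[OF c(2)]] l[OF c(3)]] ..
  also have "\<dots> = amp N k 3 i (kron (1\<^sub>m N) A' * kron B' (1\<^sub>m N) * kron (1\<^sub>m N) C')" by (simp only: e)
  also have "\<dots> = amp N k 2 (i + 1) A' * amp N k 2 i B' * amp N k 2 (i + 1) C'"
    unfolding amp_amp3[OF i] amp_mult[OF r[OF c(4)] l[OF c(5)]] amp_mult[OF mult_carrier_mat[OF r[OF c(4)] l[OF c(5)]] r[OF c(6)]] ..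
  finally show ?thesis .
qed

interpretation const_hom: semiring_hom "const :: complex \<Rightarrow> ('m::monoid_add \<Rightarrow>\<^sub>0 complex)"
  by unfold_locales (simp_all add: const_add const_mult)

abbreviation cmat :: "complex mat \<Rightarrow> ('m::monoid_add \<Rightarrow>\<^sub>0 complex) mat" where
  "cmat \<equiv> map_mat const"

lemma cmat_mult: "A \<in> carrier_mat a b \<Longrightarrow> B \<in> carrier_mat b c \<Longrightarrow> cmat (A * B) = cmat A * cmat B"
  by (rule const_hom.mat_hom_mult)

lemma cmat_one: "cmat (1\<^sub>m n) = 1\<^sub>m n"
  by (rule const_hom.mat_hom_one)

lemma cmat_kron: "cmat (kron A B) = kron (cmat A) (cmat B)"
proof (rule eq_matI)
  fix i j assume "i < dim_row (kron (cmat A) (cmat B))" "j < dim_col (kron (cmat A) (cmat B))"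
  then have ij: "i < dim_row A * dim_row B" "j < dim_col A * dim_col B" by auto
  then show "cmat (kron A B) $$ (i, j) = kron (cmat A) (cmat B) $$ (i, j)"
    using div_mod_less[OF ij(1)] div_mod_less[OF ij(2)] by (simp add: kron_index const_mult)
qed simp_all

lemma cmat_amp: "cmat (amp N k p i X) = amp N k p i (cmat X)"
  by (simp add: amp_def cmat_kron cmat_one)

lemma central_cmat [simp]: "central_mat (cmat A)"
  by (simp add: central_mat_def const_commute)

lemma cmat_commuting [simp]: "mat_commuting (cmat A) B" "mat_commuting B (cmat A)"
  by (simp_all add: central_mat_commuting)

text \<open>The pattern of the commutation rules for copies of the generators: each further copy is
  a conjugate of an earlier one, and X passes through the conjugating factor, possibly changing its
  position.\<close>

lemma mat_conj_commute:
  fixes X G X2 G' M :: "'a::semiring_1 mat"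
  assumes c: "X \<in> sqm n" "G \<in> sqm n" "X2 \<in> sqm n" "G' \<in> sqm n" "M \<in> sqm n"
    and e: "X * G = G * X2" "G * G' = 1\<^sub>m n" "G' * G = 1\<^sub>m n" "X2 * M = M * X2"
  shows "X * (G * M * G') = G * M * G' * X"
proof -
  note as = assoc_mult_mat[of _ n n _ n _ n]
  have "G' * X = G' * (X * G) * G'" using c e(2) by (simp add: as)
  also have "\<dots> = (G' * G) * X2 * G'" unfolding e(1) using c by (simp add: as)
  finally have 1: "G' * X = X2 * G'" using c e(3) by simp
  have "X * (G * M * G') = (X * G) * (M * G')" using c by (simp add: as)
  also have "\<dots> = G * (X2 * M) * G'" unfolding e(1) using c by (simp add: as)
  also have "\<dots> = G * M * (X2 * G')" unfolding e(4) using c by (simp add: as)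
  also have "\<dots> = G * M * G' * X" unfolding 1[symmetric] using c by (simp add: as)
  finally show ?thesis .
qed

section \<open>Commutation rules for the copies of the generators, and the shift by one
  factor\<close>

section \<open>Copies of the matrix of generators\<close>

text \<open>The inverses and the skew inverse are parameters, so that each is an explicit matrix.
  The equations are the given ones with the amplifications to three factors written as Kronecker
  products.\<close>

locale r_matrix_pair =
  fixes N :: nat and R F R' F' \<Psi> D' :: "complex mat"
  assumes carr: "R \<in> sqm (N * N)" "F \<in> sqm (N * N)"
      "R' \<in> sqm (N * N)" "F' \<in> sqm (N * N)"
    and R_inv: "R * R' = 1\<^sub>m (N * N)" "R' * R = 1\<^sub>m (N * N)"
    and F_inv: "F * F' = 1\<^sub>m (N * N)" "F' * F = 1\<^sub>m (N * N)" "the (mat_inverse F) = F'"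
    and yb_R: "kron R (1\<^sub>m N) * kron (1\<^sub>m N) R * kron R (1\<^sub>m N) = kron (1\<^sub>m N) R * kron R (1\<^sub>m N) * kron (1\<^sub>m N) R"
    and yb_F: "kron F (1\<^sub>m N) * kron (1\<^sub>m N) F * kron F (1\<^sub>m N) = kron (1\<^sub>m N) F * kron F (1\<^sub>m N) * kron (1\<^sub>m N) F"
    and compat1: "kron R (1\<^sub>m N) * kron (1\<^sub>m N) F * kron F (1\<^sub>m N) = kron (1\<^sub>m N) F * kron F (1\<^sub>m N) * kron (1\<^sub>m N) R"
    and compat2: "kron F (1\<^sub>m N) * kron (1\<^sub>m N) F * kron R (1\<^sub>m N) = kron (1\<^sub>m N) R * kron F (1\<^sub>m N) * kron (1\<^sub>m N) F"
    and skew: "skew_inverse N R \<Psi>"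
    and D'_inv: "D' \<in> sqm N" "D' * D_op N R = 1\<^sub>m N" "D_op N R * D' = 1\<^sub>m N"
begin

abbreviation D :: "complex mat" where "D \<equiv> D_op N R"

abbreviation op :: "complex mat \<Rightarrow> nat \<Rightarrow> nat \<Rightarrow> complex mat" where
  "op X k i \<equiv> amp N k 2 i X"

abbreviation cop :: "complex mat \<Rightarrow> nat \<Rightarrow> nat \<Rightarrow> (nat \<times> nat) free mat" where
  "cop X k i \<equiv> cmat (amp N k 2 i X)"

abbreviation M :: "nat \<Rightarrow> nat \<Rightarrow> (nat \<times> nat) free mat" where
  "M \<equiv> M_bar N F"

lemma op_carrier: "X \<in> {R, F, R', F'} \<Longrightarrow> 1 \<le> i \<Longrightarrow> i < k \<Longrightarrow> op X k i \<in> sqm (N ^ k)"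
  using carr by (auto intro!: amp2_carrier)

lemma cop_carrier: "X \<in> {R, F, R', F'} \<Longrightarrow> 1 \<le> i \<Longrightarrow> i < k \<Longrightarrow> cop X k i \<in> sqm (N ^ k)"
  using op_carrier by simp

lemma op_inv: assumes "1 \<le> i" "i < k"
  shows "op F k i * op F' k i = 1\<^sub>m (N ^ k)" "op F' k i * op F k i = 1\<^sub>m (N ^ k)"
  using amp_mult[of F N 2 F' k i] amp_mult[of F' N 2 F k i] amp_one[of i 2 k N, where 'a = complex] carr F_inv assms
  by (simp_all add: power2_eq_square)

lemma cop_inv: assumes "1 \<le> i" "i < k"
  shows "cop F k i * cop F' k i = 1\<^sub>m (N ^ k)" "cop F' k i * cop F k i = 1\<^sub>m (N ^ k)"
  using op_inv[OF assms] op_carrier[of F, OF _ assms] op_carrier[of F', OF _ assms]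
  by (simp_all add: cmat_one flip: cmat_mult)

lemma M_1: "M K (Suc 0) = amp N K 1 1 (gen_mat N)"
  by simp

lemma M_rec: "1 \<le> k \<Longrightarrow> M K (Suc k) = cop F K k * M K k * cop F' K k"
  by (cases k) (simp_all add: F_amp_def F_inv(3))

lemma M_carrier: "1 \<le> k \<Longrightarrow> k \<le> K \<Longrightarrow> M K k \<in> sqm (N ^ K)"
proof (induction k rule: dec_induct)
  case base
  then show ?case unfolding One_nat_def M_1 by (intro amp_carrier) (auto simp: gen_mat_def)
next
  case (step k)
  then have "M K k \<in> sqm (N ^ K)" by simp
  then show ?case using step cop_carrier[of F k K] cop_carrier[of F' k K]
    by (auto simp: M_rec intro!: mult_carrier_mat)
qed

lemma op_Suc: "1 \<le> i \<Longrightarrow> i < K \<Longrightarrow> op X (Suc K) i = kron (op X K i) (1\<^sub>m N)"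
  by (rule amp_Suc) auto

lemma cop_Suc: "1 \<le> i \<Longrightarrow> i < K \<Longrightarrow> cop X (Suc K) i = kron (cop X K i) (1\<^sub>m N)"
  by (simp add: op_Suc cmat_kron cmat_one)

lemma kron_one_mult3:
  fixes A B C :: "'a::semiring_1 mat"
  assumes "A \<in> sqm n" "B \<in> sqm n" "C \<in> sqm n"
  shows "kron A (1\<^sub>m m) * kron B (1\<^sub>m m) * kron C (1\<^sub>m m) = kron (A * B * C) (1\<^sub>m m)"
  using kron_mult[OF assms(1,2) one_carrier_mat[of m] one_carrier_mat[of m]]
    kron_mult[OF mult_carrier_mat[OF assms(1,2)] assms(3) one_carrier_mat[of m] one_carrier_mat[of m]]
  by simp

lemma kron_one_mult2:
  fixes A B :: "'a::semiring_1 mat"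
  assumes "A \<in> sqm n" "B \<in> sqm n"
  shows "kron A (1\<^sub>m m) * kron B (1\<^sub>m m) = kron (A * B) (1\<^sub>m m)"
  using kron_mult[OF assms(1,2) one_carrier_mat[of m] one_carrier_mat[of m]] by simp

lemma M_Suc: "1 \<le> k \<Longrightarrow> k \<le> K \<Longrightarrow> M (Suc K) k = kron (M K k) (1\<^sub>m N)"
proof (induction k rule: dec_induct)
  case base
  then show ?case unfolding One_nat_def M_1 by (intro amp_Suc) auto
next
  case (step k)
  then have k: "1 \<le> k" "k < K" "M (Suc K) k = kron (M K k) (1\<^sub>m N)" by auto
  have "M (Suc K) (Suc k) = kron (cop F K k) (1\<^sub>m N) * kron (M K k) (1\<^sub>m N) * kron (cop F' K k) (1\<^sub>m N)"
    using k by (simp add: M_rec cop_Suc)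
  also have "\<dots> = kron (M K (Suc k)) (1\<^sub>m N)"
    using k cop_carrier[of F k K] cop_carrier[of F' k K] M_carrier[of k K]
    by (subst kron_one_mult3[of _ "N ^ K"]) (auto simp: M_rec)
  finally show ?case .
qed

lemma M_add: "1 \<le> k \<Longrightarrow> k \<le> K \<Longrightarrow> M (K + j) k = kron (M K k) (1\<^sub>m (N ^ j))"
proof (induction j)
  case (Suc j)
  then show ?case using M_Suc[of k "K + j"]
    by (simp add: kron_assoc kron_one_one mult.commute)
qed simp

lemma op_add: "1 \<le> i \<Longrightarrow> i < K \<Longrightarrow> op X (K + j) i = kron (op X K i) (1\<^sub>m (N ^ j))"
  by (rule amp_add) auto

lemma cop_above_commute:
  assumes X: "X \<in> sqm (N * N)" and Z: "Z \<in> sqm (N ^ k)" and i: "k < i" "i < k + j"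
  shows "cop X (k + j) i * kron Z (1\<^sub>m (N ^ j)) = kron Z (1\<^sub>m (N ^ j)) * cop X (k + j) i"
  unfolding cmat_amp by (rule amp2_far_commute) (use X Z i in auto)

text \<open>The k-th copy is supported on the first k tensor factors.\<close>

lemma cop_M_above:
  assumes X: "X \<in> sqm (N * N)" and k: "1 \<le> k" "k < i" "i < K"
  shows "cop X K i * M K k = M K k * cop X K i"
proof -
  define d where "d = K - k"
  have K: "K = k + d" using k by (simp add: d_def)
  show ?thesis unfolding K M_add[OF k(1) order_refl]
    by (rule cop_above_commute[OF X M_carrier]) (use k K in auto)
qed

lemma cop_commute:
  assumes "X \<in> sqm (N * N)" "Y \<in> sqm (N * N)" "1 \<le> i" "i + 2 \<le> j" "j < k"
  shows "cop X k i * cop Y k j = cop Y k j * cop X k i"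
proof -
  have c: "op X k i \<in> sqm (N ^ k)" "op Y k j \<in> sqm (N ^ k)"
    using assms by (auto intro: amp2_carrier)
  show ?thesis unfolding cmat_mult[OF c(1,2), symmetric] cmat_mult[OF c(2,1), symmetric]
    by (simp only: amp2_commute[OF assms])
qed

lemma cop_triple:
  assumes c: "X \<in> sqm (N * N)" "Y \<in> sqm (N * N)" "Z \<in> sqm (N * N)"
      "X' \<in> sqm (N * N)" "Y' \<in> sqm (N * N)" "Z' \<in> sqm (N * N)"
    and e: "kron X (1\<^sub>m N) * kron (1\<^sub>m N) Y * kron Z (1\<^sub>m N) = kron (1\<^sub>m N) X' * kron Y' (1\<^sub>m N) * kron (1\<^sub>m N) Z'"
    and i: "1 \<le> i" "i + 2 \<le> k"
  shows "cop X k i * cop Y k (i + 1) * cop Z k i = cop X' k (i + 1) * cop Y' k i * cop Z' k (i + 1)"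
proof -
  have d: "op A k i \<in> sqm (N ^ k)" "op A k (i + 1) \<in> sqm (N ^ k)"
    if "A \<in> sqm (N * N)" for A
    using that i by (auto intro: amp2_carrier)
  have "cop X k i * cop Y k (i + 1) * cop Z k i = cmat (op X k i * op Y k (i + 1) * op Z k i)"
    using d[OF c(1)] d[OF c(2)] d[OF c(3)] by (simp add: cmat_mult[of _ "N ^ k" "N ^ k" _ "N ^ k"])
  also have "\<dots> = cmat (op X' k (i + 1) * op Y' k i * op Z' k (i + 1))"
    by (simp only: amp2_triple[OF c e i])
  also have "\<dots> = cop X' k (i + 1) * cop Y' k i * cop Z' k (i + 1)"
    using d[OF c(4)] d[OF c(5)] d[OF c(6)] by (simp add: cmat_mult[of _ "N ^ k" "N ^ k" _ "N ^ k"])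
  finally show ?thesis .
qed

text \<open>M_(i+2) is the conjugate of M_i by F_(i+1) F_i, and by \<open>tri\<close> this factor
  turns X_i into X_(i+1), which acts beyond the support of M_i. For larger l the next conjugating F
  is far from X_i.\<close>

lemma cop_M_below:
  assumes X: "X \<in> sqm (N * N)"
    and tri: "kron X (1\<^sub>m N) * kron (1\<^sub>m N) F * kron F (1\<^sub>m N) = kron (1\<^sub>m N) F * kron F (1\<^sub>m N) * kron (1\<^sub>m N) X"
    and i: "1 \<le> i"
  shows "i + 2 \<le> l \<Longrightarrow> l \<le> K \<Longrightarrow> cop X K i * M K l = M K l * cop X K i"
proof (induction l rule: dec_induct)
  case base
  let ?n = "N ^ K"
  note as = assoc_mult_mat[of _ ?n ?n _ ?n _ ?n]
  define G G' where "G = cop F K (i + 1) * cop F K i" and "G' = cop F' K i * cop F' K (i + 1)"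
  have c: "cop F K i \<in> sqm ?n" "cop F K (i + 1) \<in> sqm ?n" "cop F' K i \<in> sqm ?n" "cop F' K (i + 1) \<in> sqm ?n"
      "cop X K i \<in> sqm ?n" "cop X K (i + 1) \<in> sqm ?n" "M K i \<in> sqm ?n"
    using i base amp2_carrier[OF X] M_carrier by (auto intro!: op_carrier)
  have v: "cop F K i * cop F' K i = 1\<^sub>m ?n" "cop F' K i * cop F K i = 1\<^sub>m ?n"
     "cop F K (i + 1) * cop F' K (i + 1) = 1\<^sub>m ?n" "cop F' K (i + 1) * cop F K (i + 1) = 1\<^sub>m ?n"
    using cop_inv[of i K] cop_inv[of "i + 1" K] i base by auto
  have Gc: "G \<in> sqm ?n" "G' \<in> sqm ?n" unfolding G_def G'_def using c by (auto intro: mult_carrier_mat)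
  have "G * G' = cop F K (i + 1) * ((cop F K i * cop F' K i) * cop F' K (i + 1))"
    unfolding G_def G'_def as[OF c(2,1) mult_carrier_mat[OF c(3,4)]] as[OF c(1,3,4)] ..
  also have "\<dots> = 1\<^sub>m ?n" using v c by simp
  finally have GG: "G * G' = 1\<^sub>m ?n" .
  have "G' * G = cop F' K i * ((cop F' K (i + 1) * cop F K (i + 1)) * cop F K i)"
    unfolding G_def G'_def as[OF c(3,4) mult_carrier_mat[OF c(2,1)]] as[OF c(4,2,1)] ..
  also have "\<dots> = 1\<^sub>m ?n" using v c by simp
  finally have GG': "G' * G = 1\<^sub>m ?n" .
  have "cop X K i * cop F K (i + 1) * cop F K i = cop F K (i + 1) * cop F K i * cop X K (i + 1)"
    by (rule cop_triple[OF X carr(2) carr(2) carr(2) carr(2) X tri i]) (use base in simp)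
  then have XG: "cop X K i * G = G * cop X K (i + 1)" unfolding G_def as[OF c(5,2,1)] .
  have XM: "cop X K (i + 1) * M K i = M K i * cop X K (i + 1)"
    by (rule cop_M_above[OF X]) (use i base in auto)
  have "M K (i + 2) = cop F K (i + 1) * (cop F K i * M K i * cop F' K i) * cop F' K (i + 1)"
    using M_rec[of i K] M_rec[of "i + 1" K] i by simp
  also have "\<dots> = G * M K i * G'"
    unfolding G_def G'_def using c by (simp add: as)
  finally have MG: "M K (i + 2) = G * M K i * G'" .
  show ?case unfolding MG by (rule mat_conj_commute[OF c(5) Gc(1) c(6) Gc(2) c(7) XG GG GG' XM])
next
  case (step l)
  let ?n = "N ^ K"
  have l: "1 \<le> l" "l < K" using step by auto
  have M: "M K (Suc l) = cop F K l * M K l * cop F' K l" using l by (simp add: M_rec)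
  show ?case unfolding M
    by (rule mat_conj_commute[of "cop X K i" ?n "cop F K l" "cop X K i" "cop F' K l" "M K l"])
      (use step i l X cop_inv[OF l] in \<open>auto intro!: op_carrier M_carrier cop_commute carr amp2_carrier\<close>)
qed

lemmas R_M_below = cop_M_below[OF carr(1) compat1]
lemmas F_M_below = cop_M_below[OF carr(2) yb_F]

text \<open>\<open>F\<^sub>1 \<dots> F\<^sub>K\<close>, which shifts copies of the generators and R-matrices by one tensor factor.\<close>

fun gF :: "nat \<Rightarrow> complex mat" where
  "gF 0 = 1\<^sub>m N"
| "gF (Suc K) = kron (gF K) (1\<^sub>m N) * op F (Suc (Suc K)) (Suc K)"

fun gF' :: "nat \<Rightarrow> complex mat" where
  "gF' 0 = 1\<^sub>m N"
| "gF' (Suc K) = op F' (Suc (Suc K)) (Suc K) * kron (gF' K) (1\<^sub>m N)"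

lemma kron_one_carrier: "A \<in> sqm (N ^ K) \<Longrightarrow> kron A (1\<^sub>m N) \<in> sqm (N ^ Suc K)"
  using kron_carrier[of A "N ^ K" "N ^ K" "1\<^sub>m N" N N] by (simp add: mult.commute)

lemma gF_carrier: "gF K \<in> sqm (N ^ Suc K)" "gF' K \<in> sqm (N ^ Suc K)"
proof (induction K)
  case (Suc K)
  show "gF (Suc K) \<in> sqm (N ^ Suc (Suc K))"
    unfolding gF.simps by (rule mult_carrier_mat[OF kron_one_carrier[OF Suc(1)]], rule op_carrier) auto
  show "gF' (Suc K) \<in> sqm (N ^ Suc (Suc K))"
    unfolding gF'.simps by (rule mult_carrier_mat[OF _ kron_one_carrier[OF Suc(2)]], rule op_carrier) auto
qed simp_all

lemma gF_inv: "gF K * gF' K = 1\<^sub>m (N ^ Suc K)"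
proof (induction K)
  case (Suc K)
  let ?n = "N ^ Suc (Suc K)"
  note as = assoc_mult_mat[of _ ?n ?n _ ?n _ ?n]
  have c: "op F (Suc (Suc K)) (Suc K) \<in> sqm ?n" "op F' (Suc (Suc K)) (Suc K) \<in> sqm ?n"
    by (rule op_carrier; simp)+
  note g = kron_one_carrier[OF gF_carrier(1)[of K]] kron_one_carrier[OF gF_carrier(2)[of K]]
  have "gF (Suc K) * gF' (Suc K) = kron (gF K) (1\<^sub>m N) * ((op F (Suc (Suc K)) (Suc K) * op F' (Suc (Suc K)) (Suc K)) * kron (gF' K) (1\<^sub>m N))"
    unfolding gF.simps gF'.simps as[OF g(1) c(1) mult_carrier_mat[OF c(2) g(2)]] as[OF c g(2)] ..
  also have "\<dots> = kron (gF K) (1\<^sub>m N) * kron (gF' K) (1\<^sub>m N)"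
    unfolding op_inv(1)[of "Suc K" "Suc (Suc K)", OF le_add1[of 1 K, simplified plus_1_eq_Suc] lessI] left_mult_one_mat[OF g(2)] ..
  also have "\<dots> = 1\<^sub>m ?n"
    unfolding kron_one_mult2[OF gF_carrier] Suc by (simp add: kron_one_one mult.commute)
  finally show ?case .
qed simp

text \<open>Below the top position the last factor F of the shift commutes with X, and the shorter
  shift does the work. At the top position the last two factors F move X by their three-factor
  relation, and the others act at a distance.\<close>

lemma gF_op:
  assumes X: "X \<in> sqm (N * N)"
    and tri: "kron F (1\<^sub>m N) * kron (1\<^sub>m N) F * kron X (1\<^sub>m N) = kron (1\<^sub>m N) X * kron F (1\<^sub>m N) * kron (1\<^sub>m N) F"
  shows "1 \<le> k \<Longrightarrow> k < K \<Longrightarrow> gF K * op X (Suc K) k = op X (Suc K) (Suc k) * gF K"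
proof (induction K)
  case (Suc K)
  let ?n = "N ^ Suc (Suc K)"
  note as = assoc_mult_mat[of _ ?n ?n _ ?n _ ?n]
  let ?F = "op F (Suc (Suc K)) (Suc K)" and ?G = "kron (gF K) (1\<^sub>m N)" and ?X = "op X (Suc (Suc K))"
  have cF: "?F \<in> sqm ?n" by (rule op_carrier) auto
  have cG: "?G \<in> sqm ?n" by (rule kron_one_carrier[OF gF_carrier(1)])
  have cX: "?X i \<in> sqm ?n" if "1 \<le> i" "i \<le> Suc K" for i using that X by (intro amp2_carrier) auto
  show ?case
  proof (cases "k = K")
    case False
    then have k: "k < K" using Suc by simp
    have "gF (Suc K) * ?X k = ?G * (?F * ?X k)"
      unfolding gF.simps using k Suc.prems by (intro as[OF cG cF cX]) auto
    also have "?F * ?X k = ?X k * ?F"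
      by (rule amp2_commute[OF X carr(2), symmetric]) (use k Suc.prems in auto)
    also have "?G * (?X k * ?F) = ?G * ?X k * ?F"
      using k Suc.prems by (intro as[OF cG cX cF, symmetric]) auto
    also have "?G * ?X k = ?X (Suc k) * ?G"
    proof -
      have "?X k = kron (op X (Suc K) k) (1\<^sub>m N)" "?X (Suc k) = kron (op X (Suc K) (Suc k)) (1\<^sub>m N)"
        using k Suc.prems by (auto intro!: op_Suc)
      moreover have "op X (Suc K) k \<in> sqm (N ^ Suc K)" "op X (Suc K) (Suc k) \<in> sqm (N ^ Suc K)"
        using k Suc.prems X by (auto intro!: amp2_carrier simp del: power_Suc)
      ultimately show ?thesis
        using Suc.IH[OF Suc.prems(1) k] kron_one_mult2[OF gF_carrier(1)[of K]] kron_one_mult2[OF _ gF_carrier(1)[of K]] by simp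
    qed
    also have "?X (Suc k) * ?G * ?F = ?X (Suc k) * gF (Suc K)"
      unfolding gF.simps using k by (intro as[OF cX cG cF]) auto
    finally show ?thesis .
  next
    case True
    then obtain L where L: "K = Suc L" using Suc.prems by (cases K) auto
    let ?F' = "op F (Suc (Suc K)) K" and ?G' = "kron (gF L) (1\<^sub>m (N ^ 2))"
    have cF': "?F' \<in> sqm ?n" by (rule op_carrier) (use L in auto)
    have eG: "kron (kron (gF L) (1\<^sub>m N)) (1\<^sub>m N) = ?G'" by (simp add: kron_assoc kron_one_one power2_eq_square)
    have cG': "?G' \<in> sqm ?n"
      unfolding eG[symmetric] L by (rule kron_one_carrier[OF kron_one_carrier[OF gF_carrier(1)]])
    have G: "?G = ?G' * ?F'"
    proof -
      have "op F (Suc (Suc L)) (Suc L) \<in> sqm (N ^ Suc (Suc L))" by (rule op_carrier) auto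
      then have "kron (gF (Suc L)) (1\<^sub>m N) = kron (kron (gF L) (1\<^sub>m N)) (1\<^sub>m N) * kron (op F (Suc (Suc L)) (Suc L)) (1\<^sub>m N)"
        unfolding gF.simps using kron_one_mult2[OF kron_one_carrier[OF gF_carrier(1)]] by simp
      also have "kron (op F (Suc (Suc L)) (Suc L)) (1\<^sub>m N) = ?F'"
        unfolding L by (rule op_Suc[symmetric]) auto
      finally show ?thesis by (simp only: L eG)
    qed
    have c: "?X K \<in> sqm ?n" "?X (Suc K) \<in> sqm ?n" using cX L by auto
    have 1: "?F' * ?F * ?X K = ?X (Suc K) * ?F' * ?F"
      using amp2_triple[OF carr(2) carr(2) X X carr(2) carr(2) tri, of K "Suc (Suc K)"] L by simp
    have 2: "?G' * ?X (Suc K) = ?X (Suc K) * ?G'"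
    proof -
      have e: "Suc (Suc K) = Suc L + 2" using L by simp
      show ?thesis unfolding e
        by (rule amp2_far_commute[OF X gF_carrier(1), symmetric]) (use L in auto)
    qed
    have "gF (Suc K) * ?X k = ?G' * (?F' * ?F * ?X K)"
      unfolding gF.simps G True as[OF cG' cF' cF] as[OF cG' mult_carrier_mat[OF cF' cF] c(1)] ..
    also have "\<dots> = ?G' * (?X (Suc K) * (?F' * ?F))" unfolding 1 as[OF c(2) cF' cF] ..
    also have "\<dots> = (?G' * ?X (Suc K)) * (?F' * ?F)" by (rule as[OF cG' c(2) mult_carrier_mat[OF cF' cF], symmetric])
    also have "\<dots> = ?X (Suc K) * (?G' * (?F' * ?F))" unfolding 2 by (rule as[OF c(2) cG' mult_carrier_mat[OF cF' cF]])
    also have "\<dots> = ?X (Suc k) * gF (Suc K)"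
      unfolding gF.simps G True as[OF cG' cF' cF] ..
    finally show ?thesis .
  qed
qed simp

lemmas gF_R = gF_op[OF carr(1) compat2]
lemmas gF_F = gF_op[OF carr(2) yb_F]

text \<open>The factor F_1 carries M_1 to M_2 by definition, and the later factors act beyond
  M_1.\<close>

lemma gF_M_1: "1 \<le> K \<Longrightarrow> M (Suc K) 2 * cmat (gF K) = cmat (gF K) * M (Suc K) 1"
proof (induction K rule: dec_induct)
  case base
  have e: "gF 1 = op F 2 1"
    using op_carrier[of F 1 2] by (simp add: kron_one_one power2_eq_square numeral_2_eq_2)
  have c: "cop F 2 1 \<in> sqm (N ^ 2)" "cop F' 2 1 \<in> sqm (N ^ 2)" "M 2 1 \<in> sqm (N ^ 2)"
    by (rule cop_carrier; simp)+ (rule M_carrier; simp)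
  note as = assoc_mult_mat[of _ "N ^ 2" "N ^ 2" _ "N ^ 2" _ "N ^ 2"]
  have "M 2 2 * cop F 2 1 = cop F 2 1 * M 2 1 * (cop F' 2 1 * cop F 2 1)"
    using M_rec[of 1 2] as[OF mult_carrier_mat[OF c(1,3)] c(2,1)] by (simp add: numeral_2_eq_2)
  also have "\<dots> = cop F 2 1 * M 2 1" using cop_inv(2)[of 1 2] c by simp
  finally show ?case unfolding e by (simp add: numeral_2_eq_2)
next
  case (step K)
  let ?n = "N ^ Suc (Suc K)"
  note as = assoc_mult_mat[of _ ?n ?n _ ?n _ ?n]
  let ?G = "cmat (kron (gF K) (1\<^sub>m N)) :: (nat \<times> nat) free mat" and ?F = "cop F (Suc (Suc K)) (Suc K)"
  have F: "op F (Suc (Suc K)) (Suc K) \<in> sqm ?n" by (rule op_carrier) auto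
  have c: "?G \<in> sqm ?n" "?F \<in> sqm ?n" "M (Suc (Suc K)) 1 \<in> sqm ?n" "M (Suc (Suc K)) 2 \<in> sqm ?n"
    using kron_one_carrier[OF gF_carrier(1)] F M_carrier[of 1 "Suc (Suc K)"] M_carrier[of 2 "Suc (Suc K)"] step
    by (auto simp del: power_Suc)
  have G: "cmat (gF (Suc K)) = ?G * ?F"
    unfolding gF.simps by (rule cmat_mult[OF kron_one_carrier[OF gF_carrier(1)] F])
  have m: "M (Suc K) 1 \<in> sqm (N ^ Suc K)" "M (Suc K) 2 \<in> sqm (N ^ Suc K)"
     "cmat (gF K) \<in> sqm (N ^ Suc K)"
    using M_carrier[of 1 "Suc K"] M_carrier[of 2 "Suc K"] gF_carrier step by (auto simp del: power_Suc)
  have 1: "M (Suc (Suc K)) 2 * ?G = ?G * M (Suc (Suc K)) 1"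
    using step M_Suc[of 1 "Suc K"] M_Suc[of 2 "Suc K"] kron_one_mult2[OF m(2,3)] kron_one_mult2[OF m(3,1)]
    by (simp add: cmat_kron cmat_one)
  have 2: "?F * M (Suc (Suc K)) 1 = M (Suc (Suc K)) 1 * ?F"
    by (rule cop_M_above[OF carr(2)]) (use step in auto)
  show ?case
    unfolding G as[OF c(1,2,3)] 2 as[OF c(4,1,2), symmetric] 1 by (rule as[OF c(1,3,2)])
qed

text \<open>The shift sends F_k to F_(k+1), and the copies arise from each other by conjugation with
  these, so the rule for one copy gives that for the next.\<close>

lemma gF_M: "1 \<le> k \<Longrightarrow> k \<le> K \<Longrightarrow> M (Suc K) (Suc k) * cmat (gF K) = cmat (gF K) * M (Suc K) k"
proof (induction k rule: dec_induct)
  case base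
  then show ?case using gF_M_1 by (simp add: numeral_2_eq_2)
next
  case (step k)
  let ?n = "N ^ Suc K"
  note as = assoc_mult_mat[of _ ?n ?n _ ?n _ ?n]
  let ?G = "cmat (gF K) :: (nat \<times> nat) free mat"
  let ?A = "cop F (Suc K) k" and ?A' = "cop F' (Suc K) k" and ?B = "cop F (Suc K) (Suc k)" and ?B' = "cop F' (Suc K) (Suc k)"
  have c: "?G \<in> sqm ?n" "?A \<in> sqm ?n" "?A' \<in> sqm ?n" "?B \<in> sqm ?n" "?B' \<in> sqm ?n"
     "M (Suc K) k \<in> sqm ?n" "M (Suc K) (Suc k) \<in> sqm ?n"
    using gF_carrier op_carrier[of F k "Suc K"] op_carrier[of F' k "Suc K"] op_carrier[of F "Suc k" "Suc K"] op_carrier[of F' "Suc k" "Suc K"]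
      M_carrier[of k "Suc K"] M_carrier[of "Suc k" "Suc K"] step by (auto simp del: power_Suc)
  have v: "?A * ?A' = 1\<^sub>m ?n" "?B' * ?B = 1\<^sub>m ?n" using cop_inv(1)[of k "Suc K"] cop_inv(2)[of "Suc k" "Suc K"] step by auto
  have oc: "gF K \<in> sqm ?n" "op F (Suc K) k \<in> sqm ?n" "op F (Suc K) (Suc k) \<in> sqm ?n"
    using gF_carrier op_carrier[of F k "Suc K"] op_carrier[of F "Suc k" "Suc K"] step by (auto simp del: power_Suc)
  have GA: "?G * ?A = ?B * ?G"
    unfolding cmat_mult[OF oc(1,2), symmetric] cmat_mult[OF oc(3,1), symmetric] using gF_F[of k K] step by simp
  have BG: "?B' * ?G = ?G * ?A'"
  proof -
    have "?B' * ?G = ?B' * (?G * (?A * ?A'))" using v c by simp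
    also have "\<dots> = ?B' * ((?G * ?A) * ?A')" unfolding as[OF c(1,2,3)] ..
    also have "\<dots> = (?B' * ?B) * (?G * ?A')" unfolding GA as[OF c(4,1,3)] as[OF c(5,4) mult_carrier_mat[OF c(1,3)]] ..
    also have "\<dots> = ?G * ?A'" using v c by simp
    finally show ?thesis .
  qed
  have M: "M (Suc K) (Suc (Suc k)) = ?B * M (Suc K) (Suc k) * ?B'" "M (Suc K) (Suc k) = ?A * M (Suc K) k * ?A'"
    using M_rec[of "Suc k" "Suc K"] M_rec[of k "Suc K"] step by auto
  have "M (Suc K) (Suc (Suc k)) * ?G = ?B * M (Suc K) (Suc k) * (?B' * ?G)"
    unfolding M(1) by (rule as[OF mult_carrier_mat[OF c(4,7)] c(5,1)])
  also have "\<dots> = ?B * ((M (Suc K) (Suc k) * ?G) * ?A')"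
    unfolding BG as[OF c(4,7) mult_carrier_mat[OF c(1,3)]] as[OF c(7,1,3)] ..
  also have "M (Suc K) (Suc k) * ?G = ?G * M (Suc K) k" using step by simp
  also have "?B * (?G * M (Suc K) k * ?A') = (?B * ?G) * (M (Suc K) k * ?A')"
    unfolding as[OF c(1,6,3)] as[OF c(4,1) mult_carrier_mat[OF c(6,3)]] ..
  also have "\<dots> = ?G * (?A * M (Suc K) k * ?A')"
    unfolding GA[symmetric] as[OF c(1,2) mult_carrier_mat[OF c(6,3)]] as[OF c(2,6,3)] ..
  finally show ?case unfolding M(2) .
qed

end

section \<open>Words as operators, shifted words, and iterated R-traces\<close>

section \<open>The representation on tensor powers\<close>

lemma mat_prod_simps [simp]: "mat_prod n [] = 1\<^sub>m n" "mat_prod n (A # As) = A * mat_prod n As"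
  by (simp_all add: mat_prod_def)

lemma mat_prod_carrier: "(\<And>A. A \<in> set As \<Longrightarrow> A \<in> sqm n) \<Longrightarrow> mat_prod n As \<in> sqm n"
  by (induction As) (auto intro!: mult_carrier_mat)

lemma mat_prod_append: "(\<And>A. A \<in> set As \<union> set Bs \<Longrightarrow> A \<in> sqm n) \<Longrightarrow>
    mat_prod n (As @ Bs) = mat_prod n As * mat_prod n Bs"
proof (induction As)
  case Nil
  then have "mat_prod n Bs \<in> sqm n" by (intro mat_prod_carrier) auto
  then show ?case by simp
next
  case (Cons A As)
  have c: "A \<in> sqm n" "mat_prod n As \<in> sqm n" "mat_prod n Bs \<in> sqm n"
    using Cons.prems by (auto intro!: mat_prod_carrier)
  have "mat_prod n (As @ Bs) = mat_prod n As * mat_prod n Bs" using Cons by auto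
  then show ?case using assoc_mult_mat[OF c] by simp
qed

text \<open>The representation on the free algebra, before passing to classes; \<open>rho\<close> is
  this map at an arbitrary representative.\<close>

definition rhof :: "nat \<Rightarrow> complex mat \<Rightarrow> nat \<Rightarrow> nat free \<Rightarrow> complex mat" where
  "rhof N R k x = mat (N ^ k) (N ^ k) (\<lambda>ab. lin (\<lambda>w. rho_word N R k (letters w) $$ ab) x)"

lemma rhof_carrier [simp]: "rhof N R k x \<in> sqm (N ^ k)"
  by (simp add: rhof_def)

lemma dim_rhof [simp]: "dim_row (rhof N R k x) = N ^ k" "dim_col (rhof N R k x) = N ^ k"
  by (simp_all add: rhof_def)

lemma rhof_index: "a < N ^ k \<Longrightarrow> b < N ^ k \<Longrightarrow> rhof N R k x $$ (a, b) = lin (\<lambda>w. rho_word N R k (letters w) $$ (a, b)) x"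
  by (simp add: rhof_def)

lemma rhof_add: "rhof N R k (x + y) = rhof N R k x + rhof N R k y"
  by (rule eq_matI) (simp_all add: rhof_index lin_add)

lemma rhof_const_mult: "rhof N R k (const c * x) = c \<cdot>\<^sub>m rhof N R k x"
  by (rule eq_matI) (simp_all add: rhof_index lin_const_mult)

lemma rhof_0: "rhof N R k 0 = 0\<^sub>m (N ^ k) (N ^ k)"
  by (rule eq_matI) (simp_all add: rhof_index)

lemma rho_eq_rhof: "rho N R k X = rhof N R k (representative X)"
  by (simp add: rho_def rhof_def lin_def Let_def)

lemma mat_trace_add: "A \<in> sqm n \<Longrightarrow> B \<in> sqm n \<Longrightarrow> mat_trace (A + B) = mat_trace A + mat_trace B"
  by (simp add: mat_trace_def sum.distrib)

lemma mat_trace_comm_central: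
  assumes "A \<in> sqm n" "B \<in> sqm n" "central_mat B"
  shows "mat_trace (A * B) = mat_trace (B * A)"
proof -
  have "mat_trace (A * B) = (\<Sum>i<n. \<Sum>k<n. A $$ (i, k) * B $$ (k, i))"
    using assms by (simp add: mat_trace_def mat_mult_index[of A n n B n] del: index_mult_mat(1))
  also have "\<dots> = (\<Sum>i<n. \<Sum>k<n. B $$ (k, i) * A $$ (i, k))"
    using assms by (intro sum.cong refl central_matD[symmetric]) auto
  also have "\<dots> = (\<Sum>k<n. \<Sum>i<n. B $$ (k, i) * A $$ (i, k))" by (rule sum.swap)
  also have "\<dots> = mat_trace (B * A)"
    using assms by (simp add: mat_trace_def mat_mult_index[of B n n A n] del: index_mult_mat(1))
  finally show ?thesis .
qed

lemma kron_pow_carrier: "A \<in> sqm N \<Longrightarrow> kron_pow A k \<in> sqm (N ^ k)"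
proof (induction k)
  case (Suc k)
  then show ?case using kron_carrier[of A N N "kron_pow A k"] by simp
qed simp

lemma kron_pow_add: "kron_pow A (j + k) = kron (kron_pow A j) (kron_pow A k)"
  by (induction j) (simp_all add: kron_assoc)

lemma kron_pow_Suc_right: "kron_pow A (Suc k) = kron (kron_pow A k) A"
  using kron_pow_add[of A k 1] by simp

abbreviation wordel :: "nat list \<Rightarrow> nat free" where
  "wordel w \<equiv> single (FWord w) 1"

lemma wordel_mult: "wordel u * wordel w = wordel (u @ w)"
  by (simp add: mult_single plus_fword_def)

lemma wordel_Nil: "wordel [] = 1"
  by (metis single_one zero_fword_def)

lemma wordel_single: "wordel [i] = gen i"
  by (simp add: gen_def)

lemma wordel_carrier: "wordel w \<in> hecke_free k \<longleftrightarrow> set w \<subseteq> {1..<k}"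
  by (simp add: free_carrier_iff hecke_gens_def)

lemma wordel_expand: "x = (\<Sum>w\<in>keys x. const (lookup x w) * wordel (letters w))"
  by (subst pm_expand) (simp add: const_single)

context r_matrix_pair
begin

abbreviation rw :: "nat \<Rightarrow> nat list \<Rightarrow> complex mat" where "rw \<equiv> rho_word N R"
abbreviation rh :: "nat \<Rightarrow> nat free \<Rightarrow> complex mat" where "rh \<equiv> rhof N R"

lemma rw_simps: "rw k [] = 1\<^sub>m (N ^ k)" "rw k (i # w) = op R k i * rw k w"
  by (simp_all add: rho_word_def)

lemma rw_carrier: "set w \<subseteq> {1..<k} \<Longrightarrow> rw k w \<in> sqm (N ^ k)"
  unfolding rho_word_def by (intro mat_prod_carrier) (auto intro!: op_carrier)

lemma rw_append: "set u \<subseteq> {1..<k} \<Longrightarrow> set w \<subseteq> {1..<k} \<Longrightarrow> rw k (u @ w) = rw k u * rw k w"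
  unfolding rho_word_def map_append by (intro mat_prod_append) (auto intro!: op_carrier)

lemma rh_mult: assumes x: "x \<in> hecke_free k" and y: "y \<in> hecke_free k"
  shows "rh k (x * y) = rh k x * rh k y"
proof (rule eq_matI)
  fix a b assume "a < dim_row (rh k x * rh k y)" "b < dim_col (rh k x * rh k y)"
  then have ab: "a < N ^ k" "b < N ^ k" by auto
  have sub: "set (letters w) \<subseteq> {1..<k}" if "w \<in> keys x \<union> keys y" for w
    using x y that by (auto simp: free_carrier_iff hecke_gens_def)
  have "rh k (x * y) $$ (a, b) = lin (\<lambda>u. lin (\<lambda>v. rw k (letters u @ letters v) $$ (a, b)) y) x"
    using ab by (simp add: rhof_index lin_mult)
  also have "\<dots> = lin (\<lambda>u. lin (\<lambda>v. \<Sum>c<N ^ k. rw k (letters u) $$ (a, c) * rw k (letters v) $$ (c, b)) y) x"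
  proof (intro lin_cong)
    fix u v assume "u \<in> keys x" "v \<in> keys y"
    then have uv: "set (letters u) \<subseteq> {1..<k}" "set (letters v) \<subseteq> {1..<k}" using sub by auto
    show "rw k (letters u @ letters v) $$ (a, b) = (\<Sum>c<N ^ k. rw k (letters u) $$ (a, c) * rw k (letters v) $$ (c, b))"
      unfolding rw_append[OF uv] by (rule mat_mult_index[OF rw_carrier[OF uv(1)] rw_carrier[OF uv(2)] ab])
  qed
  also have "\<dots> = (\<Sum>c<N ^ k. rh k x $$ (a, c) * rh k y $$ (c, b))"
    using ab by (simp add: rhof_index lin_fun_sum lin_fun_mult mult.commute[of _ "lin _ y"])
  also have "\<dots> = (rh k x * rh k y) $$ (a, b)"
    by (rule mat_mult_index[symmetric]) (use ab in auto)
  finally show "rh k (x * y) $$ (a, b) = (rh k x * rh k y) $$ (a, b)" .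
qed simp_all

lemma rh_wordel: "set w \<subseteq> {1..<k} \<Longrightarrow> rh k (wordel w) = rw k w"
  using rw_carrier[of w k] by (intro eq_matI) (auto simp: rhof_index)

lemma rh_1: "rh k 1 = 1\<^sub>m (N ^ k)"
  using rh_wordel[of "[]" k] by (simp add: wordel_Nil rw_simps)

lemma rh_gen: "1 \<le> i \<Longrightarrow> i < k \<Longrightarrow> rh k (gen i) = op R k i"
  using rh_wordel[of "[i]" k] op_carrier[of R i k] by (simp add: wordel_single rw_simps)

lemma rw_Suc: "set w \<subseteq> {1..<k} \<Longrightarrow> rw (Suc k) w = kron (rw k w) (1\<^sub>m N)"
proof (induction w)
  case Nil
  then show ?case by (simp add: rw_simps kron_one_one mult.commute)
next
  case (Cons i w)
  then show ?case using kron_one_mult2[OF op_carrier[of R i k] rw_carrier[of w k], of N]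
    by (simp add: rw_simps op_Suc)
qed

lemma rh_Suc: assumes x: "x \<in> hecke_free k" shows "rh (Suc k) x = kron (rh k x) (1\<^sub>m N)"
proof (rule eq_matI)
  fix a b assume "a < dim_row (kron (rh k x) (1\<^sub>m N))" "b < dim_col (kron (rh k x) (1\<^sub>m N))"
  then have ab: "a < N ^ k * N" "b < N ^ k * N" by auto
  note l = div_mod_less[OF ab(1)] div_mod_less[OF ab(2)]
  have "rh (Suc k) x $$ (a, b) = lin (\<lambda>w. rw (Suc k) (letters w) $$ (a, b)) x"
    using ab by (simp add: rhof_index mult.commute)
  also have "\<dots> = lin (\<lambda>w. 1\<^sub>m N $$ (a mod N, b mod N) * rw k (letters w) $$ (a div N, b div N)) x"
  proof (rule lin_cong)
    fix w assume "w \<in> keys x"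
    then have w: "set (letters w) \<subseteq> {1..<k}" using x by (auto simp: free_carrier_iff hecke_gens_def)
    show "rw (Suc k) (letters w) $$ (a, b) = 1\<^sub>m N $$ (a mod N, b mod N) * rw k (letters w) $$ (a div N, b div N)"
      unfolding rw_Suc[OF w] using rw_carrier[OF w] ab by (subst kron_index) (auto simp: mult.commute)
  qed
  also have "\<dots> = kron (rh k x) (1\<^sub>m N) $$ (a, b)"
    using l ab by (simp add: lin_fun_mult kron_index rhof_index)
  finally show "rh (Suc k) x $$ (a, b) = kron (rh k x) (1\<^sub>m N) $$ (a, b)" .
qed (simp_all add: mult.commute)

lemma rw_add: "set w \<subseteq> {1..<k} \<Longrightarrow> rw (k + j) w = kron (rw k w) (1\<^sub>m (N ^ j))"
proof (induction j)
  case (Suc j)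
  have "set w \<subseteq> {1..<k + j}" using Suc.prems by auto
  then have "rw (Suc (k + j)) w = kron (rw (k + j) w) (1\<^sub>m N)" by (rule rw_Suc)
  then show ?case using Suc by (simp add: kron_assoc kron_one_one mult.commute)
qed simp

lemma rw_shift: "set w \<subseteq> {1..<k} \<Longrightarrow> rw (Suc k) (map Suc w) * gF k = gF k * kron (rw k w) (1\<^sub>m N)"
proof (induction w)
  case Nil
  then show ?case using gF_carrier(1)[of k] by (simp add: rw_simps kron_one_one mult.commute)
next
  case (Cons i w)
  let ?n = "N ^ Suc k"
  note as = assoc_mult_mat[of _ ?n ?n _ ?n _ ?n]
  have i: "1 \<le> i" "i < k" "set w \<subseteq> {1..<k}" using Cons.prems by auto
  have sw: "set (map Suc w) \<subseteq> {1..<Suc k}" using i(3) by (auto simp: subset_iff)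
  have c: "op R (Suc k) (Suc i) \<in> sqm ?n" "op R (Suc k) i \<in> sqm ?n" "rw (Suc k) (map Suc w) \<in> sqm ?n"
     "gF k \<in> sqm ?n" "kron (rw k w) (1\<^sub>m N) \<in> sqm ?n"
    using i op_carrier[of R "Suc i" "Suc k"] op_carrier[of R i "Suc k"] rw_carrier[OF sw] rw_carrier[of w k]
    by (auto intro!: gF_carrier kron_one_carrier simp del: power_Suc)
  have "rw (Suc k) (map Suc (i # w)) * gF k = op R (Suc k) (Suc i) * (rw (Suc k) (map Suc w) * gF k)"
    unfolding list.map rw_simps by (rule as[OF c(1,3,4)])
  also have "\<dots> = (op R (Suc k) (Suc i) * gF k) * kron (rw k w) (1\<^sub>m N)"
    unfolding Cons.IH[OF i(3)] by (rule as[OF c(1,4,5), symmetric])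
  also have "\<dots> = gF k * (op R (Suc k) i * kron (rw k w) (1\<^sub>m N))"
    unfolding gF_R[OF i(1,2), symmetric] by (rule as[OF c(4,2,5)])
  also have "op R (Suc k) i * kron (rw k w) (1\<^sub>m N) = kron (rw k (i # w)) (1\<^sub>m N)"
    unfolding rw_simps op_Suc[OF i(1,2)] by (rule kron_one_mult2[OF op_carrier rw_carrier]) (use i in auto)
  finally show ?case .
qed

definition mpr :: "nat \<Rightarrow> nat list \<Rightarrow> (nat \<times> nat) free mat" where
  "mpr K ks = mat_prod (N ^ K) (map (M K) ks)"

lemma mpr_simps: "mpr K [] = 1\<^sub>m (N ^ K)" "mpr K (k # ks) = M K k * mpr K ks"
  by (simp_all add: mpr_def)

lemma mpr_carrier: "set ks \<subseteq> {1..K} \<Longrightarrow> mpr K ks \<in> sqm (N ^ K)"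
  unfolding mpr_def by (intro mat_prod_carrier) (auto intro!: M_carrier)

lemma mpr_append: "set ks \<union> set ls \<subseteq> {1..K} \<Longrightarrow> mpr K (ks @ ls) = mpr K ks * mpr K ls"
  unfolding mpr_def map_append by (intro mat_prod_append) (auto intro!: M_carrier)

lemma mpr_add: "set ks \<subseteq> {1..K} \<Longrightarrow> mpr (K + j) ks = kron (mpr K ks) (1\<^sub>m (N ^ j))"
proof (induction ks)
  case Nil
  then show ?case by (simp add: mpr_simps kron_one_one power_add)
next
  case (Cons k ks)
  then show ?case using kron_one_mult2[OF M_carrier[of k K] mpr_carrier[of ks K], of "N ^ j"]
    by (simp add: mpr_simps M_add)
qed

lemma mpr_shift: "set ks \<subseteq> {1..K} \<Longrightarrow> mpr (Suc K) (map Suc ks) * cmat (gF K) = cmat (gF K) * kron (mpr K ks) (1\<^sub>m N)"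
proof (induction ks)
  case Nil
  then show ?case using gF_carrier(1)[of K] by (simp add: mpr_simps kron_one_one mult.commute)
next
  case (Cons k ks)
  let ?n = "N ^ Suc K"
  let ?G = "cmat (gF K) :: (nat \<times> nat) free mat"
  note as = assoc_mult_mat[of _ ?n ?n _ ?n _ ?n]
  have k: "1 \<le> k" "k \<le> K" "set ks \<subseteq> {1..K}" using Cons.prems by auto
  have sks: "set (map Suc ks) \<subseteq> {1..Suc K}" using k(3) by (auto simp: subset_iff)
  have c: "M (Suc K) (Suc k) \<in> sqm ?n" "M (Suc K) k \<in> sqm ?n" "mpr (Suc K) (map Suc ks) \<in> sqm ?n"
     "?G \<in> sqm ?n" "kron (mpr K ks) (1\<^sub>m N) \<in> sqm ?n"
    using k M_carrier[of "Suc k" "Suc K"] M_carrier[of k "Suc K"] mpr_carrier[OF sks] mpr_carrier[of ks K]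
    by (auto intro!: gF_carrier kron_one_carrier simp del: power_Suc M_bar.simps)
  have "mpr (Suc K) (map Suc (k # ks)) * ?G = M (Suc K) (Suc k) * (mpr (Suc K) (map Suc ks) * ?G)"
    unfolding list.map mpr_simps by (rule as[OF c(1,3,4)])
  also have "\<dots> = (M (Suc K) (Suc k) * ?G) * kron (mpr K ks) (1\<^sub>m N)"
    unfolding Cons.IH[OF k(3)] by (rule as[OF c(1,4,5), symmetric])
  also have "\<dots> = ?G * (M (Suc K) k * kron (mpr K ks) (1\<^sub>m N))"
    unfolding gF_M[OF k(1,2)] by (rule as[OF c(4,2,5)])
  also have "M (Suc K) k * kron (mpr K ks) (1\<^sub>m N) = kron (mpr K (k # ks)) (1\<^sub>m N)"
    unfolding mpr_simps M_Suc[OF k(1,2)] by (rule kron_one_mult2[OF M_carrier mpr_carrier]) (use k in auto)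
  finally show ?case .
qed

text \<open>The R-trace over the last i of j + i tensor factors, taken one at a time; for j = 0 a
  matrix of size 1 is left.\<close>

fun ptrn :: "nat \<Rightarrow> nat \<Rightarrow> (nat \<times> nat) free mat \<Rightarrow> (nat \<times> nat) free mat" where
  "ptrn j 0 Z = Z"
| "ptrn j (Suc i) Z = ptrn j i (ptr N (cmat D) (N ^ (j + i)) Z)"

lemma cD: "cmat D \<in> sqm N" by simp

lemma R_trace_ptrn: "Z \<in> sqm (N ^ (j + i)) \<Longrightarrow> R_trace N R (j + i) Z = R_trace N R j (ptrn j i Z)"
proof (induction i arbitrary: Z)
  case (Suc i)
  have Z: "Z \<in> sqm (N ^ (j + i) * N)" using Suc.prems by (simp add: mult.commute)
  have "R_trace N R (Suc (j + i)) Z = mat_trace (kron (cmat (kron_pow D (j + i))) (cmat D) * Z)"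
    by (simp only: R_trace_def kron_pow_Suc_right cmat_kron)
  also have "\<dots> = R_trace N R (j + i) (ptr N (cmat D) (N ^ (j + i)) Z)"
    unfolding R_trace_def using kron_pow_carrier[OF D_op_carrier] by (intro mat_trace_ptr cD Z) simp
  also have "\<dots> = R_trace N R j (ptrn j i (ptr N (cmat D) (N ^ (j + i)) Z))" by (rule Suc.IH) simp
  finally show ?case by simp
qed simp

lemma ptrn_carrier: "Z \<in> sqm (N ^ (j + i)) \<Longrightarrow> ptrn j i Z \<in> sqm (N ^ j)"
  by (induction i arbitrary: Z) auto

lemma ptrn_mult_left:
  assumes W: "W \<in> sqm (N ^ j)"
  shows "Z \<in> sqm (N ^ (j + i)) \<Longrightarrow> ptrn j i (kron W (1\<^sub>m (N ^ i)) * Z) = W * ptrn j i Z"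
proof (induction i arbitrary: Z)
  case 0
  then show ?case by simp
next
  case (Suc i)
  have Z: "Z \<in> sqm (N ^ (j + i) * N)" using Suc.prems by (simp add: mult.commute)
  have c: "kron W (1\<^sub>m (N ^ i)) \<in> sqm (N ^ (j + i))"
    using kron_carrier[OF W one_carrier_mat[of "N ^ i"]] by (simp add: power_add)
  have e: "kron W (1\<^sub>m (N ^ Suc i)) = kron (kron W (1\<^sub>m (N ^ i))) (1\<^sub>m N)"
    by (simp add: kron_assoc kron_one_one mult.commute)
  show ?case unfolding ptrn.simps e ptr_mult_left[OF cD central_cmat c Z]
    by (rule Suc.IH) simp
qed

lemma braid_kernel_cmat:
  assumes "a < N" "c < N" "x < N" "y < N"
  shows "braid_kernel N (cmat D) (cmat F) (cmat F') a c x y = (if a = c then cmat D $$ (y, x) else (0 :: (nat \<times> nat) free))"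
proof -
  have "braid_kernel N (cmat D) (cmat F) (cmat F') a c x y = (const (braid_kernel N D F F' a c x y) :: (nat \<times> nat) free)"
    unfolding braid_kernel_def const_sum using assms carr pair_less
    by (intro sum.cong refl) (auto simp: const_mult)
  also have "braid_kernel N D F F' a c x y = (if a = c then D $$ (y, x) else 0)"
    by (rule braid_kernel_eq[OF carr(1) skew carr(2,4) F_inv(1,2) compat2 assms])
  finally show ?thesis using assms by simp
qed

text \<open>The factor of the shift next to Z is absorbed by the trace over the last tensor factor
  through \<open>ptr_conj\<close>; the other factors of the shift pass outside this trace. Iteration
  leaves the shift over the first j factors.\<close>

lemma ptrn_conj:
  "Z \<in> sqm (N ^ (j + i)) \<Longrightarrow>
    ptrn (Suc j) i (cmat (gF (j + i)) * kron Z (1\<^sub>m N) * cmat (gF' (j + i))) = cmat (gF j) * kron (ptrn j i Z) (1\<^sub>m N) * cmat (gF' j)"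
proof (induction i arbitrary: Z)
  case 0
  then show ?case by simp
next
  case (Suc i)
  define L where "L = j + i"
  let ?n = "N ^ Suc (Suc L)"
  note as = assoc_mult_mat[of _ ?n ?n _ ?n _ ?n]
  have Z: "Z \<in> sqm (N ^ Suc L)" "Z \<in> sqm (N ^ L * N)"
    using Suc.prems by (simp_all add: L_def mult.commute)
  let ?A = "cmat (gF L) :: (nat \<times> nat) free mat" and ?A' = "cmat (gF' L) :: (nat \<times> nat) free mat"
  let ?B = "cop F (Suc (Suc L)) (Suc L)" and ?B' = "cop F' (Suc (Suc L)) (Suc L)"
  have oB: "op F (Suc (Suc L)) (Suc L) \<in> sqm ?n" "op F' (Suc (Suc L)) (Suc L) \<in> sqm ?n"
    by (rule op_carrier; simp)+
  have cA: "?A \<in> sqm (N ^ Suc L)" "?A' \<in> sqm (N ^ Suc L)"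
    using gF_carrier by auto
  have c: "kron ?A (1\<^sub>m N) \<in> sqm ?n" "kron ?A' (1\<^sub>m N) \<in> sqm ?n" "?B \<in> sqm ?n" "?B' \<in> sqm ?n"
     "kron Z (1\<^sub>m N) \<in> sqm ?n"
    using oB kron_one_carrier[OF cA(1)] kron_one_carrier[OF cA(2)] kron_one_carrier[OF Z(1)] by (simp_all del: power_Suc)
  have G: "cmat (gF (Suc L)) = kron ?A (1\<^sub>m N) * ?B" "cmat (gF' (Suc L)) = ?B' * kron ?A' (1\<^sub>m N)"
    unfolding gF.simps gF'.simps cmat_mult[OF kron_one_carrier[OF gF_carrier(1)] oB(1)] cmat_mult[OF oB(2) kron_one_carrier[OF gF_carrier(2)]]
    by (simp_all only: cmat_kron cmat_one)
  have B: "?B = kron (1\<^sub>m (N ^ L)) (cmat F)" "?B' = kron (1\<^sub>m (N ^ L)) (cmat F')"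
    using amp_top[of N L F] amp_top[of N L F'] by (simp_all add: cmat_kron cmat_one)
  have cBZ: "?B * kron Z (1\<^sub>m N) * ?B' \<in> sqm ?n" using c by (auto intro!: mult_carrier_mat)
  have nn: "?n = N ^ Suc L * N" by simp
  have inner: "ptr N (cmat D) (N ^ Suc L) (?B * kron Z (1\<^sub>m N) * ?B') = kron (ptr N (cmat D) (N ^ L) Z) (1\<^sub>m N)"
  proof -
    have "ptr N (cmat D) (N ^ L * N) (kron (1\<^sub>m (N ^ L)) (cmat F) * kron Z (1\<^sub>m N) * kron (1\<^sub>m (N ^ L)) (cmat F')) = kron (ptr N (cmat D) (N ^ L) Z) (1\<^sub>m N)"
      by (rule ptr_conj[OF _ _ central_cmat Z(2) braid_kernel_cmat]) (use carr in auto)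
    then show ?thesis unfolding B by (simp add: mult.commute)
  qed
  have "cmat (gF (Suc L)) * kron Z (1\<^sub>m N) * cmat (gF' (Suc L)) = kron ?A (1\<^sub>m N) * ((?B * kron Z (1\<^sub>m N) * ?B') * kron ?A' (1\<^sub>m N))"
    unfolding G using c by (simp add: as)
  then have "ptr N (cmat D) (N ^ Suc L) (cmat (gF (Suc L)) * kron Z (1\<^sub>m N) * cmat (gF' (Suc L)))
     = ?A * (ptr N (cmat D) (N ^ Suc L) (?B * kron Z (1\<^sub>m N) * ?B') * ?A')"
    using ptr_mult_left[OF cD central_cmat cA(1), of "(?B * kron Z (1\<^sub>m N) * ?B') * kron ?A' (1\<^sub>m N)"]
      ptr_mult_right[OF cA(2), of "?B * kron Z (1\<^sub>m N) * ?B'" N "cmat D"] cBZ mult_carrier_mat[OF cBZ c(2)]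
    unfolding nn by simp
  also have "\<dots> = ?A * kron (ptr N (cmat D) (N ^ L) Z) (1\<^sub>m N) * ?A'"
    unfolding inner by (rule assoc_mult_mat[OF cA(1) kron_one_carrier[OF ptr_carrier] cA(2), symmetric])
  finally have "ptr N (cmat D) (N ^ Suc L) (cmat (gF (Suc L)) * kron Z (1\<^sub>m N) * cmat (gF' (Suc L)))
     = ?A * kron (ptr N (cmat D) (N ^ L) Z) (1\<^sub>m N) * ?A'" .
  then show ?case using Suc.IH[of "ptr N (cmat D) (N ^ L) Z"] by (simp add: L_def)
qed

end

section \<open>Juxtaposed blocks of tensor factors have independent R-traces\<close>

section \<open>Multiplicativity of the R-trace\<close>

lemma mult_smult_one_central:
  fixes A :: "'a::semiring_1 mat"
  assumes "A \<in> sqm n" "central_mat A"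
  shows "A * (c \<cdot>\<^sub>m 1\<^sub>m n) = c \<cdot>\<^sub>m A"
proof (rule eq_matI)
  fix i j assume "i < dim_row (c \<cdot>\<^sub>m A)" "j < dim_col (c \<cdot>\<^sub>m A)"
  then have ij: "i < n" "j < n" using assms by auto
  have "(A * (c \<cdot>\<^sub>m 1\<^sub>m n)) $$ (i, j) = (\<Sum>k<n. A $$ (i, k) * (c \<cdot>\<^sub>m 1\<^sub>m n) $$ (k, j))"
    by (rule mat_mult_index) (use assms ij in auto)
  also have "\<dots> = (\<Sum>k<n. if k = j then A $$ (i, j) * c else 0)" using ij by (intro sum.cong refl) auto
  also have "\<dots> = A $$ (i, j) * c" using ij by simp
  also have "\<dots> = (c \<cdot>\<^sub>m A) $$ (i, j)" using central_matD[OF assms(2)] assms(1) ij by auto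
  finally show "(A * (c \<cdot>\<^sub>m 1\<^sub>m n)) $$ (i, j) = (c \<cdot>\<^sub>m A) $$ (i, j)" .
qed (use assms in auto)

lemma smult_mult_mat:
  fixes A B :: "'a::semiring_1 mat"
  assumes "A \<in> sqm n" "B \<in> sqm n"
  shows "(c \<cdot>\<^sub>m A) * B = c \<cdot>\<^sub>m (A * B)"
  by (rule eq_matI) (use assms in \<open>auto simp: mat_mult_index[of _ n n B n] sum_distrib_left mult.assoc simp del: index_mult_mat(1)\<close>)

lemma kron_smult_one: "kron (c \<cdot>\<^sub>m 1\<^sub>m a) (1\<^sub>m b) = (c :: 'a::semiring_1) \<cdot>\<^sub>m 1\<^sub>m (a * b)"
proof -
  have "kron (c \<cdot>\<^sub>m 1\<^sub>m a) (1\<^sub>m b) = c \<cdot>\<^sub>m kron (1\<^sub>m a) (1\<^sub>m b)"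
    by (rule eq_matI) (auto simp: kron_index div_mod_less mult.assoc)
  then show ?thesis by (simp add: kron_one_one)
qed

context r_matrix_pair
begin

text \<open>The trace functional on representatives, with values in the free algebra on the
  generators. It respects products of juxtaposed blocks exactly, while its trace property holds
  modulo the relations.\<close>

definition t :: "nat \<Rightarrow> nat free \<Rightarrow> (nat \<times> nat) free" where
  "t k x = R_trace N R k (M_prod N F k * cmat (rh k x))"

lemma M_prod_mpr: "M_prod N F k = mpr k [1..<Suc k]"
  by (simp add: M_prod_def mpr_def)

lemma M_prod_carrier: "M_prod N F k \<in> sqm (N ^ k)"
  unfolding M_prod_mpr by (rule mpr_carrier) auto

lemma cD_pow: "cmat (kron_pow D k) \<in> sqm (N ^ k)"
  using kron_pow_carrier[OF D_op_carrier] by simp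

lemma t_add: "t k (x + y) = t k x + t k y"
proof -
  note c = M_prod_carrier[of k] cD_pow[of k]
  have "cmat (rh k (x + y)) = cmat (rh k x) + (cmat (rh k y) :: (nat \<times> nat) free mat)"
    by (rule eq_matI) (auto simp: rhof_add const_add)
  then show ?thesis unfolding t_def R_trace_def
    using c mult_add_distrib_mat[OF c(1), of "cmat (rh k x)" "N ^ k" "cmat (rh k y)"]
      mult_add_distrib_mat[OF c(2), of "M_prod N F k * cmat (rh k x)" "N ^ k" "M_prod N F k * cmat (rh k y)"]
      mat_trace_add[of "cmat (kron_pow D k) * (M_prod N F k * cmat (rh k x))" "N ^ k" "cmat (kron_pow D k) * (M_prod N F k * cmat (rh k y))"]
    by simp
qed

lemma mat_trace_smult: "mat_trace (c \<cdot>\<^sub>m A) = (c :: 'a::semiring_1) * mat_trace A" if "A \<in> sqm n"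
  using that by (simp add: mat_trace_def sum_distrib_left)

lemma t_const_mult: "t k (const c * x) = const c * t k x"
proof -
  note c = M_prod_carrier[of k] cD_pow[of k]
  let ?X = "cmat (rh k x) :: (nat \<times> nat) free mat"
  have X: "?X \<in> sqm (N ^ k)" by simp
  have sm: "A * (const c \<cdot>\<^sub>m B) = const c \<cdot>\<^sub>m (A * B)"
    if A: "A \<in> sqm (N ^ k)" and B: "B \<in> sqm (N ^ k)" for A B :: "(nat \<times> nat) free mat"
  proof (rule eq_matI)
    fix i j assume "i < dim_row (const c \<cdot>\<^sub>m (A * B))" "j < dim_col (const c \<cdot>\<^sub>m (A * B))"
    then have ij: "i < N ^ k" "j < N ^ k" using A B by auto
    have "(A * (const c \<cdot>\<^sub>m B)) $$ (i, j) = (\<Sum>l<N ^ k. A $$ (i, l) * (const c \<cdot>\<^sub>m B) $$ (l, j))"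
      by (rule mat_mult_index) (use A B ij in auto)
    also have "\<dots> = (\<Sum>l<N ^ k. const c * (A $$ (i, l) * B $$ (l, j)))"
    proof (intro sum.cong refl)
      fix l assume "l \<in> {..<N ^ k}"
      then have "(const c \<cdot>\<^sub>m B) $$ (l, j) = const c * B $$ (l, j)" using B ij by simp
      then show "A $$ (i, l) * (const c \<cdot>\<^sub>m B) $$ (l, j) = const c * (A $$ (i, l) * B $$ (l, j))"
        using const_commute[of c "A $$ (i, l)"] by (simp add: mult.assoc[symmetric])
    qed
    also have "\<dots> = const c * (A * B) $$ (i, j)"
      using mat_mult_index[OF A B ij] by (simp add: sum_distrib_left)
    also have "\<dots> = (const c \<cdot>\<^sub>m (A * B)) $$ (i, j)" using A B ij by simp
    finally show "(A * (const c \<cdot>\<^sub>m B)) $$ (i, j) = (const c \<cdot>\<^sub>m (A * B)) $$ (i, j)" .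
  qed (use A B in auto)
  have e: "cmat (rh k (const c * x)) = const c \<cdot>\<^sub>m ?X"
    by (rule eq_matI) (auto simp: rhof_const_mult const_mult)
  show ?thesis unfolding t_def R_trace_def e sm[OF c(1) X] sm[OF c(2) mult_carrier_mat[OF c(1) X]]
    by (rule mat_trace_smult[OF mult_carrier_mat[OF c(2) mult_carrier_mat[OF c(1) X]]])
qed

lemma t_0 [simp]: "t k 0 = 0"
  using t_const_mult[of k 0 0] by simp

lemma t_sum: "t k (sum f A) = (\<Sum>a\<in>A. t k (f a))"
  by (induction A rule: infinite_finite_induct) (simp_all add: t_add)

text \<open>The block on the factors j + 1 to j + i: copies of the generators followed by a word in
  R-matrices on the same factors. It is the second block of the product formula.\<close>

definition Y :: "nat \<Rightarrow> nat \<Rightarrow> nat list \<Rightarrow> (nat \<times> nat) free mat" where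
  "Y j i w = mpr (j + i) [Suc j..<Suc (j + i)] * cmat (rw (j + i) (map ((+) j) w))"

lemma shift_subset: "set w \<subseteq> {1..<i} \<Longrightarrow> set (map ((+) j) w) \<subseteq> {1..<j + i}" for w :: "nat list"
  unfolding set_map by (intro image_subsetI) (drule (1) subsetD, auto)

lemma Y_carrier: assumes "set w \<subseteq> {1..<i}" shows "Y j i w \<in> sqm (N ^ (j + i))"
proof -
  have "mpr (j + i) [Suc j..<Suc (j + i)] \<in> sqm (N ^ (j + i))"
    by (rule mpr_carrier) auto
  then show ?thesis unfolding Y_def using rw_carrier[OF shift_subset[OF assms, of j]] by (auto intro!: mult_carrier_mat)
qed

lemma Y_step:
  assumes w: "set w \<subseteq> {1..<i}"
  shows "Y (Suc j) i w = cmat (gF (j + i)) * kron (Y j i w) (1\<^sub>m N) * cmat (gF' (j + i))"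
proof -
  define K ks w' where "K = j + i" and "ks = [Suc j..<Suc K]" and "w' = map ((+) j) w"
  let ?n = "N ^ Suc K"
  note as = assoc_mult_mat[of _ ?n ?n _ ?n _ ?n]
  have w': "set w' \<subseteq> {1..<K}" using shift_subset[OF w] by (simp add: w'_def K_def)
  have sw: "set (map Suc w') \<subseteq> {1..<Suc K}" using w' by (auto simp: subset_iff)
  have ks: "set ks \<subseteq> {1..K}" "set (map Suc ks) \<subseteq> {1..Suc K}" by (auto simp: ks_def)
  have e: "map Suc ks = [Suc (Suc j)..<Suc (Suc K)]" "map Suc w' = map ((+) (Suc j)) w"
    unfolding ks_def map_Suc_upt by (simp_all add: w'_def)
  let ?G = "cmat (gF K) :: (nat \<times> nat) free mat" and ?G' = "cmat (gF' K) :: (nat \<times> nat) free mat"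
  let ?W = "cmat (rw (Suc K) (map Suc w')) :: (nat \<times> nat) free mat" and ?P = "mpr (Suc K) (map Suc ks)"
  let ?w = "kron (cmat (rw K w')) (1\<^sub>m N) :: (nat \<times> nat) free mat" and ?p = "kron (mpr K ks) (1\<^sub>m N)"
  have c: "?G \<in> sqm ?n" "?G' \<in> sqm ?n" "?W \<in> sqm ?n" "?P \<in> sqm ?n"
    "?w \<in> sqm ?n" "?p \<in> sqm ?n"
    using gF_carrier rw_carrier[OF sw] mpr_carrier[OF ks(2)] rw_carrier[OF w'] mpr_carrier[OF ks(1)]
    by (auto intro!: kron_one_carrier simp del: power_Suc)
  have GG: "?G * ?G' = 1\<^sub>m ?n" unfolding cmat_mult[OF gF_carrier, symmetric] gF_inv by (rule cmat_one)
  have WG: "?W * ?G = ?G * ?w"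
    unfolding cmat_mult[OF rw_carrier[OF sw] gF_carrier(1), symmetric] rw_shift[OF w']
    by (subst cmat_mult[OF gF_carrier(1) kron_one_carrier[OF rw_carrier[OF w']]]) (simp add: cmat_kron cmat_one)
  have PG: "?P * ?G = ?G * ?p" by (rule mpr_shift[OF ks(1)])
  have pw: "?p * ?w = kron (Y j i w) (1\<^sub>m N)"
  proof -
    have "cmat (rw K w') \<in> sqm (N ^ K)" using rw_carrier[OF w'] by simp
    then show ?thesis unfolding Y_def K_def[symmetric] w'_def[symmetric] ks_def[symmetric]
      by (rule kron_one_mult2[OF mpr_carrier[OF ks(1)]])
  qed
  have "Y (Suc j) i w = ?P * ?W" unfolding Y_def e by (simp add: K_def)
  also have "\<dots> = ?P * ?W * (?G * ?G')" unfolding GG using right_mult_one_mat[OF mult_carrier_mat[OF c(4,3)]] by simp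
  also have "\<dots> = (?P * (?W * ?G)) * ?G'"
    unfolding as[OF c(4,3) mult_carrier_mat[OF c(1,2)]] as[OF c(3,1,2), symmetric]
    by (rule as[OF c(4) mult_carrier_mat[OF c(3,1)] c(2), symmetric])
  also have "?P * (?W * ?G) = ?G * (?p * ?w)"
    unfolding WG as[OF c(4,1,5), symmetric] PG by (rule as[OF c(1,6,5)])
  finally show ?thesis unfolding pw by (simp only: K_def)
qed

text \<open>For j = 0 this is the definition of the functional. Each further shift is a conjugation
  by matrices of scalars, which commute with a multiple of the identity, so the result is the same
  at every position.\<close>

lemma ptrn_Y:
  assumes w: "set w \<subseteq> {1..<i}"
  shows "ptrn j i (Y j i w) = t i (wordel w) \<cdot>\<^sub>m 1\<^sub>m (N ^ j)"
proof (induction j)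
  case 0
  have Y0: "Y 0 i w = M_prod N F i * cmat (rh i (wordel w))"
  proof -
    have "map ((+) 0) w = w" by (induction w) auto
    then show ?thesis unfolding Y_def M_prod_mpr rh_wordel[OF w] by simp
  qed
  have c: "Y 0 i w \<in> sqm (N ^ (0 + i))" by (rule Y_carrier[OF w])
  have d: "ptrn 0 i (Y 0 i w) \<in> sqm 1" using ptrn_carrier[OF c] by simp
  have "t i (wordel w) = R_trace N R 0 (ptrn 0 i (Y 0 i w))"
    using R_trace_ptrn[OF c] by (simp add: t_def Y0)
  also have "\<dots> = ptrn 0 i (Y 0 i w) $$ (0, 0)"
    using d by (simp add: R_trace_def cmat_one mat_trace_def)
  finally show ?case using d by (intro eq_matI) auto
next
  case (Suc j)
  let ?c = "t i (wordel w)"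
  let ?G = "cmat (gF j) :: (nat \<times> nat) free mat" and ?G' = "cmat (gF' j) :: (nat \<times> nat) free mat"
  have c: "?G \<in> sqm (N ^ Suc j)" "?G' \<in> sqm (N ^ Suc j)"
    using gF_carrier by auto
  have GG: "?G * ?G' = 1\<^sub>m (N ^ Suc j)" unfolding cmat_mult[OF gF_carrier, symmetric] gF_inv by (rule cmat_one)
  have k: "kron (?c \<cdot>\<^sub>m 1\<^sub>m (N ^ j)) (1\<^sub>m N) = ?c \<cdot>\<^sub>m 1\<^sub>m (N ^ Suc j)"
    using kron_smult_one[of ?c "N ^ j" N] by (simp add: mult.commute)
  show ?case
    unfolding Y_step[OF w] ptrn_conj[OF Y_carrier[OF w]] Suc k mult_smult_one_central[OF c(1) central_cmat]
      smult_mult_mat[OF c] GG ..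
qed

lemma rw_mpr_commute:
  assumes "set u \<subseteq> {1..<j}" "set ks \<subseteq> {Suc j..K}" "j \<le> K"
  shows "cmat (rw K u) * mpr K ks = mpr K ks * cmat (rw K u)"
proof -
  let ?n = "N ^ K"
  note as = assoc_mult_mat[of _ ?n ?n _ ?n _ ?n]
  have 1: "cop R K i * mpr K ks = mpr K ks * cop R K i" if i: "1 \<le> i" "i < j" for i
    using assms(2)
  proof (induction ks)
    case Nil
    have "cop R K i \<in> sqm ?n" by (rule cop_carrier) (use i assms(3) in auto)
    then show ?case by (simp add: mpr_simps)
  next
    case (Cons k ks)
    then have k: "Suc j \<le> k" "k \<le> K" "set ks \<subseteq> {1..K}" "set ks \<subseteq> {Suc j..K}" by auto
    have c: "cop R K i \<in> sqm ?n" by (rule cop_carrier) (use i assms(3) in auto)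
    have d: "M K k \<in> sqm ?n" "mpr K ks \<in> sqm ?n"
      using k by (auto intro!: M_carrier mpr_carrier)
    have "cop R K i * mpr K (k # ks) = (cop R K i * M K k) * mpr K ks"
      unfolding mpr_simps by (rule as[OF c d, symmetric])
    also have "cop R K i * M K k = M K k * cop R K i"
      by (rule R_M_below) (use i k in auto)
    also have "M K k * cop R K i * mpr K ks = M K k * (mpr K ks * cop R K i)"
      unfolding Cons.IH[OF k(4), symmetric] by (rule as[OF d(1) c d(2)])
    also have "\<dots> = mpr K (k # ks) * cop R K i"
      unfolding mpr_simps by (rule as[OF d c, symmetric])
    finally show ?case .
  qed
  have P: "mpr K ks \<in> sqm ?n" by (rule mpr_carrier) (use assms(2) in auto)
  show ?thesis using assms(1)
  proof (induction u)
    case Nil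
    then show ?case using P by (simp add: rw_simps cmat_one)
  next
    case (Cons i u)
    then have i: "1 \<le> i" "i < j" "set u \<subseteq> {1..<j}" "set u \<subseteq> {1..<K}" using assms(3) by auto
    have o: "op R K i \<in> sqm ?n" by (rule op_carrier) (use i assms(3) in auto)
    have c: "cop R K i \<in> sqm ?n" "cmat (rw K u) \<in> sqm ?n" using o rw_carrier[OF i(4)] by simp_all
    have e: "cmat (rw K (i # u)) = cop R K i * cmat (rw K u)"
      unfolding rw_simps by (rule cmat_mult[OF o rw_carrier[OF i(4)]])
    have "cmat (rw K (i # u)) * mpr K ks = cop R K i * (mpr K ks * cmat (rw K u))"
      unfolding e Cons.IH[OF i(3), symmetric] by (rule as[OF c P])
    also have "\<dots> = mpr K ks * cmat (rw K (i # u))"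
      unfolding e as[OF c(1) P c(2), symmetric] 1[OF i(1,2)] by (rule as[OF P c])
    finally show ?case .
  qed
qed

text \<open>The R-matrices of the first block pass the copies of the second one, so the operator
  splits into a part on the first j factors times the shifted block. Tracing the shifted block first
  yields a right multiple of the identity.\<close>

lemma t_mult_word:
  assumes u: "set u \<subseteq> {1..<j}" and w: "set w \<subseteq> {1..<i}"
  shows "t (j + i) (wordel (u @ map ((+) j) w)) = t j (wordel u) * t i (wordel w)"
proof -
  define K w' where "K = j + i" and "w' = map ((+) j) w"
  let ?n = "N ^ K"
  note as = assoc_mult_mat[of _ ?n ?n _ ?n _ ?n]
  have w': "set w' \<subseteq> {1..<K}" using shift_subset[OF w] by (simp add: w'_def K_def)
  have uK: "set u \<subseteq> {1..<K}" using u by (auto simp: K_def)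
  let ?P = "mpr K [1..<Suc j]" and ?Q = "mpr K [Suc j..<Suc K]"
  let ?U = "cmat (rw K u) :: (nat \<times> nat) free mat" and ?W = "cmat (rw K w') :: (nat \<times> nat) free mat"
  have c: "?P \<in> sqm ?n" "?Q \<in> sqm ?n" "?U \<in> sqm ?n" "?W \<in> sqm ?n"
    using rw_carrier[OF uK] rw_carrier[OF w'] by (auto intro!: mpr_carrier simp: K_def)
  have M: "M_prod N F K = ?P * ?Q"
  proof -
    have "[1..<Suc K] = [1..<Suc j] @ [Suc j..<Suc K]"
      using upt_add_eq_append[of 1 "Suc j" i] by (simp add: K_def)
    then show ?thesis unfolding M_prod_mpr by (simp only:) (rule mpr_append, auto simp: K_def)
  qed
  have rr: "set (u @ w') \<subseteq> {1..<K}" using uK w' by auto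
  let ?Z = "mpr j [1..<Suc j] * cmat (rw j u)"
  have cj: "mpr j [1..<Suc j] \<in> sqm (N ^ j)" "cmat (rw j u) \<in> sqm (N ^ j)"
    using rw_carrier[OF u] by (auto intro!: mpr_carrier)
  have PU: "?P * ?U = kron ?Z (1\<^sub>m (N ^ i))"
  proof -
    have "?P = kron (mpr j [1..<Suc j]) (1\<^sub>m (N ^ i))" unfolding K_def by (rule mpr_add) auto
    moreover have "?U = kron (cmat (rw j u)) (1\<^sub>m (N ^ i))"
      unfolding K_def rw_add[OF u] by (simp add: cmat_kron cmat_one)
    ultimately show ?thesis using kron_one_mult2[OF cj] by simp
  qed
  have QU: "?U * ?Q = ?Q * ?U"
    by (rule rw_mpr_commute[OF u]) (auto simp: K_def)
  have "M_prod N F K * cmat (rh K (wordel (u @ w'))) = ?P * ?Q * (?U * ?W)"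
    unfolding M rh_wordel[OF rr] rw_append[OF uK w'] cmat_mult[OF rw_carrier[OF uK] rw_carrier[OF w']] ..
  also have "\<dots> = ?P * ((?Q * ?U) * ?W)"
    unfolding as[OF c(1,2) mult_carrier_mat[OF c(3,4)]] as[OF c(2,3,4)] ..
  also have "\<dots> = (?P * ?U) * (?Q * ?W)"
    unfolding QU[symmetric] as[OF c(3,2,4)] by (rule as[OF c(1,3) mult_carrier_mat[OF c(2,4)], symmetric])
  also have "\<dots> = kron ?Z (1\<^sub>m (N ^ i)) * Y j i w"
    unfolding PU Y_def by (simp only: K_def w'_def)
  finally have e: "M_prod N F K * cmat (rh K (wordel (u @ w'))) = kron ?Z (1\<^sub>m (N ^ i)) * Y j i w" .
  let ?c = "t i (wordel w)"
  have Z: "?Z \<in> sqm (N ^ j)" using cj by (rule mult_carrier_mat)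
  have kc: "kron ?Z (1\<^sub>m (N ^ i)) * Y j i w \<in> sqm (N ^ (j + i))"
    using kron_carrier[OF Z one_carrier_mat[of "N ^ i"]] Y_carrier[OF w, of j] by (auto simp: power_add intro: mult_carrier_mat)
  have "t K (wordel (u @ w')) = R_trace N R j (?Z * (?c \<cdot>\<^sub>m 1\<^sub>m (N ^ j)))"
    unfolding t_def[of K] e using R_trace_ptrn[OF kc] ptrn_mult_left[OF Z Y_carrier[OF w]]
    by (simp add: K_def ptrn_Y[OF w])
  also have "\<dots> = R_trace N R j ?Z * ?c"
  proof -
    let ?X = "cmat (kron_pow D j) :: (nat \<times> nat) free mat"
    have E: "(A * (?c \<cdot>\<^sub>m 1\<^sub>m (N ^ j))) $$ (a, b) = A $$ (a, b) * ?c"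
      if "A \<in> sqm (N ^ j)" "a < N ^ j" "b < N ^ j" for A a b
    proof -
      have "(A * (?c \<cdot>\<^sub>m 1\<^sub>m (N ^ j))) $$ (a, b) = (\<Sum>k<N ^ j. A $$ (a, k) * (?c \<cdot>\<^sub>m 1\<^sub>m (N ^ j)) $$ (k, b))"
        by (rule mat_mult_index) (use that in auto)
      also have "\<dots> = (\<Sum>k<N ^ j. if k = b then A $$ (a, b) * ?c else 0)" using that by (intro sum.cong refl) auto
      finally show ?thesis using that by simp
    qed
    have X: "?X \<in> sqm (N ^ j)" by (rule cD_pow)
    have "?X * (?Z * (?c \<cdot>\<^sub>m 1\<^sub>m (N ^ j))) = (?X * ?Z) * (?c \<cdot>\<^sub>m 1\<^sub>m (N ^ j))"
      by (rule assoc_mult_mat[OF X Z, symmetric]) auto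
    then show ?thesis unfolding R_trace_def mat_trace_def sum_distrib_right
      using X Z E[OF mult_carrier_mat[OF X Z]] by (simp del: index_mult_mat(1))
  qed
  also have "R_trace N R j ?Z = t j (wordel u)" unfolding t_def rh_wordel[OF u] M_prod_mpr ..
  finally show ?thesis by (simp only: K_def w'_def)
qed

lemma t_mult:
  assumes x: "x \<in> hecke_free j" and w: "set w \<subseteq> {1..<i}"
  shows "t (j + i) (x * wordel (map ((+) j) w)) = t j x * t i (wordel w)"
proof -
  have "x * wordel (map ((+) j) w) = (\<Sum>u\<in>keys x. const (lookup x u) * wordel (letters u @ map ((+) j) w))"
    by (subst wordel_expand[of x]) (simp only: sum_distrib_right mult.assoc wordel_mult)
  then have "t (j + i) (x * wordel (map ((+) j) w)) = (\<Sum>u\<in>keys x. const (lookup x u) * t (j + i) (wordel (letters u @ map ((+) j) w)))"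
    by (simp add: t_sum t_const_mult)
  also have "\<dots> = (\<Sum>u\<in>keys x. const (lookup x u) * (t j (wordel (letters u)) * t i (wordel w)))"
  proof (intro sum.cong refl)
    fix u assume "u \<in> keys x"
    then have "set (letters u) \<subseteq> {1..<j}" using x by (auto simp: free_carrier_iff hecke_gens_def)
    then show "const (lookup x u) * t (j + i) (wordel (letters u @ map ((+) j) w)) = const (lookup x u) * (t j (wordel (letters u)) * t i (wordel w))"
      by (simp only: t_mult_word[OF _ w])
  qed
  also have "\<dots> = t j (\<Sum>u\<in>keys x. const (lookup x u) * wordel (letters u)) * t i (wordel w)"
    by (simp add: t_sum t_const_mult sum_distrib_right mult.assoc)
  finally show ?thesis by (simp only: wordel_expand[symmetric])
qed

end

section \<open>The trace property modulo the relations of the quantum matrix algebra\<close>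

section \<open>Traciality of the R-trace\<close>

context r_matrix_pair
begin

abbreviation Fr :: "(nat \<times> nat) free set" where "Fr \<equiv> free_carrier (qma_gens N)"

text \<open>As a type, the free algebra has a generator for each pair of natural numbers, so it must
  be tracked that entries involve only the generators with indices below N.\<close>

definition fm :: "nat \<Rightarrow> (nat \<times> nat) free mat \<Rightarrow> bool" where
  "fm n A \<longleftrightarrow> A \<in> sqm n \<and> (\<forall>i<n. \<forall>j<n. A $$ (i, j) \<in> Fr)"

lemma fm_carrier: "fm n A \<Longrightarrow> A \<in> sqm n"
  by (simp add: fm_def)

lemma fm_mult: assumes "fm n A" "fm n B" shows "fm n (A * B)"
proof -
  have c: "A \<in> sqm n" "B \<in> sqm n" using assms by (auto simp: fm_def)
  have "(A * B) $$ (i, j) \<in> Fr" if "i < n" "j < n" for i j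
    unfolding mat_mult_index[OF c that]
    by (intro free_carrier_sum free_carrier_mult) (use assms that in \<open>auto simp: fm_def\<close>)
  then show ?thesis using mult_carrier_mat[OF c] by (simp add: fm_def)
qed

lemma fm_cmat: "A \<in> sqm n \<Longrightarrow> fm n (cmat A)"
  by (auto simp: fm_def)

lemma fm_kron_one: assumes "fm n A" shows "fm (n * m) (kron A (1\<^sub>m m))"
proof -
  have c: "A \<in> sqm n" using assms by (simp add: fm_def)
  have "kron A (1\<^sub>m m) $$ (i, j) \<in> Fr" if "i < n * m" "j < n * m" for i j
    using c that assms div_mod_less[OF that(1)] div_mod_less[OF that(2)] by (simp add: kron_index fm_def)
  then show ?thesis using kron_carrier[OF c one_carrier_mat[of m]] by (simp add: fm_def)
qed

lemma fm_one: "fm n (1\<^sub>m n)"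
  by (simp add: fm_def)

lemma fm_cop: "X \<in> {R, F, R', F'} \<Longrightarrow> 1 \<le> i \<Longrightarrow> i < k \<Longrightarrow> fm (N ^ k) (cop X k i)"
  by (rule fm_cmat[OF op_carrier])

lemma fm_M: "1 \<le> k \<Longrightarrow> k \<le> K \<Longrightarrow> fm (N ^ K) (M K k)"
proof (induction k rule: dec_induct)
  case base
  have g: "gen_mat N \<in> sqm N" by (simp add: gen_mat_def)
  have "fm N (gen_mat N)" by (auto simp: fm_def gen_mat_def qma_gens_def)
  then have "fm (N * N ^ (K - 1)) (kron (gen_mat N) (1\<^sub>m (N ^ (K - 1))))" by (rule fm_kron_one)
  moreover have "N * N ^ (K - 1) = N ^ K" using base by (cases K) auto
  ultimately show ?case using g by (simp add: amp_def)
next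
  case (step k)
  then show ?case unfolding M_rec[OF step(1)] by (intro fm_mult fm_cop) auto
qed

lemma qma_rels_subset: "qma_rels N R F \<subseteq> Fr"
proof -
  have R: "fm (N ^ 2) (cmat R)" using carr(1) by (auto simp: fm_def power2_eq_square)
  have MM: "fm (N ^ 2) (M 2 1 * M 2 2)" by (intro fm_mult fm_M) auto
  have sub: "(A - B) $$ (a, b) \<in> Fr" if "fm n A" "fm n B" "a < n" "b < n" for n A B a b
  proof -
    have "(A - B) $$ (a, b) = A $$ (a, b) - B $$ (a, b)"
      using that by (intro index_minus_mat) (auto simp: fm_def)
    then show ?thesis using that by (simp add: fm_def)
  qed
  show ?thesis using sub[OF fm_mult[OF R MM] fm_mult[OF MM R]]
    unfolding qma_rels_def Let_def by blast
qed

definition J :: "(nat \<times> nat) free set" where "J = rel_ideal (qma_gens N) (qma_rels N R F)"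

lemmas J_closed = rel_ideal_subset[OF qma_rels_subset, folded J_def]
  rel_ideal_0[OF qma_rels_subset, folded J_def]
  rel_ideal_add[OF qma_rels_subset, folded J_def]
  rel_ideal_mult[OF qma_rels_subset, folded J_def]
  rel_ideal_minus[OF qma_rels_subset, folded J_def]
  rel_ideal_diff[OF qma_rels_subset, folded J_def]
  rel_ideal_sum[OF qma_rels_subset, folded J_def]
  rel_ideal_rel[OF qma_rels_subset, folded J_def]

text \<open>Entrywise congruence modulo the defining relations; identities of the quantum matrix
  algebra are used in this form without computing with cosets.\<close>

definition mc :: "nat \<Rightarrow> (nat \<times> nat) free mat \<Rightarrow> (nat \<times> nat) free mat \<Rightarrow> bool" where
  "mc n A B \<longleftrightarrow> fm n A \<and> fm n B \<and> (\<forall>i<n. \<forall>j<n. A $$ (i, j) - B $$ (i, j) \<in> J)"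

lemma mc_mult_left: assumes "fm n C" "mc n A B" shows "mc n (C * A) (C * B)"
proof -
  have c: "C \<in> sqm n" "A \<in> sqm n" "B \<in> sqm n" using assms by (auto simp: mc_def fm_def)
  have "(C * A) $$ (i, j) - (C * B) $$ (i, j) \<in> J" if ij: "i < n" "j < n" for i j
  proof -
    have "(C * A) $$ (i, j) - (C * B) $$ (i, j) = (\<Sum>k<n. C $$ (i, k) * (A $$ (k, j) - B $$ (k, j)))"
      unfolding mat_mult_index[OF c(1,2) ij] mat_mult_index[OF c(1,3) ij] by (simp add: sum_subtractf right_diff_distrib)
    also have "\<dots> \<in> J" using assms ij by (intro J_closed(8) J_closed(5)) (auto simp: mc_def fm_def)
    finally show ?thesis .
  qed
  then show ?thesis using assms fm_mult by (simp add: mc_def)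
qed

lemma mc_mult_right: assumes "mc n A B" "fm n C" shows "mc n (A * C) (B * C)"
proof -
  have c: "C \<in> sqm n" "A \<in> sqm n" "B \<in> sqm n" using assms by (auto simp: mc_def fm_def)
  have "(A * C) $$ (i, j) - (B * C) $$ (i, j) \<in> J" if ij: "i < n" "j < n" for i j
  proof -
    have "(A * C) $$ (i, j) - (B * C) $$ (i, j) = (\<Sum>k<n. (A $$ (i, k) - B $$ (i, k)) * C $$ (k, j))"
      unfolding mat_mult_index[OF c(2,1) ij] mat_mult_index[OF c(3,1) ij] by (simp add: sum_subtractf left_diff_distrib)
    also have "\<dots> \<in> J" using assms ij by (intro J_closed(8) J_closed(4)) (auto simp: mc_def fm_def)
    finally show ?thesis .
  qed
  then show ?thesis using assms fm_mult by (simp add: mc_def)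
qed

lemma mc_kron_one: assumes "mc n A B" shows "mc (n * m) (kron A (1\<^sub>m m)) (kron B (1\<^sub>m m))"
proof -
  have c: "A \<in> sqm n" "B \<in> sqm n" using assms by (auto simp: mc_def fm_def)
  have "kron A (1\<^sub>m m) $$ (i, j) - kron B (1\<^sub>m m) $$ (i, j) \<in> J" if "i < n * m" "j < n * m" for i j
    using c that assms div_mod_less[OF that(1)] div_mod_less[OF that(2)] J_closed(2) by (simp add: kron_index mc_def)
  then show ?thesis using assms fm_kron_one by (simp add: mc_def)
qed

lemma mc_trace: assumes "mc n A B" shows "mat_trace A - mat_trace B \<in> J"
proof -
  have "mat_trace A - mat_trace B = (\<Sum>i<n. A $$ (i, i) - B $$ (i, i))"
    using assms by (auto simp: mat_trace_def mc_def fm_def sum_subtractf)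
  also have "\<dots> \<in> J" using assms by (intro J_closed(8)) (auto simp: mc_def)
  finally show ?thesis .
qed

lemma R_MM_2: "mc (N ^ 2) (cop R 2 1 * (M 2 1 * M 2 2)) (M 2 1 * M 2 2 * cop R 2 1)"
proof -
  have e: "cop R 2 1 = cmat R" by (simp add: amp_def)
  have R: "fm (N ^ 2) (cmat R)" using carr(1) by (auto simp: fm_def power2_eq_square)
  have MM: "fm (N ^ 2) (M 2 1 * M 2 2)" by (intro fm_mult fm_M) auto
  note c = fm_mult[OF R MM] fm_mult[OF MM R]
  have "(cmat R * (M 2 1 * M 2 2)) $$ (i, j) - (M 2 1 * M 2 2 * cmat R) $$ (i, j) \<in> J" if ij: "i < N ^ 2" "j < N ^ 2" for i j
  proof -
    have "(cmat R * (M 2 1 * M 2 2) - M 2 1 * M 2 2 * cmat R) $$ (i, j) \<in> qma_rels N R F"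
      unfolding qma_rels_def Let_def using ij by blast
    moreover have "(cmat R * (M 2 1 * M 2 2) - M 2 1 * M 2 2 * cmat R) $$ (i, j) = (cmat R * (M 2 1 * M 2 2)) $$ (i, j) - (M 2 1 * M 2 2 * cmat R) $$ (i, j)"
      using fm_carrier[OF c(1)] fm_carrier[OF c(2)] ij by (intro index_minus_mat) auto
    ultimately show ?thesis using J_closed(9) by metis
  qed
  then show ?thesis unfolding e mc_def using c by simp
qed

text \<open>With H = F_k F_(k+1) one has M_(k+1) M_(k+2) = H M_k M_(k+1) H^(-1) and R_(k+1) H = H
  R_k, so conjugation by H moves the defining relation one position further.\<close>

lemma R_MM: "1 \<le> k \<Longrightarrow> Suc k \<le> K \<Longrightarrow> mc (N ^ K) (cop R K k * (M K k * M K (Suc k))) (M K k * M K (Suc k) * cop R K k)"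
proof (induction k rule: dec_induct)
  case base
  define d where "d = K - 2"
  have K: "K = 2 + d" using base by (simp add: d_def)
  have c: "cop R 2 1 \<in> sqm (N ^ 2)" "M 2 1 \<in> sqm (N ^ 2)" "M 2 2 \<in> sqm (N ^ 2)"
    by (rule cop_carrier; simp) (rule M_carrier; simp)+
  have e: "cop R K 1 = kron (cop R 2 1) (1\<^sub>m (N ^ d))" "M K 1 = kron (M 2 1) (1\<^sub>m (N ^ d))" "M K 2 = kron (M 2 2) (1\<^sub>m (N ^ d))"
    unfolding K using op_add[of 1 2 d R] M_add[of 1 2 d] M_add[of 2 2 d] by (simp_all add: cmat_kron cmat_one del: M_bar.simps)
  have 2: "Suc 1 = (2::nat)" by simp
  have "mc (N ^ 2 * N ^ d) (kron (cop R 2 1 * (M 2 1 * M 2 2)) (1\<^sub>m (N ^ d))) (kron (M 2 1 * M 2 2 * cop R 2 1) (1\<^sub>m (N ^ d)))"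
    by (rule mc_kron_one[OF R_MM_2])
  then show ?case
    unfolding 2 e kron_one_mult2[OF c(2,3)] kron_one_mult2[OF c(1) mult_carrier_mat[OF c(2,3)]] kron_one_mult2[OF mult_carrier_mat[OF c(2,3)] c(1)]
    by (simp only: K power_add)
next
  case (step k)
  let ?n = "N ^ K"
  note as = assoc_mult_mat[of _ ?n ?n _ ?n _ ?n]
  let ?A = "cop F K k" and ?A' = "cop F' K k" and ?B = "cop F K (Suc k)" and ?B' = "cop F' K (Suc k)"
  let ?M0 = "M K k" and ?M1 = "M K (Suc k)" and ?M2 = "M K (Suc (Suc k))" and ?R = "cop R K k" and ?R1 = "cop R K (Suc k)"
  have f: "fm ?n ?A" "fm ?n ?A'" "fm ?n ?B" "fm ?n ?B'" "fm ?n ?M0" "fm ?n ?M1" "fm ?n ?M2" "fm ?n ?R" "fm ?n ?R1"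
    using step by (auto intro!: fm_cop fm_M simp del: M_bar.simps)
  note c = f[THEN fm_carrier]
  have v: "?A * ?A' = 1\<^sub>m ?n" "?A' * ?A = 1\<^sub>m ?n" "?B * ?B' = 1\<^sub>m ?n" "?B' * ?B = 1\<^sub>m ?n"
    using cop_inv[of k K] cop_inv[of "Suc k" K] step by auto
  have AM2: "?A * ?M2 = ?M2 * ?A" by (rule F_M_below) (use step in auto)
  have A'M2: "?A' * ?M2 = ?M2 * ?A'"
  proof -
    have "?A' * ?M2 = ?A' * (?M2 * (?A * ?A'))" using v c by (simp del: M_bar.simps)
    also have "\<dots> = ?A' * ((?A * ?M2) * ?A')" unfolding AM2 as[OF c(7,1,2)] ..
    also have "\<dots> = (?A' * ?A) * (?M2 * ?A')" unfolding as[OF c(1,7,2)] as[OF c(2,1) mult_carrier_mat[OF c(7,2)]] ..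
    also have "\<dots> = ?M2 * ?A'" using v c by (simp del: M_bar.simps)
    finally show ?thesis .
  qed
  have BM0: "?B * ?M0 = ?M0 * ?B" by (rule cop_M_above[OF carr(2)]) (use step in auto)
  have M1: "?M1 = ?A * ?M0 * ?A'" and M2: "?M2 = ?B * ?M1 * ?B'"
    using M_rec[of k K] M_rec[of "Suc k" K] step by auto
  define H H' P where "H = ?A * ?B" and "H' = ?B' * ?A'" and "P = ?M0 * ?M1"
  have fH: "fm ?n H" "fm ?n H'" "fm ?n P" unfolding H_def H'_def P_def by (intro fm_mult f)+
  note cH = fH[THEN fm_carrier]
  have "?M1 * ?M2 = ?A * ?M0 * (?A' * ?M2)"
    by (subst (1) M1) (rule as[OF mult_carrier_mat[OF c(1,5)] c(2,7)])
  also have "\<dots> = ?A * ?M0 * (?M2 * ?A')" unfolding A'M2 ..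
  also have "\<dots> = ?A * ?M0 * ((?B * ?M1 * ?B') * ?A')" by (subst (1) M2) (rule refl)
  also have "\<dots> = ?A * ((?M0 * ?B) * (?M1 * H'))"
    unfolding H'_def using c by (simp add: as del: M_bar.simps)
  also have "\<dots> = H * P * H'"
    unfolding BM0[symmetric] H_def P_def using c cH(2) by (simp add: as del: M_bar.simps)
  finally have MM: "?M1 * ?M2 = H * P * H'" .
  have HR: "?R1 * H = H * ?R"
    using cop_triple[OF carr(2) carr(2) carr(1) carr(1) carr(2) carr(2) compat2, of k K] step
    unfolding H_def by (simp add: as[OF c(9,1,3)])
  have HH: "H * H' = 1\<^sub>m ?n"
  proof -
    have "H * H' = ?A * ((?B * ?B') * ?A')"
      unfolding H_def H'_def as[OF c(1,3) mult_carrier_mat[OF c(4,2)]] as[OF c(3,4,2)] ..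
    then show ?thesis using v c by simp
  qed
  have H'H: "H' * H = 1\<^sub>m ?n"
  proof -
    have "H' * H = ?B' * ((?A' * ?A) * ?B)"
      unfolding H_def H'_def as[OF c(4,2) mult_carrier_mat[OF c(1,3)]] as[OF c(2,1,3)] ..
    then show ?thesis using v c by simp
  qed
  have H'R: "?R * H' = H' * ?R1"
  proof -
    have "H' * ?R1 = H' * (?R1 * (H * H'))" using HH c by simp
    also have "\<dots> = H' * ((H * ?R) * H')" unfolding HR[symmetric] as[OF c(9) cH(1,2)] ..
    also have "\<dots> = (H' * H) * (?R * H')" unfolding as[OF cH(1) c(8) cH(2)] as[OF cH(2,1) mult_carrier_mat[OF c(8) cH(2)]] ..
    also have "\<dots> = ?R * H'" using H'H c cH by simp
    finally show ?thesis ..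
  qed
  have IH: "mc ?n (?R * P) (P * ?R)" using step by (simp add: P_def)
  have "?R1 * (?M1 * ?M2) = H * (?R * P) * H'"
    unfolding MM as[OF cH(1,3,2)] as[OF c(9) cH(1) mult_carrier_mat[OF cH(3,2)], symmetric] HR
      as[OF cH(1) mult_carrier_mat[OF c(8) cH(3)] cH(2)] as[OF c(8) cH(3,2)]
    by (rule as[OF cH(1) c(8) mult_carrier_mat[OF cH(3,2)]])
  also have "mc ?n \<dots> (H * (P * ?R) * H')" by (intro mc_mult_right mc_mult_left IH fH)
  also have "H * (P * ?R) * H' = H * P * (?R * H')"
    unfolding as[OF cH(1) mult_carrier_mat[OF cH(3) c(8)] cH(2)] as[OF cH(3) c(8) cH(2)]
    by (rule as[OF cH(1,3) mult_carrier_mat[OF c(8) cH(2)], symmetric])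
  also have "\<dots> = ?M1 * ?M2 * ?R1"
    unfolding MM H'R by (rule as[OF mult_carrier_mat[OF cH(1,3)] cH(2) c(9), symmetric])
  finally show ?case .
qed

lemma M_prod_Suc: "M_prod N F (Suc k) = kron (M_prod N F k) (1\<^sub>m N) * M (Suc k) (Suc k)"
proof -
  have s: "[1..<Suc (Suc k)] = [1..<Suc k] @ [Suc k]" by simp
  have "mpr (Suc k) [1..<Suc (Suc k)] = mpr (Suc k) [1..<Suc k] * mpr (Suc k) [Suc k]"
    unfolding s by (rule mpr_append) auto
  also have "mpr (Suc k) [1..<Suc k] = kron (mpr k [1..<Suc k]) (1\<^sub>m N)"
  proof -
    have "set [1..<Suc k] \<subseteq> {1..k}" by auto
    from mpr_add[OF this, of 1] show ?thesis by (simp del: upt_Suc)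
  qed
  also have "mpr (Suc k) [Suc k] = M (Suc k) (Suc k)"
    using M_carrier[of "Suc k" "Suc k"] by (simp add: mpr_simps del: M_bar.simps)
  finally show ?thesis by (simp only: M_prod_mpr)
qed

lemma fm_M_prod: "fm (N ^ k) (M_prod N F k)"
proof (induction k)
  case 0
  then show ?case by (simp add: M_prod_mpr mpr_simps fm_one)
next
  case (Suc k)
  have "fm (N ^ k * N) (kron (M_prod N F k) (1\<^sub>m N))" by (rule fm_kron_one[OF Suc])
  then show ?case unfolding M_prod_Suc by (intro fm_mult fm_M) (auto simp: mult.commute)
qed

text \<open>R_i commutes with the copies beyond i + 1, passes the product of the copies i and i + 1
  by the relation, and acts beyond the support of the earlier copies.\<close>

lemma R_M_prod: "1 \<le> i \<Longrightarrow> i < k \<Longrightarrow> mc (N ^ k) (cop R k i * M_prod N F k) (M_prod N F k * cop R k i)"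
proof (induction k)
  case (Suc k)
  let ?n = "N ^ Suc k"
  note as = assoc_mult_mat[of _ ?n ?n _ ?n _ ?n]
  let ?P = "kron (M_prod N F k) (1\<^sub>m N)" and ?M = "M (Suc k) (Suc k)" and ?R = "cop R (Suc k) i"
  have fP: "fm ?n ?P" using fm_kron_one[OF fm_M_prod[of k], of N] by (simp add: mult.commute)
  have fM: "fm ?n ?M" by (rule fm_M) auto
  have fR: "fm ?n ?R" by (rule fm_cop) (use Suc.prems in auto)
  note c = fP[THEN fm_carrier] fM[THEN fm_carrier] fR[THEN fm_carrier]
  show ?case
  proof (cases "i = k")
    case False
    then have ik: "i < k" using Suc.prems by simp
    have cR: "cop R k i \<in> sqm (N ^ k)" by (rule cop_carrier) (use ik Suc.prems in auto)
    have RP: "mc ?n (?R * ?P) (?P * ?R)"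
    proof -
      have "mc (N ^ k * N) (kron (cop R k i * M_prod N F k) (1\<^sub>m N)) (kron (M_prod N F k * cop R k i) (1\<^sub>m N))"
        by (rule mc_kron_one[OF Suc.IH[OF Suc.prems(1) ik]])
      then show ?thesis
        unfolding cop_Suc[OF Suc.prems(1) ik] kron_one_mult2[OF cR M_prod_carrier] kron_one_mult2[OF M_prod_carrier cR]
        by (simp add: mult.commute)
    qed
    have RM: "?R * ?M = ?M * ?R" by (rule R_M_below) (use Suc.prems ik in auto)
    have "?R * M_prod N F (Suc k) = (?R * ?P) * ?M" unfolding M_prod_Suc by (rule as[OF c(3,1,2), symmetric])
    also have "mc ?n \<dots> ((?P * ?R) * ?M)" by (rule mc_mult_right[OF RP fM])
    also have "(?P * ?R) * ?M = M_prod N F (Suc k) * ?R"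
      unfolding M_prod_Suc as[OF c(1,3,2)] RM by (rule as[OF c(1,2,3), symmetric])
    finally show ?thesis .
  next
    case True
    then obtain l where l: "k = Suc l" using Suc.prems by (cases k) auto
    let ?Q = "kron (M_prod N F l) (1\<^sub>m (N ^ 2))" and ?M' = "M (Suc k) k"
    have nn: "?n = N ^ l * N ^ 2" by (simp add: l power2_eq_square)
    have fQ: "fm ?n ?Q" unfolding nn by (rule fm_kron_one[OF fm_M_prod])
    have fM': "fm ?n ?M'" by (rule fm_M) (use l in auto)
    note d = fQ[THEN fm_carrier] fM'[THEN fm_carrier]
    have P: "?P = ?Q * ?M'"
    proof -
      have "fm (N ^ l * N) (kron (M_prod N F l) (1\<^sub>m N))" by (rule fm_kron_one[OF fm_M_prod])
      then have a: "kron (M_prod N F l) (1\<^sub>m N) \<in> sqm (N ^ k)" by (simp add: l fm_def mult.commute)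
      have b: "M k k \<in> sqm (N ^ k)" by (rule M_carrier) (use l in auto)
      have "?P = kron (kron (M_prod N F l) (1\<^sub>m N)) (1\<^sub>m N) * kron (M k k) (1\<^sub>m N)"
        using kron_one_mult2[OF a b, of N] by (simp only: l M_prod_Suc)
      then show ?thesis using M_Suc[of k k] l by (simp add: kron_assoc kron_one_one power2_eq_square del: M_bar.simps)
    qed
    have RQ: "?R * ?Q = ?Q * ?R"
    proof -
      have "Suc k = l + 2" using l by simp
      then show ?thesis using cop_above_commute[OF carr(1) M_prod_carrier[of l], of i 2] True l by simp
    qed
    have MM: "M_prod N F (Suc k) = ?Q * (?M' * ?M)" unfolding M_prod_Suc P by (rule as[OF d c(2)])
    have k1: "1 \<le> k" using l by simp
    have "?R * M_prod N F (Suc k) = ?Q * (?R * (?M' * ?M))"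
      unfolding MM as[OF c(3) d(1) mult_carrier_mat[OF d(2) c(2)], symmetric] RQ
      by (rule as[OF d(1) c(3) mult_carrier_mat[OF d(2) c(2)]])
    also have "mc ?n \<dots> (?Q * (?M' * ?M * ?R))"
      using R_MM[OF k1 order_refl] True by (intro mc_mult_left fQ) simp
    also have "?Q * (?M' * ?M * ?R) = M_prod N F (Suc k) * ?R"
      unfolding MM by (rule as[OF d(1) mult_carrier_mat[OF d(2) c(2)] c(3), symmetric])
    finally show ?thesis .
  qed
qed simp

lemma op_kron_pow: assumes "1 \<le> i" "i < k" shows "op R k i * kron_pow D k = kron_pow D k * op R k i"
proof -
  define a b where "a = i - 1" and "b = k - 1 - i"
  have k: "k = a + 2 + b" and i: "i = Suc a" using assms by (simp_all add: a_def b_def)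
  have e: "kron_pow D k = kron (kron (kron_pow D a) (kron D D)) (kron_pow D b)"
    unfolding k kron_pow_add by (simp add: numeral_2_eq_2)
  have o: "op R k i = kron (kron (1\<^sub>m (N ^ a)) R) (1\<^sub>m (N ^ b))"
    by (simp add: amp_def k i)
  have DD: "kron D D \<in> sqm (N * N)" by (rule kron_carrier) simp_all
  have ca: "kron_pow D a \<in> sqm (N ^ a)" "kron_pow D b \<in> sqm (N ^ b)"
    by (rule kron_pow_carrier; simp)+
  have RD: "R * kron D D = kron D D * R"
    by (rule D_op_braid[OF carr(1) skew carr(3) R_inv yb_R D'_inv])
  have 1: "kron (1\<^sub>m (N ^ a)) R * kron (kron_pow D a) (kron D D) = kron (kron_pow D a) (kron D D) * kron (1\<^sub>m (N ^ a)) R"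
    using kron_mult[OF one_carrier_mat ca(1) carr(1) DD] kron_mult[OF ca(1) one_carrier_mat DD carr(1)] ca RD by simp
  note k1 = kron_carrier[OF one_carrier_mat[of "N ^ a"] carr(1)] and k2 = kron_carrier[OF ca(1) DD]
  show ?thesis unfolding e o
    using kron_mult[OF k1 k2 one_carrier_mat ca(2)] kron_mult[OF k2 k1 ca(2) one_carrier_mat] ca 1 by simp
qed

text \<open>Cyclicity of the ordinary trace is available for R, whose entries are scalars. After
  that R passes the weight D on all factors exactly, and the product of the copies modulo the
  relations.\<close>

lemma t_gen_commute:
  assumes y: "y \<in> hecke_free k" and i: "1 \<le> i" "i < k"
  shows "t k (gen i * y) - t k (y * gen i) \<in> J"
proof -
  let ?n = "N ^ k"
  note as = assoc_mult_mat[of _ ?n ?n _ ?n _ ?n]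
  let ?K = "cmat (kron_pow D k) :: (nat \<times> nat) free mat" and ?P = "M_prod N F k" and ?R = "cop R k i"
    and ?Z = "cmat (rh k y) :: (nat \<times> nat) free mat"
  have o: "op R k i \<in> sqm ?n" by (rule op_carrier) (use i in auto)
  have kp: "kron_pow D k \<in> sqm ?n" by (rule kron_pow_carrier) simp
  have f: "fm ?n ?K" "fm ?n ?P" "fm ?n ?R" "fm ?n ?Z"
    using fm_cmat[OF kp] fm_M_prod fm_cmat[OF o] fm_cmat[OF rhof_carrier] by auto
  note c = f[THEN fm_carrier]
  have g: "gen i \<in> hecke_free k" by (rule gen_hecke_free[OF i])
  have KR: "?R * ?K = ?K * ?R"
    unfolding cmat_mult[OF o kp, symmetric] cmat_mult[OF kp o, symmetric] by (simp only: op_kron_pow[OF i])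
  have 1: "t k (gen i * y) = mat_trace (?K * (?P * ?R) * ?Z)"
    unfolding t_def R_trace_def rh_mult[OF g y] rh_gen[OF i] cmat_mult[OF o rhof_carrier] using c by (simp add: as)
  have "t k (y * gen i) = mat_trace ((?K * (?P * ?Z)) * ?R)"
    unfolding t_def R_trace_def rh_mult[OF y g] rh_gen[OF i] cmat_mult[OF rhof_carrier o] using c by (simp add: as)
  also have "\<dots> = mat_trace (?R * (?K * (?P * ?Z)))"
    by (rule mat_trace_comm_central[OF _ c(3) central_cmat]) (use c in \<open>auto intro!: mult_carrier_mat\<close>)
  also have "?R * (?K * (?P * ?Z)) = (?R * ?K) * (?P * ?Z)"
    by (rule as[OF c(3,1) mult_carrier_mat[OF c(2,4)], symmetric])
  also have "\<dots> = ?K * (?R * ?P) * ?Z" unfolding KR using c by (simp add: as)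
  finally have 2: "t k (y * gen i) = mat_trace (?K * (?R * ?P) * ?Z)" .
  have "mc ?n (?K * (?R * ?P) * ?Z) (?K * (?P * ?R) * ?Z)"
    by (intro mc_mult_right mc_mult_left R_M_prod i f)
  then have "t k (y * gen i) - t k (gen i * y) \<in> J" unfolding 1 2 by (rule mc_trace)
  then show ?thesis using J_closed(6)[of "t k (y * gen i) - t k (gen i * y)"] by simp
qed

lemma t_commute:
  assumes x: "x \<in> hecke_free k" and y: "y \<in> hecke_free k"
  shows "t k (x * y) - t k (y * x) \<in> J"
proof -
  have w: "t k (wordel w * y) - t k (y * wordel w) \<in> J" if "set w \<subseteq> {1..<k}" "y \<in> hecke_free k" for w y
    using that
  proof (induction w arbitrary: y)
    case Nil
    then show ?case by (simp add: wordel_Nil J_closed)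
  next
    case (Cons i w)
    then have i: "1 \<le> i" "i < k" "set w \<subseteq> {1..<k}" by auto
    have g: "gen i \<in> hecke_free k" "wordel w \<in> hecke_free k" using gen_hecke_free[OF i(1,2)] i(3) by (auto simp: wordel_carrier)
    have e: "wordel (i # w) = gen i * wordel w" using wordel_mult[of "[i]" w] by (simp add: wordel_single)
    have "t k (gen i * (wordel w * y)) - t k (wordel w * y * gen i) \<in> J"
      by (rule t_gen_commute) (use g Cons.prems i in auto)
    moreover have "t k (wordel w * (y * gen i)) - t k (y * gen i * wordel w) \<in> J"
      by (rule Cons.IH) (use g Cons.prems i in auto)
    ultimately show ?case using J_closed(3) unfolding e by (fastforce simp: mult.assoc)
  qed
  have "t k (x * y) - t k (y * x) = (\<Sum>u\<in>keys x. const (lookup x u) * (t k (wordel (letters u) * y) - t k (y * wordel (letters u))))"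
  proof -
    have "x * y = (\<Sum>u\<in>keys x. const (lookup x u) * (wordel (letters u) * y))"
      by (subst wordel_expand[of x]) (simp only: sum_distrib_right mult.assoc)
    moreover have "y * x = (\<Sum>u\<in>keys x. const (lookup x u) * (y * wordel (letters u)))"
      by (subst (1) wordel_expand[of x]) (simp only: sum_distrib_left mult.assoc[symmetric] const_commute[of _ y, symmetric])
    ultimately show ?thesis by (simp add: t_sum t_const_mult sum_subtractf right_diff_distrib)
  qed
  also have "\<dots> \<in> J"
    using x y by (intro J_closed(8) J_closed(5)[OF _ free_carrier_const] w) (auto simp: free_carrier_iff hecke_gens_def)
  finally show ?thesis .
qed

lemma t_carrier: "t k x \<in> Fr"
proof -
  have "fm (N ^ k) (cmat (kron_pow D k) * (M_prod N F k * cmat (rh k x)))"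
    by (intro fm_mult fm_cmat fm_M_prod kron_pow_carrier) simp_all
  then show ?thesis unfolding t_def R_trace_def mat_trace_def
    by (intro free_carrier_sum) (auto simp: fm_def simp del: index_mult_mat(1))
qed

end

locale hecke_pair = r_matrix_pair +
  fixes q :: complex
  assumes q: "generic q" and hecke: "R * R = (q - inverse q) \<cdot>\<^sub>m R + 1\<^sub>m (N * N)"
begin

lemma ideal_rh_ker: "ideal {x \<in> hecke_free k. rh k x = 0\<^sub>m (N ^ k) (N ^ k)} (free_alg (hecke_gens k))"
  unfolding ideal_of_free_alg_iff by (auto simp: rhof_0 rhof_add rh_mult)

lemma hecke_rels_rh: assumes x: "x \<in> hecke_rels q k" shows "rh k x = 0\<^sub>m (N ^ k) (N ^ k)"
proof -
  have diff0: "rh k (a - b) = 0\<^sub>m (N ^ k) (N ^ k)" if "rh k a = rh k b" for a b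
  proof -
    have "a - b = a + const (- 1) * b" by (simp add: const_minus)
    then have "rh k (a - b) = rh k a + (- 1) \<cdot>\<^sub>m rh k b"
      by (simp only: rhof_add rhof_const_mult)
    then show ?thesis by (intro eq_matI) (simp_all add: that)
  qed
  from x consider (1) i where "x = gen i * gen (i + 1) * gen i - gen (i + 1) * gen i * gen (i + 1)"
      "i \<in> hecke_gens k" "i + 1 \<in> hecke_gens k"
    | (2) i j where "x = gen i * gen j - gen j * gen i" "i \<in> hecke_gens k" "j \<in> hecke_gens k" "i + 2 \<le> j"
    | (3) i where "x = (gen i - const q) * (gen i + const (inverse q))" "i \<in> hecke_gens k"
    unfolding hecke_rels_def by blast
  then show ?thesis
  proof cases
    case 1
    then have i: "1 \<le> i" "i + 1 < k" by (auto simp: hecke_gens_def)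
    have "op R k i * op R k (i + 1) * op R k i = op R k (i + 1) * op R k i * op R k (i + 1)"
      by (rule amp2_triple[OF carr(1,1,1,1,1,1) yb_R]) (use i in auto)
    then show ?thesis unfolding 1(1) using i gen_hecke_free[of i k] gen_hecke_free[of "i + 1" k]
      by (intro diff0) (simp add: rh_mult rh_gen del: free_carrier_gen)
  next
    case 2
    then have i: "1 \<le> i" "1 \<le> j" "i < k" "j < k" by (auto simp: hecke_gens_def)
    have "op R k i * op R k j = op R k j * op R k i"
      by (rule amp2_commute[OF carr(1,1)]) (use 2 i in auto)
    then show ?thesis unfolding 2(1) using i gen_hecke_free[of i k] gen_hecke_free[of j k]
      by (intro diff0) (simp add: rh_mult rh_gen)
  next
    case 3
    then have i: "1 \<le> i" "i < k" by (auto simp: hecke_gens_def)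
    have q0: "q \<noteq> 0" using q by (simp add: generic_def)
    have 1: "const q * const (inverse q) = (1 :: nat free)" unfolding const_mult[symmetric] using q0 by simp
    have x': "x = gen i * gen i - (const (q - inverse q) * gen i + 1)"
      unfolding 3(1) by (simp add: 1 const_diff left_diff_distrib right_diff_distrib distrib_left distrib_right
        const_commute[of "inverse q" "gen i"])
    have RR: "op R k i * op R k i = amp N k 2 i (R * R)"
      using amp_mult[of R N 2 R k i] carr(1) by (simp add: power2_eq_square)
    have "amp N k 2 i (R * R) = (q - inverse q) \<cdot>\<^sub>m op R k i + 1\<^sub>m (N ^ k)"
    proof -
      have e: "(1\<^sub>m (N ^ k) :: complex mat) = amp N k 2 i (1\<^sub>m (N * N))" using amp_one[of i 2 k N, where 'a = complex] i by (simp add: power2_eq_square)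
      show ?thesis unfolding hecke e
      proof (rule eq_matI)
        let ?a = "N ^ (i - 1)" and ?b = "N ^ (k - 2 + 1 - i)"
        fix a b assume "a < dim_row ((q - inverse q) \<cdot>\<^sub>m op R k i + amp N k 2 i (1\<^sub>m (N * N)))"
          "b < dim_col ((q - inverse q) \<cdot>\<^sub>m op R k i + amp N k 2 i (1\<^sub>m (N * N)))"
        then have ab: "a < ?a * (N * N) * ?b" "b < ?a * (N * N) * ?b" by (auto simp: amp_def)
        note l = div_mod_less[OF ab(1)] div_mod_less[OF ab(2)]
        note l' = l div_mod_less[OF l(1)] div_mod_less[OF l(3)]
        show "amp N k 2 i ((q - inverse q) \<cdot>\<^sub>m R + 1\<^sub>m (N * N)) $$ (a, b) = ((q - inverse q) \<cdot>\<^sub>m op R k i + amp N k 2 i (1\<^sub>m (N * N))) $$ (a, b)"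
          using carr(1) ab l' by (simp add: amp_def kron_index algebra_simps)
      qed (use carr(1) in \<open>simp_all add: amp_def\<close>)
    qed
    then show ?thesis unfolding x' using RR gen_hecke_free[OF i]
      by (intro diff0) (simp add: rh_mult rh_gen[OF i] rhof_add rhof_const_mult rh_1)
  qed
qed

lemma rh_ideal: assumes "x \<in> hecke_ideal q k" shows "rh k x = 0\<^sub>m (N ^ k) (N ^ k)"
proof -
  have "hecke_ideal q k \<subseteq> {x \<in> hecke_free k. rh k x = 0\<^sub>m (N ^ k) (N ^ k)}"
    unfolding hecke_ideal_def
    by (rule rel_ideal_minimal[OF hecke_rels_subset ideal_rh_ker]) (use hecke_rels_rh hecke_rels_subset in blast)
  with assms show ?thesis by blast
qed

lemma rh_heq: assumes "heq q k x y" shows "rh k x = rh k y"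
proof -
  have "rh k (x - y) = 0\<^sub>m (N ^ k) (N ^ k)" using assms by (intro rh_ideal) (simp add: heq_def)
  then have "rh k x = rh k y + 0\<^sub>m (N ^ k) (N ^ k)" using rhof_add[of N R k y "x - y"] by simp
  then show ?thesis using rhof_carrier by simp
qed

lemma t_heq: "heq q k x y \<Longrightarrow> t k x = t k y"
  by (simp add: t_def rh_heq)

lemma rho_class: "x \<in> hecke_free k \<Longrightarrow> rho N R k (hecke_class q k x) = rh k x"
  unfolding rho_eq_rhof by (rule rh_heq[OF hecke_representative])

end

section \<open>Antisymmetrizers, Schur functions as traces of matrix units, and the Newton
  relations\<close>

section \<open>Newton relations in the quantum matrix algebra\<close>

lemma heq_mono: "j \<le> k \<Longrightarrow> heq q j x y \<Longrightarrow> heq q k x y"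
  by (induction k rule: dec_induct) (auto intro: hecke_free_heq_mono)

lemma mcoef_munit:
  assumes "generic q" "S \<in> Stdk k" "T \<in> Stdk k" "set S = set T" "U \<in> Stdk k"
  shows "mcoef q (munit q S T) U V = of_bool (U = S \<and> V = T)"
  using acts_asD[OF munit[OF assms(1-4)] assms(5)] by (auto simp: mcoef_def)

lemma Stdk_finite_set: "S \<in> Stdk k \<Longrightarrow> downset (set S) \<and> card (set S) = k"
  by (auto simp: Stdk_def Std_downset Std_distinct distinct_card)

lemma std_pairsD: "(S, T) \<in> std_pairs k \<Longrightarrow> S \<in> Stdk k \<and> T \<in> Stdk k \<and> set S = set T"
  using distinct_card[of S] distinct_card[of T] Std_distinct[of S] Std_distinct[of T]
  by (auto simp: std_pairs_def std_of_def Stdk_def)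

text \<open>The difference of the two sides has vanishing matrix coefficients, so faithfulness
  applies: the matrix units form a basis.\<close>

lemma munit_expand:
  assumes q: "generic q" and x: "x \<in> hecke_free k"
  shows "heq q k x (\<Sum>p\<in>std_pairs k. const (mcoef q x (fst p) (snd p)) * munit q (fst p) (snd p))" (is "heq q k x ?y")
proof -
  have p: "fst p \<in> Stdk k \<and> snd p \<in> Stdk k \<and> set (fst p) = set (snd p)" if "p \<in> std_pairs k" for p
    using that std_pairsD[of "fst p" "snd p" k] by simp
  have y: "?y \<in> hecke_free k"
    by (intro free_carrier_sum free_carrier_mult free_carrier_const munit_carrier[OF q]) (use p in auto)
  have "x - ?y \<in> hecke_ideal q k"
  proof (rule hecke_faithful[OF q])
    fix S T assume ST: "(S, T) \<in> std_pairs k"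
    have "mcoef q ?y S T = (\<Sum>p\<in>std_pairs k. mcoef q x (fst p) (snd p) * mcoef q (munit q (fst p) (snd p)) S T)"
      by (simp add: mcoef_def actx_sum actx_const_mult)
    also have "\<dots> = (\<Sum>p\<in>std_pairs k. if p = (S, T) then mcoef q x S T else 0)"
    proof (intro sum.cong refl)
      fix r assume "r \<in> std_pairs k"
      from mcoef_munit[OF q, of "fst r" k "snd r" S T] p[OF this] p[OF ST]
      show "mcoef q x (fst r) (snd r) * mcoef q (munit q (fst r) (snd r)) S T = (if r = (S, T) then mcoef q x S T else 0)"
        by (cases r) auto
    qed
    also have "\<dots> = mcoef q x S T" using ST finite_std_pairs by simp
    finally show "mcoef q (x - ?y) S T = 0" by (simp add: mcoef_def actx_diff)
  qed (use x y in simp)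
  then show ?thesis using x y by (simp add: heq_def)
qed

lemma munit_mult:
  assumes q: "generic q" and "S \<in> Stdk k" "T \<in> Stdk k" "R \<in> Stdk k" "set S = set T" "set T = set R"
  shows "heq q k (munit q S T * munit q T R) (munit q S R)"
  by (rule heqI[OF q])
    (use assms munit_carrier[OF q] in \<open>auto simp: actx_mult acts_asD[OF munit[OF q]]\<close>)

lemma munit_mult_zero:
  assumes q: "generic q" and "S \<in> Stdk k" "T \<in> Stdk k" "T' \<in> Stdk k" "R \<in> Stdk k" "set S = set T" "set T' = set R" "T \<noteq> T'"
  shows "heq q k (munit q S T * munit q T' R) 0"
  by (rule heqI[OF q])
    (use assms munit_carrier[OF q] in \<open>auto simp: actx_mult acts_asD[OF munit[OF q]]\<close>)

definition colT :: "nat \<Rightarrow> box list" where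
  "colT j = map (\<lambda>r. (r, 0)) [0..<j]"

lemma colT_Suc: "colT (Suc j) = colT j @ [(j, 0)]"
  by (simp add: colT_def)

lemma set_colT: "set (colT j) = {..<j} \<times> {0}"
  by (auto simp: colT_def)

lemma downset_col: "downset ({..<j} \<times> {0})"
  by (auto simp: downset_def)

lemma colT_Stdk: "colT j \<in> Stdk j"
proof (induction j)
  case 0
  then show ?case by (simp add: colT_def Stdk_def)
next
  case (Suc j)
  have e: "insert (j, 0) ({..<j} \<times> {0}) = {..<Suc j} \<times> {0::nat}" by auto
  have "downset (insert (j, 0) (set (colT j)))" unfolding set_colT e by (rule downset_col)
  with Suc show ?case unfolding colT_Suc Stdk_snoc addb_def set_colT by auto
qed

lemma std_of_col: "std_of ({..<j} \<times> {0}) = {colT j}"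
proof (induction j)
  case 0
  then show ?case by (auto simp: std_of_def colT_def)
next
  case (Suc j)
  let ?D = "{..<Suc j} \<times> {0::nat}"
  have r: "remb ?D = {(j, 0)}"
  proof
    show "remb ?D \<subseteq> {(j, 0)}"
    proof
      fix b assume b: "b \<in> remb ?D"
      then obtain i where i: "b = (i, 0)" "i < Suc j" "downset (?D - {(i, 0)})" by (auto simp: remb_def)
      have "i = j"
      proof (rule ccontr)
        assume "i \<noteq> j"
        then show False using downsetD[OF i(3), of j 0 i 0] i(2) by auto
      qed
      with i show "b \<in> {(j, 0)}" by simp
    qed
    have "?D - {(j, 0)} = {..<j} \<times> {0}" by auto
    then show "{(j, 0)} \<subseteq> remb ?D" using downset_col[of j] by (auto simp: remb_def)
  qed
  have e: "?D - {(j, 0)} = {..<j} \<times> {0}" by auto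
  show ?case using std_of_decomp[OF downset_col[of "Suc j"]] by (auto simp: r e Suc colT_Suc)
qed

lemma addb_col: assumes "1 \<le> j" shows "addb ({..<j} \<times> {0}) \<subseteq> {(j, 0), (0, 1)}"
proof
  fix b assume b: "b \<in> addb ({..<j} \<times> {0})"
  obtain r c where rc: "b = (r, c)" by (cases b)
  have d: "downset (insert (r, c) ({..<j} \<times> {0}))" and n: "(r, c) \<notin> {..<j} \<times> {0}" using b rc by (auto simp: addb_def)
  show "b \<in> {(j, 0), (0, 1)}"
  proof (cases "c = 0")
    case True
    then have "j \<le> r" using n by auto
    then have "(j, 0) \<in> insert (r, c) ({..<j} \<times> {0})" using downsetD[OF d, of r c j 0] by auto
    then show ?thesis using True rc by auto
  next
    case False
    then have "(0, c) \<in> insert (r, c) ({..<j} \<times> {0})" "(0, 1) \<in> insert (r, c) ({..<j} \<times> {0})"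
      using downsetD[OF d, of r c 0 c] downsetD[OF d, of r c 0 1] by auto
    then show ?thesis using False rc by auto
  qed
qed

text \<open>Exchanging the last two boxes changes the tableau of the first k entries, which the
  diagonal unit then annihilates; only the diagonal coefficient of the generator survives.\<close>

lemma actx_sandwich:
  assumes q: "generic q" and T: "P @ [a] \<in> Stdk k" and U: "W @ [b] \<in> Stdk (Suc k)"
  shows "actx q (munit q (P @ [a]) (P @ [a]) * gen k * munit q (P @ [a]) (P @ [a])) v (W @ [b])
    = of_bool (W = P @ [a]) * qf q (content b - content a) * v (W @ [b])"
proof -
  let ?e = "munit q (P @ [a]) (P @ [a])"
  note e = munit[OF q T T refl]
  have "actx q (?e * gen k * ?e) v (W @ [b]) = of_bool (W = P @ [a]) * act1 q k (actx q ?e v) (P @ [a, b])"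
    using acts_as_snoc[OF e U] by (simp add: actx_mult)
  also have "\<dots> = of_bool (W = P @ [a]) * qf q (content b - content a) * v (W @ [b])"
  proof (cases "W = P @ [a]")
    case True
    have k: "k = Suc (length P)" using T by (simp add: Stdk_def)
    have ab: "(P @ [a]) @ [b] \<in> Stdk (Suc k)" using U True by simp
    then have ne: "b \<noteq> a" unfolding Stdk_snoc[of "P @ [a]" b k] addb_def by auto
    have 1: "actx q ?e v (P @ [a, b]) = v (P @ [a, b])" using acts_as_snoc[OF e ab] by simp
    have 2: "actx q ?e v (P @ [b, a]) = 0" if "P @ [b, a] \<in> Std"
    proof -
      have "(P @ [b]) @ [a] \<in> Stdk (Suc k)" using that k by (simp add: Stdk_def)
      from acts_as_snoc[OF e this] show ?thesis using ne by simp
    qed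
    show ?thesis using True 1 2 unfolding k act1_mid[of q P _ a b "[]"] by auto
  qed simp
  finally show ?thesis .
qed

text \<open>A column of length j can be extended downwards or to the right, at axial distances -1
  and j from its last box. On these two extensions the recursion reads [j+1] = q^j + [j]/q and 0 =
  q^j - [j] (q^j/[j]).\<close>

lemma column_recursion:
  assumes q: "generic q" and j: "1 \<le> j"
  defines "e \<equiv> \<lambda>j. munit q (colT j) (colT j)"
  shows "heq q (Suc j) (const (qnat q (Suc j)) * e (Suc j)) (const (q ^ j) * e j - const (qnat q j) * (e j * gen j * e j))"
proof -
  obtain i where i: "j = Suc i" using j by (cases j) auto
  have q0: "q \<noteq> 0" using q by (simp add: generic_def)
  have ec: "e j \<in> hecke_free (Suc j)" "e (Suc j) \<in> hecke_free (Suc j)" "gen j \<in> hecke_free (Suc j)"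
    using munit_carrier[OF q colT_Stdk colT_Stdk refl] hecke_free_mono[of j "Suc j"] gen_hecke_free[of j "Suc j"] j by (auto simp: e_def)
  show ?thesis
  proof (rule heqI[OF q])
    fix U v assume U: "U \<in> Stdk (Suc j)"
    from U obtain W b where W: "U = W @ [b]" by (auto simp: Stdk_Suc)
    have U': "W @ [b] \<in> Stdk (Suc j)" using U W by simp
    have E1: "actx q (e j) v (W @ [b]) = of_bool (W = colT j) * v (W @ [b])"
      using acts_as_snoc[OF munit[OF q colT_Stdk colT_Stdk refl] U'] by (auto simp: e_def)
    have E2: "actx q (e (Suc j)) v (W @ [b]) = of_bool (W = colT j \<and> b = (j, 0)) * v (W @ [b])"
      using acts_asD[OF munit[OF q colT_Stdk colT_Stdk refl] U'] by (auto simp: e_def colT_Suc)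
    have cj: "colT j = colT i @ [(i, 0)]" by (simp add: i colT_Suc)
    have E3: "actx q (e j * gen j * e j) v (W @ [b]) = of_bool (W = colT j) * qf q (content b + int i) * v (W @ [b])"
      using actx_sandwich[OF q colT_Stdk[of j, unfolded cj] U'] unfolding e_def cj by (simp add: content_def)
    have "qnat q (Suc j) * of_bool (W = colT j \<and> b = (j, 0)) = of_bool (W = colT j) * (q ^ j - qnat q j * qf q (content b + int i))"
    proof (cases "W = colT j")
      case True
      then have "b \<in> addb ({..<j} \<times> {0})" using U' set_colT[of j] by (simp add: Stdk_snoc)
      then consider "b = (j, 0)" | "b = (0, 1)" using addb_col[OF j] by blast
      then show ?thesis
      proof cases
        case 1
        have "qf q (- 1) = - inverse q" using qint_minus[of q 1] by (simp add: qf_def power_int_minus)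
        moreover have "content b + int i = - 1" using 1 i by (simp add: content_def)
        ultimately have "qnat q (Suc j) = q ^ j - qnat q j * qf q (content b + int i)"
          unfolding qnat_Suc(2)[OF q0, of j] by (simp add: mult.commute)
        then show ?thesis using True 1 by simp
      next
        case 2
        have "content b + int i = int j" using 2 i by (simp add: content_def)
        moreover have "qnat q j * qf q (int j) = q ^ j"
          using qint_nonzero[OF q, of "int j"] j by (simp add: qf_def qint_of_nat)
        moreover have "b \<noteq> (j, 0)" using 2 by simp
        ultimately show ?thesis by simp
      qed
    qed simp
    note E4 = this
    have "qnat q (Suc j) * (of_bool (W = colT j \<and> b = (j, 0)) * v (W @ [b])) = q ^ j * (of_bool (W = colT j) * v (W @ [b])) - qnat q j * (of_bool (W = colT j) * qf q (content b + int i) * v (W @ [b]))"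
      unfolding mult.assoc[of "qnat q (Suc j)", symmetric] E4 by (simp add: left_diff_distrib right_diff_distrib)
    then show "actx q (const (qnat q (Suc j)) * e (Suc j)) v U = actx q (const (q ^ j) * e j - const (qnat q j) * (e j * gen j * e j)) v U"
      unfolding W actx_diff actx_const_mult E1 E2 E3 .
  qed (use ec in simp_all)
qed

lemma heq_word_commute:
  assumes x: "x \<in> hecke_free j" and w: "set w \<subseteq> {Suc j..<k}" and jk: "j \<le> k"
  shows "heq q k (x * wordel w) (wordel w * x)"
proof -
  have g: "heq q k (gen i * wordel w) (wordel w * gen i)" if i: "1 \<le> i" "i < j" for i
    using w
  proof (induction w)
    case Nil
    then show ?case using i jk gen_hecke_free[of i k] by (simp add: wordel_Nil heq_refl)
  next
    case (Cons l w)
    then have l: "Suc j \<le> l" "l < k" "set w \<subseteq> {1..<k}" "set w \<subseteq> {Suc j..<k}" by auto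
    have c: "wordel w \<in> hecke_free k" "gen l \<in> hecke_free k" using l gen_hecke_free[of l k] by (auto simp: wordel_carrier)
    have e: "wordel (l # w) = gen l * wordel w" using wordel_mult[of "[l]" w] by (simp add: wordel_single)
    have "heq q k (gen i * gen l * wordel w) (gen l * gen i * wordel w)"
      by (intro heq_mult_right heq_commute c) (use i l in auto)
    also have "gen l * gen i * wordel w = gen l * (gen i * wordel w)" by (simp add: mult.assoc)
    also have "heq q k \<dots> (gen l * (wordel w * gen i))" by (rule heq_mult_left[OF Cons.IH[OF l(4)] c(2)])
    finally show ?case unfolding e by (simp add: mult.assoc)
  qed
  have wk: "wordel w \<in> hecke_free k" using w by (auto simp: wordel_carrier)
  have u: "heq q k (wordel u * wordel w) (wordel w * wordel u)" if "set u \<subseteq> {1..<j}" for u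
    using that
  proof (induction u)
    case Nil
    then show ?case using wk by (simp add: wordel_Nil heq_refl)
  next
    case (Cons i u)
    then have i: "1 \<le> i" "i < j" "set u \<subseteq> {1..<j}" "set u \<subseteq> {1..<k}" using jk by auto
    have c: "wordel u \<in> hecke_free k" "gen i \<in> hecke_free k" using i jk gen_hecke_free[of i k] by (auto simp: wordel_carrier)
    have e: "wordel (i # u) = gen i * wordel u" using wordel_mult[of "[i]" u] by (simp add: wordel_single)
    have "heq q k (gen i * (wordel u * wordel w)) (gen i * (wordel w * wordel u))"
      by (rule heq_mult_left[OF Cons.IH[OF i(3)] c(2)])
    also have "gen i * (wordel w * wordel u) = gen i * wordel w * wordel u" by (simp add: mult.assoc)
    also have "heq q k \<dots> (wordel w * gen i * wordel u)" by (rule heq_mult_right[OF g[OF i(1,2)] c(1)])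
    finally show ?case unfolding e by (simp add: mult.assoc)
  qed
  have "x * wordel w = (\<Sum>u\<in>keys x. const (lookup x u) * (wordel (letters u) * wordel w))"
    by (subst (1) wordel_expand[of x]) (simp only: sum_distrib_right mult.assoc)
  moreover have "wordel w * x = (\<Sum>u\<in>keys x. const (lookup x u) * (wordel w * wordel (letters u)))"
    by (subst (1) wordel_expand[of x]) (simp only: sum_distrib_left mult.assoc[symmetric] const_commute[of _ "wordel w", symmetric])
  moreover have "heq q k (\<Sum>u\<in>keys x. const (lookup x u) * (wordel (letters u) * wordel w))
     (\<Sum>u\<in>keys x. const (lookup x u) * (wordel w * wordel (letters u)))"
    using x by (intro heq_sum heq_mult_left u free_carrier_const) (auto simp: free_carrier_iff hecke_gens_def)
  ultimately show ?thesis by simp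
qed

context hecke_pair
begin

abbreviation "cls \<equiv> qma_class N R F"

lemma cls_eq_iff: "x \<in> Fr \<Longrightarrow> y \<in> Fr \<Longrightarrow> cls x = cls y \<longleftrightarrow> x - y \<in> J"
  unfolding qma_class_def J_def by (rule presented_class_eq_iff[OF qma_rels_subset])

lemma cls_add: "x \<in> Fr \<Longrightarrow> y \<in> Fr \<Longrightarrow> cls x \<oplus>\<^bsub>qma N R F\<^esub> cls y = cls (x + y)"
  unfolding qma_class_def qma_def by (rule presented_class_add[OF qma_rels_subset])

lemma cls_mult: "x \<in> Fr \<Longrightarrow> y \<in> Fr \<Longrightarrow> cls x \<otimes>\<^bsub>qma N R F\<^esub> cls y = cls (x * y)"
  unfolding qma_class_def qma_def by (rule presented_class_mult[OF qma_rels_subset])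

lemma schur_free_eq:
  assumes \<nu>: "\<nu> \<in> partitions_of k" and k: "1 \<le> k"
  shows "schur_free N q R F \<nu> = const (1 / of_nat (fcount (young_diagram \<nu>))) * t k (cidem q (young_diagram \<nu>))"
proof -
  have \<nu>': "\<nu> \<in> partitions" "sum_list \<nu> = k" using \<nu> by (auto simp: partitions_of_def)
  have "\<nu> \<noteq> []" using \<nu>' k by auto
  moreover have "rho N R k (central_idempotent q \<nu>) = rh k (cidem q (young_diagram \<nu>))"
    unfolding central_idempotent_eq[OF q \<nu>'(1)] \<nu>'(2)
    using cidem_carrier[OF q, of "young_diagram \<nu>"] card_young_diagram[of \<nu>] \<nu>'(2) by (intro rho_class) simp
  ultimately show ?thesis
    using \<nu>' std_tableaux_eq[OF \<nu>'(1)] by (simp add: schur_free_def t_def irrep_dim_def fcount_def Let_def)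
qed

text \<open>Multiplying by the diagonal unit of S on the left reproduces the unit, on the right it
  gives zero; traciality equates the two.\<close>

lemma t_munit_offdiag:
  assumes "S \<in> Stdk k" "T \<in> Stdk k" "set S = set T" "S \<noteq> T"
  shows "t k (munit q S T) \<in> J"
proof -
  note c = munit_carrier[OF q]
  have "t k (munit q S S * munit q S T) - t k (munit q S T * munit q S S) \<in> J"
    by (rule t_commute) (use c assms in auto)
  moreover have "t k (munit q S S * munit q S T) = t k (munit q S T)"
    by (rule t_heq[OF munit_mult[OF q]]) (use assms in auto)
  moreover have "t k (munit q S T * munit q S S) = 0"
    using t_heq[OF munit_mult_zero[OF q assms(1,2,1,1)]] assms by simp
  ultimately show ?thesis by simp
qed

text \<open>The units of S and T are the two products, in opposite orders, of the off-diagonal units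
  between them.\<close>

lemma t_munit_diag:
  assumes "S \<in> Stdk k" "T \<in> Stdk k" "set S = set T"
  shows "t k (munit q S S) - t k (munit q T T) \<in> J"
proof -
  note c = munit_carrier[OF q]
  have "t k (munit q S T * munit q T S) - t k (munit q T S * munit q S T) \<in> J"
    by (rule t_commute) (use c assms in auto)
  moreover have "t k (munit q S T * munit q T S) = t k (munit q S S)" "t k (munit q T S * munit q S T) = t k (munit q T T)"
    by (rule t_heq[OF munit_mult[OF q]]; use assms in simp)+
  ultimately show ?thesis by simp
qed

text \<open>The central idempotent is the sum of all diagonal units of the shape, whose traces agree
  modulo the relations, so division by their number returns the trace of a single unit.\<close>

lemma t_munit_schur:
  assumes \<nu>: "\<nu> \<in> partitions_of k" and k: "1 \<le> k" and S: "S \<in> std_of (young_diagram \<nu>)"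
  shows "t k (munit q S S) - schur_free N q R F \<nu> \<in> J"
proof -
  let ?D = "young_diagram \<nu>"
  have \<nu>': "\<nu> \<in> partitions" "card ?D = k" using \<nu> card_young_diagram by (auto simp: partitions_of_def)
  have d: "downset ?D" by (rule young_diagram_downset[OF \<nu>'(1)])
  have fin: "finite (std_of ?D)" by (rule finite_std_of[OF d])
  have f0: "fcount ?D \<noteq> 0" using S fin by (auto simp: fcount_def)
  have "t k (munit q S S) - schur_free N q R F \<nu> = (\<Sum>T\<in>std_of ?D. const (1 / of_nat (fcount ?D)) * (t k (munit q S S) - t k (munit q T T)))"
  proof -
    have "(\<Sum>T\<in>std_of ?D. const (1 / of_nat (fcount ?D)) * t k (munit q S S)) = const (\<Sum>T\<in>std_of ?D. 1 / of_nat (fcount ?D)) * t k (munit q S S)"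
      by (simp only: const_sum sum_distrib_right)
    also have "(\<Sum>T\<in>std_of ?D. 1 / of_nat (fcount ?D)) = (1 :: complex)" using f0 by (simp add: fcount_def)
    finally show ?thesis
      by (simp add: schur_free_eq[OF \<nu> k] cidem_def t_sum right_diff_distrib sum_subtractf sum_distrib_left)
  qed
  also have "\<dots> \<in> J"
  proof (intro J_closed(8) J_closed(5)[OF _ free_carrier_const] t_munit_diag)
    have "T \<in> Stdk k" if "T \<in> std_of ?D" for T using std_of_Stdk[OF that] \<nu>'(2) by simp
    then show "S \<in> Stdk k" "\<And>T. T \<in> std_of ?D \<Longrightarrow> T \<in> Stdk k" using S by auto
    show "\<And>T. T \<in> std_of ?D \<Longrightarrow> set S = set T" using S by (auto simp: std_of_def)
  qed
  finally show ?thesis .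
qed

lemma finite_partitions_of: "finite (partitions_of k)"
proof (rule finite_imageD)
  show "finite (young_diagram ` partitions_of k)"
  proof (rule finite_subset)
    show "young_diagram ` partitions_of k \<subseteq> set ` Stdk k"
    proof (rule image_subsetI)
      fix \<nu> assume "\<nu> \<in> partitions_of k"
      then have "downset (young_diagram \<nu>)" "card (young_diagram \<nu>) = k"
        using young_diagram_downset card_young_diagram by (auto simp: partitions_of_def)
      then obtain T where "T \<in> std_of (young_diagram \<nu>)" "card (young_diagram \<nu>) = k" using Std_exists by (auto simp: std_of_def)
      then show "young_diagram \<nu> \<in> set ` Stdk k" using std_of_Stdk[of T] by (auto simp: std_of_def)
    qed
  qed (simp add: finite_Stdk)
  show "inj_on young_diagram (partitions_of k)"
    using young_diagram_inj by (auto simp: inj_on_def partitions_of_def)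
qed

lemma Stdk_decomp: "Stdk k = (\<Union>\<nu>\<in>partitions_of k. std_of (young_diagram \<nu>))"
proof (intro equalityI subsetI)
  fix S assume S: "S \<in> Stdk k"
  then obtain \<nu> where "\<nu> \<in> partitions_of k" "young_diagram \<nu> = set S"
    using young_diagram_surj[of "set S"] Stdk_finite_set[OF S] by metis
  then show "S \<in> (\<Union>\<nu>\<in>partitions_of k. std_of (young_diagram \<nu>))" using S by (auto simp: std_of_def Stdk_def)
next
  fix S assume "S \<in> (\<Union>\<nu>\<in>partitions_of k. std_of (young_diagram \<nu>))"
  then show "S \<in> Stdk k" using std_of_Stdk card_young_diagram by (fastforce simp: partitions_of_def)
qed

text \<open>Needed to apply \<open>\<phi>\<close>, which is additive and multiplicative on the
  characteristic subalgebra. In the expansion into matrix units the off-diagonal terms have trace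
  zero modulo the relations, and the diagonal ones are Schur functions.\<close>

lemma t_char: assumes x: "x \<in> hecke_free k" and k: "1 \<le> k" shows "cls (t k x) \<in> char_subalgebra N q R F"
proof -
  define c where "c \<nu> = (\<Sum>S\<in>std_of (young_diagram \<nu>). mcoef q x S S)" for \<nu>
  let ?s = "\<Sum>\<nu>\<in>partitions_of k. const (c \<nu>) * schur_free N q R F \<nu>"
  have sF: "schur_free N q R F \<nu> \<in> Fr" if "\<nu> \<in> partitions_of k" for \<nu>
    unfolding schur_free_eq[OF that k] by (intro free_carrier_mult free_carrier_const t_carrier)
  have "t k x = (\<Sum>p\<in>std_pairs k. const (mcoef q x (fst p) (snd p)) * t k (munit q (fst p) (snd p)))"
    using t_heq[OF munit_expand[OF q x]] by (simp add: t_sum t_const_mult)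
  also have "\<dots> = (\<Sum>S\<in>Stdk k. \<Sum>T\<in>std_of (set S). const (mcoef q x S T) * t k (munit q S T))"
    unfolding std_pairs_def using Stdk_finite_set finite_std_of
    by (subst sum.Sigma) (auto simp: finite_Stdk split_beta)
  also have "\<dots> = (\<Sum>S\<in>Stdk k. const (mcoef q x S S) * t k (munit q S S) + (\<Sum>T\<in>std_of (set S) - {S}. const (mcoef q x S T) * t k (munit q S T)))"
  proof (intro sum.cong refl)
    fix S assume "S \<in> Stdk k"
    then have "S \<in> std_of (set S)" "finite (std_of (set S))" using finite_std_of Stdk_finite_set by (auto simp: Stdk_def std_of_def)
    then show "(\<Sum>T\<in>std_of (set S). const (mcoef q x S T) * t k (munit q S T)) = const (mcoef q x S S) * t k (munit q S S) + (\<Sum>T\<in>std_of (set S) - {S}. const (mcoef q x S T) * t k (munit q S T))"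
      by (rule sum.remove[rotated])
  qed
  also have "\<dots> = (\<Sum>S\<in>Stdk k. const (mcoef q x S S) * t k (munit q S S)) + (\<Sum>S\<in>Stdk k. \<Sum>T\<in>std_of (set S) - {S}. const (mcoef q x S T) * t k (munit q S T))"
    by (rule sum.distrib)
  also have "(\<Sum>S\<in>Stdk k. const (mcoef q x S S) * t k (munit q S S)) = (\<Sum>\<nu>\<in>partitions_of k. \<Sum>S\<in>std_of (young_diagram \<nu>). const (mcoef q x S S) * t k (munit q S S))"
    unfolding Stdk_decomp
  proof (rule sum.UNION_disjoint[OF finite_partitions_of])
    show "\<forall>\<nu>\<in>partitions_of k. finite (std_of (young_diagram \<nu>))"
      using finite_std_of young_diagram_downset by (auto simp: partitions_of_def)
    show "\<forall>\<nu>\<in>partitions_of k. \<forall>\<nu>'\<in>partitions_of k. \<nu> \<noteq> \<nu>' \<longrightarrow> std_of (young_diagram \<nu>) \<inter> std_of (young_diagram \<nu>') = {}"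
      using young_diagram_inj by (auto simp: std_of_def partitions_of_def)
  qed
  finally have e: "t k x - ?s = (\<Sum>\<nu>\<in>partitions_of k. \<Sum>S\<in>std_of (young_diagram \<nu>). const (mcoef q x S S) * (t k (munit q S S) - schur_free N q R F \<nu>))
      + (\<Sum>S\<in>Stdk k. \<Sum>T\<in>std_of (set S) - {S}. const (mcoef q x S T) * t k (munit q S T))"
    by (simp add: c_def const_sum sum_distrib_right right_diff_distrib sum_subtractf)
  have "t k x - ?s \<in> J"
    unfolding e
  proof (intro J_closed(3) J_closed(8))
    show "const (mcoef q x S S) * (t k (munit q S S) - schur_free N q R F \<nu>) \<in> J"
      if "\<nu> \<in> partitions_of k" "S \<in> std_of (young_diagram \<nu>)" for \<nu> S
      by (rule J_closed(5)[OF t_munit_schur[OF that(1) k that(2)] free_carrier_const])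
    show "const (mcoef q x S T) * t k (munit q S T) \<in> J" if "S \<in> Stdk k" "T \<in> std_of (set S) - {S}" for S T
    proof (rule J_closed(5)[OF t_munit_offdiag free_carrier_const])
      have "(S, T) \<in> std_pairs k" using that by (simp add: std_pairs_def)
      from std_pairsD[OF this] show "S \<in> Stdk k" "T \<in> Stdk k" "set S = set T" by auto
      show "S \<noteq> T" using that by auto
    qed
  qed
  moreover have "?s \<in> Fr" using sF by (intro free_carrier_sum free_carrier_mult free_carrier_const) auto
  ultimately have "cls (t k x) = cls ?s" using t_carrier by (simp add: cls_eq_iff)
  then show ?thesis unfolding char_subalgebra_def using finite_partitions_of
    by (auto simp: partitions_of_def intro!: exI[of _ "partitions_of k"] exI[of _ c])
qed

lemma const_char: "cls (const c) \<in> char_subalgebra N q R F"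
proof -
  have "cls (const c) = cls (\<Sum>\<nu>\<in>{[]}. const c * schur_free N q R F \<nu>)" by (simp add: schur_free_def)
  then show ?thesis unfolding char_subalgebra_def
    by (intro CollectI exI[of _ "{[]}"] exI[of _ "\<lambda>_. c"]) (auto simp: partitions_def)
qed

context
  fixes m n :: nat and \<phi> :: "(nat \<times> nat) free set \<Rightarrow> cpoly"
  assumes sp: "spectral_parameterization N q m n R F \<phi>"
begin

definition Phi :: "nat \<Rightarrow> nat free \<Rightarrow> cpoly" where
  "Phi k x = \<phi> (cls (t k x))"

lemma phi_hom: "\<phi> \<in> Ring.ring_hom ((qma N R F)\<lparr>carrier := char_subalgebra N q R F\<rparr>) (spectral_poly_ring m n)"
  and phi_const: "\<phi> (cls (const c)) = const c"
  and phi_elem: "\<phi> (elem_fun N q R F k) = spectral_elem q m n k"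
  using sp by (auto simp: spectral_parameterization_def)

lemma phi_add: "U \<in> char_subalgebra N q R F \<Longrightarrow> V \<in> char_subalgebra N q R F \<Longrightarrow> \<phi> (U \<oplus>\<^bsub>qma N R F\<^esub> V) = \<phi> U + \<phi> V"
  using ring_hom_add[OF phi_hom, of U V] by (simp add: spectral_poly_ring_def)

lemma phi_mult: "U \<in> char_subalgebra N q R F \<Longrightarrow> V \<in> char_subalgebra N q R F \<Longrightarrow> \<phi> (U \<otimes>\<^bsub>qma N R F\<^esub> V) = \<phi> U * \<phi> V"
  using ring_hom_mult[OF phi_hom, of U V] by (simp add: spectral_poly_ring_def)

lemma Phi_add: "x \<in> hecke_free k \<Longrightarrow> y \<in> hecke_free k \<Longrightarrow> 1 \<le> k \<Longrightarrow> Phi k (x + y) = Phi k x + Phi k y"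
  using phi_add[OF t_char t_char, of x k y k] cls_add[OF t_carrier t_carrier, of k x k y] by (simp add: Phi_def t_add)

lemma Phi_const_mult: "x \<in> hecke_free k \<Longrightarrow> 1 \<le> k \<Longrightarrow> Phi k (const c * x) = const c * Phi k x"
  using phi_mult[OF const_char t_char, of x k c] cls_mult[OF free_carrier_const t_carrier, of c k x]
  by (simp add: Phi_def t_const_mult phi_const)

lemma Phi_diff: "x \<in> hecke_free k \<Longrightarrow> y \<in> hecke_free k \<Longrightarrow> 1 \<le> k \<Longrightarrow> Phi k (x - y) = Phi k x - Phi k y"
  using Phi_add[of x k "const (- 1) * y"] Phi_const_mult[of y k "- 1"] by (simp add: const_minus)

lemma Phi_heq: "heq q k x y \<Longrightarrow> Phi k x = Phi k y"
  by (simp add: Phi_def t_heq)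

lemma Phi_commute: "x \<in> hecke_free k \<Longrightarrow> y \<in> hecke_free k \<Longrightarrow> Phi k (x * y) = Phi k (y * x)"
  using t_commute[of x k y] cls_eq_iff[OF t_carrier t_carrier, of k "x * y" k "y * x"] by (simp add: Phi_def)

lemma Phi_mult:
  assumes "x \<in> hecke_free j" "set w \<subseteq> {1..<i}" "1 \<le> j" "1 \<le> i"
  shows "Phi (j + i) (x * wordel (map ((+) j) w)) = Phi j x * Phi i (wordel w)"
proof -
  have "wordel w \<in> hecke_free i" using assms(2) by (simp add: wordel_carrier)
  then show ?thesis
    using phi_mult[OF t_char[OF assms(1,3)] t_char[OF _ assms(4), of "wordel w"]]
    by (simp add: Phi_def t_mult[OF assms(1,2)] cls_mult[OF t_carrier t_carrier])
qed

abbreviation "ecol j \<equiv> munit q (colT j) (colT j)"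

lemma col_carrier: "j \<le> k \<Longrightarrow> ecol j \<in> hecke_free k"
  using munit_carrier[OF q colT_Stdk colT_Stdk refl] hecke_free_mono by blast

text \<open>A column has a single standard tableau, so its central idempotent is one diagonal unit
  and the normalization is 1.\<close>

lemma Phi_col: assumes "1 \<le> k" shows "Phi k (ecol k) = spectral_elem q m n k"
proof -
  have p: "replicate k 1 \<in> partitions_of k"
    by (auto simp: partitions_of_def partitions_def sum_list_replicate sorted_wrt_iff_nth_less)
  have D: "young_diagram (replicate k 1) = {..<k} \<times> {0}"
    by (auto simp: young_diagram_def)
  have "elem_fun N q R F k = cls (t k (ecol k))"
    unfolding elem_fun_def schur_fun_def schur_free_eq[OF p assms] D
    by (simp add: cidem_def std_of_col fcount_def)
  then show ?thesis using phi_elem[of k] by (simp add: Phi_def)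
qed

lemma Phi_power_sum: assumes "1 \<le> k" shows "\<phi> (power_sum N R F k) = Phi k (wordel (rev [1..<k]))"
proof -
  have w: "set (rev [1..<k]) \<subseteq> {1..<k}" by auto
  have "power_sum N R F k = cls (t k (wordel (rev [1..<k])))"
    using assms unfolding power_sum_def t_def rh_wordel[OF w] by (simp add: rho_word_def)
  then show ?thesis by (simp add: Phi_def)
qed

abbreviation "A j \<equiv> spectral_elem q m n j"
abbreviation "P j \<equiv> \<phi> (power_sum N R F j)"

text \<open>The column recursion is multiplied by the descending word on the remaining strands. In
  the first term that word is an independent block, which gives A_j p_(k-j); in the second the
  generator with index j extends the word by one letter.\<close>

lemma newton_step:
  assumes j: "1 \<le> j" "j < k"
  shows "const (qnat q (Suc j)) * Phi k (ecol (Suc j) * wordel (rev [Suc j..<k]))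
    = const (q ^ j) * (A j * P (k - j)) - const (qnat q j) * Phi k (ecol j * wordel (rev [j..<k]))"
proof -
  let ?Z = "wordel (rev [Suc j..<k])" and ?g = "gen j :: nat free" and ?e = "ecol j"
  have k: "1 \<le> k" using j by simp
  have c: "?Z \<in> hecke_free k" "?g \<in> hecke_free k" "?e \<in> hecke_free k" "ecol (Suc j) \<in> hecke_free k"
    using j gen_hecke_free[of j k] col_carrier[of j k] col_carrier[of "Suc j" k] by (auto simp: wordel_carrier)
  have heq_up: "heq q k x y" if "heq q (Suc j) x y" for x y
    by (rule heq_mono[OF _ that]) (use j in simp)
  have Zg: "wordel (rev [j..<k]) = ?Z * ?g"
    using j wordel_mult[of "rev [Suc j..<k]" "[j]"] by (simp add: upt_conv_Cons wordel_single)
  have com: "heq q k (?e * ?Z) (?Z * ?e)"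
    by (rule heq_word_commute[OF col_carrier[OF order_refl]]) (use j in auto)
  have ee: "heq q k (?e * ?e) ?e"
  proof -
    have "heq q j (?e * ?e) ?e" by (rule munit_mult[OF q]) (auto simp: colT_Stdk)
    then have "heq q (Suc j) (?e * ?e) ?e" by (rule hecke_free_heq_mono)
    then show ?thesis by (rule heq_up)
  qed
  \<comment> \<open>The right-hand antisymmetrizer commutes with the word beyond strand j, is
    carried around the trace and merges with the left-hand one.\<close>
  have mid: "Phi k (?e * ?g * ?e * ?Z) = Phi k (?e * wordel (rev [j..<k]))"
  proof -
    have "Phi k (?e * ?g * ?e * ?Z) = Phi k (?e * ?g * (?Z * ?e))"
      unfolding mult.assoc[of _ ?e ?Z] by (rule Phi_heq[OF heq_mult_left[OF com]]) (use c in simp)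
    also have "\<dots> = Phi k (?e * (?e * ?g * ?Z))"
      using Phi_commute[OF free_carrier_mult[OF free_carrier_mult[OF c(3,2)] c(1)] c(3)] unfolding mult.assoc .
    also have "\<dots> = Phi k (?e * (?g * ?Z))"
      using Phi_heq[OF heq_mult_right[OF ee free_carrier_mult[OF c(2,1)]]] unfolding mult.assoc .
    also have "\<dots> = Phi k (?g * (?Z * ?e))"
      using Phi_commute[OF c(3) free_carrier_mult[OF c(2,1)]] unfolding mult.assoc .
    also have "\<dots> = Phi k (?g * (?e * ?Z))"
      by (rule Phi_heq[OF heq_mult_left[OF heq_sym[OF com]]]) (use c in simp)
    also have "\<dots> = Phi k (?e * (?Z * ?g))"
      using Phi_commute[OF c(2) free_carrier_mult[OF c(3,1)]] unfolding mult.assoc .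
    finally show ?thesis unfolding Zg .
  qed
  have YY: "Phi k (?e * ?Z) = A j * P (k - j)"
  proof -
    have "rev [Suc j..<k] = map ((+) j) (rev [1..<k - j])"
    proof -
      have "map ((+) j) [1..<k - j] = [Suc j..<k]" by (rule nth_equalityI) (use j in auto)
      then show ?thesis by (simp only: rev_map[symmetric])
    qed
    then have "Phi (j + (k - j)) (?e * ?Z) = Phi j ?e * Phi (k - j) (wordel (rev [1..<k - j]))"
      using Phi_mult[OF col_carrier[OF order_refl], of "rev [1..<k - j]" "k - j" j] j by auto
    then show ?thesis using j Phi_col[of j] Phi_power_sum[of "k - j"] by simp
  qed
  have "const (qnat q (Suc j)) * Phi k (ecol (Suc j) * ?Z) = Phi k (const (qnat q (Suc j)) * ecol (Suc j) * ?Z)"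
    using Phi_const_mult[of "ecol (Suc j) * ?Z" k "qnat q (Suc j)"] c k by (simp add: mult.assoc)
  also have "\<dots> = Phi k ((const (q ^ j) * ?e - const (qnat q j) * (?e * ?g * ?e)) * ?Z)"
    by (rule Phi_heq[OF heq_mult_right[OF heq_up[OF column_recursion[OF q j(1)]] c(1)]])
  also have "\<dots> = const (q ^ j) * Phi k (?e * ?Z) - const (qnat q j) * Phi k (?e * ?g * ?e * ?Z)"
  proof -
    have cc: "?e * ?Z \<in> hecke_free k" "?e * ?g * ?e * ?Z \<in> hecke_free k" by (intro free_carrier_mult c)+
    have 1: "(const (q ^ j) * ?e - const (qnat q j) * (?e * ?g * ?e)) * ?Z = const (q ^ j) * (?e * ?Z) - const (qnat q j) * (?e * ?g * ?e * ?Z)"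
      by (simp only: left_diff_distrib mult.assoc)
    have 2: "Phi k (const (q ^ j) * (?e * ?Z) - const (qnat q j) * (?e * ?g * ?e * ?Z)) = Phi k (const (q ^ j) * (?e * ?Z)) - Phi k (const (qnat q j) * (?e * ?g * ?e * ?Z))"
      by (rule Phi_diff[OF free_carrier_mult[OF free_carrier_const cc(1)] free_carrier_mult[OF free_carrier_const cc(2)] k])
    show ?thesis unfolding 1 2 Phi_const_mult[OF cc(1) k] Phi_const_mult[OF cc(2) k] ..
  qed
  finally show ?thesis unfolding YY mid .
qed

lemma A_0: "A 0 = 1"
  using phi_elem[of 0] phi_const[of 1] by (simp add: elem_fun_def schur_fun_def schur_free_def)

text \<open>Consecutive steps share their unfinished trace with opposite signs, so with alternating
  signs they telescope.\<close>

lemma newton_partial: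
  assumes k: "1 \<le> k"
  shows "j < k \<Longrightarrow> (- 1) ^ j * const (qnat q (Suc j)) * Phi k (ecol (Suc j) * wordel (rev [Suc j..<k]))
    = (\<Sum>l\<le>j. const ((- q) ^ l) * (A l * P (k - l)))"
proof (induction j)
  case 0
  \<comment> \<open>On one strand the corner box is the only tableau, so the antisymmetrizer is 1
    and the unfinished trace is p_k.\<close>
  have "heq q 1 (ecol 1) 1"
  proof (rule heqI[OF q])
    fix S v assume S: "S \<in> Stdk 1"
    have "S = colT 1"
    proof -
      obtain b where b: "S = [b]" using S by (auto simp: Stdk_def length_Suc_conv)
      obtain r c where rc: "b = (r, c)" by (cases b)
      have "downset {b}" using S b Std_downset[of S] by (simp add: Stdk_def)
      then have "(0, 0) = b" using downsetD[of "{b}" r c 0 0] rc by auto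
      then show ?thesis using b by (simp add: colT_def)
    qed
    then show "actx q (ecol 1) v S = actx q 1 v S"
      using acts_asD[OF munit[OF q colT_Stdk colT_Stdk refl], of S 1 v] S by simp
  qed (simp_all add: col_carrier)
  then have "heq q k (ecol 1) 1" by (rule heq_mono[OF k])
  then have "Phi k (ecol 1 * wordel (rev [1..<k])) = Phi k (1 * wordel (rev [1..<k]))"
    by (intro Phi_heq heq_mult_right) (auto simp: wordel_carrier)
  then show ?case using Phi_power_sum[OF k] A_0 qint_of_nat[of q 1] by simp
next
  case (Suc j)
  have s: "const ((- q) ^ Suc j) = (- 1) ^ Suc j * (const (q ^ Suc j) :: cpoly)"
    by (induction j) (simp_all add: const_minus const_mult algebra_simps)
  have "(- 1) ^ Suc j * const (qnat q (Suc (Suc j))) * Phi k (ecol (Suc (Suc j)) * wordel (rev [Suc (Suc j)..<k]))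
    = (- 1) ^ Suc j * (const (q ^ Suc j) * (A (Suc j) * P (k - Suc j)) - const (qnat q (Suc j)) * Phi k (ecol (Suc j) * wordel (rev [Suc j..<k])))"
    using newton_step[of "Suc j" k] Suc.prems by (simp only: mult.assoc)
  also have "\<dots> = const ((- q) ^ Suc j) * (A (Suc j) * P (k - Suc j)) + (- 1) ^ j * const (qnat q (Suc j)) * Phi k (ecol (Suc j) * wordel (rev [Suc j..<k]))"
    unfolding s by (simp add: algebra_simps)
  also have "(- 1) ^ j * const (qnat q (Suc j)) * Phi k (ecol (Suc j) * wordel (rev [Suc j..<k])) = (\<Sum>l\<le>j. const ((- q) ^ l) * (A l * P (k - l)))"
    using Suc by simp
  finally show ?case by (simp add: add.commute)
qed

text \<open>At j = k - 1 the remaining word is empty, and the unfinished trace is that of the full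
  antisymmetrizer.\<close>

theorem newton:
  assumes "1 \<le> k"
  shows "(- 1) ^ (k - 1) * const (qnat q k) * A k = (\<Sum>l<k. const ((- q) ^ l) * (A l * P (k - l)))"
proof -
  obtain j where j: "k = Suc j" using assms by (cases k) auto
  show ?thesis using newton_partial[OF assms, of j] Phi_col[OF assms] by (simp add: j wordel_Nil lessThan_Suc_atMost)
qed

lemma power_sum_0: "P 0 = const (mat_trace D)"
proof -
  have "R_trace N R 1 (1\<^sub>m N) = (const (mat_trace D) :: (nat \<times> nat) free)"
  proof -
    have "kron_pow D 1 = D" by simp
    then show ?thesis unfolding R_trace_def
      using right_mult_one_mat[of "cmat D :: (nat \<times> nat) free mat" N N] by (simp add: mat_trace_def const_sum)
  qed
  then show ?thesis using phi_const by (simp add: power_sum_def)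
qed

end

end

section \<open>Branching at the truncated rectangle and the value of p_0\<close>

section \<open>The R-trace of the identity\<close>

lemma munit_branch:
  assumes q: "generic q" and T: "T \<in> Stdk k"
  shows "heq q (Suc k) (munit q T T) (\<Sum>b\<in>addb (set T). munit q (T @ [b]) (T @ [b]))"
proof (rule heqI[OF q])
  have f: "finite (addb (set T))" using finite_addb Stdk_finite_set[OF T] by auto
  have Tb: "T @ [b] \<in> Stdk (Suc k)" if "b \<in> addb (set T)" for b using that T by (simp add: Stdk_snoc)
  show "(\<Sum>b\<in>addb (set T). munit q (T @ [b]) (T @ [b])) \<in> hecke_free (Suc k)"
    by (intro free_carrier_sum munit_carrier[OF q] Tb refl) auto
  show "munit q T T \<in> hecke_free (Suc k)" using munit_carrier[OF q T T refl] hecke_free_mono[of k "Suc k"] by simp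
  fix U v assume U: "U \<in> Stdk (Suc k)"
  then obtain W b where W: "U = W @ [b]" "W \<in> Stdk k" "b \<in> addb (set W)" by (auto simp: Stdk_Suc)
  have "actx q (\<Sum>b\<in>addb (set T). munit q (T @ [b]) (T @ [b])) v U = (\<Sum>c\<in>addb (set T). of_bool (U = T @ [c]) * v (T @ [c]))"
    unfolding actx_sum by (intro sum.cong refl acts_asD[OF munit[OF q Tb Tb refl] U])
  also have "\<dots> = (\<Sum>c\<in>addb (set T). if c = b then of_bool (W = T) * v (T @ [b]) else 0)"
    by (intro sum.cong refl) (auto simp: W(1))
  also have "\<dots> = of_bool (W = T) * v (T @ [b])" using f W(3) by auto
  finally show "actx q (munit q T T) v U = actx q (\<Sum>b\<in>addb (set T). munit q (T @ [b]) (T @ [b])) v U"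
    using acts_as_snoc[OF munit[OF q T T refl]] U W(1) by simp
qed

text \<open>The unit of T is transported to a tableau of the same shape ending in the removable box
  a, where sandwiching the generator is diagonal. Each removable box yields its own relation between
  the extensions of T.\<close>

lemma munit_branch_gen:
  assumes q: "generic q" and T: "T \<in> Stdk k" and P: "P @ [a] \<in> Stdk k" "set (P @ [a]) = set T"
  defines "e \<equiv> munit q (P @ [a]) (P @ [a])"
  shows "heq q (Suc k) (munit q T (P @ [a]) * (e * gen k * e) * munit q (P @ [a]) T)
    (\<Sum>b\<in>addb (set T). const (qf q (content b - content a)) * munit q (T @ [b]) (T @ [b]))"
proof (rule heqI[OF q])
  let ?P = "P @ [a]"
  have f: "finite (addb (set T))" using finite_addb Stdk_finite_set[OF T] by auto
  have k: "1 \<le> k" using P by (auto simp: Stdk_def)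
  have Tb: "T @ [b] \<in> Stdk (Suc k)" if "b \<in> addb (set T)" for b using that T by (simp add: Stdk_snoc)
  show "(\<Sum>b\<in>addb (set T). const (qf q (content b - content a)) * munit q (T @ [b]) (T @ [b])) \<in> hecke_free (Suc k)"
    by (intro free_carrier_sum free_carrier_mult free_carrier_const munit_carrier[OF q] Tb refl) auto
  have up: "munit q S S' \<in> hecke_free (Suc k)" if "S \<in> Stdk k" "S' \<in> Stdk k" "set S = set S'" for S S'
    using munit_carrier[OF q that] hecke_free_mono[of k "Suc k"] by simp
  show "munit q T ?P * (e * gen k * e) * munit q ?P T \<in> hecke_free (Suc k)"
    unfolding e_def by (intro free_carrier_mult up P T refl P(2)[symmetric] gen_hecke_free k) auto
  fix U v assume U: "U \<in> Stdk (Suc k)"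
  then obtain W b where W: "U = W @ [b]" "W \<in> Stdk k" "b \<in> addb (set W)" by (auto simp: Stdk_Suc)
  have U': "W @ [b] \<in> Stdk (Suc k)" using U W by simp
  have "actx q (\<Sum>b\<in>addb (set T). const (qf q (content b - content a)) * munit q (T @ [b]) (T @ [b])) v U
      = (\<Sum>c\<in>addb (set T). qf q (content c - content a) * (of_bool (U = T @ [c]) * v (T @ [c])))"
    unfolding actx_sum actx_const_mult by (intro sum.cong refl arg_cong2[where f = "(*)"] acts_asD[OF munit[OF q Tb Tb refl] U])
  also have "\<dots> = (\<Sum>c\<in>addb (set T). if c = b then qf q (content b - content a) * (of_bool (W = T) * v (T @ [b])) else 0)"
    by (intro sum.cong refl) (auto simp: W(1))
  also have "\<dots> = qf q (content b - content a) * (of_bool (W = T) * v (T @ [b]))" using f W(3) by auto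
  also have "\<dots> = actx q (munit q T ?P * (e * gen k * e) * munit q ?P T) v U"
  proof (cases "W = T")
    case True
    have Pb: "?P @ [b] \<in> Stdk (Suc k)" using W True P by (auto simp: Stdk_snoc[of "P @ [a]" b k] simp del: append_assoc)
    have "actx q (munit q T ?P * (e * gen k * e) * munit q ?P T) v (W @ [b]) = actx q (e * gen k * e) (actx q (munit q ?P T) v) (?P @ [b])"
      using acts_as_snoc[OF munit[OF q T P(1) P(2)[symmetric]] U'] True by (simp only: actx_mult mult.assoc) simp
    also have "\<dots> = qf q (content b - content a) * actx q (munit q ?P T) v (?P @ [b])"
      unfolding e_def actx_sandwich[OF q P(1) Pb] by simp
    also have "actx q (munit q ?P T) v (?P @ [b]) = v (T @ [b])"
      using acts_as_snoc[OF munit[OF q P(1) T P(2)] Pb] by simp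
    finally show ?thesis using True W(1) by simp
  next
    case False
    then show ?thesis using acts_as_snoc[OF munit[OF q T P(1) P(2)[symmetric]] U'] by (simp add: actx_mult mult.assoc W(1))
  qed
  finally show "actx q (munit q T ?P * (e * gen k * e) * munit q ?P T) v U = actx q (\<Sum>b\<in>addb (set T). const (qf q (content b - content a)) * munit q (T @ [b]) (T @ [b])) v U" ..
qed

lemma one_expand: assumes q: "generic q" shows "heq q k 1 (\<Sum>T\<in>Stdk k. munit q T T)"
proof (rule heqI[OF q])
  show "(\<Sum>T\<in>Stdk k. munit q T T) \<in> hecke_free k" by (intro free_carrier_sum munit_carrier[OF q]) auto
  fix U v assume U: "U \<in> Stdk k"
  have "actx q (\<Sum>T\<in>Stdk k. munit q T T) v U = (\<Sum>T\<in>Stdk k. of_bool (U = T) * v T)"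
    unfolding actx_sum by (intro sum.cong refl acts_asD[OF munit[OF q] U]) auto
  also have "\<dots> = (\<Sum>T\<in>Stdk k. if T = U then v U else 0)" by (intro sum.cong) auto
  finally show "actx q 1 v U = actx q (\<Sum>T\<in>Stdk k. munit q T T) v U" using U finite_Stdk by simp
qed simp

lemma std_last:
  assumes "downset B" "a \<in> B" "downset (B - {a})"
  shows "\<exists>P. P @ [a] \<in> Stdk (card B) \<and> set (P @ [a]) = B"
proof -
  obtain P where P: "P \<in> Std" "set P = B - {a}" using Std_exists[OF assms(3)] by auto
  have "insert a (B - {a}) = B" using assms by auto
  then have "P @ [a] \<in> Std" "set (P @ [a]) = B" using P assms by (auto simp: Std_snoc)
  then show ?thesis using std_of_Stdk[of "P @ [a]" B] by (auto simp: std_of_def)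
qed

text \<open>The unknown z is an entry of the operator of the truncated rectangle, x and y are
  entries of the partial traces of its surviving extensions. After clearing denominators a
  combination of the two equations has the common factor [2], which is nonzero.\<close>

lemma qint_solve:
  assumes q: "generic q"
    and 1: "qint q m * z = q powi m * x + qint q m * (qf q (- n - 2) * y)"
    and 2: "qint q n * z = qint q n * (qf q (m + 2) * x) - q powi (- n) * y"
    and nz: "m + 2 \<noteq> 0" "n + 2 \<noteq> 0"
  shows "x + y = q powi (n - m) * qint q (m - n) * z"
proof -
  have q0: "q \<noteq> 0" using q by (simp add: generic_def)
  note nn = qint_nonzero[OF q nz(1)] qint_nonzero[OF q nz(2)] qint_nonzero[OF q, of 2]
  define a b where "a = q powi m" and "b = q powi (- n)"
  define A B M C T where "A = qint q m" and "B = qint q n" and "M = qint q (m + 2)" and "C = qint q (n + 2)" and "T = qint q 2"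
  have ab: "a \<noteq> 0" "b \<noteq> 0" using q0 by (auto simp: a_def b_def)
  have p: "q powi (- n - 2) = b / q\<^sup>2" "q powi (m + 2) = a * q\<^sup>2" "q powi (- m) = inverse a" "q powi n = inverse b"
    using q0 by (simp_all add: a_def b_def power_int_add power_int_diff power_int_minus)
  \<comment> \<open>Both [m+2] and [n+2] are expanded in two ways; which expansion is inserted
    decides whether the unwanted terms cancel.\<close>
  have M: "M = a * T + A / q\<^sup>2" and C': "C = inverse b * T + B / q\<^sup>2"
    using qint_add[OF q0, of m 2] qint_add[OF q0, of n 2] p(4)
    by (simp_all add: M_def C_def T_def A_def B_def a_def power_int_minus divide_inverse mult.commute)
  have M': "M = q\<^sup>2 * A + inverse a * T" and C: "C = q\<^sup>2 * B + b * T"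
    using qint_add[OF q0, of 2 m] qint_add[OF q0, of 2 n] p(3)
    by (simp_all add: M_def C_def T_def A_def B_def b_def add.commute)
  have D: "qint q (m - n) = b * A - inverse a * B"
    using qint_add[OF q0, of "- n" m] p(3) by (simp add: A_def B_def b_def qint_minus)
  have f: "qf q (- n - 2) = - (b / q\<^sup>2) / C" "qf q (m + 2) = a * q\<^sup>2 / M"
    using qint_minus[of q "n + 2"] p by (simp_all add: qf_def C_def M_def)
  have nn': "M \<noteq> 0" "C \<noteq> 0" "T \<noteq> 0" using nn by (auto simp: M_def C_def T_def)
  have e1: "A * C * z = a * C * x - A * (b / q\<^sup>2) * y"
  proof -
    have "A * C * z = C * (A * z)" by simp
    also have "A * z = a * x + A * (- (b / q\<^sup>2) / C * y)" using 1 unfolding f by (simp add: A_def a_def)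
    also have "C * (a * x + A * (- (b / q\<^sup>2) / C * y)) = a * C * x - A * (b / q\<^sup>2) * y" using nn' q0 by (simp add: field_simps)
    finally show ?thesis .
  qed
  have e2: "B * M * z = B * (a * q\<^sup>2) * x - b * M * y"
  proof -
    have "B * M * z = M * (B * z)" by simp
    also have "B * z = B * (a * q\<^sup>2 / M * x) - b * y" using 2 unfolding f by (simp add: B_def b_def)
    also have "M * (B * (a * q\<^sup>2 / M * x) - b * y) = B * (a * q\<^sup>2) * x - b * M * y" using nn' q0 by (simp add: field_simps)
    finally show ?thesis .
  qed
  have "T * (b * A - inverse a * B) * z = (A * C - B * M) * z" unfolding C M' by (simp add: algebra_simps)
  also have "\<dots> = (a * C - B * (a * q\<^sup>2)) * x + (b * M - A * (b / q\<^sup>2)) * y"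
    using e1 e2 by (simp add: left_diff_distrib)
  also have "a * C - B * (a * q\<^sup>2) = T * (a * b)" unfolding C by (simp add: algebra_simps)
  also have "b * M - A * (b / q\<^sup>2) = T * (a * b)" unfolding M by (simp add: algebra_simps)
  finally have "T * ((b * A - inverse a * B) * z) = T * (a * b * (x + y))" by (simp add: algebra_simps)
  then have e: "(b * A - inverse a * B) * z = a * b * (x + y)" using nn' by simp
  have "q powi (n - m) = inverse (a * b)"
    using q0 by (simp add: a_def b_def power_int_diff power_int_minus field_simps)
  then have "q powi (n - m) * qint q (m - n) * z = inverse (a * b) * (a * b * (x + y))"
    unfolding D e[symmetric] by (simp only: mult.assoc)
  also have "\<dots> = x + y"
  proof -
    have "inverse c * (c * w) = w" if "c \<noteq> 0" for c w :: complex using that by (simp add: field_simps)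
    then show ?thesis using ab by (simp only: mult_eq_0_iff simp_thms)
  qed
  finally show ?thesis ..
qed

text \<open>Counted from 0, the box in row m and column n is present precisely when part m + 1
  exceeds n.\<close>

lemma hook_iff: "\<nu> \<in> partitions \<Longrightarrow> \<nu> \<in> hook_partitions m n \<longleftrightarrow> (m, n) \<notin> young_diagram \<nu>"
  by (auto simp: hook_partitions_def young_diagram_iff)

context r_matrix_pair
begin

text \<open>One entry of the partial R-trace over the last tensor factor. Fixing the entry turns
  operator equations into scalar ones, in which a nonzero z can be cancelled.\<close>

definition pe :: "nat \<Rightarrow> nat \<Rightarrow> nat \<Rightarrow> nat free \<Rightarrow> complex" where
  "pe k i j x = ptr N D (N ^ k) (rh (Suc k) x) $$ (i, j)"

lemma pe_lin: "i < N ^ k \<Longrightarrow> j < N ^ k \<Longrightarrow>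
    pe k i j x = (\<Sum>s<N. \<Sum>t<N. D $$ (s, t) * lin (\<lambda>w. rho_word N R (Suc k) (letters w) $$ (i * N + t, j * N + s)) x)"
  using pair_less[of i "N ^ k" _ N] pair_less[of j "N ^ k" _ N] unfolding pe_def
  by (subst ptr_index) (auto intro!: sum.cong rhof_index simp: mult.commute)

lemma pe_sum: assumes "i < N ^ k" "j < N ^ k" "finite A" shows "pe k i j (\<Sum>a\<in>A. const (c a) * f a) = (\<Sum>a\<in>A. c a * pe k i j (f a))"
  using assms(3)
proof (induction A rule: finite_induct)
  case empty
  then show ?case using assms by (simp add: pe_lin)
next
  case (insert a A)
  then show ?case using assms
    by (simp add: pe_lin lin_add lin_const_mult distrib_left sum.distrib sum_distrib_left mult_ac)
qed

lemma pe_below: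
  assumes "i < N ^ k" "j < N ^ k" "x \<in> hecke_free k"
  shows "pe k i j x = mat_trace D * rh k x $$ (i, j)"
proof -
  have "pe k i j x = (\<Sum>s<N. \<Sum>t<N. D $$ (s, t) * kron (rh k x) (1\<^sub>m N) $$ (i * N + t, j * N + s))"
    unfolding pe_def rh_Suc[OF assms(3)] by (rule ptr_index[OF assms(1,2)])
  also have "\<dots> = (\<Sum>s<N. \<Sum>t<N. if t = s then D $$ (s, s) * rh k x $$ (i, j) else 0)"
  proof (intro sum.cong refl)
    fix s t assume "s \<in> {..<N}" "t \<in> {..<N}"
    then show "D $$ (s, t) * kron (rh k x) (1\<^sub>m N) $$ (i * N + t, j * N + s) = (if t = s then D $$ (s, s) * rh k x $$ (i, j) else 0)"
      using kron_index_pair[of i "rh k x" t "1\<^sub>m N" j s] assms(1,2) by auto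
  qed
  also have "\<dots> = mat_trace D * rh k x $$ (i, j)"
    by (simp add: mat_trace_def sum_distrib_right)
  finally show ?thesis .
qed

text \<open>Operators on the first k factors pass outside the partial trace, and
  \<open>ptr_R\<close> sends the remaining R-matrix to the identity.\<close>

lemma pe_gen:
  assumes "i < N ^ k" "j < N ^ k" and x: "x \<in> hecke_free k" and y: "y \<in> hecke_free k" and k: "1 \<le> k"
  shows "pe k i j (x * gen k * y) = rh k (x * y) $$ (i, j)"
proof -
  have N: "N > 0" using assms(1) k by (cases "N = 0") (auto simp: power_0_left)
  obtain l where l: "k = Suc l" using k by (cases k) auto
  have up: "x \<in> hecke_free (Suc k)" "y \<in> hecke_free (Suc k)" using x y hecke_free_mono[of k "Suc k"] by auto
  have g: "gen k \<in> hecke_free (Suc k)" using gen_hecke_free[of k "Suc k"] k by simp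
  have o: "op R (Suc k) k = kron (1\<^sub>m (N ^ l)) R" using amp_top[of N l R] by (simp add: l)
  have oc: "op R (Suc k) k \<in> sqm (N ^ k * N)" using op_carrier[of R k "Suc k"] k by (simp add: mult.commute)
  have c: "rh k x \<in> sqm (N ^ k)" "rh k y \<in> sqm (N ^ k)" by simp_all
  have kc: "kron (rh k x) (1\<^sub>m N) \<in> sqm (N ^ k * N)" by simp
  have po: "ptr N D (N ^ k) (op R (Suc k) k) = 1\<^sub>m (N ^ k)"
    using ptr_one_kron[of R N N D "N ^ l"] ptr_R[OF carr(1) skew] carr(1) N unfolding o unfolding l by (simp add: kron_one_one mult.commute)
  have "rh (Suc k) (x * gen k * y) = kron (rh k x) (1\<^sub>m N) * op R (Suc k) k * kron (rh k y) (1\<^sub>m N)"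
    unfolding rh_mult[OF free_carrier_mult[OF up(1) g] up(2)] rh_mult[OF up(1) g] rh_Suc[OF x] rh_Suc[OF y]
    using rh_gen[of k "Suc k"] k by simp
  then have "pe k i j (x * gen k * y) = (rh k x * ptr N D (N ^ k) (op R (Suc k) k) * rh k y) $$ (i, j)"
    unfolding pe_def
    using ptr_mult_right[OF c(2) mult_carrier_mat[OF kc oc]] ptr_mult_left[OF D_op_carrier central_mat_comm c(1) oc] by simp
  then show ?thesis unfolding po rh_mult[OF x y] using c by simp
qed

lemma rh_sum_entry: "i < N ^ k \<Longrightarrow> j < N ^ k \<Longrightarrow> rh k (sum f A) $$ (i, j) = (\<Sum>a\<in>A. rh k (f a) $$ (i, j))"
  by (simp add: rhof_index lin_sum)

end

context hecke_pair
begin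

lemma pe_heq: "heq q (Suc k) x y \<Longrightarrow> pe k i j x = pe k i j y"
  by (simp add: pe_def rh_heq)

lemma branch_trace:
  assumes T: "T \<in> Stdk k" and ij: "i < N ^ k" "j < N ^ k"
  shows "mat_trace D * rh k (munit q T T) $$ (i, j) = (\<Sum>b\<in>addb (set T). pe k i j (munit q (T @ [b]) (T @ [b])))"
proof -
  have f: "finite (addb (set T))" using finite_addb Stdk_finite_set[OF T] by auto
  show ?thesis
    using pe_heq[OF munit_branch[OF q T], of i j] pe_below[OF ij munit_carrier[OF q T T refl]]
      pe_sum[OF ij f, of "\<lambda>_. 1" "\<lambda>b. munit q (T @ [b]) (T @ [b])"] by (simp add: const_1)
qed

lemma branch_gen_trace:
  assumes T: "T \<in> Stdk k" and ij: "i < N ^ k" "j < N ^ k" and B: "set T = B" "downset B" "a \<in> B" "downset (B - {a})"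
  shows "rh k (munit q T T) $$ (i, j) = (\<Sum>b\<in>addb B. qf q (content b - content a) * pe k i j (munit q (T @ [b]) (T @ [b])))"
proof -
  have k: "card B = k" using Stdk_finite_set[OF T] B by simp
  obtain P where P: "P @ [a] \<in> Stdk k" "set (P @ [a]) = set T" using std_last[OF B(2-4)] k B(1) by auto
  let ?P = "P @ [a]" let ?e = "munit q ?P ?P"
  have f: "finite (addb B)" using finite_addb B by auto
  have k1: "1 \<le> k" using P by (auto simp: Stdk_def)
  note mc = munit_carrier[OF q T P(1) P(2)[symmetric]] munit_carrier[OF q P(1) P(1) refl] munit_carrier[OF q P(1) T P(2)]
  have "heq q k (munit q T ?P * ?e) (munit q T ?P)" by (rule munit_mult[OF q]) (use T P in auto)
  from heq_mult_right[OF this free_carrier_mult[OF mc(2,3)]]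
  have "heq q k (munit q T ?P * ?e * (?e * munit q ?P T)) (munit q T ?P * (?e * munit q ?P T))" .
  also have "heq q k \<dots> (munit q T ?P * munit q ?P T)"
    by (rule heq_mult_left[OF munit_mult[OF q] mc(1)]) (use T P in auto)
  also have "heq q k \<dots> (munit q T T)" by (rule munit_mult[OF q]) (use T P in auto)
  finally have r: "rh k (munit q T ?P * ?e * (?e * munit q ?P T)) = rh k (munit q T T)" by (rule rh_heq)
  have "(\<Sum>b\<in>addb B. qf q (content b - content a) * pe k i j (munit q (T @ [b]) (T @ [b])))
     = pe k i j (munit q T ?P * (?e * gen k * ?e) * munit q ?P T)"
    using pe_heq[OF munit_branch_gen[OF q T P], of i j] pe_sum[OF ij f, of "\<lambda>b. qf q (content b - content a)" "\<lambda>b. munit q (T @ [b]) (T @ [b])"]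
    by (simp only: B(1))
  also have "munit q T ?P * (?e * gen k * ?e) * munit q ?P T = munit q T ?P * ?e * gen k * (?e * munit q ?P T)"
    by (simp only: mult.assoc)
  also have "pe k i j \<dots> = rh k (munit q T T) $$ (i, j)"
    unfolding r[symmetric] by (rule pe_gen[OF ij free_carrier_mult[OF mc(1,2)] free_carrier_mult[OF mc(2,3)] k1])
  finally show ?thesis ..
qed

context
  fixes m n :: nat
  assumes gl: "GL_type N q m n R"
begin

text \<open>The GL condition starts at two boxes, hence the bound on the size; a single box is
  treated apart in \<open>dim_nonzero\<close>.\<close>

lemma GL_cidem:
  assumes "downset B" "2 \<le> card B"
  shows "rh (card B) (cidem q B) = 0\<^sub>m (N ^ card B) (N ^ card B) \<longleftrightarrow> (m, n) \<in> B"
proof -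
  obtain \<nu> where \<nu>: "\<nu> \<in> partitions_of (card B)" "young_diagram \<nu> = B" using young_diagram_surj[OF assms(1)] by auto
  then have \<nu>': "\<nu> \<in> partitions" "sum_list \<nu> = card B" by (auto simp: partitions_of_def)
  have "rho N R (card B) (central_idempotent q \<nu>) = rh (card B) (cidem q B)"
    unfolding central_idempotent_eq[OF q \<nu>'(1)] \<nu>'(2) \<nu>(2) by (rule rho_class[OF cidem_carrier[OF q]])
  moreover have "rho N R (card B) (central_idempotent q \<nu>) = 0\<^sub>m (N ^ card B) (N ^ card B) \<longleftrightarrow> \<nu> \<notin> hook_partitions m n"
    using gl assms(2) \<nu>(1) unfolding GL_type_def by blast
  ultimately show ?thesis using hook_iff[OF \<nu>'(1), of m n] \<nu>(2) by simp
qed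

text \<open>A diagonal unit is a multiple of the central idempotent of its shape, and that one is
  annihilated when the shape contains (m, n).\<close>

lemma GL_vanish:
  assumes T: "T \<in> Stdk k" "(m, n) \<in> set T" "2 \<le> k"
  shows "rh k (munit q T T) = 0\<^sub>m (N ^ k) (N ^ k)"
proof -
  have B: "downset (set T)" "card (set T) = k" using Stdk_finite_set[OF T(1)] by auto
  have c: "cidem q (set T) \<in> hecke_free k" using cidem_carrier[OF q, of "set T"] B by simp
  note mc = munit_carrier[OF q T(1) T(1) refl]
  have z: "rh k (cidem q (set T)) = 0\<^sub>m (N ^ k) (N ^ k)" using GL_cidem[OF B(1)] B(2) T by simp
  have "heq q k (cidem q (set T) * munit q T T) (munit q T T)"
  proof (rule heqI[OF q])
    fix U v assume "U \<in> Stdk k"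
    then show "actx q (cidem q (set T) * munit q T T) v U = actx q (munit q T T) v U"
      using actx_cidem[OF q B(1)] B(2) acts_asD[OF munit[OF q T(1) T(1) refl]] by (auto simp: actx_mult)
  qed (use c mc in simp_all)
  then have "rh k (munit q T T) = rh k (cidem q (set T)) * rh k (munit q T T)" using rh_heq rh_mult[OF c mc] by metis
  then show ?thesis unfolding z by (simp add: left_mult_zero_mat[OF rhof_carrier])
qed

lemma pe_zero: assumes "rh (Suc k) x = 0\<^sub>m (N ^ Suc k) (N ^ Suc k)" "i < N ^ k" "j < N ^ k" shows "pe k i j x = 0"
  unfolding pe_def assms(1) ptr_index[OF assms(2,3)]
  using pair_less[OF assms(2)] pair_less[OF assms(3)] by (auto intro!: sum.neutral simp: mult.commute)

text \<open>Every nonempty diagram contains (0, 0), so all diagonal units on two strands vanish, and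
  with them their sum, the identity of the second tensor power.\<close>

lemma N_zero: assumes "m = 0" "n = 0" shows "N = 0"
proof (rule ccontr)
  assume "N \<noteq> 0"
  then have N: "0 < N ^ 2" by simp
  have "rh 2 (munit q T T) $$ (0, 0) = 0" if "T \<in> Stdk 2" for T
  proof -
    have B: "downset (set T)" "card (set T) = 2" using Stdk_finite_set[OF that] by auto
    then obtain r c where "(r, c) \<in> set T" by (metis card.empty equals0I surj_pair zero_neq_numeral)
    then have "(m, n) \<in> set T" using downsetD[OF B(1), of r c 0 0] assms by simp
    then show ?thesis using GL_vanish[OF that] N by simp
  qed
  then have "rh 2 1 $$ (0, 0) = (0 :: complex)" using rh_heq[OF one_expand[OF q, of 2]] N by (simp add: rh_sum_entry)
  then show False using N by (simp add: rh_1)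
qed

text \<open>A row (if m is positive) or a column (if m is zero) of two boxes avoids (m, n), and its
  idempotent cannot be nonzero on the zero space.\<close>

lemma N_pos: assumes "m \<noteq> 0 \<or> n \<noteq> 0" shows "0 < N"
proof (rule ccontr)
  assume "\<not> 0 < N"
  define B where "B = (if m \<noteq> 0 then {(0, 0), (0, 1)} else {(0, 0), (1, 0)} :: box set)"
  have "downset B" "card B = 2" "(m, n) \<notin> B" using assms by (auto simp: B_def downset_def)
  then have "rh 2 (cidem q B) \<noteq> 0\<^sub>m (N ^ 2) (N ^ 2)" using GL_cidem[of B] by simp
  moreover have "rh 2 (cidem q B) = 0\<^sub>m (N ^ 2) (N ^ 2)" using \<open>\<not> 0 < N\<close> by (intro eq_matI) auto
  ultimately show False by simp
qed

lemma dim_nonzero: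
  assumes B: "downset B" "card B = k" "1 \<le> k" "(m, n) \<notin> B" and mn: "m \<noteq> 0 \<or> n \<noteq> 0"
  shows "\<exists>T\<in>std_of B. \<exists>i<N ^ k. \<exists>j<N ^ k. rh k (munit q T T) $$ (i, j) \<noteq> 0"
proof -
  have "rh k (cidem q B) \<noteq> 0\<^sub>m (N ^ k) (N ^ k)"
  proof (cases "k = 1")
    case True
    \<comment> \<open>With one box there is one tableau, so the idempotent is 1 and acts as the
      identity, which is nonzero because N is positive.\<close>
    obtain T where T: "T \<in> std_of B" using Std_exists[OF B(1)] by (auto simp: std_of_def)
    have "heq q 1 1 (cidem q B)"
    proof (rule heqI[OF q])
      show "cidem q B \<in> hecke_free 1" using cidem_carrier[OF q, of B] B(2) True by simp
      fix U v assume U: "U \<in> Stdk 1"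
      have T1: "T \<in> Stdk 1" using std_of_Stdk[OF T] B(2) True by simp
      have "{(U, U), (T, T)} \<subseteq> std_pairs 1" using U T1 by (auto simp: std_pairs_def std_of_def Stdk_def)
      then have "card {(U, U), (T, T)} \<le> 1" using card_mono[OF finite_std_pairs[of 1]] card_std_pairs[of 1] by fastforce
      then have "U = T" by (cases "U = T") auto
      then show "actx q 1 v U = actx q (cidem q B) v U"
        using actx_cidem[OF q B(1), of U] U B(2) True T by (simp add: std_of_def)
    qed simp
    then have "rh k (cidem q B) = 1\<^sub>m (N ^ k)" using rh_heq rh_1 True by metis
    moreover have "(1\<^sub>m (N ^ k) :: complex mat) $$ (0, 0) = 1" using N_pos[OF mn] by simp
    moreover have "(0\<^sub>m (N ^ k) (N ^ k) :: complex mat) $$ (0, 0) = 0" using N_pos[OF mn] by simp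
    ultimately show ?thesis by auto
  next
    case False
    then show ?thesis using GL_cidem[OF B(1)] B by auto
  qed
  then obtain i j where ij: "i < N ^ k" "j < N ^ k" "rh k (cidem q B) $$ (i, j) \<noteq> 0"
    by (metis eq_matI dim_rhof index_zero_mat)
  then have "(\<Sum>T\<in>std_of B. rh k (munit q T T) $$ (i, j)) \<noteq> 0"
    unfolding cidem_def rh_sum_entry[OF ij(1,2)] by blast
  then obtain T where "T \<in> std_of B" "rh k (munit q T T) $$ (i, j) \<noteq> 0"
    using sum.not_neutral_contains_not_neutral by blast
  then show ?thesis using ij by blast
qed

text \<open>The truncated rectangle B has at most three extensions. Branching without a generator
  gives Tr D z = x + y, and the removable boxes (m-1, n) and (m, n-1), where present, give two
  relations for z. Since B avoids (m, n), a tableau and an entry with nonzero z exist.\<close>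

lemma trace_D: "mat_trace D = q powi (int n - int m) * qint q (int m - int n)"
proof (cases "m = 0 \<and> n = 0")
  case True
  then show ?thesis using N_zero by (simp add: mat_trace_def)
next
  case False
  define B where "B = {..m} \<times> {..n} - {(m, n)}"
  define k where "k = card B"
  have k: "k = (m + 1) * (n + 1) - 1" by (simp add: k_def B_def card_Diff_subset)
  have k1: "1 \<le> k" unfolding k using False by (cases m; cases n) auto
  have B: "downset B" by (auto simp: B_def downset_def)
  obtain T i j where T: "T \<in> std_of B" and ij: "i < N ^ k" "j < N ^ k" and nz: "rh k (munit q T T) $$ (i, j) \<noteq> 0"
    using dim_nonzero[OF B k_def[symmetric] k1] False by (auto simp: B_def)
  have TB: "set T = B" "T \<in> Stdk k" using T std_of_Stdk[OF T] by (auto simp: std_of_def k_def)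
  define z where "z = rh k (munit q T T) $$ (i, j)"
  define X where "X b = pe k i j (munit q (T @ [b]) (T @ [b]))" for b
  \<comment> \<open>Adding the corner completes the rectangle, whose units are annihilated.\<close>
  have X0: "X (m, n) = 0" if "(m, n) \<in> addb B"
  proof -
    have "T @ [(m, n)] \<in> Stdk (Suc k)" using that TB by (simp add: Stdk_snoc)
    from GL_vanish[OF this] k1 show ?thesis unfolding X_def by (intro pe_zero ij) auto
  qed
  \<comment> \<open>For m = 0 or n = 0 the corresponding extension does not exist, and its unknown
    is set to 0.\<close>
  define x where "x = (if m = 0 then 0 else X (0, n + 1))"
  define y where "y = (if n = 0 then 0 else X (m + 1, 0))"
  have add: "addb B = {(m, n)} \<union> (if m = 0 then {} else {(0, n + 1)}) \<union> (if n = 0 then {} else {(m + 1, 0)})"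
  proof
    show "addb B \<subseteq> {(m, n)} \<union> (if m = 0 then {} else {(0, n + 1)}) \<union> (if n = 0 then {} else {(m + 1, 0)})"
    proof
      fix b assume b: "b \<in> addb B"
      obtain r c where rc: "b = (r, c)" by (cases b)
      have d: "downset (insert (r, c) B)" "(r, c) \<notin> B" using b rc by (auto simp: addb_def)
      have below: "(r', c') = (r, c) \<or> (r', c') \<in> B" if "r' \<le> r" "c' \<le> c" for r' c'
        using downsetD[OF d(1), of r c r' c'] that by simp
      have c0: "r = 0 \<and> m \<noteq> 0" if "n < c"
      proof -
        have "r = 0" using below[of 0 c] that by (auto simp: B_def)
        moreover have "m \<noteq> 0" using below[of 0 n] that by (auto simp: B_def)
        ultimately show ?thesis by simp
      qed
      have r0: "c = 0 \<and> n \<noteq> 0" if "m < r"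
      proof -
        have "c = 0" using below[of r 0] that by (auto simp: B_def)
        moreover have "n \<noteq> 0" using below[of m 0] that by (auto simp: B_def)
        ultimately show ?thesis by simp
      qed
      have "c = n + 1" if "n < c" using below[of r "n + 1"] that by (auto simp: B_def)
      moreover have "r = m + 1" if "m < r" using below[of "m + 1" c] that by (auto simp: B_def)
      ultimately show "b \<in> {(m, n)} \<union> (if m = 0 then {} else {(0, n + 1)}) \<union> (if n = 0 then {} else {(m + 1, 0)})"
        using c0 r0 d(2) rc by (auto simp: B_def not_le)
    qed
    have "downset (insert (m, n) B)" by (auto simp: B_def downset_def)
    moreover have "downset (insert (0, n + 1) B)" if "m \<noteq> 0" using that by (auto simp: B_def downset_def)
    moreover have "downset (insert (m + 1, 0) B)" if "n \<noteq> 0" using that by (auto simp: B_def downset_def)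
    ultimately show "{(m, n)} \<union> (if m = 0 then {} else {(0, n + 1)}) \<union> (if n = 0 then {} else {(m + 1, 0)}) \<subseteq> addb B"
      by (auto simp: addb_def B_def)
  qed
  have sum: "(\<Sum>b\<in>addb B. g b * X b) = g (0, n + 1) * x + g (m + 1, 0) * y" for g :: "box \<Rightarrow> complex"
  proof -
    have "X (m, n) = 0" by (rule X0) (simp add: add)
    then show ?thesis using False unfolding add x_def y_def by auto
  qed
  have D: "mat_trace D * z = x + y"
    using branch_trace[OF TB(2) ij] sum[of "\<lambda>_. 1"] by (simp add: TB(1) z_def X_def)
  note G = branch_gen_trace[OF TB(2) ij TB(1) B, folded X_def z_def, unfolded sum]
  have q0: "q \<noteq> 0" using q by (simp add: generic_def)
  \<comment> \<open>The factor [m] makes the equation trivial for m = 0, when the removable box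
    (m-1, n) is missing; [n] plays the same part in the next equation.\<close>
  have 1: "qint q (int m) * z = q powi int m * x + qint q (int m) * (qf q (- int n - 2) * y)"
  proof (cases "m = 0")
    case True
    then show ?thesis by (simp add: x_def)
  next
    case m: False
    have "(m - 1, n) \<in> B" "downset (B - {(m - 1, n)})" using m by (auto simp: B_def downset_def)
    moreover have "int (n + 1) - (int n - int (m - 1)) = int m" "- int (m + 1) - (int n - int (m - 1)) = - int n - 2"
      using m by auto
    ultimately have "z = qf q (int m) * x + qf q (- int n - 2) * y"
      using G[of "(m - 1, n)"] by (simp only: content_def fst_conv snd_conv of_nat_0 diff_0 diff_0_right)
    moreover have "qint q (int m) * qf q (int m) = q powi int m" using qint_nonzero[OF q, of "int m"] m by (simp add: qf_def)
    ultimately show ?thesis by (simp add: distrib_left flip: mult.assoc)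
  qed
  have 2: "qint q (int n) * z = qint q (int n) * (qf q (int m + 2) * x) - q powi (- int n) * y"
  proof (cases "n = 0")
    case True
    then show ?thesis by (simp add: y_def)
  next
    case n: False
    have "(m, n - 1) \<in> B" "downset (B - {(m, n - 1)})" using n by (auto simp: B_def downset_def)
    moreover have "int (n + 1) - (int (n - 1) - int m) = int m + 2" "- int (m + 1) - (int (n - 1) - int m) = - int n"
      using n by auto
    ultimately have "z = qf q (int m + 2) * x + qf q (- int n) * y"
      using G[of "(m, n - 1)"] by (simp only: content_def fst_conv snd_conv of_nat_0 diff_0 diff_0_right)
    moreover have "qint q (int n) * qf q (- int n) = - (q powi (- int n))"
      using qint_nonzero[OF q, of "int n"] n by (simp add: qf_def qint_minus)
    ultimately show ?thesis by (simp add: distrib_left flip: mult.assoc)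
  qed
  have "x + y = q powi (int n - int m) * qint q (int m - int n) * z"
    by (rule qint_solve[OF q 1 2]) auto
  then show ?thesis using nz D by (simp add: z_def)
qed

end

end

section \<open>Partial fractions and generating series for the weighted power sums\<close>

section \<open>Newton relations for the spectral values\<close>

lemma partial_fraction:
  fixes a b v :: "'k::field"
  assumes "a \<noteq> b" "v \<noteq> a" "v \<noteq> b"
  shows "b / (a - b) * (a / (v - a)) + a / (b - a) * (b / (v - b)) = b / (v - b) * (a / (v - a))"
proof -
  have "a / (b - a) = - (a / (a - b))" by (metis minus_diff_eq minus_divide_right)
  moreover have "v - a \<noteq> 0" "v - b \<noteq> 0" "a - b \<noteq> 0" using assms by auto
  ultimately show ?thesis by (simp add: divide_simps) (simp add: algebra_simps)
qed

text \<open>The series aX/(1 - aX). It has no constant term, because the power sums of exponent 0 do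
  not enter the Newton relations.\<close>

definition geom :: "'k::field \<Rightarrow> 'k fps" where
  "geom a = Abs_fps (\<lambda>k. if k = 0 then 0 else a ^ k)"

lemma geom_eq: "(1 - fps_const a * fps_X) * geom a = fps_const a * fps_X"
proof (rule fps_ext)
  fix k
  have "(1 - fps_const a * fps_X) * geom a = geom a - fps_const a * (fps_X * geom a)" by (simp add: algebra_simps)
  then show "fps_nth ((1 - fps_const a * fps_X) * geom a) k = fps_nth (fps_const a * fps_X) k"
    by (cases k) (auto simp: geom_def)
qed

lemma linear_fps_nonzero: "(1 - fps_const a * fps_X :: 'k::field fps) \<noteq> 0"
proof
  assume "(1 - fps_const a * fps_X :: 'k fps) = 0"
  then have "fps_nth (1 - fps_const a * fps_X :: 'k fps) 0 = 0" by simp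
  then show False by simp
qed

lemma fps_const_sum: "fps_const (sum f S) = (\<Sum>i\<in>S. fps_const (f i))"
  by (induction S rule: infinite_finite_induct) (simp_all flip: fps_const_add)

lemma one_plus_linear_neg: "1 + fps_const (- a) * fps_X = 1 - fps_const a * (fps_X :: 'k::field fps)"
  by (simp flip: fps_const_neg)

text \<open>This is \<open>partial_fraction\<close> at v = 1/X, where a/(v - a) becomes aX/(1 - aX),
  proved in power series by clearing the two denominators.\<close>

lemma geom_partial_fraction:
  assumes "a \<noteq> b"
  shows "fps_const (b / (a - b)) * geom a + fps_const (a / (b - a)) * geom b = geom a * geom b"
proof -
  let ?c = fps_const and ?p = "1 - fps_const a * fps_X" and ?r = "1 - fps_const b * fps_X"
  define u where "u = 1 / (a - b)"
  have "(a - b) * u = 1" using assms by (simp add: u_def)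
  then have u: "(?c a - ?c b) * ?c u = 1" by (metis fps_const_mult fps_const_sub fps_const_1_eq_1)
  have e: "b / (a - b) = b * u" "a / (b - a) = - (a * u)"
    by (simp add: u_def) (metis u_def minus_diff_eq minus_divide_right mult.right_neutral times_divide_eq_right)
  have "?p * ?r * (?c (b * u) * geom a + ?c (- (a * u)) * geom b) = ?c (b * u) * ?r * (?p * geom a) + ?c (- (a * u)) * ?p * (?r * geom b)"
    by (simp only: algebra_simps)
  also have "\<dots> = ?c b * ?c u * ?r * (?c a * fps_X) - ?c a * ?c u * ?p * (?c b * fps_X)"
    unfolding geom_eq by (simp only: fps_const_mult[symmetric] fps_const_neg[symmetric] mult_minus_left add_uminus_conv_diff)
  also have "\<dots> = ((?c a - ?c b) * ?c u) * (?c a * fps_X) * (?c b * fps_X)"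
    by (simp only: algebra_simps)
  also have "\<dots> = (?p * geom a) * (?r * geom b)" unfolding u geom_eq by simp
  also have "\<dots> = ?p * ?r * (geom a * geom b)" by (simp only: mult_ac)
  finally show ?thesis unfolding e using linear_fps_nonzero[of a] linear_fps_nonzero[of b] by simp
qed

text \<open>One family of weights for both kinds of spectral values: with h = q - 1/q, the parameter
  kappa is 1/q for the mu and -q for the nu, and 1 - h kappa becomes q^(-2) or q^2.\<close>

locale spectral_weights =
  fixes \<kappa> z :: "nat \<Rightarrow> 'k::field" and h :: 'k
  assumes inj_z: "inj z"
begin

definition wt :: "nat set \<Rightarrow> nat \<Rightarrow> 'k" where
  "wt S i = \<kappa> i * (\<Prod>p\<in>S - {i}. (z i - (1 - h * \<kappa> p) * z p) / (z i - z p))"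

definition H :: "nat set \<Rightarrow> 'k fps" where
  "H S = (\<Sum>i\<in>S. fps_const (wt S i) * geom (z i))"

lemma z_eq_iff [simp]: "z i = z j \<longleftrightarrow> i = j"
  using inj_z by (auto simp: inj_def)

lemma factor_eq: assumes "v \<noteq> b" shows "(v - (1 - h * k) * b) / (v - b) = 1 + h * k * (b / (v - b))"
  using assms by (simp add: divide_simps) (simp add: algebra_simps)

lemma wt_insert_old:
  assumes "finite S" "w \<notin> S" "i \<in> S"
  shows "wt (insert w S) i = wt S i * (1 + h * \<kappa> w * (z w / (z i - z w)))"
proof -
  have "insert w S - {i} = insert w (S - {i})" "w \<notin> S - {i}" "finite (S - {i})" using assms by auto
  then have 1: "wt (insert w S) i = wt S i * ((z i - (1 - h * \<kappa> w) * z w) / (z i - z w))"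
    by (simp add: wt_def)
  have 2: "z i \<noteq> z w" using assms by auto
  show ?thesis unfolding 1 factor_eq[OF 2] ..
qed

lemma wt_insert_new_prod:
  assumes "w \<notin> S"
  shows "wt (insert w S) w = \<kappa> w * (\<Prod>p\<in>S. (z w - (1 - h * \<kappa> p) * z p) / (z w - z p))"
proof -
  have "insert w S - {w} = S" using assms by auto
  then show ?thesis by (simp add: wt_def)
qed

text \<open>As a function of v the product has value 1 at infinity and simple poles at the z_i with
  residues h z_i \<open>wt S i\<close>. The induction on S proves this partial fraction expansion by
  algebra alone.\<close>

lemma factor_prod:
  assumes "finite S" "v \<notin> z ` S"
  shows "(\<Prod>p\<in>S. (v - (1 - h * \<kappa> p) * z p) / (v - z p)) = 1 + h * (\<Sum>i\<in>S. wt S i * (z i / (v - z i)))"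
  using assms
proof (induction S arbitrary: v rule: finite_induct)
  case (insert w S)
  define u where "u = z w / (v - z w)"
  define a where "a i = z i / (v - z i)" for i
  define b where "b i = z i / (z w - z i)" for i
  define g where "g i = z w / (z i - z w)" for i
  define X where "X = (\<Sum>i\<in>S. wt S i * a i)"
  define Y where "Y = (\<Sum>i\<in>S. wt S i * b i)"
  define Z where "Z = (\<Sum>i\<in>S. wt S i * (g i * a i))"
  have vw: "v \<noteq> z w" and vS: "v \<notin> z ` S" using insert.prems by auto
  have "z w \<notin> z ` S" using insert.hyps by auto
  note new = wt_insert_new_prod[OF insert.hyps(2)] insert.IH[OF this]
  have pf: "g i * a i + b i * u = u * a i" if "i \<in> S" for i
  proof -
    have "z i \<noteq> z w" "v \<noteq> z i" using that insert.hyps insert.prems by auto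
    then show ?thesis unfolding g_def a_def b_def u_def using partial_fraction[of "z i" "z w" v] vw by simp
  qed
  have "Z + Y * u = (\<Sum>i\<in>S. wt S i * (g i * a i + b i * u))"
    by (simp add: Z_def Y_def sum_distrib_right sum.distrib distrib_left mult.assoc)
  also have "\<dots> = (\<Sum>i\<in>S. wt S i * (u * a i))" by (intro sum.cong refl) (simp only: pf)
  also have "\<dots> = u * X" by (simp add: X_def sum_distrib_left mult_ac)
  finally have ZY: "Z + Y * u = u * X" .
  have "(\<Sum>i\<in>S. wt (insert w S) i * a i) = (\<Sum>i\<in>S. wt S i * a i + h * \<kappa> w * (wt S i * (g i * a i)))"
    by (intro sum.cong refl) (simp add: wt_insert_old[OF insert.hyps] g_def algebra_simps)
  also have "\<dots> = X + h * \<kappa> w * Z" by (simp add: X_def Z_def sum.distrib sum_distrib_left)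
  finally have 1: "(\<Sum>i\<in>S. wt (insert w S) i * a i) = X + h * \<kappa> w * Z" .
  have 2: "wt (insert w S) w = \<kappa> w * (1 + h * Y)" unfolding new Y_def b_def ..
  have "(\<Prod>p\<in>insert w S. (v - (1 - h * \<kappa> p) * z p) / (v - z p)) = (1 + h * \<kappa> w * u) * (1 + h * X)"
    using insert.IH[OF vS] insert.hyps by (simp add: factor_eq[OF vw] u_def X_def a_def)
  also have "\<dots> = 1 + h * (\<kappa> w * (1 + h * Y) * u + (X + h * \<kappa> w * Z))"
  proof -
    have "h * (h * \<kappa> w) * (u * X) = h * (h * \<kappa> w) * (Z + Y * u)" unfolding ZY ..
    then show ?thesis by (simp add: algebra_simps)
  qed
  also have "\<dots> = 1 + h * (\<Sum>i\<in>insert w S. wt (insert w S) i * a i)"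
    unfolding sum.insert[OF insert.hyps] 1 2 by (simp only: a_def u_def)
  finally show ?case by (simp add: a_def)
qed simp

lemma wt_insert_new:
  assumes "finite S" "w \<notin> S"
  shows "wt (insert w S) w = \<kappa> w * (1 + h * (\<Sum>i\<in>S. wt S i * (z i / (z w - z i))))"
proof -
  have "z w \<notin> z ` S" using assms by auto
  then show ?thesis by (simp add: wt_insert_new_prod[OF assms(2)] factor_prod[OF assms(1)])
qed

text \<open>Multiplied by h, this says that 1 + h H gains the factor 1 + h kappa L, with L the
  geometric series of the new value. In the form without h it also holds for h = 0.\<close>

lemma H_insert:
  assumes S: "finite S" "w \<notin> S"
  shows "H (insert w S) = H S + fps_const (\<kappa> w) * geom (z w) * (1 + fps_const h * H S)"
proof -
  let ?c = fps_const
  define b where "b i = z i / (z w - z i)" for i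
  define g where "g i = z w / (z i - z w)" for i
  define Y where "Y = (\<Sum>i\<in>S. wt S i * b i)"
  define Z where "Z = (\<Sum>i\<in>S. ?c (wt S i) * (?c (g i) * geom (z i)))"
  have pf: "?c (g i) * geom (z i) + ?c (b i) * geom (z w) = geom (z i) * geom (z w)" if "i \<in> S" for i
  proof -
    have "z i \<noteq> z w" using that assms by auto
    from geom_partial_fraction[OF this] show ?thesis by (simp only: g_def b_def)
  qed
  have cY: "?c Y = (\<Sum>i\<in>S. ?c (wt S i) * ?c (b i))"
    by (simp only: Y_def fps_const_sum fps_const_mult)
  have "Z + ?c Y * geom (z w) = (\<Sum>i\<in>S. ?c (wt S i) * (?c (g i) * geom (z i) + ?c (b i) * geom (z w)))"
    unfolding Z_def cY sum_distrib_right sum.distrib[symmetric] by (simp only: distrib_left mult.assoc)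
  also have "\<dots> = (\<Sum>i\<in>S. ?c (wt S i) * (geom (z i) * geom (z w)))" by (intro sum.cong refl) (simp only: pf)
  also have "\<dots> = H S * geom (z w)" by (simp only: H_def sum_distrib_right mult.assoc)
  finally have ZY: "Z + ?c Y * geom (z w) = H S * geom (z w)" .
  have "(\<Sum>i\<in>S. ?c (wt (insert w S) i) * geom (z i)) = (\<Sum>i\<in>S. ?c (wt S i) * geom (z i) + ?c (h * \<kappa> w) * (?c (wt S i) * (?c (g i) * geom (z i))))"
  proof (intro sum.cong refl)
    fix i assume "i \<in> S"
    have "?c (wt (insert w S) i) = ?c (wt S i) * (1 + ?c (h * \<kappa> w) * ?c (g i))"
      unfolding wt_insert_old[OF assms \<open>i \<in> S\<close>] g_def[symmetric] by (simp flip: fps_const_add fps_const_mult fps_const_1_eq_1)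
    then show "?c (wt (insert w S) i) * geom (z i) = ?c (wt S i) * geom (z i) + ?c (h * \<kappa> w) * (?c (wt S i) * (?c (g i) * geom (z i)))"
      by (simp only: distrib_left distrib_right mult_ac mult_1_left mult_1_right)
  qed
  also have "\<dots> = H S + ?c (h * \<kappa> w) * Z" unfolding H_def Z_def sum.distrib sum_distrib_left ..
  finally have 1: "(\<Sum>i\<in>S. ?c (wt (insert w S) i) * geom (z i)) = H S + ?c (h * \<kappa> w) * Z" .
  have 2: "?c (wt (insert w S) w) = ?c (\<kappa> w) * (1 + ?c h * ?c Y)"
    unfolding wt_insert_new[OF assms] Y_def b_def by (simp flip: fps_const_add fps_const_mult fps_const_1_eq_1)
  have "H (insert w S) = ?c (\<kappa> w) * (1 + ?c h * ?c Y) * geom (z w) + (H S + ?c (h * \<kappa> w) * Z)"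
    unfolding H_def[of "insert w S"] sum.insert[OF assms] 1 2 ..
  also have "\<dots> = H S + ?c (\<kappa> w) * geom (z w) + ?c h * ?c (\<kappa> w) * (Z + ?c Y * geom (z w))"
    by (simp add: algebra_simps flip: fps_const_mult)
  also have "\<dots> = H S + ?c (\<kappa> w) * geom (z w) * (1 + ?c h * H S)" unfolding ZY by (simp only: algebra_simps mult_1_left mult_1_right)
  finally show ?thesis .
qed

text \<open>The analogue at exponent 0: multiplied by h, it says that 1 - h times the total weight
  gains the factor 1 - h kappa.\<close>

lemma sum_wt_insert:
  assumes S: "finite S" "w \<notin> S"
  shows "sum (wt (insert w S)) (insert w S) = (1 - h * \<kappa> w) * sum (wt S) S + \<kappa> w"
proof -
  have "sum (wt (insert w S)) S = (\<Sum>i\<in>S. wt S i + h * \<kappa> w * (wt S i * (z w / (z i - z w))))"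
    by (intro sum.cong refl) (simp add: wt_insert_old[OF assms] algebra_simps)
  also have "\<dots> = sum (wt S) S + h * \<kappa> w * (\<Sum>i\<in>S. wt S i * (z w / (z i - z w)))"
    by (simp add: sum.distrib sum_distrib_left)
  also have "(\<Sum>i\<in>S. wt S i * (z w / (z i - z w))) = (\<Sum>i\<in>S. - (wt S i) - wt S i * (z i / (z w - z i)))"
  proof (intro sum.cong refl)
    fix i assume "i \<in> S"
    then have "z i - z w \<noteq> 0" "z w - z i \<noteq> 0" using assms by auto
    then show "wt S i * (z w / (z i - z w)) = - wt S i - wt S i * (z i / (z w - z i))"
      by (simp add: divide_simps) (simp add: algebra_simps)
  qed
  also have "\<dots> = - sum (wt S) S - (\<Sum>i\<in>S. wt S i * (z i / (z w - z i)))"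
    by (simp add: sum_subtractf sum_negf)
  finally show ?thesis using assms by (simp add: wt_insert_new[OF assms] algebra_simps)
qed

lemma H_nth: "fps_nth (H S) k = (if k = 0 then 0 else \<Sum>i\<in>S. wt S i * z i ^ k)"
  by (simp add: H_def geom_def fps_sum_nth)

end

definition dilate :: "'k::field \<Rightarrow> 'k fps \<Rightarrow> 'k fps" where
  "dilate a A = Abs_fps (\<lambda>k. a ^ k * fps_nth A k)"

text \<open>With coefficients (-1)^(k-1) [k] this is the difference A(-QX) - A(-X/Q) divided by -Q +
  1/Q, in a form that makes sense also when Q^2 = 1.\<close>

definition weigh :: "(nat \<Rightarrow> 'k::field) \<Rightarrow> 'k fps \<Rightarrow> 'k fps" where
  "weigh c A = Abs_fps (\<lambda>k. c k * fps_nth A k)"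

lemma mult_linear_fps: "A * (1 + fps_const a * fps_X) = A + fps_const a * (fps_X * A)" for A :: "'k::field fps"
  by (simp add: algebra_simps)

lemma dilate_linear:
  "dilate b (A * (1 + fps_const a * fps_X)) = dilate b A * (1 + fps_const (b * a) * fps_X)"
proof (rule fps_ext)
  fix k
  show "fps_nth (dilate b (A * (1 + fps_const a * fps_X))) k = fps_nth (dilate b A * (1 + fps_const (b * a) * fps_X)) k"
    unfolding mult_linear_fps by (cases k) (simp_all add: dilate_def, simp add: algebra_simps)
qed

text \<open>The twisted product rule of this divided difference for a linear factor; the recursion
  of the coefficients is all that enters.\<close>

lemma weigh_linear:
  assumes "c 0 = 0" "\<And>k. c (Suc k) = - inverse Q * c k + (- Q) ^ k"
  shows "weigh c (A * (1 + fps_const a * fps_X))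
    = weigh c A + fps_const a * fps_X * (dilate (- Q) A - fps_const (inverse Q) * weigh c A)"
proof (rule fps_ext)
  fix k
  have e: "fps_const a * fps_X * (dilate (- Q) A - fps_const (inverse Q) * weigh c A) = fps_const a * (fps_X * (dilate (- Q) A - fps_const (inverse Q) * weigh c A))"
    by (simp only: mult.assoc)
  show "fps_nth (weigh c (A * (1 + fps_const a * fps_X))) k
    = fps_nth (weigh c A + fps_const a * fps_X * (dilate (- Q) A - fps_const (inverse Q) * weigh c A)) k"
    unfolding mult_linear_fps e by (cases k) (simp_all add: weigh_def dilate_def assms, simp add: algebra_simps)
qed

lemma finite_multisets: "finite I \<Longrightarrow> finite {A. set_mset A \<subseteq> I \<and> size A = r}"
proof -
  assume I: "finite I"
  have "{A. set_mset A \<subseteq> I \<and> size A = r} \<subseteq> mset ` {xs. set xs \<subseteq> I \<and> length xs = r}"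
  proof
    fix A assume "A \<in> {A. set_mset A \<subseteq> I \<and> size A = r}"
    moreover obtain xs where "mset xs = A" using ex_mset by blast
    ultimately show "A \<in> mset ` {xs. set xs \<subseteq> I \<and> length xs = r}" by auto
  qed
  then show ?thesis using finite_lists_length_eq[OF I] finite_surj by blast
qed

lemma elem_sym_0 [simp]: "finite I \<Longrightarrow> elem_sym I x 0 = 1"
proof -
  assume "finite I"
  then have "{S. S \<subseteq> I \<and> card S = 0} = {{}}" by (auto dest: finite_subset)
  then show ?thesis by (simp add: elem_sym_def)
qed

lemma elem_sym_empty: "elem_sym {} x (Suc r) = 0"
proof -
  have e: "{S. S \<subseteq> {} \<and> card S = Suc r} = {}" by auto
  show ?thesis unfolding elem_sym_def e by simp
qed

lemma elem_sym_insert: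
  assumes "finite I" "a \<notin> I"
  shows "elem_sym (insert a I) x (Suc r) = elem_sym I x (Suc r) + x a * elem_sym I x r"
proof -
  let ?A = "{S. S \<subseteq> I \<and> card S = Suc r}" and ?B = "{S. S \<subseteq> I \<and> card S = r}"
  have f: "finite S" "a \<notin> S" if "S \<subseteq> I" for S using that assms finite_subset by auto
  have "{S. S \<subseteq> insert a I \<and> card S = Suc r} = ?A \<union> insert a ` ?B"
  proof (intro equalityI subsetI)
    fix S assume S: "S \<in> {S. S \<subseteq> insert a I \<and> card S = Suc r}"
    show "S \<in> ?A \<union> insert a ` ?B"
    proof (cases "a \<in> S")
      case True
      then have "S = insert a (S - {a})" "S - {a} \<subseteq> I" "card (S - {a}) = r" using S by auto
      then show ?thesis by blast
    qed (use S in auto)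
  qed (use f in auto)
  then have "elem_sym (insert a I) x (Suc r) = (\<Sum>S\<in>?A. \<Prod>i\<in>S. x i) + (\<Sum>S\<in>insert a ` ?B. \<Prod>i\<in>S. x i)"
    unfolding elem_sym_def using f assms by (simp only:) (rule sum.union_disjoint, auto)
  also have "(\<Sum>S\<in>insert a ` ?B. \<Prod>i\<in>S. x i) = (\<Sum>S\<in>?B. \<Prod>i\<in>insert a S. x i)"
  proof (rule sum.reindex_cong[of "insert a" ?B])
    show "inj_on (insert a) ?B" using f by (auto simp: inj_on_def dest!: insert_ident[THEN iffD1, rotated 2])
  qed auto
  also have "\<dots> = x a * (\<Sum>S\<in>?B. \<Prod>i\<in>S. x i)" unfolding sum_distrib_left using f by (intro sum.cong) auto
  finally show ?thesis by (simp add: elem_sym_def)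
qed

lemma complete_sym_0 [simp]: "complete_sym I x 0 = 1"
proof -
  have "{A. set_mset A \<subseteq> I \<and> size A = 0} = {{#}}" by auto
  then show ?thesis by (simp add: complete_sym_def)
qed

lemma complete_sym_empty: "complete_sym {} x (Suc r) = 0"
proof -
  have e: "{A. set_mset A \<subseteq> {} \<and> size A = Suc r} = {}" by auto
  show ?thesis unfolding complete_sym_def e by simp
qed

lemma complete_sym_insert:
  assumes "finite I" "a \<notin> I"
  shows "complete_sym (insert a I) x (Suc r) = complete_sym I x (Suc r) + x a * complete_sym (insert a I) x r"
proof -
  let ?A = "{A. set_mset A \<subseteq> I \<and> size A = Suc r}" and ?B = "{A. set_mset A \<subseteq> insert a I \<and> size A = r}"
  have "{A. set_mset A \<subseteq> insert a I \<and> size A = Suc r} = ?A \<union> add_mset a ` ?B"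
  proof (intro equalityI subsetI)
    fix A assume A: "A \<in> {A. set_mset A \<subseteq> insert a I \<and> size A = Suc r}"
    show "A \<in> ?A \<union> add_mset a ` ?B"
    proof (cases "a \<in># A")
      case True
      then obtain A' where "A = add_mset a A'" by (metis insert_DiffM)
      then show ?thesis using A by auto
    qed (use A in auto)
  qed auto
  then have "complete_sym (insert a I) x (Suc r) = (\<Sum>A\<in>?A. \<Prod>i\<in>#A. x i) + (\<Sum>A\<in>add_mset a ` ?B. \<Prod>i\<in>#A. x i)"
    unfolding complete_sym_def using assms finite_multisets[of I "Suc r"] finite_multisets[of "insert a I" r]
    by (simp only:) (rule sum.union_disjoint, auto)
  also have "(\<Sum>A\<in>add_mset a ` ?B. \<Prod>i\<in>#A. x i) = (\<Sum>A\<in>?B. \<Prod>i\<in>#add_mset a A. x i)"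
    by (rule sum.reindex_cong[of "add_mset a" ?B]) (auto simp: inj_on_def)
  also have "\<dots> = x a * (\<Sum>A\<in>?B. \<Prod>i\<in>#A. x i)" by (simp add: sum_distrib_left)
  finally show ?thesis by (simp add: complete_sym_def)
qed

definition elem_fps :: "nat \<Rightarrow> (nat \<Rightarrow> 'k::field) \<Rightarrow> 'k fps" where
  "elem_fps m x = Abs_fps (elem_sym {1..m} x)"

definition complete_fps :: "nat \<Rightarrow> (nat \<Rightarrow> 'k::field) \<Rightarrow> 'k fps" where
  "complete_fps n x = Abs_fps (complete_sym {1..n} x)"

lemma elem_fps_0: "elem_fps 0 x = 1"
proof (rule fps_ext)
  fix k show "fps_nth (elem_fps 0 x) k = fps_nth 1 k"
    by (cases k) (auto simp: elem_fps_def elem_sym_empty)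
qed

lemma complete_fps_0: "complete_fps 0 x = 1"
proof (rule fps_ext)
  fix k show "fps_nth (complete_fps 0 x) k = fps_nth 1 k"
    by (cases k) (auto simp: complete_fps_def complete_sym_empty)
qed

lemma elem_fps_Suc: "elem_fps (Suc m) x = elem_fps m x * (1 + fps_const (x (Suc m)) * fps_X)"
proof (rule fps_ext)
  fix k
  have "{1..Suc m} = insert (Suc m) {1..m}" by auto
  then show "fps_nth (elem_fps (Suc m) x) k = fps_nth (elem_fps m x * (1 + fps_const (x (Suc m)) * fps_X)) k"
    unfolding mult_linear_fps by (cases k) (simp_all add: elem_fps_def elem_sym_insert)
qed

lemma complete_fps_Suc: "complete_fps n x = complete_fps (Suc n) x * (1 + fps_const (- x (Suc n)) * fps_X)"
proof (rule fps_ext)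
  fix k
  have "{1..Suc n} = insert (Suc n) {1..n}" by auto
  then show "fps_nth (complete_fps n x) k = fps_nth (complete_fps (Suc n) x * (1 + fps_const (- x (Suc n)) * fps_X)) k"
    unfolding mult_linear_fps by (cases k) (simp_all add: complete_fps_def complete_sym_insert)
qed

locale spectral_values = spectral_weights "\<lambda>i. if i \<le> m then inverse Q else - Q" z "Q - inverse Q"
  for Q :: "'k::field" and m :: nat and z :: "nat \<Rightarrow> 'k" +
  fixes c :: "nat \<Rightarrow> 'k"
  assumes Q: "Q \<noteq> 0" and c: "c 0 = 0" "\<And>k. c (Suc k) = - inverse Q * c k + (- Q) ^ k"
begin

abbreviation "A k n \<equiv> elem_fps k (\<lambda>i. inverse Q * z i) * complete_fps n (\<lambda>j. - Q * z (m + j))"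

text \<open>A new mu multiplies the elementary series by one linear factor, while H changes by
  \<open>H_insert\<close>. After multiplying out, \<open>geom_eq\<close> removes the geometric
  series and the induction hypothesis removes H.\<close>

lemma newton_mu: "k \<le> m \<Longrightarrow> dilate (- Q) (A k 0) * H {1..k} = weigh c (A k 0)"
proof (induction k)
  case 0
  have "weigh c (1 :: 'k fps) = 0" by (rule fps_ext) (auto simp: weigh_def c(1))
  then show ?case by (simp add: elem_fps_0 complete_fps_0 H_def)
next
  case (Suc k)
  let ?w = "fps_const (z (Suc k))" and ?i = "fps_const (inverse Q)" and ?Q = "fps_const Q" and ?h = "fps_const (Q - inverse Q)"
  let ?A = "elem_fps k (\<lambda>i. inverse Q * z i)" and ?L = "geom (z (Suc k))" and ?H = "H {1..k}"
  let ?s = "dilate (- Q) ?A" and ?d = "weigh c ?A"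
  have IH: "?s * ?H = ?d" using Suc by (simp add: complete_fps_0)
  have i: "?i * ?Q = 1" using Q by simp
  have h: "?h = ?Q - ?i" by simp
  have "{1..Suc k} = insert (Suc k) {1..k}" by auto
  then have H': "H {1..Suc k} = ?H + ?i * ?L * (1 + ?h * ?H)"
    using H_insert[of "{1..k}" "Suc k"] Suc.prems by simp
  have s': "dilate (- Q) (A (Suc k) 0) = ?s * (1 - ?w * fps_X)"
  proof -
    have "- Q * (inverse Q * z (Suc k)) = - z (Suc k)" using Q by simp
    then show ?thesis by (simp only: elem_fps_Suc complete_fps_0 mult_1_right dilate_linear one_plus_linear_neg)
  qed
  have d': "weigh c (A (Suc k) 0) = ?d + ?i * ?w * fps_X * (?s - ?i * ?d)"
    by (simp add: elem_fps_Suc complete_fps_0 weigh_linear[OF c])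
  have "?s * (1 - ?w * fps_X) * (?H + ?i * ?L * (1 + ?h * ?H))
    = (1 - ?w * fps_X) * (?s * ?H) + ?i * ((1 - ?w * fps_X) * ?L) * (?s + ?h * (?s * ?H))" by (simp only: algebra_simps mult_1_left mult_1_right)
  also have "\<dots> = (1 - ?w * fps_X) * ?d + ?i * (?w * fps_X) * (?s + ?h * ?d)" unfolding IH geom_eq ..
  also have "\<dots> = ?d + ?i * ?w * fps_X * (?s - ?i * ?d) + (?i * ?Q - 1) * (?w * fps_X * ?d)"
    unfolding h by (simp only: algebra_simps mult_1_left mult_1_right)
  also have "\<dots> = ?d + ?i * ?w * fps_X * (?s - ?i * ?d)" unfolding i by simp
  finally show ?case unfolding s' d' H' .
qed

text \<open>A new nu enters the series A through a denominator, so the old series is the new one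
  times a linear factor. The identity is proved after multiplication by 1 - nu X, which is cancelled
  at the end.\<close>

lemma newton_fps: "dilate (- Q) (A m n) * H {1..m + n} = weigh c (A m n)"
proof (induction n)
  case 0
  then show ?case using newton_mu[of m] by simp
next
  case (Suc n)
  let ?w = "fps_const (z (Suc (m + n)))" and ?i = "fps_const (inverse Q)" and ?Q = "fps_const Q" and ?h = "fps_const (Q - inverse Q)"
  let ?A = "A m n" and ?A' = "A m (Suc n)" and ?L = "geom (z (Suc (m + n)))" and ?H = "H {1..m + n}" and ?p = "1 - fps_const (z (Suc (m + n))) * fps_X"
  let ?s = "dilate (- Q) ?A" and ?d = "weigh c ?A" and ?s' = "dilate (- Q) ?A'" and ?d' = "weigh c ?A'"
  have i: "?i * ?Q = 1" using Q by simp
  have h: "?h = ?Q - ?i" by simp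
  have "{1..m + Suc n} = insert (Suc (m + n)) {1..m + n}" by auto
  then have H': "H {1..m + Suc n} = ?H - ?Q * ?L * (1 + ?h * ?H)"
    using H_insert[of "{1..m + n}" "Suc (m + n)"] by (simp flip: fps_const_neg)
  have AA: "?A = ?A' * (1 + fps_const (Q * z (Suc (m + n))) * fps_X)"
    using complete_fps_Suc[of n "\<lambda>j. - Q * z (m + j)"] by (simp add: mult.assoc)
  have s: "?s = ?s' * (1 - ?Q * ?Q * ?w * fps_X)"
    unfolding AA dilate_linear by (simp add: mult.assoc flip: fps_const_neg)
  have d: "?d = ?d' + ?Q * ?w * fps_X * (?s' - ?i * ?d')"
    unfolding AA weigh_linear[OF c] by simp
  have "?p * (?s' * H {1..m + Suc n}) = ?s' * (?p * ?H - ?Q * (?p * ?L) * (1 + ?h * ?H))"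
    unfolding H' by (simp only: algebra_simps mult_1_left mult_1_right)
  also have "\<dots> = ?s' * (?p * ?H - ?Q * (?w * fps_X) * (1 + ?h * ?H))" unfolding geom_eq ..
  also have "\<dots> = ?s' * (1 - ?Q * ?Q * ?w * fps_X) * ?H - ?Q * ?w * fps_X * ?s' + (?i * ?Q - 1) * (?w * fps_X * ?H * ?s')"
    unfolding h by (simp only: algebra_simps mult_1_left mult_1_right)
  also have "\<dots> = ?d - ?Q * ?w * fps_X * ?s'" using Suc unfolding i s by simp
  also have "\<dots> = ?p * ?d' + (1 - ?i * ?Q) * (?w * fps_X * ?d')" unfolding d by (simp only: algebra_simps mult_1_left mult_1_right)
  also have "\<dots> = ?p * ?d'" unfolding i by simp
  finally show ?case using linear_fps_nonzero[of "z (Suc (m + n))"] by simp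
qed

lemma newton_spectral:
  assumes "1 \<le> k"
  shows "c k * fps_nth (A m n) k = (\<Sum>l<k. (- Q) ^ l * fps_nth (A m n) l * (\<Sum>i\<in>{1..m + n}. wt {1..m + n} i * z i ^ (k - l)))"
proof -
  have "c k * fps_nth (A m n) k = fps_nth (dilate (- Q) (A m n) * H {1..m + n}) k"
    unfolding newton_fps by (simp add: weigh_def)
  also have "\<dots> = (\<Sum>l=0..k. (- Q) ^ l * fps_nth (A m n) l * fps_nth (H {1..m + n}) (k - l))"
    by (simp add: fps_mult_nth dilate_def)
  also have "\<dots> = (\<Sum>l<k. (- Q) ^ l * fps_nth (A m n) l * fps_nth (H {1..m + n}) (k - l))"
    by (simp add: atLeast0AtMost lessThan_Suc_atMost[symmetric] H_nth[of _ 0])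
  finally show ?thesis by (simp add: H_nth cong: sum.cong_simp)
qed

end

section \<open>Transfer to the field of fractions and assembly of the result\<close>

section \<open>The power sums\<close>

lemma var_neq: "i \<noteq> p \<Longrightarrow> var i \<noteq> const c * var p"
proof
  assume ip: "i \<noteq> p" and e: "var i = const c * var p"
  have "lookup (single i (1 :: nat)) i \<noteq> lookup (single p (1 :: nat)) i"
    using ip by (simp add: lookup_single_not_eq)
  then have "single p (1 :: nat) \<noteq> single i 1" by auto
  then have "lookup (const c * var p) (single i 1) = 0"
    by (simp add: var_def const_single lookup_single_not_eq)
  then show False unfolding e[symmetric] by (simp add: var_def)
qed

lemma to_fract_prod: "to_fract (prod f A) = (\<Prod>x\<in>A. to_fract (f x))"
  by (induction A rule: infinite_finite_induct) simp_all

lemma to_fract_prod_mset: "to_fract (\<Prod>i\<in>#A. f i) = (\<Prod>i\<in>#A. to_fract (f i))"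
  by (induction A) simp_all

lemma to_fract_elem_sym: "to_fract (elem_sym I x r) = elem_sym I (\<lambda>i. to_fract (x i)) r"
  by (simp add: elem_sym_def to_fract_prod)

lemma to_fract_complete_sym: "to_fract (complete_sym I x r) = complete_sym I (\<lambda>i. to_fract (x i)) r"
  by (simp add: complete_sym_def to_fract_prod_mset)

text \<open>Since b_0 = 1 the system is triangular: the term l = 0 isolates the value at k.\<close>

lemma convolution_unique:
  fixes b p r :: "nat \<Rightarrow> 'a::comm_ring_1"
  assumes b: "b 0 = 1" and e: "\<And>k. 1 \<le> k \<Longrightarrow> (\<Sum>l<k. b l * p (k - l)) = (\<Sum>l<k. b l * r (k - l))"
  shows "1 \<le> k \<Longrightarrow> p k = r k"
proof (induction k rule: less_induct)
  case (less k)
  have s: "{..<k} = insert 0 {1..<k}" using less.prems by auto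
  have "(\<Sum>l\<in>{1..<k}. b l * p (k - l)) = (\<Sum>l\<in>{1..<k}. b l * r (k - l))"
    using less.IH by (intro sum.cong refl) auto
  then show ?case using e[OF less.prems] b unfolding s by simp
qed

abbreviation fconst :: "complex \<Rightarrow> cpoly fract" where
  "fconst c \<equiv> to_fract (const c)"

abbreviation fvar :: "nat \<Rightarrow> cpoly fract" where
  "fvar i \<equiv> to_fract (var i)"

lemma fconst_simps: "fconst (a + b) = fconst a + fconst b" "fconst (a - b) = fconst a - fconst b"
  "fconst (- a) = - fconst a" "fconst (a * b) = fconst a * fconst b" "fconst (a ^ k) = fconst a ^ k"
proof -
  show 1: "fconst (a * b) = fconst a * fconst b" for a b by (simp add: const_mult)
  show "fconst (a ^ k) = fconst a ^ k" by (induction k) (simp_all add: 1)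
qed (simp_all add: const_add const_diff const_minus)

lemma fconst_inverse: "q \<noteq> 0 \<Longrightarrow> fconst (inverse q) = inverse (fconst q)"
  by (rule inverse_unique[symmetric]) (simp flip: fconst_simps)

lemma inj_fvar: "inj fvar"
  unfolding inj_def using var_neq[of _ _ 1] by auto

abbreviation fweight_mu :: "complex \<Rightarrow> nat \<Rightarrow> nat \<Rightarrow> nat \<Rightarrow> cpoly fract" where
  "fweight_mu q m n \<equiv> weight_mu (fconst q) m n (\<lambda>i. to_fract (mu i)) (\<lambda>j. to_fract (nu m j))"

abbreviation fweight_nu :: "complex \<Rightarrow> nat \<Rightarrow> nat \<Rightarrow> nat \<Rightarrow> cpoly fract" where
  "fweight_nu q m n \<equiv> weight_nu (fconst q) m n (\<lambda>i. to_fract (mu i)) (\<lambda>j. to_fract (nu m j))"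

lemma spectral_elem_fps:
  assumes "q \<noteq> 0"
  shows "fps_nth (elem_fps m (\<lambda>i. inverse (fconst q) * fvar i) * complete_fps n (\<lambda>j. - fconst q * fvar (m + j))) k
    = to_fract (spectral_elem q m n k)"
  by (simp add: fps_mult_nth elem_fps_def complete_fps_def spectral_elem_def to_fract_elem_sym to_fract_complete_sym
      atLeast0AtMost mu_def nu_def fconst_simps fconst_inverse[OF assms])

context
  fixes q :: complex and m :: nat
  assumes q0: "q \<noteq> 0"
begin

text \<open>The coefficients are (-1)^(k-1) [k], written with exponent k so that k = 0 is no
  exception.\<close>

interpretation sv: spectral_values "fconst q" m fvar "\<lambda>k. - ((- 1) ^ k * fconst (qnat q k))"
proof (unfold_locales)
  show "inj fvar" by (rule inj_fvar)
  show "fconst q \<noteq> 0" using q0 by simp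
  show "- ((- 1) ^ 0 * fconst (qnat q 0)) = 0" by (simp add: qnat_def)
  fix k
  have "fconst (qnat q (Suc k)) = fconst q ^ k + inverse (fconst q) * fconst (qnat q k)"
    unfolding qnat_Suc(2)[OF q0] by (simp add: fconst_simps fconst_inverse[OF q0])
  moreover have "(- fconst q) ^ k = (- 1) ^ k * fconst q ^ k" by (rule power_minus)
  ultimately show "- ((- 1) ^ Suc k * fconst (qnat q (Suc k))) = - inverse (fconst q) * - ((- 1) ^ k * fconst (qnat q k)) + (- fconst q) ^ k"
    by (simp add: algebra_simps)
qed

lemma ratio_mu: "1 - (fconst q - inverse (fconst q)) * inverse (fconst q) = inverse (fconst q ^ 2)"
  and ratio_nu: "1 - (fconst q - inverse (fconst q)) * - fconst q = fconst q ^ 2"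
  using q0 by (simp_all add: power2_eq_square field_simps)

lemma interval_split: "{1..m + n} = {1..m} \<union> (+) m ` {1..n}"
proof (intro equalityI subsetI)
  fix i assume i: "i \<in> {1..m + n}"
  show "i \<in> {1..m} \<union> (+) m ` {1..n}"
  proof (cases "i \<le> m")
    case False
    then have "i = m + (i - m)" "i - m \<in> {1..n}" using i by auto
    then show ?thesis by blast
  qed (use i in simp)
qed auto

lemma wt_mu:
  assumes i: "i \<in> {1..m}"
  shows "sv.wt {1..m + n} i = fweight_mu q m n i"
proof -
  have s: "{1..m + n} - {i} = ({1..m} - {i}) \<union> (+) m ` {1..n}" using i unfolding interval_split by auto
  have d: "({1..m} - {i}) \<inter> (+) m ` {1..n} = {}" by auto
  have 1: "(\<Prod>p\<in>{1..m} - {i}. (fvar i - (1 - (fconst q - inverse (fconst q)) * (if p \<le> m then inverse (fconst q) else - fconst q)) * fvar p) / (fvar i - fvar p))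
    = (\<Prod>p\<in>{1..m} - {i}. (fvar i - inverse (fconst q ^ 2) * fvar p) / (fvar i - fvar p))"
    by (intro prod.cong refl) (simp add: ratio_mu)
  have 2: "(\<Prod>p\<in>(+) m ` {1..n}. (fvar i - (1 - (fconst q - inverse (fconst q)) * (if p \<le> m then inverse (fconst q) else - fconst q)) * fvar p) / (fvar i - fvar p))
    = (\<Prod>j\<in>{1..n}. (fvar i - fconst q ^ 2 * fvar (m + j)) / (fvar i - fvar (m + j)))"
    by (subst prod.reindex) (auto intro!: prod.cong simp: inj_on_def ratio_nu simp del: mult_minus_right)
  show ?thesis
    unfolding sv.wt_def weight_mu_def s
    using i by (subst prod.union_disjoint) (auto simp: d 1[simplified] 2[simplified] 1 2 mu_def nu_def)
qed

lemma wt_nu: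
  assumes j: "j \<in> {1..n}"
  shows "sv.wt {1..m + n} (m + j) = fweight_nu q m n j"
proof -
  let ?i = "m + j"
  have im: "(+) m ` ({1..n} - {j}) = (+) m ` {1..n} - {?i}" by (subst image_set_diff) (auto simp: inj_on_def)
  have s: "{1..m + n} - {?i} = {1..m} \<union> (+) m ` ({1..n} - {j})" unfolding interval_split im using j by auto
  have d: "{1..m} \<inter> (+) m ` ({1..n} - {j}) = {}" by auto
  have 1: "(\<Prod>p\<in>{1..m}. (fvar ?i - (1 - (fconst q - inverse (fconst q)) * (if p \<le> m then inverse (fconst q) else - fconst q)) * fvar p) / (fvar ?i - fvar p))
    = (\<Prod>p\<in>{1..m}. (fvar ?i - inverse (fconst q ^ 2) * fvar p) / (fvar ?i - fvar p))"
    by (intro prod.cong refl) (simp add: ratio_mu)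
  have 2: "(\<Prod>p\<in>(+) m ` ({1..n} - {j}). (fvar ?i - (1 - (fconst q - inverse (fconst q)) * (if p \<le> m then inverse (fconst q) else - fconst q)) * fvar p) / (fvar ?i - fvar p))
    = (\<Prod>p\<in>{1..n} - {j}. (fvar ?i - fconst q ^ 2 * fvar (m + p)) / (fvar ?i - fvar (m + p)))"
    by (subst prod.reindex) (auto intro!: prod.cong simp: inj_on_def ratio_nu simp del: mult_minus_right)
  show ?thesis
    unfolding sv.wt_def weight_nu_def s
    using j by (subst prod.union_disjoint) (auto simp: d 1[simplified] 2[simplified] 1 2 mu_def nu_def)
qed

lemma sum_wt_power:
  "(\<Sum>i\<in>{1..m + n}. sv.wt {1..m + n} i * fvar i ^ k)
    = (\<Sum>i=1..m. fweight_mu q m n i * to_fract (mu i) ^ k)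
    + (\<Sum>j=1..n. fweight_nu q m n j * to_fract (nu m j) ^ k)"
proof -
  have "(\<Sum>i\<in>{1..m + n}. sv.wt {1..m + n} i * fvar i ^ k)
    = (\<Sum>i\<in>{1..m}. sv.wt {1..m + n} i * fvar i ^ k) + (\<Sum>i\<in>(+) m ` {1..n}. sv.wt {1..m + n} i * fvar i ^ k)"
    by (subst (1) interval_split, rule sum.union_disjoint) auto
  also have "(\<Sum>i\<in>(+) m ` {1..n}. sv.wt {1..m + n} i * fvar i ^ k) = (\<Sum>j\<in>{1..n}. sv.wt {1..m + n} (m + j) * fvar (m + j) ^ k)"
    by (subst sum.reindex) (auto simp: inj_on_def)
  finally show ?thesis using wt_mu[of _ n] wt_nu[of _ n] by (simp add: mu_def nu_def)
qed

lemma sum_wt_mu: "k \<le> m \<Longrightarrow> sum (sv.wt {1..k}) {1..k} = fconst (q powi (- int k) * qint q (int k))"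
proof (induction k)
  case (Suc k)
  have e: "{1..Suc k} = insert (Suc k) {1..k}" by auto
  have "q powi (- int (Suc k)) * qint q (int (Suc k)) = inverse (q ^ 2) * (q powi (- int k) * qint q (int k)) + inverse q"
    using qint_add[OF q0, of "int k" 1] q0
    by (simp add: power_int_minus power_int_diff power2_eq_square field_simps)
  then show ?case using Suc sv.sum_wt_insert[of "{1..k}" "Suc k"] ratio_mu
    unfolding e by (simp add: fconst_simps fconst_inverse q0)
qed simp

text \<open>Each new nu multiplies the total weight by q^2 and subtracts q. The expression q^(n-m)
  [m-n], which is also the value of Tr D, obeys the same recursion in n and starts from the total
  weight of the mu alone.\<close>

lemma sum_wt: "sum (sv.wt {1..m + n}) {1..m + n} = fconst (q powi (int n - int m) * qint q (int m - int n))"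
proof (induction n)
  case 0
  then show ?case using sum_wt_mu[of m] by simp
next
  case (Suc n)
  have e: "{1..m + Suc n} = insert (m + Suc n) {1..m + n}" by auto
  define d where "d = int m - int n"
  have d: "int n - int m = - d" "int (Suc n) - int m = 1 - d" "int m - int (Suc n) = d + - 1" "int m - int n = d" by (auto simp: d_def)
  have "q powi (1 - d) * qint q (d + - 1) = q ^ 2 * (q powi (- d) * qint q d) - q"
    unfolding qint_add[OF q0, of d "- 1"] using q0 qint_minus[of q 1]
    by (simp add: power_int_minus power_int_diff power2_eq_square field_simps)
  then have q1: "fconst (q powi (1 - d) * qint q (d + - 1)) = fconst q ^ 2 * fconst (q powi (- d) * qint q d) - fconst q"
    by (simp only: fconst_simps)
  have "sum (sv.wt {1..m + Suc n}) {1..m + Suc n} = (1 - (fconst q - inverse (fconst q)) * - fconst q) * sum (sv.wt {1..m + n}) {1..m + n} + - fconst q"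
    using sv.sum_wt_insert[of "{1..m + n}" "m + Suc n"] unfolding e by simp
  then show ?case unfolding ratio_nu Suc d q1 by simp
qed

lemma fvar_diff: "i \<noteq> p \<Longrightarrow> fvar i - fconst c * fvar p \<noteq> 0"
  using var_neq[of i p c] by (simp flip: to_fract_mult)

text \<open>A variable is never a scalar multiple of a different one, so neither numerators nor
  denominators vanish.\<close>

lemma weight_nonzero: "i \<in> {1..m + n} \<Longrightarrow> sv.wt {1..m + n} i \<noteq> 0"
proof -
  assume i: "i \<in> {1..m + n}"
  have "fvar i - (1 - (fconst q - inverse (fconst q)) * (if p \<le> m then inverse (fconst q) else - fconst q)) * fvar p \<noteq> 0" "fvar i - fvar p \<noteq> 0" if "i \<noteq> p" for p
    using fvar_diff[OF that, of "inverse (q ^ 2)"] fvar_diff[OF that, of "q ^ 2"] fvar_diff[OF that, of 1] ratio_mu ratio_nu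
    by (simp_all add: fconst_simps fconst_inverse q0 del: mult_minus_right)
  then show ?thesis using q0 unfolding sv.wt_def by (auto simp del: mult_minus_right)
qed

lemma spectral_power_sums:
  fixes p :: "nat \<Rightarrow> cpoly"
  assumes "\<And>k. 1 \<le> k \<Longrightarrow> (- 1) ^ (k - 1) * const (qnat q k) * spectral_elem q m n k
      = (\<Sum>l<k. const ((- q) ^ l) * (spectral_elem q m n l * p (k - l)))"
    and A0: "spectral_elem q m n 0 = 1"
    and p0: "p 0 = const (q powi (int n - int m) * qint q (int m - int n))"
  shows "to_fract (p k) = (\<Sum>i\<in>{1..m + n}. sv.wt {1..m + n} i * fvar i ^ k)"
proof (cases "k = 0")
  case True
  then show ?thesis using p0 sum_wt by simp
next
  case False
  define b where "b l = (- fconst q) ^ l * to_fract (spectral_elem q m n l)" for l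
  define r where "r k = (\<Sum>i\<in>{1..m + n}. sv.wt {1..m + n} i * fvar i ^ k)" for k
  have "to_fract (p k) = r k"
  proof (rule convolution_unique[of b "\<lambda>k. to_fract (p k)" r])
    show "b 0 = 1" by (simp add: b_def A0)
    fix k :: nat assume k: "1 \<le> k"
    have "(\<Sum>l<k. b l * to_fract (p (k - l))) = to_fract (\<Sum>l<k. const ((- q) ^ l) * (spectral_elem q m n l * p (k - l)))"
      by (simp add: b_def fconst_simps mult.assoc)
    also have "\<dots> = to_fract ((- 1) ^ (k - 1) * const (qnat q k) * spectral_elem q m n k)" using assms(1)[OF k] by simp
    also have "\<dots> = - ((- 1) ^ k * fconst (qnat q k)) * to_fract (spectral_elem q m n k)"
    proof -
      have "to_fract ((- 1) ^ j :: cpoly) = (- 1) ^ j" for j by (induction j) simp_all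
      then show ?thesis using k by (cases k) simp_all
    qed
    also have "\<dots> = (\<Sum>l<k. b l * r (k - l))"
      using sv.newton_spectral[OF k, of n] unfolding spectral_elem_fps[OF q0] b_def r_def .
    finally show "(\<Sum>l<k. b l * to_fract (p (k - l))) = (\<Sum>l<k. b l * r (k - l))" .
  qed (use False in simp)
  then show ?thesis by (simp add: r_def)
qed

end

text \<open>Invertibility is given abstractly, whereas the copies of the generators are built with
  the matrix returned by \<open>mat_inverse\<close>; invertibility makes that computation
  succeed.\<close>

lemma invertible_mat_inverse:
  fixes A :: "complex mat"
  assumes A: "A \<in> sqm n" "invertible_mat A"
  shows "\<exists>B. mat_inverse A = Some B \<and> A * B = 1\<^sub>m n \<and> B * A = 1\<^sub>m n \<and> B \<in> sqm n"
proof -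
  obtain B where B: "A * B = 1\<^sub>m n" "B * A = 1\<^sub>m (dim_row B)"
    using A by (auto simp: invertible_mat_def inverts_mat_def)
  have "dim_col B = n" using arg_cong[OF B(1), of dim_col] by simp
  moreover have "dim_row B = n" using arg_cong[OF B(2), of dim_col] A(1) by simp
  ultimately have Bc: "B \<in> sqm n" "B * A = 1\<^sub>m n" using B by auto
  then have "A \<in> Units (ring_mat TYPE(complex) n ())" using A(1) B(1) by (auto simp: Units_def ring_mat_def)
  then obtain C where "mat_inverse A = Some C" using mat_inverse(1)[OF A(1), where b = "()"] by (cases "mat_inverse A") auto
  with mat_inverse(2)[OF A(1) this] show ?thesis by auto
qed

lemma hecke_quadratic:
  fixes R :: "complex mat"
  assumes R: "R \<in> sqm n" and q0: "q \<noteq> 0"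
    and h: "(R - q \<cdot>\<^sub>m 1\<^sub>m n) * (R + inverse q \<cdot>\<^sub>m 1\<^sub>m n) = 0\<^sub>m n n"
  shows "R * R = (q - inverse q) \<cdot>\<^sub>m R + 1\<^sub>m n"
proof (rule eq_matI)
  have c: "q \<cdot>\<^sub>m 1\<^sub>m n \<in> sqm n" "inverse q \<cdot>\<^sub>m 1\<^sub>m n \<in> sqm n" "R + inverse q \<cdot>\<^sub>m 1\<^sub>m n \<in> sqm n" using R by auto
  have 1: "(q \<cdot>\<^sub>m 1\<^sub>m n) * (R + inverse q \<cdot>\<^sub>m 1\<^sub>m n) = q \<cdot>\<^sub>m (R + inverse q \<cdot>\<^sub>m 1\<^sub>m n)"
    using mult_smult_assoc_mat[OF one_carrier_mat c(3), of q] c(3) by simp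
  have 2: "R * (R + inverse q \<cdot>\<^sub>m 1\<^sub>m n) = R * R + inverse q \<cdot>\<^sub>m R"
    unfolding mult_add_distrib_mat[OF R R c(2)] using mult_smult_distrib[OF R one_carrier_mat, of "inverse q"] R by simp
  have e: "(R * R + inverse q \<cdot>\<^sub>m R) - q \<cdot>\<^sub>m (R + inverse q \<cdot>\<^sub>m 1\<^sub>m n) = 0\<^sub>m n n"
    using h unfolding minus_mult_distrib_mat[OF R c(1,3)] 1 2 .
  fix i j assume "i < dim_row ((q - inverse q) \<cdot>\<^sub>m R + 1\<^sub>m n)" "j < dim_col ((q - inverse q) \<cdot>\<^sub>m R + 1\<^sub>m n)"
  then have ij: "i < n" "j < n" using R by auto
  have "((R * R + inverse q \<cdot>\<^sub>m R) - q \<cdot>\<^sub>m (R + inverse q \<cdot>\<^sub>m 1\<^sub>m n)) $$ (i, j) = 0" unfolding e using ij by simp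
  then have "(R * R) $$ (i, j) + inverse q * R $$ (i, j) - q * (R $$ (i, j) + inverse q * (1\<^sub>m n $$ (i, j))) = 0"
    using R ij by (simp del: index_mult_mat(1))
  moreover have "q * (R $$ (i, j) + inverse q * (1\<^sub>m n $$ (i, j))) = q * R $$ (i, j) + 1\<^sub>m n $$ (i, j)"
    using q0 by (simp add: field_simps del: index_one_mat(1))
  ultimately have "(R * R) $$ (i, j) = (q - inverse q) * R $$ (i, j) + 1\<^sub>m n $$ (i, j)"
    by (simp only: left_diff_distrib) (simp add: algebra_simps del: index_mult_mat(1) index_one_mat(1))
  then show "(R * R) $$ (i, j) = ((q - inverse q) \<cdot>\<^sub>m R + 1\<^sub>m n) $$ (i, j)"
    using R ij by (simp del: index_mult_mat(1))
qed (use R in auto)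

lemma GL_type_qma_hecke_pair:
  assumes q: "generic q" and gl: "GL_type_qma N q m n R F"
  shows "\<exists>R' F' \<Psi> D'. hecke_pair N R F R' F' \<Psi> D' q"
proof -
  have cm: "compatible_R_matrices N R F" and h: "hecke_R_matrix N q R" using gl by (auto simp: GL_type_qma_def GL_type_def)
  have R: "R \<in> sqm (N * N)" "invertible_mat R" and F: "F \<in> sqm (N * N)" "invertible_mat F"
    and yb: "yang_baxter N R" "yang_baxter N F" "compatible N R F" and sk: "strictly_skew_invertible N R"
    using cm by (auto simp: compatible_R_matrices_def power2_eq_square)
  obtain R' where R': "R * R' = 1\<^sub>m (N * N)" "R' * R = 1\<^sub>m (N * N)" "R' \<in> sqm (N * N)"
    using invertible_mat_inverse[OF R] by auto
  obtain F' where F': "mat_inverse F = Some F'" "F * F' = 1\<^sub>m (N * N)" "F' * F = 1\<^sub>m (N * N)" "F' \<in> sqm (N * N)"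
    using invertible_mat_inverse[OF F] by auto
  obtain \<Psi> where \<Psi>: "skew_inverse N R \<Psi>" using sk by (auto simp: strictly_skew_invertible_def)
  obtain D' where D': "D_op N R * D' = 1\<^sub>m N" "D' * D_op N R = 1\<^sub>m N" "D' \<in> sqm N"
    using invertible_mat_inverse[OF D_op_carrier] sk by (metis strictly_skew_invertible_def)
  have "hecke_pair N R F R' F' \<Psi> D' q"
  proof (unfold_locales)
    show "R * R = (q - inverse q) \<cdot>\<^sub>m R + 1\<^sub>m (N * N)"
      using hecke_quadratic[OF R(1)] h q by (auto simp: hecke_R_matrix_def generic_def power2_eq_square)
  qed (use R F R' F' \<Psi> D' q yb[unfolded yang_baxter_def compatible_def amp_3_2] in auto)
  then show ?thesis by blast
qed

theorem proposition5:
  fixes q :: complex and N m n :: nat and R F :: "complex mat"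
    and \<phi> :: "(nat \<times> nat) free set \<Rightarrow> cpoly"
  assumes "generic q"
    and "GL_type_qma N q m n R F"
    and "spectral_parameterization N q m n R F \<phi>"
  shows "let Q = to_fract (const q :: cpoly);
             x = (\<lambda>i. to_fract (mu i));
             y = (\<lambda>j. to_fract (nu m j));
             d = weight_mu Q m n x y;
             d' = weight_nu Q m n x y
         in (\<forall>k. to_fract (\<phi> (power_sum N R F k)) =
                (\<Sum>i=1..m. d i * x i ^ k) + (\<Sum>j=1..n. d' j * y j ^ k)) \<and>
            (\<forall>i\<in>{1..m}. \<forall>p\<in>{1..m} - {i}. x i - x p \<noteq> 0) \<and>
            (\<forall>i\<in>{1..m}. \<forall>j\<in>{1..n}. x i - y j \<noteq> 0) \<and>
            (\<forall>j\<in>{1..n}. \<forall>p\<in>{1..n} - {j}. y j - y p \<noteq> 0) \<and>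
            (\<forall>i\<in>{1..m}. d i \<noteq> 0) \<and>
            (\<forall>j\<in>{1..n}. d' j \<noteq> 0)"
proof -
  have q0: "q \<noteq> 0" using assms(1) by (simp add: generic_def)
  have gl: "GL_type N q m n R" using assms(2) by (simp add: GL_type_qma_def)
  obtain R' F' \<Psi> D' where "hecke_pair N R F R' F' \<Psi> D' q"
    using GL_type_qma_hecke_pair[OF assms(1,2)] by blast
  then interpret hecke_pair N R F R' F' \<Psi> D' q .
  have ps: "to_fract (\<phi> (power_sum N R F k))
    = (\<Sum>i=1..m. fweight_mu q m n i * to_fract (mu i) ^ k)
    + (\<Sum>j=1..n. fweight_nu q m n j * to_fract (nu m j) ^ k)" for k
    unfolding sum_wt_power[OF q0, symmetric]
  proof (rule spectral_power_sums[OF q0, of m n "\<lambda>k. \<phi> (power_sum N R F k)"])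
    \<comment> \<open>The exponent 0: the R-trace of the identity, found from the GL condition,
      equals the total weight of the spectral values.\<close>
    show "\<phi> (power_sum N R F 0) = const (q powi (int n - int m) * qint q (int m - int n))"
      unfolding power_sum_0[OF assms(3)] trace_D[OF gl] ..
  qed (rule newton[OF assms(3)] A_0[OF assms(3)], assumption?)+
  have mu0: "fweight_mu q m n i \<noteq> 0" if "i \<in> {1..m}" for i
    using weight_nonzero[OF q0, of i m n] wt_mu[OF q0 that, of n] that by simp
  have nu0: "fweight_nu q m n j \<noteq> 0" if "j \<in> {1..n}" for j
    using weight_nonzero[OF q0, of "m + j" m n] wt_nu[OF q0 that, of m] that by simp
  have ne: "fvar i - fvar p \<noteq> 0" if "i \<noteq> p" for i p using inj_fvar that by (auto simp: inj_def)
  show ?thesis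
    unfolding Let_def
  proof (intro conjI allI ballI)
    fix i p assume "i \<in> {1..m}" "p \<in> {1..m} - {i}"
    then show "to_fract (mu i) - to_fract (mu p) \<noteq> 0" using ne[of i p] by (simp add: mu_def)
  next
    fix i j assume "i \<in> {1..m}" "j \<in> {1..n}"
    then show "to_fract (mu i) - to_fract (nu m j) \<noteq> 0" using ne[of i "m + j"] by (simp add: mu_def nu_def)
  next
    fix j p assume "j \<in> {1..n}" "p \<in> {1..n} - {j}"
    then show "to_fract (nu m j) - to_fract (nu m p) \<noteq> 0" using ne[of "m + j" "m + p"] by (simp add: nu_def)
  qed (rule ps mu0 nu0, assumption?)+
qed

end
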